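(* Let $R$ be a commutative ring and $S\subset R$ a multiplicative subset all of whose elements are nonzero-divisors in $R$. Assume that the projective dimension of the $R$-module $S^{-1}R$ does not exceed $1$. Then a flat $R$-module $F$ is $S$-strongly flat if and only if the $R/sR$-module $F/sF$ is projective for every $s\in S$ and the $S^{-1}R$-module $S^{-1}F$ is projective.
   Context: For a commutative ring $R$ and a multiplicative subset $S\subset R$: $S^{-1}R$ is the localization and $S^{-1}F=S^{-1}R\otimes_R F$ for an $R$-module $F$. An $R$-module $C$ is called $S$-weakly cotorsion if $\operatorname{Ext}^1_R(S^{-1}R,C)=0$. An $R$-module $F$ is called $S$-strongly flat if $\operatorname{Ext}^1_R(F,C)=0$ for every $S$-weakly cotorsion $R$-module $C$. *)

theory Defs
  imports "HOL-Algebra.Module" "HOL-Algebra.QuotRing"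
begin

text \<open>
  All modules are carrier-based (\<^locale>\<open>module\<close>).  The fields \<^const>\<open>mult\<close> and \<^const>\<open>one\<close> that a
  \<^typ>\<open>('a, 'b) module\<close> record inherits from rings play no role for modules and are left undefined
  in the constructions below.
\<close>

section \<open>Homomorphisms, submodules, quotients, free modules\<close>

text \<open>Homomorphisms are extensional, so that equality of homomorphisms is equality on the carrier.\<close>

definition mod_hom ::
  "('a, 'k) ring_scheme \<Rightarrow> ('a, 'm) module \<Rightarrow> ('a, 'n) module \<Rightarrow> ('m \<Rightarrow> 'n) set" where
  "mod_hom R M N = {h \<in> carrier M \<rightarrow>\<^sub>E carrier N.
     (\<forall>x\<in>carrier M. \<forall>y\<in>carrier M. h (x \<oplus>\<^bsub>M\<^esub> y) = h x \<oplus>\<^bsub>N\<^esub> h y) \<and>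
     (\<forall>r\<in>carrier R. \<forall>x\<in>carrier M. h (r \<odot>\<^bsub>M\<^esub> x) = r \<odot>\<^bsub>N\<^esub> h x)}"

definition hom_module ::
  "('a, 'k) ring_scheme \<Rightarrow> ('a, 'm) module \<Rightarrow> ('a, 'n) module \<Rightarrow> ('a, 'm \<Rightarrow> 'n) module" where
  "hom_module R M N = \<lparr>carrier = mod_hom R M N, mult = undefined, one = undefined,
     zero = (\<lambda>x\<in>carrier M. \<zero>\<^bsub>N\<^esub>), add = (\<lambda>f g. \<lambda>x\<in>carrier M. f x \<oplus>\<^bsub>N\<^esub> g x),
     smult = (\<lambda>r f. \<lambda>x\<in>carrier M. r \<odot>\<^bsub>N\<^esub> f x)\<rparr>"

definition sub_module :: "('a, 'm) module \<Rightarrow> 'm set \<Rightarrow> ('a, 'm) module" where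
  "sub_module M N = M\<lparr>carrier := N\<rparr>"

definition quotient_module :: "('a, 'm) module \<Rightarrow> 'm set \<Rightarrow> ('a, 'm set) module" where
  "quotient_module M N = \<lparr>carrier = a_rcosets\<^bsub>M\<^esub> N, mult = undefined, one = undefined,
     zero = N, add = set_add M, smult = (\<lambda>r X. \<Union>x\<in>X. N +>\<^bsub>M\<^esub> (r \<odot>\<^bsub>M\<^esub> x))\<rparr>"

definition submodule_span :: "('a, 'k) ring_scheme \<Rightarrow> ('a, 'm) module \<Rightarrow> 'm set \<Rightarrow> 'm set" where
  "submodule_span R M G = \<Inter>{N. submodule N R M \<and> G \<subseteq> N}"

definition free_module :: "('a, 'k) ring_scheme \<Rightarrow> 'x set \<Rightarrow> ('a, 'x \<Rightarrow> 'a) module" where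
  "free_module R X = \<lparr>carrier = {f. (\<forall>x\<in>X. f x \<in> carrier R) \<and> (\<forall>x. x \<notin> X \<longrightarrow> f x = \<zero>\<^bsub>R\<^esub>)
       \<and> finite {x. f x \<noteq> \<zero>\<^bsub>R\<^esub>}},
     mult = undefined, one = undefined,
     zero = (\<lambda>x. \<zero>\<^bsub>R\<^esub>), add = (\<lambda>f g x. f x \<oplus>\<^bsub>R\<^esub> g x), smult = (\<lambda>r f x. r \<otimes>\<^bsub>R\<^esub> f x)\<rparr>"

definition basis_vector :: "('a, 'k) ring_scheme \<Rightarrow> 'x \<Rightarrow> 'x \<Rightarrow> 'a" where
  "basis_vector R x = (\<lambda>y. if y = x then \<one>\<^bsub>R\<^esub> else \<zero>\<^bsub>R\<^esub>)"

text \<open>The linear extension to \<open>free_module R X\<close> of a map \<open>\<phi>\<close> from \<open>X\<close> to a module.\<close>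

definition linear_ext ::
  "('a, 'k) ring_scheme \<Rightarrow> 'x set \<Rightarrow> ('a, 'm) module \<Rightarrow> ('x \<Rightarrow> 'm) \<Rightarrow> ('x \<Rightarrow> 'a) \<Rightarrow> 'm" where
  "linear_ext R X M \<phi> =
     (\<lambda>f\<in>carrier (free_module R X). \<Oplus>\<^bsub>M\<^esub>x\<in>{x. f x \<noteq> \<zero>\<^bsub>R\<^esub>}. f x \<odot>\<^bsub>M\<^esub> \<phi> x)"

section \<open>Tensor products and flatness\<close>

definition tensor_relations ::
  "('a, 'k) ring_scheme \<Rightarrow> ('a, 'm) module \<Rightarrow> ('a, 'n) module \<Rightarrow> ('m \<times> 'n \<Rightarrow> 'a) set" where
  "tensor_relations R M N =
     (let F = free_module R (carrier M \<times> carrier N); e = basis_vector R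
      in submodule_span R F
       ({e (x \<oplus>\<^bsub>M\<^esub> x', y) \<ominus>\<^bsub>F\<^esub> (e (x, y) \<oplus>\<^bsub>F\<^esub> e (x', y)) | x x' y.
           x \<in> carrier M \<and> x' \<in> carrier M \<and> y \<in> carrier N}
      \<union> {e (x, y \<oplus>\<^bsub>N\<^esub> y') \<ominus>\<^bsub>F\<^esub> (e (x, y) \<oplus>\<^bsub>F\<^esub> e (x, y')) | x y y'.
           x \<in> carrier M \<and> y \<in> carrier N \<and> y' \<in> carrier N}
      \<union> {e (r \<odot>\<^bsub>M\<^esub> x, y) \<ominus>\<^bsub>F\<^esub> r \<odot>\<^bsub>F\<^esub> e (x, y) | r x y.
           r \<in> carrier R \<and> x \<in> carrier M \<and> y \<in> carrier N}
      \<union> {e (x, r \<odot>\<^bsub>N\<^esub> y) \<ominus>\<^bsub>F\<^esub> r \<odot>\<^bsub>F\<^esub> e (x, y) | r x y.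
           r \<in> carrier R \<and> x \<in> carrier M \<and> y \<in> carrier N}))"

definition tensor ::
  "('a, 'k) ring_scheme \<Rightarrow> ('a, 'm) module \<Rightarrow> ('a, 'n) module \<Rightarrow> ('a, ('m \<times> 'n \<Rightarrow> 'a) set) module" where
  "tensor R M N =
     quotient_module (free_module R (carrier M \<times> carrier N)) (tensor_relations R M N)"

definition pure_tensor ::
  "('a, 'k) ring_scheme \<Rightarrow> ('a, 'm) module \<Rightarrow> ('a, 'n) module \<Rightarrow> 'm \<Rightarrow> 'n \<Rightarrow> ('m \<times> 'n \<Rightarrow> 'a) set" where
  "pure_tensor R M N x y =
     tensor_relations R M N +>\<^bsub>free_module R (carrier M \<times> carrier N)\<^esub> basis_vector R (x, y)"

text \<open>
  \<open>tensor_map R M N M' N' f g\<close> is the map \<open>f \<otimes> g\<close> from \<open>M \<otimes> N\<close> to \<open>M' \<otimes> N'\<close>: the linear extension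
  of \<open>(x, y) \<mapsto> f x \<otimes> g y\<close> is constant on every coset \<open>T \<in> M \<otimes> N\<close>.
\<close>

definition tensor_map ::
  "('a, 'k) ring_scheme \<Rightarrow> ('a, 'm) module \<Rightarrow> ('a, 'n) module \<Rightarrow> ('a, 'p) module \<Rightarrow> ('a, 'q) module
     \<Rightarrow> ('m \<Rightarrow> 'p) \<Rightarrow> ('n \<Rightarrow> 'q) \<Rightarrow> ('m \<times> 'n \<Rightarrow> 'a) set \<Rightarrow> ('p \<times> 'q \<Rightarrow> 'a) set" where
  "tensor_map R M N M' N' f g =
     (\<lambda>T\<in>carrier (tensor R M N).
        the_elem (linear_ext R (carrier M \<times> carrier N) (tensor R M' N')
                    (\<lambda>(x, y). pure_tensor R M' N' (f x) (g y)) ` T))"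

text \<open>
  The modules \<open>A\<close> and \<open>B\<close> range over those carried by a type \<open>'u\<close>.  For \<open>'u = 'a\<close> they include
  \<open>R\<close> and all its ideals, so that this case already implies injectivity for all other types
  (ideal criterion for flatness); as a hypothesis it is the least restrictive choice.
\<close>

definition flat_module :: "'u itself \<Rightarrow> ('a, 'k) ring_scheme \<Rightarrow> ('a, 'm) module \<Rightarrow> bool" where
  "flat_module (_ :: 'u itself) R F \<longleftrightarrow> module R F \<and>
     (\<forall>(A :: ('a, 'u) module) (B :: ('a, 'u) module). \<forall>h\<in>mod_hom R A B.
        module R A \<and> module R B \<and> inj_on h (carrier A) \<longrightarrow>
        inj_on (tensor_map R A F B F h (\<lambda>x\<in>carrier F. x)) (carrier (tensor R A F)))"

section \<open>Projective modules and projective dimension\<close>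

text \<open>
  Direct summands of free modules.  A basis indexed by the type of \<open>P\<close> suffices, because a
  projective \<open>P\<close> is a direct summand of \<open>free_module R (carrier P)\<close>.
\<close>

definition projective_module :: "('a, 'k) ring_scheme \<Rightarrow> ('a, 'p) module \<Rightarrow> bool" where
  "projective_module R P \<longleftrightarrow> module R P \<and>
     (\<exists>X :: 'p set. \<exists>i\<in>mod_hom R P (free_module R X). \<exists>q\<in>mod_hom R (free_module R X) P.
        \<forall>x\<in>carrier P. q (i x) = x)"

definition projective_resolution ::
  "('a, 'k) ring_scheme \<Rightarrow> ('a, 'm) module \<Rightarrow> (nat \<Rightarrow> ('a, 'p) module)
     \<Rightarrow> (nat \<Rightarrow> 'p \<Rightarrow> 'p) \<Rightarrow> ('p \<Rightarrow> 'm) \<Rightarrow> bool" where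
  "projective_resolution R M P d \<epsilon> \<longleftrightarrow>
     (\<forall>i. projective_module R (P i)) \<and>
     (\<forall>i. d i \<in> mod_hom R (P (Suc i)) (P i)) \<and>
     \<epsilon> \<in> mod_hom R (P 0) M \<and> \<epsilon> ` carrier (P 0) = carrier M \<and>
     d 0 ` carrier (P 1) = a_kernel (P 0) M \<epsilon> \<and>
     (\<forall>i. d (Suc i) ` carrier (P (Suc (Suc i))) = a_kernel (P (Suc i)) (P i) (d i))"

text \<open>
  The terms of the resolution are carried by a type \<open>'p\<close>.  A hypothesis \<open>proj_dim_le TYPE('p) R M n\<close>
  with a type variable \<open>'p\<close> admits resolutions on all types.
\<close>

definition proj_dim_le ::
  "'p itself \<Rightarrow> ('a, 'k) ring_scheme \<Rightarrow> ('a, 'm) module \<Rightarrow> nat \<Rightarrow> bool" where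
  "proj_dim_le (_ :: 'p itself) R M n \<longleftrightarrow> module R M \<and>
     (\<exists>(P :: nat \<Rightarrow> ('a, 'p) module) d \<epsilon>. projective_resolution R M P d \<epsilon> \<and>
        (\<forall>i>n. carrier (P i) = {\<zero>\<^bsub>P i\<^esub>}))"

section \<open>Ext\<close>

text \<open>
  The canonical free resolution of \<open>M\<close>: each term is the free module on the elements of the
  previous kernel.  Only the part \<open>P\<^sub>2 \<rightarrow> P\<^sub>1 \<rightarrow> P\<^sub>0 \<rightarrow> M\<close> is needed for the first Ext module.
\<close>

definition free_cover ::
  "('a, 'k) ring_scheme \<Rightarrow> ('a, 'm) module \<Rightarrow> ('m \<Rightarrow> 'a) \<Rightarrow> 'm" where
  "free_cover R M = linear_ext R (carrier M) M (\<lambda>x. x)"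

definition syzygy ::
  "('a, 'k) ring_scheme \<Rightarrow> ('a, 'm) module \<Rightarrow> ('a, 'm \<Rightarrow> 'a) module" where
  "syzygy R M = sub_module (free_module R (carrier M))
     (a_kernel (free_module R (carrier M)) M (free_cover R M))"

text \<open>
  \<open>Ext1 R M N\<close> is the first cohomology of \<open>Hom (P\<^sub>0, N) \<rightarrow> Hom (P\<^sub>1, N) \<rightarrow> Hom (P\<^sub>2, N)\<close>.
  Since \<^const>\<open>sub_module\<close> keeps the operations, the cover of \<open>syzygy R M\<close> is at the same time
  the differential \<open>d\<^sub>1 : P\<^sub>1 \<rightarrow> P\<^sub>0\<close>, and likewise for \<open>d\<^sub>2 : P\<^sub>2 \<rightarrow> P\<^sub>1\<close>.
\<close>

definition Ext1 ::
  "('a, 'k) ring_scheme \<Rightarrow> ('a, 'm) module \<Rightarrow> ('a, 'n) module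
     \<Rightarrow> ('a, ((('m \<Rightarrow> 'a) \<Rightarrow> 'a) \<Rightarrow> 'n) set) module" where
  "Ext1 R M N =
    (let K0 = syzygy R M; K1 = syzygy R K0;
         P0 = free_module R (carrier M); P1 = free_module R (carrier K0);
         P2 = free_module R (carrier K1);
         d1 = free_cover R K0; d2 = free_cover R K1;
         Z = {\<phi> \<in> mod_hom R P1 N. compose (carrier P2) \<phi> d2 = (\<lambda>p\<in>carrier P2. \<zero>\<^bsub>N\<^esub>)};
         B = {compose (carrier P1) \<psi> d1 | \<psi>. \<psi> \<in> mod_hom R P0 N}
     in quotient_module (sub_module (hom_module R P1 N) Z) B)"

definition zero_module :: "('a, 'm) module \<Rightarrow> bool" where
  "zero_module M \<longleftrightarrow> carrier M = {\<zero>\<^bsub>M\<^esub>}"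

section \<open>Localization\<close>

definition frac_rel ::
  "('a, 'k) ring_scheme \<Rightarrow> 'a set \<Rightarrow> (('a \<times> 'a) \<times> ('a \<times> 'a)) set" where
  "frac_rel R S = {((a, s), (b, t)). a \<in> carrier R \<and> s \<in> S \<and> b \<in> carrier R \<and> t \<in> S \<and>
     (\<exists>u\<in>S. u \<otimes>\<^bsub>R\<^esub> (a \<otimes>\<^bsub>R\<^esub> t \<ominus>\<^bsub>R\<^esub> b \<otimes>\<^bsub>R\<^esub> s) = \<zero>\<^bsub>R\<^esub>)}"

definition fraction :: "('a, 'k) ring_scheme \<Rightarrow> 'a set \<Rightarrow> 'a \<Rightarrow> 'a \<Rightarrow> ('a \<times> 'a) set" where
  "fraction R S a s = frac_rel R S `` {(a, s)}"

definition loc_ring :: "('a, 'k) ring_scheme \<Rightarrow> 'a set \<Rightarrow> ('a \<times> 'a) set ring" where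
  "loc_ring R S = \<lparr>carrier = (carrier R \<times> S) // frac_rel R S,
     mult = (\<lambda>X Y. \<Union>(a, s)\<in>X. \<Union>(b, t)\<in>Y. fraction R S (a \<otimes>\<^bsub>R\<^esub> b) (s \<otimes>\<^bsub>R\<^esub> t)),
     one = fraction R S \<one>\<^bsub>R\<^esub> \<one>\<^bsub>R\<^esub>,
     zero = fraction R S \<zero>\<^bsub>R\<^esub> \<one>\<^bsub>R\<^esub>,
     add = (\<lambda>X Y. \<Union>(a, s)\<in>X. \<Union>(b, t)\<in>Y.
       fraction R S (a \<otimes>\<^bsub>R\<^esub> t \<oplus>\<^bsub>R\<^esub> b \<otimes>\<^bsub>R\<^esub> s) (s \<otimes>\<^bsub>R\<^esub> t))\<rparr>"

definition loc_as_module ::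
  "('a, 'k) ring_scheme \<Rightarrow> 'a set \<Rightarrow> ('a, ('a \<times> 'a) set) module" where
  "loc_as_module R S = ring.extend (loc_ring R S)
     \<lparr>smult = (\<lambda>r x. fraction R S r \<one>\<^bsub>R\<^esub> \<otimes>\<^bsub>loc_ring R S\<^esub> x)\<rparr>"

text \<open>
  The tensor product of the localization with \<open>F\<close>, as a module over the localization:
  \<open>l \<in> loc_ring R S\<close> acts as \<open>(l \<otimes> _) \<otimes> id\<close>.
\<close>

definition localized_module ::
  "('a, 'k) ring_scheme \<Rightarrow> 'a set \<Rightarrow> ('a, 'm) module
     \<Rightarrow> (('a \<times> 'a) set, (('a \<times> 'a) set \<times> 'm \<Rightarrow> 'a) set) module" where
  "localized_module R S F =
     (let L = loc_as_module R S; T = tensor R L F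
      in \<lparr>carrier = carrier T, mult = undefined, one = undefined, zero = zero T, add = add T,
          smult = (\<lambda>l. tensor_map R L F L F (\<lambda>x\<in>carrier L. l \<otimes>\<^bsub>loc_ring R S\<^esub> x)
                         (\<lambda>y\<in>carrier F. y))\<rparr>)"

section \<open>Reduction modulo an element\<close>

text \<open>\<open>F / sF\<close>, as a module over \<open>R Quot (PIdl\<^bsub>R\<^esub> s)\<close>.\<close>

definition reduced_module ::
  "('a, 'm) module \<Rightarrow> 'a \<Rightarrow> ('a set, 'm set) module" where
  "reduced_module F s =
     (let sF = (\<lambda>x. s \<odot>\<^bsub>F\<^esub> x) ` carrier F; Q = quotient_module F sF
      in \<lparr>carrier = carrier Q, mult = undefined, one = undefined, zero = zero Q, add = add Q,
          smult = (\<lambda>A X. \<Union>r\<in>A. \<Union>x\<in>X. sF +>\<^bsub>F\<^esub> (r \<odot>\<^bsub>F\<^esub> x))\<rparr>)"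

section \<open>Weakly cotorsion and strongly flat modules\<close>

definition weakly_cotorsion ::
  "('a, 'k) ring_scheme \<Rightarrow> 'a set \<Rightarrow> ('a, 'c) module \<Rightarrow> bool" where
  "weakly_cotorsion R S C \<longleftrightarrow> module R C \<and> zero_module (Ext1 R (loc_as_module R S) C)"

text \<open>
  HOL cannot quantify over all modules of all types inside a formula, so \<open>C\<close> ranges over the
  modules carried by a type \<open>'u\<close>.  Isomorphic copies do not matter, so only the size of \<open>'u\<close> is
  relevant.  With \<open>'u = 'c + ('m \<Rightarrow> ('a \<times> 'a) set)\<close> for an arbitrary \<open>'c\<close>, every module on
  every type \<open>'c\<close> is covered, while the second summand keeps \<open>'u\<close> from being too small: it
  carries the free modules on the elements of \<open>F\<close> over \<open>loc_ring R S\<close>, and copies of those over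
  the rings \<open>R Quot PIdl\<^bsub>R\<^esub> s\<close>.
\<close>

definition strongly_flat ::
  "'u itself \<Rightarrow> ('a, 'k) ring_scheme \<Rightarrow> 'a set \<Rightarrow> ('a, 'm) module \<Rightarrow> bool" where
  "strongly_flat (_ :: 'u itself) R S F \<longleftrightarrow> module R F \<and>
     (\<forall>C :: ('a, 'u) module. weakly_cotorsion R S C \<longrightarrow> zero_module (Ext1 R F C))"

end

theory Submission
 imports Defs
begin

text \<open>  Write \<open>Q = S\<^sup>-\<^sup>1R\<close>, let \<open>F\<close> be the flat module and \<open>F\<^sub>S\<close> its module of fractions; \<open>S\<close> acts injectively on \<open>F\<close>
 (\<open>flat_torsion_free\<close>).  Vanishing of \<open>Ext\<^sup>1(M, C)\<close> means that linear maps into \<open>C\<close> extend from the syzygies of \<open>M\<close> to its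
 free cover (\<open>zero_Ext1_iff\<close>).

 Suppose that \<open>F\<close> is strongly flat, let \<open>R'\<close> be \<open>Q\<close> or \<open>R / sR\<close>, and let \<open>F'\<close> be the base change of \<open>F\<close> to \<open>R'\<close>.  The kernel of
 \<open>R'\<^sup>(\<^sup>F\<^sup>) \<rightarrow> F'\<close> is an \<open>R'\<close>-module, and \<open>R'\<close>-modules are weakly cotorsion over \<open>R\<close>: elements of \<open>S\<close> act bijectively on
 them, or \<open>s\<close> kills them (\<open>divisible_weakly_cotorsion\<close>, \<open>killed_weakly_cotorsion\<close>).  Therefore \<open>F \<rightarrow> F'\<close> lifts to
 \<open>R'\<^sup>(\<^sup>F\<^sup>)\<close>, and by the universal property of \<open>F'\<close> the lift splits a free cover of \<open>F'\<close> (\<open>projective_of_extends\<close>).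

 Conversely, let \<open>F\<^sub>S\<close> and all \<open>F / sF\<close> be projective.  The main step is that the surjection from
 \<open>Q\<^sup>(\<^sup>F\<^sup>) / R\<^sup>(\<^sup>F\<^sup>)\<close> onto \<open>F\<^sub>S / F\<close> splits (\<open>torsion_section\<close>).  Both are torsion modules.  The elements of
 \<open>F\<^sub>S / F\<close> killed by \<open>v\<close> form a copy of \<open>F / vF\<close>, and projectivity of the latter extends a section from the
 \<open>s\<close>-torsion to the \<open>s t\<close>-torsion (\<open>extend_section\<close>).  If \<open>S\<close> were countable up to divisibility, this could be iterated.  In general, the
 presentation \<open>0 \<rightarrow> N \<rightarrow> R\<^sup>(\<^sup>X\<^sup>) \<rightarrow> Q \<rightarrow> 0\<close> with \<open>N\<close> projective, which exists because the projective dimension of \<open>Q\<close> is at most one,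
 reduces to the countable case.  Call a set \<open>A\<close> of generators of \<open>Q\<close> admissible if it is closed under what the
 relations between its elements require and if its denominators (those \<open>t\<close> for which \<open>1 / t\<close> is a combination
 of elements of \<open>A\<close>) are closed under products.  Each \<open>s\<close> is a denominator of a countable admissible
 set, whose denominators divide the members of a sequence (\<open>countable_admissible\<close>).  For admissible \<open>A\<close> and each \<open>s\<close>
 the ring \<open>R / sR\<close> is a product of a ring in which the denominators of \<open>A\<close> are invertible and one in which some of them is
 zero (\<open>splitting_idempotent\<close>).  Consequently unions of two admissible sets are admissible, sections
 over their torsion parts can be glued, and Zorn's lemma gives a section everywhere (\<open>torsion_splits\<close>).

 The section makes the kernel \<open>G\<close> of \<open>R\<^sup>(\<^sup>X\<^sup>\<times>\<^sup>F\<^sup>) \<rightarrow> Q\<^sup>(\<^sup>F\<^sup>) \<rightarrow> F\<^sub>S / F\<close> projective (\<open>GF_selects\<close>).  The kernel \<open>H\<close> of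
 \<open>R\<^sup>(\<^sup>X\<^sup>\<times>\<^sup>F\<^sup>) \<rightarrow> F\<^sub>S\<close> satisfies \<open>G / H = F\<close>.  If \<open>C\<close> is weakly cotorsion, maps from \<open>H\<close> into \<open>C\<close> extend to \<open>R\<^sup>(\<^sup>X\<^sup>\<times>\<^sup>F\<^sup>)\<close>, because
 \<open>F\<^sub>S\<close> is a direct summand of some \<open>Q\<^sup>(\<^sup>Z\<^sup>)\<close>; in particular they extend to \<open>G\<close>, whence \<open>Ext\<^sup>1(F, C) = 0\<close> (\<open>syzygy_extends\<close>).\<close>

text \<open>Bracketed input forms of the indexed operations, for formulas that involve several modules.\<close>

abbreviation (input) zero_in ("\<zero>[_]") where "\<zero>[M] \<equiv> \<zero>\<^bsub>M\<^esub>"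
abbreviation (input) one_in ("\<one>[_]") where "\<one>[M] \<equiv> \<one>\<^bsub>M\<^esub>"
abbreviation (input) add_in ("_ \<oplus>[_] _" [65, 0, 66] 65) where "x \<oplus>[M] y \<equiv> x \<oplus>\<^bsub>M\<^esub> y"
abbreviation (input) minus_in ("_ \<ominus>[_] _" [65, 0, 66] 65) where "x \<ominus>[M] y \<equiv> x \<ominus>\<^bsub>M\<^esub> y"
abbreviation (input) uminus_in ("\<ominus>[_] _" [0, 81] 80) where "\<ominus>[M] x \<equiv> \<ominus>\<^bsub>M\<^esub> x"
abbreviation (input) mult_in ("_ \<otimes>[_] _" [70, 0, 71] 70) where "x \<otimes>[M] y \<equiv> x \<otimes>\<^bsub>M\<^esub> y"
abbreviation (input) smult_in ("_ \<odot>[_] _" [70, 0, 71] 70) where "r \<odot>[M] x \<equiv> r \<odot>\<^bsub>M\<^esub> x"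
abbreviation (input) coset_in ("_ +>[_] _" [60, 0, 61] 60) where "H +>[M] x \<equiv> H +>\<^bsub>M\<^esub> x"

abbreviation free_set where "free_set R X \<equiv> carrier (free_module R X)"

section \<open>Linear maps on subsets of modules\<close>

lemma (in abelian_group) zero_inv [simp]: "\<ominus>[G] \<zero>[G] = \<zero>[G]"
 using l_neg[of "\<zero>[G]"] r_zero[of "\<ominus>[G] \<zero>[G]"] by auto

lemma (in abelian_group) minus_zero_right [simp]: "x \<in> carrier G ==> x \<ominus>[G] \<zero>[G] = x"
 by (simp add: a_minus_def)

lemma (in abelian_group) minus_self [simp]: "x \<in> carrier G ==> x \<ominus>[G] x = \<zero>[G]"
 by (simp add: a_minus_def r_neg)

lemma (in abelian_group) minus_add_cancel: "x \<in> carrier G ==> y \<in> carrier G ==> x \<ominus>[G] y \<oplus>[G] y = x"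
 by (simp add: a_minus_def a_assoc l_neg)

lemma (in abelian_group) add_minus_cancel: "x \<in> carrier G ==> y \<in> carrier G ==> x \<oplus>[G] (y \<ominus>[G] x) = y"
 by (metis a_comm minus_add_cancel minus_closed)

lemma (in abelian_group) minus_eq_zero_iff:
 "x \<in> carrier G ==> y \<in> carrier G ==> x \<ominus>[G] y = \<zero>[G] \<longleftrightarrow> x = y"
 by (metis l_zero minus_add_cancel minus_self)

lemma (in abelian_group) add_minus_add:
 "a \<in> carrier G ==> b \<in> carrier G ==> c \<in> carrier G ==> d \<in> carrier G ==>
  (a \<oplus>[G] b) \<ominus>[G] (c \<oplus>[G] d) = (a \<ominus>[G] c) \<oplus>[G] (b \<ominus>[G] d)"
 by (simp add: a_minus_def minus_add a_ac)

lemma (in module) smult_minus: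
 "r \<in> carrier R ==> x \<in> carrier M ==> y \<in> carrier M ==> r \<odot>[M] (x \<ominus>[M] y) = r \<odot>[M] x \<ominus>[M] r \<odot>[M] y"
 by (simp add: a_minus_def smult_r_distr smult_r_minus)

lemma (in module) minus_smult:
 "a \<in> carrier R ==> b \<in> carrier R ==> x \<in> carrier M ==> (a \<ominus>[R] b) \<odot>[M] x = a \<odot>[M] x \<ominus>[M] b \<odot>[M] x"
 by (simp add: a_minus_def smult_l_distr smult_l_minus)

text \<open>Linearity on a subset \<open>A\<close>, usually a submodule: many maps below are linear only on a submodule, and none of them
has to be extensional.\<close>

definition lin ::
 "('a, 'k) ring_scheme => ('a, 'm) module => 'm set => ('a, 'n) module => ('m => 'n) => bool" where
 "lin R M A N h \<longleftrightarrow> (\<forall>x\<in>A. h x \<in> carrier N) &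
   (\<forall>x\<in>A. \<forall>y\<in>A. h (x \<oplus>[M] y) = h x \<oplus>[N] h y) &
   (\<forall>r\<in>carrier R. \<forall>x\<in>A. h (r \<odot>[M] x) = r \<odot>[N] h x)"

abbreviation linear where "linear R M N h \<equiv> lin R M (carrier M) N h"

lemma linI:
 assumes "!!x. x \<in> A ==> h x \<in> carrier N"
  and "!!x y. x \<in> A ==> y \<in> A ==> h (x \<oplus>[M] y) = h x \<oplus>[N] h y"
  and "!!r x. r \<in> carrier R ==> x \<in> A ==> h (r \<odot>[M] x) = r \<odot>[N] h x"
 shows "lin R M A N h"
 using assms by (auto simp: lin_def)

lemma lin_closed: "lin R M A N h ==> x \<in> A ==> h x \<in> carrier N"
 and lin_add: "lin R M A N h ==> x \<in> A ==> y \<in> A ==> h (x \<oplus>[M] y) = h x \<oplus>[N] h y"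
 and lin_smult: "lin R M A N h ==> r \<in> carrier R ==> x \<in> A ==> h (r \<odot>[M] x) = r \<odot>[N] h x"
 by (auto simp: lin_def)

lemma lin_subset: "lin R M A N h ==> B <= A ==> lin R M B N h"
 unfolding lin_def by blast

lemma lin_compose:
 "lin R M A N h ==> lin R N B U g ==> (!!x. x \<in> A ==> h x \<in> B) ==> lin R M A U (%x. g (h x))"
 by (auto simp: lin_def)

lemma submodule_closed:
 assumes "module R M" "submodule A R M"
 shows "!!x. x \<in> A ==> x \<in> carrier M"
  and "\<zero>[M] \<in> A"
  and "!!x. x \<in> A ==> \<ominus>[M] x \<in> A"
  and "!!x y. x \<in> A ==> y \<in> A ==> x \<oplus>[M] y \<in> A"
  and "!!x y. x \<in> A ==> y \<in> A ==> x \<ominus>[M] y \<in> A"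
  and "!!r x. r \<in> carrier R ==> x \<in> A ==> r \<odot>[M] x \<in> A"
proof -
 interpret module R M by fact
 note E = submoduleE[OF assms(2)]
 show "!!x. x \<in> A ==> x \<in> carrier M" using E by auto
 show "\<zero>[M] \<in> A"
  using submodule.axioms(1)[OF assms(2)] subgroup.one_closed by fastforce
 show "!!x. x \<in> A ==> \<ominus>[M] x \<in> A" "!!x y. x \<in> A ==> y \<in> A ==> x \<oplus>[M] y \<in> A"
  "!!x y. x \<in> A ==> y \<in> A ==> x \<ominus>[M] y \<in> A"
  "!!r x. r \<in> carrier R ==> x \<in> A ==> r \<odot>[M] x \<in> A"
  using E by (auto simp: a_minus_def)
qed

lemma submoduleI':
 assumes "module R M" "A <= carrier M" "\<zero>[M] \<in> A"
  and "!!x y. x \<in> A ==> y \<in> A ==> x \<oplus>[M] y \<in> A"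
  and "!!r x. r \<in> carrier R ==> x \<in> A ==> r \<odot>[M] x \<in> A"
 shows "submodule A R M"
proof -
 interpret module R M by fact
 have "\<ominus>[M] x \<in> A" if "x \<in> A" for x
 proof -
  have "\<ominus>[M] x = (\<ominus>[R] \<one>[R]) \<odot>[M] x" using that assms(2) by (auto simp: smult_l_minus)
  thus ?thesis using assms(5) that by auto
 qed
 thus ?thesis using assms by (intro submoduleI) auto
qed

lemma lin_zero:
 assumes "module R M" "module R N" "submodule A R M" "lin R M A N h"
 shows "h \<zero>[M] = \<zero>[N]"
proof -
 interpret M: module R M by fact
 interpret N: module R N by fact
 have z: "\<zero>[M] \<in> A" by (rule submodule_closed[OF assms(1,3)])
 have "h (\<zero>[R] \<odot>[M] \<zero>[M]) = \<zero>[R] \<odot>[N] h \<zero>[M]" using lin_smult[OF assms(4) _ z] by auto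
 thus ?thesis using lin_closed[OF assms(4) z] by simp
qed

lemma lin_uminus:
 assumes "module R M" "module R N" "submodule A R M" "lin R M A N h" "x \<in> A"
 shows "h (\<ominus>[M] x) = \<ominus>[N] h x"
proof -
 interpret M: module R M by fact
 interpret N: module R N by fact
 have "x \<in> carrier M" using submodule_closed[OF assms(1,3)] assms(5) by auto
 hence "h (\<ominus>[M] x) = h ((\<ominus>[R] \<one>[R]) \<odot>[M] x)" by (simp add: M.smult_l_minus)
 also have "\<dots> = (\<ominus>[R] \<one>[R]) \<odot>[N] h x" using lin_smult[OF assms(4)] assms(5) by auto
 finally show ?thesis using lin_closed[OF assms(4,5)] by (simp add: N.smult_l_minus)
qed

lemma lin_minus:
 assumes "module R M" "module R N" "submodule A R M" "lin R M A N h" "x \<in> A" "y \<in> A"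
 shows "h (x \<ominus>[M] y) = h x \<ominus>[N] h y"
 using lin_uminus[OF assms(1-4)] lin_add[OF assms(4)] submodule_closed[OF assms(1,3)] assms(5,6)
 by (simp add: a_minus_def)

lemma carrier_submodule: "module R M ==> submodule (carrier M) R M"
 by (rule module.carrier_is_submodule)

lemma lin_kernel_submodule:
 assumes "module R M" "module R N" "submodule A R M" "lin R M A N h" "submodule B R N"
 shows "submodule {x\<in>A. h x \<in> B} R M"
proof (rule submoduleI'[OF assms(1)])
 note A = submodule_closed[OF assms(1,3)] and B = submodule_closed[OF assms(2,5)]
 show "{x\<in>A. h x \<in> B} <= carrier M" using A by auto
 show "\<zero>[M] \<in> {x\<in>A. h x \<in> B}" using A(2) B(2) lin_zero[OF assms(1-4)] by simp
 show "x \<oplus>[M] y \<in> {x\<in>A. h x \<in> B}" if "x \<in> {x\<in>A. h x \<in> B}" "y \<in> {x\<in>A. h x \<in> B}" for x y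
  using that A(4) B(4) by (simp add: lin_add[OF assms(4)])
 show "r \<odot>[M] x \<in> {x\<in>A. h x \<in> B}" if "r \<in> carrier R" "x \<in> {x\<in>A. h x \<in> B}" for r x
  using that A(6) B(6) by (simp add: lin_smult[OF assms(4)])
qed

lemma zero_submodule: "module R M ==> submodule {\<zero>[M]} R M"
proof -
 assume M: "module R M"
 interpret module R M by fact
 show ?thesis by (rule submoduleI'[OF M]) auto
qed

lemma lin_image_submodule:
 assumes "module R M" "module R N" "submodule A R M" "lin R M A N h"
 shows "submodule (h ` A) R N"
proof (rule submoduleI'[OF assms(2)])
 note A = submodule_closed[OF assms(1,3)]
 show "h ` A <= carrier N" using lin_closed[OF assms(4)] by auto
 show "\<zero>[N] \<in> h ` A" using A(2) lin_zero[OF assms] by (metis imageI)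
 show "x \<oplus>[N] y \<in> h ` A" if "x \<in> h ` A" "y \<in> h ` A" for x y
  using that A(4) by (auto simp: lin_add[OF assms(4), symmetric])
 show "r \<odot>[N] x \<in> h ` A" if "r \<in> carrier R" "x \<in> h ` A" for r x
  using that A(6) by (auto simp: lin_smult[OF assms(4), symmetric])
qed

lemma lin_diff:
 assumes "module R M" "module R N" "submodule A R M" "lin R M A N h" "lin R M A N g"
 shows "lin R M A N (%x. h x \<ominus>[N] g x)"
proof -
 interpret N: module R N by fact
 note A = submodule_closed[OF assms(1,3)]
 note h = lin_closed[OF assms(4)] lin_add[OF assms(4)] lin_smult[OF assms(4)]
 note g = lin_closed[OF assms(5)] lin_add[OF assms(5)] lin_smult[OF assms(5)]
 show ?thesis
 proof (rule linI)
  show "h x \<ominus>[N] g x \<in> carrier N" if "x \<in> A" for x using h(1) g(1) that by simp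
  show "h (x \<oplus>[M] y) \<ominus>[N] g (x \<oplus>[M] y) = h x \<ominus>[N] g x \<oplus>[N] (h y \<ominus>[N] g y)"
   if xy: "x \<in> A" "y \<in> A" for x y
  proof -
   have c: "h x \<in> carrier N" "h y \<in> carrier N" "g x \<in> carrier N" "g y \<in> carrier N"
    using xy h g by auto
   show ?thesis unfolding h(2)[OF xy] g(2)[OF xy] using c by (simp add: a_minus_def N.minus_add N.a_ac)
  qed
  show "h (r \<odot>[M] x) \<ominus>[N] g (r \<odot>[M] x) = r \<odot>[N] (h x \<ominus>[N] g x)"
   if "r \<in> carrier R" "x \<in> A" for r x
   using that h g by (simp add: a_minus_def N.smult_r_distr N.smult_r_minus)
 qed
qed

lemma lin_sum:
 assumes "module R N" "lin R M A N h" "lin R M A N g"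
 shows "lin R M A N (%x. h x \<oplus>[N] g x)"
proof -
 interpret N: module R N by fact
 note h = lin_closed[OF assms(2)] lin_add[OF assms(2)] lin_smult[OF assms(2)]
 note g = lin_closed[OF assms(3)] lin_add[OF assms(3)] lin_smult[OF assms(3)]
 show ?thesis
  by (rule linI) (use h g in "auto simp: N.a_ac N.smult_r_distr")
qed

lemma lin_ident: "A <= carrier M ==> lin R M A M (%x. x)"
 by (auto simp: lin_def)

lemma mod_hom_iff_lin:
 "h \<in> mod_hom R M N \<longleftrightarrow> h \<in> extensional (carrier M) & linear R M N h"
 by (auto simp: mod_hom_def lin_def PiE_def)

lemma mod_hom_lin: "h \<in> mod_hom R M N ==> linear R M N h"
 by (simp add: mod_hom_iff_lin)

lemma lin_cong:
 assumes "lin R M A N h" "submodule A R M" "module R M" "!!x. x \<in> A ==> g x = h x"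
 shows "lin R M A N g"
 using assms(1,4) submodule_closed[OF assms(3,2)] by (auto simp: lin_def)

lemma lin_mod_hom:
 assumes "module R M" "linear R M N h"
 shows "restrict h (carrier M) \<in> mod_hom R M N"
 using lin_cong[OF assms(2) carrier_submodule[OF assms(1)] assms(1)]
 by (simp add: mod_hom_iff_lin)

lemma sub_module_sel [simp]:
 "carrier (sub_module M N) = N" "add (sub_module M N) = add M" "zero (sub_module M N) = zero M"
 "smult (sub_module M N) = smult M"
 by (simp_all add: sub_module_def)

lemma sub_module_module: "module R M ==> submodule N R M ==> module R (sub_module M N)"
 unfolding sub_module_def by (rule submodule.submodule_is_module)

lemma lin_sub_module [simp]: "lin R (sub_module M N) A U h \<longleftrightarrow> lin R M A U h"
 by (simp add: lin_def)

section \<open>Free modules\<close>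

lemma free_module_sel [simp]:
 "zero (free_module R X) = (%x. \<zero>[R])"
 "f \<oplus>[free_module R X] g = (%x. f x \<oplus>[R] g x)"
 "r \<odot>[free_module R X] f = (%x. r \<otimes>[R] f x)"
 by (simp_all add: free_module_def)

lemma free_module_mem:
 "f \<in> free_set R X \<longleftrightarrow> (\<forall>x\<in>X. f x \<in> carrier R) & (\<forall>x. x \<notin> X --> f x = \<zero>[R])
   & finite {x. f x ~= \<zero>[R]}"
 by (simp add: free_module_def)

lemma free_module_coord:
 assumes "cring R" "f \<in> free_set R X"
 shows "f x \<in> carrier R"
proof -
 interpret cring R by fact
 show ?thesis using assms(2) by (cases "x \<in> X") (auto simp: free_module_mem)
qed

lemma free_module_module:
 assumes "cring R"
 shows "module R (free_module R X)"
proof -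
 interpret cring R by fact
 note c = free_module_coord[OF assms]
 have fin: "finite {x. g x ~= \<zero>[R]}" if "{x. g x ~= \<zero>[R]} <= {x. f x ~= \<zero>[R]} \<union> {x. h x ~= \<zero>[R]}"
  "finite {x. f x ~= \<zero>[R]}" "finite {x. h x ~= \<zero>[R]}" for f g h :: "_ => 'a"
  using that finite_subset by blast
 show ?thesis
 proof (rule moduleI)
  show "cring R" by fact
  show "abelian_group (free_module R X)"
  proof (rule abelian_groupI)
   fix f g assume fg: "f \<in> free_set R X" "g \<in> free_set R X"
   have "{x. f x \<oplus>[R] g x ~= \<zero>[R]} <= {x. f x ~= \<zero>[R]} \<union> {x. g x ~= \<zero>[R]}" by auto
   hence "finite {x. f x \<oplus>[R] g x ~= \<zero>[R]}" using fg fin[of "%x. f x \<oplus>[R] g x" f g] by (simp add: free_module_mem)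
   thus "f \<oplus>[free_module R X] g \<in> free_set R X"
    using fg by (auto simp: free_module_mem)
   show "f \<oplus>[free_module R X] g = g \<oplus>[free_module R X] f"
    using c[OF fg(1)] c[OF fg(2)] by (auto intro: a_comm)
   fix h assume h: "h \<in> free_set R X"
   show "f \<oplus>[free_module R X] g \<oplus>[free_module R X] h = f \<oplus>[free_module R X] (g \<oplus>[free_module R X] h)"
    using c[OF fg(1)] c[OF fg(2)] c[OF h] by (auto simp: fun_eq_iff a_assoc)
  next
   show "\<zero>[free_module R X] \<in> free_set R X" by (simp add: free_module_mem)
  next
   fix f assume f: "f \<in> free_set R X"
   show "\<zero>[free_module R X] \<oplus>[free_module R X] f = f" using c[OF f] by simp
   have "(%x. \<ominus>[R] f x) \<in> free_set R X"
   proof -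
    have "{x. \<ominus>[R] f x ~= \<zero>[R]} <= {x. f x ~= \<zero>[R]}" by auto
    thus ?thesis using f finite_subset by (auto simp: free_module_mem)
   qed
   moreover have "(%x. \<ominus>[R] f x) \<oplus>[free_module R X] f = \<zero>[free_module R X]"
    using c[OF f] by (simp add: l_neg)
   ultimately show "\<exists>y\<in>free_set R X. y \<oplus>[free_module R X] f = \<zero>[free_module R X]"
    by blast
  qed
  fix a f assume a: "a \<in> carrier R" and f: "f \<in> free_set R X"
  have "{x. a \<otimes>[R] f x ~= \<zero>[R]} <= {x. f x ~= \<zero>[R]}" using a by auto
  thus "a \<odot>[free_module R X] f \<in> free_set R X"
   using a f finite_subset by (auto simp: free_module_mem)
 qed (auto simp: c fun_eq_iff l_distr r_distr m_assoc)
qed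

lemma basis_vector_closed:
 assumes "cring R" "x \<in> X"
 shows "basis_vector R x \<in> free_set R X"
proof -
 interpret cring R by fact
 have "{y. basis_vector R x y ~= \<zero>[R]} <= {x}" by (auto simp: basis_vector_def)
 thus ?thesis using assms(2) finite_subset by (auto simp: free_module_mem basis_vector_def)
qed

lemma free_module_induct [consumes 2, case_names zero add smult basis]:
 assumes "cring R" "f \<in> free_set R X"
  and zero: "P (%x. \<zero>[R])"
  and add: "!!f g. f \<in> free_set R X ==> g \<in> free_set R X ==> P f ==> P g
    ==> P (f \<oplus>[free_module R X] g)"
  and smult: "!!r f. r \<in> carrier R ==> f \<in> free_set R X ==> P f ==> P (r \<odot>[free_module R X] f)"
  and basis: "!!x. x \<in> X ==> P (basis_vector R x)"
 shows "P f"
proof -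
 interpret cring R by fact
 have "\<forall>f\<in>free_set R X. {x. f x ~= \<zero>[R]} <= B --> P f" if "finite B" for B
  using that
 proof (induction B)
  case empty
  show ?case
  proof (intro ballI impI)
   fix f assume "f \<in> free_set R X" "{x. f x ~= \<zero>[R]} <= {}"
   hence "f = (%x. \<zero>[R])" by auto
   thus "P f" using zero by simp
  qed
 next
  case (insert b B)
  show ?case
  proof (intro ballI impI)
   fix f assume f: "f \<in> free_set R X" and sub: "{x. f x ~= \<zero>[R]} <= insert b B"
   show "P f"
   proof (cases "b \<in> X")
    case True
    let ?g = "f(b := \<zero>[R])"
    have g: "?g \<in> free_set R X"
    proof -
     have "{x. ?g x ~= \<zero>[R]} <= {x. f x ~= \<zero>[R]}" by auto
     thus ?thesis using f finite_subset[OF \<open>{x. ?g x ~= \<zero>[R]} <= _\<close>]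
      by (auto simp: free_module_mem)
    qed
    have "{x. ?g x ~= \<zero>[R]} <= B" using sub by auto
    hence "P ?g" using insert.IH g by auto
    moreover have "P (f b \<odot>[free_module R X] basis_vector R b)"
     using smult basis basis_vector_closed[OF assms(1) True] True free_module_coord[OF assms(1) f] by blast
    moreover have "?g \<oplus>[free_module R X] (f b \<odot>[free_module R X] basis_vector R b) = f"
     using free_module_coord[OF assms(1) f] by (auto simp: basis_vector_def)
    moreover have "f b \<odot>[free_module R X] basis_vector R b \<in> free_set R X"
     using module.smult_closed[OF free_module_module[OF assms(1)]]
      basis_vector_closed[OF assms(1) True] free_module_coord[OF assms(1) f] by blast
    ultimately show ?thesis using add[OF g] by metis
   next
    case False
    hence "f b = \<zero>[R]" using f by (auto simp: free_module_mem)
    hence "{x. f x ~= \<zero>[R]} <= B" using sub by auto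
    thus ?thesis using insert.IH f by auto
   qed
  qed
 qed
 moreover have "finite {x. f x ~= \<zero>[R]}" using assms(2) by (simp add: free_module_mem)
 ultimately show ?thesis using assms(2) by blast
qed

lemma lin_eq_on_basis:
 assumes "cring R" "module R U" "linear R (free_module R X) U h"
  "linear R (free_module R X) U g"
  and "!!x. x \<in> X ==> h (basis_vector R x) = g (basis_vector R x)"
  and "f \<in> free_set R X"
 shows "h f = g f"
 using assms(1,6)
proof (induction rule: free_module_induct)
 case zero
 have M: "module R (free_module R X)" by (rule free_module_module) fact
 show ?case using lin_zero[OF M assms(2) carrier_submodule[OF M] assms(3)]
   lin_zero[OF M assms(2) carrier_submodule[OF M] assms(4)] by simp
next
 case (add f g')
 thus ?case using lin_add[OF assms(3)] lin_add[OF assms(4)] by metis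
next
 case (smult r f)
 thus ?case using lin_smult[OF assms(3)] lin_smult[OF assms(4)] by metis
qed (use assms(5) in auto)

text \<open>The support of a single function is too small to be kept fixed in a computation with several functions.\<close>

lemma linear_ext_superset:
 assumes "cring R" "module R U" "!!x. x \<in> X ==> \<phi> x \<in> carrier U" "f \<in> free_set R X"
  "finite B" "{x. f x ~= \<zero>[R]} <= B" "B <= X"
 shows "linear_ext R X U \<phi> f = (\<Oplus>\<^bsub>U\<^esub>x\<in>B. f x \<odot>[U] \<phi> x)"
proof -
 interpret U: module R U by fact
 have "(\<Oplus>\<^bsub>U\<^esub>x\<in>{x. f x ~= \<zero>[R]}. f x \<odot>[U] \<phi> x) = (\<Oplus>\<^bsub>U\<^esub>x\<in>B. f x \<odot>[U] \<phi> x)"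
  using assms free_module_coord[OF assms(1,4)]
  by (intro U.add.finprod_mono_neutral_cong_left) auto
 thus ?thesis using assms(4) by (simp add: linear_ext_def)
qed

lemma linear_ext_lin:
 assumes "cring R" "module R U" "!!x. x \<in> X ==> \<phi> x \<in> carrier U"
 shows "linear R (free_module R X) U (linear_ext R X U \<phi>)"
proof -
 interpret R: cring R by fact
 interpret U: module R U by fact
 interpret M: module R "free_module R X" by (rule free_module_module) fact
 note c = free_module_coord[OF assms(1)]
 note ls = linear_ext_superset[OF assms]
 show ?thesis
 proof (rule linI)
  fix f assume f: "f \<in> free_set R X"
  hence fin: "finite {x. f x ~= \<zero>[R]}" and sub: "{x. f x ~= \<zero>[R]} <= X" by (auto simp: free_module_mem)
  show "linear_ext R X U \<phi> f \<in> carrier U"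
   using f sub assms(3) c[OF f] by (auto simp: linear_ext_def intro!: U.finsum_closed)
  fix r assume r: "r \<in> carrier R"
  have rf: "r \<odot>[free_module R X] f \<in> free_set R X" using r f by blast
  have "linear_ext R X U \<phi> (r \<odot>[free_module R X] f) = (\<Oplus>\<^bsub>U\<^esub>x\<in>{x. f x ~= \<zero>[R]}. (r \<odot>[free_module R X] f) x \<odot>[U] \<phi> x)"
   by (rule ls[OF _ rf fin _ sub]) (use r in auto)
  also have "\<dots> = (\<Oplus>\<^bsub>U\<^esub>x\<in>{x. f x ~= \<zero>[R]}. r \<odot>[U] (f x \<odot>[U] \<phi> x))"
   by (intro U.finsum_cong') (use r c[OF f] sub assms(3) in "auto simp: U.smult_assoc1")
  also have "\<dots> = r \<odot>[U] (\<Oplus>\<^bsub>U\<^esub>x\<in>{x. f x ~= \<zero>[R]}. f x \<odot>[U] \<phi> x)"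
   using fin r c[OF f] sub assms(3) by (intro U.finsum_smult_ldistr[symmetric]) auto
  also have "\<dots> = r \<odot>[U] linear_ext R X U \<phi> f" using f by (simp add: linear_ext_def)
  finally show "linear_ext R X U \<phi> (r \<odot>[free_module R X] f) = r \<odot>[U] linear_ext R X U \<phi> f" .
 next
  fix f g assume f: "f \<in> free_set R X" and g: "g \<in> free_set R X"
  let ?B = "{x. f x ~= \<zero>[R]} \<union> {x. g x ~= \<zero>[R]}"
  have fin: "finite ?B" and sub: "?B <= X" using f g by (auto simp: free_module_mem)
  have fg: "f \<oplus>[free_module R X] g \<in> free_set R X" using f g by blast
  have "linear_ext R X U \<phi> (f \<oplus>[free_module R X] g) = (\<Oplus>\<^bsub>U\<^esub>x\<in>?B. (f x \<oplus>[R] g x) \<odot>[U] \<phi> x)"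
   by (subst ls[OF _ fg fin _ sub]) auto
  also have "\<dots> = (\<Oplus>\<^bsub>U\<^esub>x\<in>?B. f x \<odot>[U] \<phi> x \<oplus>[U] g x \<odot>[U] \<phi> x)"
   by (intro U.finsum_cong') (use c[OF f] c[OF g] sub assms(3) in "auto simp: U.smult_l_distr")
  also have "\<dots> = (\<Oplus>\<^bsub>U\<^esub>x\<in>?B. f x \<odot>[U] \<phi> x) \<oplus>[U] (\<Oplus>\<^bsub>U\<^esub>x\<in>?B. g x \<odot>[U] \<phi> x)"
   using fin c[OF f] c[OF g] sub assms(3) by (intro U.finsum_addf) auto
  also have "\<dots> = linear_ext R X U \<phi> f \<oplus>[U] linear_ext R X U \<phi> g"
   by (subst ls[OF _ f fin _ sub], auto, subst ls[OF _ g fin _ sub], auto)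
  finally show "linear_ext R X U \<phi> (f \<oplus>[free_module R X] g) = linear_ext R X U \<phi> f \<oplus>[U] linear_ext R X U \<phi> g" .
 qed
qed

lemma linear_ext_basis:
 assumes "cring R" "module R U" "!!x. x \<in> X ==> \<phi> x \<in> carrier U" "x \<in> X"
 shows "linear_ext R X U \<phi> (basis_vector R x) = \<phi> x"
proof -
 interpret R: cring R by fact
 interpret U: module R U by fact
 have "linear_ext R X U \<phi> (basis_vector R x) = (\<Oplus>\<^bsub>U\<^esub>y\<in>{x}. basis_vector R x y \<odot>[U] \<phi> y)"
  by (rule linear_ext_superset[OF assms(1-3) basis_vector_closed[OF assms(1,4)]])
   (use assms in "auto simp: basis_vector_def")
 thus ?thesis using assms by (simp add: basis_vector_def)
qed

section \<open>Quotient modules\<close>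

lemma quotient_module_sel [simp]:
 "carrier (quotient_module M N) = a_rcosets\<^bsub>M\<^esub> N"
 "zero (quotient_module M N) = N"
 "add (quotient_module M N) = set_add M"
 "r \<odot>[quotient_module M N] X = (\<Union>x\<in>X. N +>[M] (r \<odot>[M] x))"
 by (simp_all add: quotient_module_def)

lemma submodule_abelian_subgroup:
 assumes "module R M" "submodule N R M"
 shows "abelian_subgroup N M"
proof -
 interpret M: module R M by fact
 have "additive_subgroup N M"
  using submodule.axioms(1)[OF assms(2)] by (simp add: additive_subgroup_def)
 thus ?thesis using M.abelian_group_axioms by (rule abelian_subgroupI3)
qed

lemma coset_eq_iff:
 assumes "module R M" "submodule N R M" "x \<in> carrier M" "y \<in> carrier M"
 shows "N +>[M] x = N +>[M] y \<longleftrightarrow> x \<ominus>[M] y \<in> N"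
proof -
 interpret M: module R M by fact
 interpret abelian_subgroup N M by (rule submodule_abelian_subgroup) fact+
 have "N +>[M] x = N +>[M] y \<longleftrightarrow> x \<in> N +>[M] y"
  using a_repr_independence'[of x y] a_rcos_self[OF assms(3)] assms by auto
 also have "\<dots> \<longleftrightarrow> x \<ominus>[M] y \<in> N"
  using a_rcos_module[OF assms(4,3)] by (simp add: a_minus_def)
 finally show ?thesis .
qed

lemma coset_smult:
 assumes "module R M" "submodule N R M" "x \<in> carrier M" "r \<in> carrier R"
 shows "r \<odot>[quotient_module M N] (N +>[M] x) = N +>[M] (r \<odot>[M] x)"
proof -
 interpret M: module R M by fact
 interpret abelian_subgroup N M by (rule submodule_abelian_subgroup) fact+
 have "N +>[M] (r \<odot>[M] y) = N +>[M] (r \<odot>[M] x)" if "y \<in> N +>[M] x" for y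
 proof -
  have y: "y \<in> carrier M" using that a_elemrcos_carrier[OF assms(3)] by auto
  hence "y \<ominus>[M] x \<in> N" using that a_rcos_module[OF assms(3)] by (simp add: a_minus_def)
  hence "r \<odot>[M] (y \<ominus>[M] x) \<in> N" using submodule_closed(6)[OF assms(1,2,4)] by auto
  hence "r \<odot>[M] y \<ominus>[M] r \<odot>[M] x \<in> N"
   using assms y by (simp add: a_minus_def M.smult_r_distr M.smult_r_minus)
  thus ?thesis using coset_eq_iff[OF assms(1,2)] assms y by simp
 qed
 moreover have "x \<in> N +>[M] x" by (rule a_rcos_self) fact
 ultimately show ?thesis unfolding quotient_module_sel by blast
qed

lemma coset_add:
 assumes "module R M" "submodule N R M" "x \<in> carrier M" "y \<in> carrier M"
 shows "(N +>[M] x) \<oplus>[quotient_module M N] (N +>[M] y) = N +>[M] (x \<oplus>[M] y)"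
proof -
 interpret M: module R M by fact
 interpret abelian_subgroup N M by (rule submodule_abelian_subgroup) fact+
 show ?thesis using a_rcos_sum[OF assms(3,4)] by simp
qed

lemma coset_closed: "x \<in> carrier M ==> N +>[M] x \<in> carrier (quotient_module M N)"
 by (auto simp: A_RCOSETS_def' )

lemma coset_cases:
 assumes "C \<in> carrier (quotient_module M N)"
 obtains x where "x \<in> carrier M" "C = N +>[M] x"
 using assms by (auto simp: A_RCOSETS_def')

lemma quotient_module_module:
 assumes "module R M" "submodule N R M"
 shows "module R (quotient_module M N)"
proof -
 interpret M: module R M by fact
 interpret abelian_subgroup N M by (rule submodule_abelian_subgroup) fact+
 note S = coset_smult[OF assms] and A = coset_add[OF assms]
 have z: "N +>[M] \<zero>[M] = N"
  using submodule_closed(1)[OF assms] by (intro M.a_coset_add_zero) auto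
 show ?thesis
 proof (rule moduleI)
  show "cring R" by (rule M.R.is_cring)
  show "abelian_group (quotient_module M N)"
  proof (rule abelian_groupI)
   fix C D assume C: "C \<in> carrier (quotient_module M N)" and D: "D \<in> carrier (quotient_module M N)"
   obtain x where x: "x \<in> carrier M" "C = N +>[M] x" using C by (rule coset_cases)
   obtain y where y: "y \<in> carrier M" "D = N +>[M] y" using D by (rule coset_cases)
   show "C \<oplus>[quotient_module M N] D \<in> carrier (quotient_module M N)"
    unfolding x(2) y(2) A[OF x(1) y(1)] by (rule coset_closed[OF M.a_closed[OF x(1) y(1)]])
   show "C \<oplus>[quotient_module M N] D = D \<oplus>[quotient_module M N] C"
    unfolding x(2) y(2) A[OF x(1) y(1)] A[OF y(1) x(1)] using x(1) y(1) by (simp add: M.a_comm)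
   fix E assume E: "E \<in> carrier (quotient_module M N)"
   obtain z where z: "z \<in> carrier M" "E = N +>[M] z" using E by (rule coset_cases)
   show "C \<oplus>[quotient_module M N] D \<oplus>[quotient_module M N] E = C \<oplus>[quotient_module M N] (D \<oplus>[quotient_module M N] E)"
    unfolding x(2) y(2) z(2) using x(1) y(1) z(1) A by (simp add: M.a_assoc del: quotient_module_sel)
  next
   show "\<zero>[quotient_module M N] \<in> carrier (quotient_module M N)"
    using coset_closed[OF M.zero_closed, of N] z by simp
  next
   fix C assume C: "C \<in> carrier (quotient_module M N)"
   obtain x where x: "x \<in> carrier M" "C = N +>[M] x" using C by (rule coset_cases)
   have "\<zero>[quotient_module M N] \<oplus>[quotient_module M N] C = (N +>[M] \<zero>[M]) \<oplus>[quotient_module M N] (N +>[M] x)"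
    unfolding x(2) z by simp
   thus "\<zero>[quotient_module M N] \<oplus>[quotient_module M N] C = C"
    unfolding A[OF M.zero_closed x(1)] using x by simp
   have "(N +>[M] (\<ominus>[M] x)) \<oplus>[quotient_module M N] C = \<zero>[quotient_module M N]"
    unfolding x(2) using A[of "\<ominus>[M] x" x] x(1) z by (simp add: M.l_neg del: quotient_module_sel(3))
   thus "\<exists>D\<in>carrier (quotient_module M N). D \<oplus>[quotient_module M N] C = \<zero>[quotient_module M N]"
    using coset_closed[OF M.a_inv_closed[OF x(1)]] by blast
  qed
  fix a C assume a: "a \<in> carrier R" and C: "C \<in> carrier (quotient_module M N)"
  obtain x where x: "x \<in> carrier M" "C = N +>[M] x" using C by (rule coset_cases)
  show "a \<odot>[quotient_module M N] C \<in> carrier (quotient_module M N)"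
   unfolding x(2) S[OF x(1) a] by (rule coset_closed[OF M.smult_closed[OF a x(1)]])
  fix b assume b: "b \<in> carrier R"
  show "(a \<oplus>[R] b) \<odot>[quotient_module M N] C = a \<odot>[quotient_module M N] C \<oplus>[quotient_module M N] b \<odot>[quotient_module M N] C"
   unfolding x(2) using a b x(1) S[of x] A by (simp add: M.smult_l_distr del: quotient_module_sel)
  show "(a \<otimes>[R] b) \<odot>[quotient_module M N] C = a \<odot>[quotient_module M N] (b \<odot>[quotient_module M N] C)"
   unfolding x(2) using a b x(1) S by (simp add: M.smult_assoc1 del: quotient_module_sel)
 next
  fix a C D assume a: "a \<in> carrier R" and C: "C \<in> carrier (quotient_module M N)" and D: "D \<in> carrier (quotient_module M N)"
  obtain x where x: "x \<in> carrier M" "C = N +>[M] x" using C by (rule coset_cases)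
  obtain y where y: "y \<in> carrier M" "D = N +>[M] y" using D by (rule coset_cases)
  show "a \<odot>[quotient_module M N] (C \<oplus>[quotient_module M N] D) = a \<odot>[quotient_module M N] C \<oplus>[quotient_module M N] a \<odot>[quotient_module M N] D"
   unfolding x(2) y(2) using a x(1) y(1) S A by (simp add: M.smult_r_distr del: quotient_module_sel)
 next
  fix C assume C: "C \<in> carrier (quotient_module M N)"
  obtain x where x: "x \<in> carrier M" "C = N +>[M] x" using C by (rule coset_cases)
  show "\<one>[R] \<odot>[quotient_module M N] C = C"
   unfolding x(2) using x(1) S by (simp del: quotient_module_sel)
 qed
qed

lemma coset_lin:
 assumes "module R M" "submodule N R M"
 shows "linear R M (quotient_module M N) (%x. N +>[M] x)"
 by (rule linI) (simp_all add: coset_closed coset_add[OF assms, symmetric] coset_smult[OF assms, symmetric]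
   del: quotient_module_sel)

lemma coset_eq_zero:
 assumes "module R M" "submodule N R M" "x \<in> carrier M"
 shows "N +>[M] x = N \<longleftrightarrow> x \<in> N"
proof -
 interpret M: module R M by fact
 note N = submodule_closed[OF assms(1,2)]
 have "N +>[M] \<zero>[M] = N"
  using N(1) by (intro M.a_coset_add_zero) auto
 moreover have "x \<ominus>[M] \<zero>[M] = x"
  using M.l_neg[of "\<zero>[M]"] M.r_zero[of "\<ominus>[M] \<zero>[M]"] M.r_zero[OF assms(3)] by (metis M.a_inv_closed M.zero_closed a_minus_def)
 ultimately show ?thesis using coset_eq_iff[OF assms, of "\<zero>[M]"] assms(3) by simp
qed

section \<open>Selecting linear maps from linear relations\<close>

text \<open>
 A linear relation that is total on \<open>A\<close> is a surjection onto \<open>A\<close> in disguise (its graph projects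
 onto \<open>A\<close>), and a linear map contained in it is a section of that surjection.  Phrasing the lifting
 property of projective modules in this way spares the pullbacks and quotient modules which a
 formulation with surjections would need.
\<close>

definition linrel ::
 "('a, 'k) ring_scheme => ('a, 'm) module => 'm set => ('a, 'n) module => ('m => 'n => bool) => bool" where
 "linrel R M A N \<Gamma> \<longleftrightarrow> (\<forall>x\<in>A. \<exists>u\<in>carrier N. \<Gamma> x u) &
   (\<forall>x\<in>A. \<forall>y\<in>A. \<forall>u\<in>carrier N. \<forall>v\<in>carrier N. \<Gamma> x u --> \<Gamma> y v --> \<Gamma> (x \<oplus>[M] y) (u \<oplus>[N] v)) &
   (\<forall>r\<in>carrier R. \<forall>x\<in>A. \<forall>u\<in>carrier N. \<Gamma> x u --> \<Gamma> (r \<odot>[M] x) (r \<odot>[N] u))"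

lemma linrelI:
 assumes "!!x. x \<in> A ==> \<exists>u\<in>carrier N. \<Gamma> x u"
  and "!!x y u v. x \<in> A ==> y \<in> A ==> u \<in> carrier N ==> v \<in> carrier N ==> \<Gamma> x u ==> \<Gamma> y v ==> \<Gamma> (x \<oplus>[M] y) (u \<oplus>[N] v)"
  and "!!r x u. r \<in> carrier R ==> x \<in> A ==> u \<in> carrier N ==> \<Gamma> x u ==> \<Gamma> (r \<odot>[M] x) (r \<odot>[N] u)"
 shows "linrel R M A N \<Gamma>"
 using assms by (auto simp: linrel_def)

lemma linrel_total: "linrel R M A N \<Gamma> ==> x \<in> A ==> \<exists>u\<in>carrier N. \<Gamma> x u"
 and linrel_add: "linrel R M A N \<Gamma> ==> x \<in> A ==> y \<in> A ==> u \<in> carrier N ==> v \<in> carrier N ==> \<Gamma> x u ==> \<Gamma> y v ==> \<Gamma> (x \<oplus>[M] y) (u \<oplus>[N] v)"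
 and linrel_smult: "linrel R M A N \<Gamma> ==> r \<in> carrier R ==> x \<in> A ==> u \<in> carrier N ==> \<Gamma> x u ==> \<Gamma> (r \<odot>[M] x) (r \<odot>[N] u)"
 by (auto simp: linrel_def)

lemma linrel_uminus:
 assumes "module R M" "module R N" "linrel R M A N \<Gamma>" "x \<in> A" "x \<in> carrier M" "u \<in> carrier N" "\<Gamma> x u"
 shows "\<Gamma> (\<ominus>[M] x) (\<ominus>[N] u)"
proof -
 interpret M: module R M by fact
 interpret N: module R N by fact
 have "\<Gamma> ((\<ominus>[R]\<one>[R]) \<odot>[M] x) ((\<ominus>[R]\<one>[R]) \<odot>[N] u)"
  by (rule linrel_smult[OF assms(3)]) (use assms in auto)
 thus ?thesis using assms by (simp add: M.smult_l_minus N.smult_l_minus)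
qed

lemma linrel_minus:
 assumes "module R M" "module R N" "submodule A R M" "linrel R M A N \<Gamma>" "x \<in> A" "y \<in> A"
  "u \<in> carrier N" "v \<in> carrier N" "\<Gamma> x u" "\<Gamma> y v"
 shows "\<Gamma> (x \<ominus>[M] y) (u \<ominus>[N] v)"
proof -
 interpret N: module R N by fact
 note A = submodule_closed[OF assms(1,3)]
 show ?thesis unfolding a_minus_def
  by (rule linrel_add[OF assms(4)]) (use assms A linrel_uminus[OF assms(1,2,4)] in auto)
qed

text \<open>Over all \<open>N\<close> this is projectivity of \<open>A\<close>.\<close>

definition selects ::
 "('a, 'k) ring_scheme => ('a, 'm) module => 'm set => ('a, 'n) module => bool" where
 "selects R M A N \<longleftrightarrow> (\<forall>\<Gamma>. linrel R M A N \<Gamma> --> (\<exists>h. lin R M A N h & (\<forall>x\<in>A. \<Gamma> x (h x))))"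

lemma selectsD:
 assumes "selects R M A N" "linrel R M A N \<Gamma>"
 obtains h where "lin R M A N h" "\<forall>x\<in>A. \<Gamma> x (h x)"
 using assms unfolding selects_def by blast

lemma linrel_comp:
 assumes "linrel R N B U \<Gamma>" "lin R M A N h" "!!x. x \<in> A ==> h x \<in> B"
 shows "linrel R M A U (%x. \<Gamma> (h x))"
proof (rule linrelI)
 note h = lin_add[OF assms(2)] lin_smult[OF assms(2)]
 show "\<exists>u\<in>carrier U. \<Gamma> (h x) u" if "x \<in> A" for x
  using linrel_total[OF assms(1)] assms(3) that by auto
 show "\<Gamma> (h (x \<oplus>[M] y)) (u \<oplus>[U] v)"
  if "x \<in> A" "y \<in> A" "u \<in> carrier U" "v \<in> carrier U" "\<Gamma> (h x) u" "\<Gamma> (h y) v" for x y u v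
  unfolding h(1)[OF that(1,2)] by (rule linrel_add[OF assms(1)]) (use that assms(3) in auto)
 show "\<Gamma> (h (r \<odot>[M] x)) (r \<odot>[U] u)"
  if "r \<in> carrier R" "x \<in> A" "u \<in> carrier U" "\<Gamma> (h x) u" for r x u
  unfolding h(2)[OF that(1,2)] by (rule linrel_smult[OF assms(1)]) (use that assms(3) in auto)
qed

lemma linear_ext_selects:
 assumes "cring R" "module R U" "!!x. x \<in> X ==> \<phi> x \<in> carrier U" "!!x. x \<in> X ==> \<Gamma> (basis_vector R x) (\<phi> x)"
  "linrel R (free_module R X) (free_set R X) U \<Gamma>" "f \<in> free_set R X"
 shows "\<Gamma> f (linear_ext R X U \<phi> f)"
proof -
 interpret M: module R "free_module R X" by (rule free_module_module) fact
 interpret U: module R U by fact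
 have L: "linear R (free_module R X) U (linear_ext R X U \<phi>)"
  by (rule linear_ext_lin) fact+
 note c = lin_closed[OF L]
 show ?thesis
  using assms(1,6)
 proof (induction rule: free_module_induct)
  case zero
  obtain u where u: "u \<in> carrier U" "\<Gamma> \<zero>[free_module R X] u"
   using linrel_total[OF assms(5)] by blast
  hence "\<Gamma> (\<zero>[R] \<odot>[free_module R X] \<zero>[free_module R X]) (\<zero>[R] \<odot>[U] u)"
   using linrel_smult[OF assms(5)] by blast
  moreover have "linear_ext R X U \<phi> \<zero>[free_module R X] = \<zero>[U]"
   by (rule lin_zero[OF M.module_axioms U.module_axioms carrier_submodule[OF M.module_axioms] L])
  ultimately show ?case using u by simp
 next
  case (add f g)
  thus ?case using linrel_add[OF assms(5), of f g] lin_add[OF L, of f g] c by simp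
 next
  case (smult r f)
  thus ?case using linrel_smult[OF assms(5), of r f] lin_smult[OF L, of r f] c by simp
 next
  case (basis x)
  have "linear_ext R X U \<phi> (basis_vector R x) = \<phi> x" 
   by (rule linear_ext_basis[OF assms(1) assms(2) _ basis]) (rule assms(3))
  thus ?case using assms(4)[OF basis] by (rule ssubst)
 qed
qed

lemma free_selects:
 assumes "cring R" "module R U"
 shows "selects R (free_module R X) (free_set R X) U"
 unfolding selects_def
proof (intro allI impI)
 fix \<Gamma> assume \<Gamma>: "linrel R (free_module R X) (free_set R X) U \<Gamma>"
 have "\<forall>x\<in>X. \<exists>u\<in>carrier U. \<Gamma> (basis_vector R x) u"
  by (intro ballI linrel_total[OF \<Gamma>] basis_vector_closed[OF assms(1)])
 then obtain \<phi> where \<phi>: "!!x. x \<in> X ==> \<phi> x \<in> carrier U" "!!x. x \<in> X ==> \<Gamma> (basis_vector R x) (\<phi> x)"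
  by metis
 show "\<exists>h. linear R (free_module R X) U h & (\<forall>f\<in>free_set R X. \<Gamma> f (h f))"
  by (intro exI[of _ "linear_ext R X U \<phi>"] conjI ballI linear_ext_lin[OF assms \<phi>(1)]
    linear_ext_selects[OF assms \<phi> \<Gamma>])
qed

text \<open>The lifting property passes to linear retracts.\<close>

lemma retract_selects:
 assumes "selects R M A U" "lin R N B M i" "lin R M A N q"
  and "!!x. x \<in> B ==> i x \<in> A" "!!x. x \<in> A ==> q x \<in> B" "!!x. x \<in> B ==> q (i x) = x"
 shows "selects R N B U"
 unfolding selects_def
proof (intro allI impI)
 fix \<Gamma> assume \<Gamma>: "linrel R N B U \<Gamma>"
 have "linrel R M A U (%x. \<Gamma> (q x))"
  by (rule linrel_comp[OF \<Gamma> assms(3,5)])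
 then obtain h where h: "lin R M A U h" "\<forall>x\<in>A. \<Gamma> (q x) (h x)"
  by (rule selectsD[OF assms(1)])
 have "lin R N B U (%x. h (i x))" by (rule lin_compose[OF assms(2) h(1) assms(4)])
 moreover have "\<forall>x\<in>B. \<Gamma> x (h (i x))" using bspec[OF h(2) assms(4)] assms(6) by simp
 ultimately show "\<exists>h. lin R N B U h & (\<forall>x\<in>B. \<Gamma> x (h x))" by blast
qed

lemma projective_selects:
 fixes P :: "('a, 'p) module"
 assumes "projective_module R P" "module R U"
 shows "selects R P (carrier P) U"
proof -
 obtain X :: "'p set" and i q where iq: "i \<in> mod_hom R P (free_module R X)" "q \<in> mod_hom R (free_module R X) P"
  "\<forall>x\<in>carrier P. q (i x) = x" and P: "module R P"
  using assms(1) unfolding projective_module_def by blast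
 have R: "cring R" using P by (rule module.axioms)
 note i = mod_hom_lin[OF iq(1)] and q = mod_hom_lin[OF iq(2)]
 show ?thesis
  by (rule retract_selects[OF free_selects[OF R assms(2)] i q])
   (use lin_closed[OF i] lin_closed[OF q] iq(3) in auto)
qed

section \<open>Vanishing of the first Ext module\<close>

text \<open>The condition that \<open>Ext\<^sup>1\<close> of \<open>P / A\<close> with values in \<open>C\<close> vanishes, for a projective \<open>P\<close>.\<close>

definition extends :: "('a, 'k) ring_scheme => ('a, 'm) module => 'm set => ('a, 'c) module => bool" where
 "extends R P A C \<longleftrightarrow> (\<forall>f. lin R P A C f --> (\<exists>g. linear R P C g & (\<forall>x\<in>A. g x = f x)))"

lemma extendsD:
 assumes "extends R P A C" "lin R P A C f"
 obtains g where "linear R P C g" "!!x. x \<in> A ==> g x = f x"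
 using assms by (auto simp: extends_def)

text \<open>
 Two presentations of the same module, or of a module and a retract of it, are compared by lifting
 the identity (or the inclusion and the retraction) to maps \<open>a\<close> and \<open>b\<close>.
\<close>

lemma extends_transfer:
 assumes M: "module R P" "module R P'" "module R C" and A: "submodule A R P"
  and a: "linear R P P' a" "!!x. x \<in> carrier P ==> a x \<in> B" "!!x. x \<in> A ==> a x \<in> A'"
  and b: "lin R P' B P b" "!!x. x \<in> A' ==> b x \<in> A" and AB: "A' <= B"
  and ba: "!!x. x \<in> carrier P ==> b (a x) \<ominus>[P] x \<in> A"
  and ext: "!!f. lin R P' A' C f ==> \<exists>g. lin R P' B C g & (\<forall>x\<in>A'. g x = f x)"
 shows "extends R P A C"
 unfolding extends_def
proof (intro allI impI)
 fix f assume f: "lin R P A C f"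
 interpret P: module R P by fact
 interpret C: module R C by fact
 have P: "submodule (carrier P) R P" by (rule carrier_submodule) fact
 have "lin R P' A' C (%x. f (b x))"
  by (rule lin_compose[OF lin_subset[OF b(1) AB] f b(2)])
 then obtain g where g: "lin R P' B C g" "\<forall>x\<in>A'. g x = f (b x)" using ext by blast
 have l1: "linear R P C (%x. g (a x))" by (rule lin_compose[OF a(1) g(1) a(2)])
 have l2: "linear R P C (%x. f (b (a x) \<ominus>[P] x))"
  by (rule lin_compose[OF lin_diff[OF M(1,1) P lin_compose[OF a(1) b(1) a(2)] lin_ident[OF subset_refl]] f ba])
 have "linear R P C (%x. g (a x) \<ominus>[C] f (b (a x) \<ominus>[P] x))"
  by (rule lin_diff[OF M(1,3) P l1 l2])
 moreover have "g (a x) \<ominus>[C] f (b (a x) \<ominus>[P] x) = f x" if x: "x \<in> A" for x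
 proof -
  have xc: "x \<in> carrier P" using submodule_closed[OF M(1) A] x by auto
  have ba': "b (a x) \<in> A" using a(3) b(2) x by auto
  have "f (b (a x) \<ominus>[P] x) = f (b (a x)) \<ominus>[C] f x"
   by (rule lin_minus[OF M(1,3) A f ba' x])
  moreover have "g (a x) = f (b (a x))" using g(2) a(3)[OF x] by auto
  ultimately show ?thesis using lin_closed[OF f ba'] lin_closed[OF f x]
   by (simp add: a_minus_def C.minus_add C.a_assoc[symmetric] C.r_neg)
 qed
 ultimately show "\<exists>g. linear R P C g & (\<forall>x\<in>A. g x = f x)" by blast
qed

lemma mod_homI:
 assumes "!!x. x \<in> carrier M ==> h x \<in> carrier N" "h \<in> extensional (carrier M)"
  "!!x y. x \<in> carrier M ==> y \<in> carrier M ==> h (x \<oplus>[M] y) = h x \<oplus>[N] h y"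
  "!!r x. r \<in> carrier R ==> x \<in> carrier M ==> h (r \<odot>[M] x) = r \<odot>[N] h x"
 shows "h \<in> mod_hom R M N"
 using assms by (auto simp: mod_hom_def PiE_def)

lemma free_cover_lin:
 assumes "module R M"
 shows "linear R (free_module R (carrier M)) M (free_cover R M)"
 unfolding free_cover_def using assms by (intro linear_ext_lin) (auto intro: module.axioms)

lemma free_cover_basis:
 assumes "module R M" "x \<in> carrier M"
 shows "free_cover R M (basis_vector R x) = x"
 unfolding free_cover_def using assms
 by (intro linear_ext_basis[where \<phi> = "%x. x"]) (auto intro: module.axioms)

lemma syzygy_carrier:
 "carrier (syzygy R M) = {f \<in> free_set R (carrier M). free_cover R M f = \<zero>[M]}"
 by (auto simp: syzygy_def a_kernel_def' )

lemma syzygy_submodule: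
 assumes "module R M"
 shows "submodule (carrier (syzygy R M)) R (free_module R (carrier M))"
proof -
 have F: "module R (free_module R (carrier M))"
  using assms by (intro free_module_module) (rule module.axioms)
 show ?thesis
  using lin_kernel_submodule[OF F assms carrier_submodule[OF F] free_cover_lin[OF assms] zero_submodule[OF assms]]
  unfolding syzygy_carrier by simp
qed

lemma syzygy_module:
 assumes "module R M"
 shows "module R (syzygy R M)"
proof -
 have F: "module R (free_module R (carrier M))"
  using assms by (intro free_module_module) (rule module.axioms)
 show ?thesis
  using sub_module_module[OF F syzygy_submodule[OF assms]]
  unfolding syzygy_def by simp
qed

lemma syzygy_lin: "lin R (syzygy R M) A N h \<longleftrightarrow> lin R (free_module R (carrier M)) A N h"
 by (simp add: syzygy_def)

text \<open>
 A cocycle kills the image of \<open>P\<^sub>2 \<rightarrow> P\<^sub>1\<close>, which is the kernel of \<open>P\<^sub>1 \<rightarrow> K\<^sub>0\<close>, so it is a linear map on the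
 first syzygy \<open>K\<^sub>0\<close>; the coboundaries are the maps that extend to \<open>P\<^sub>0\<close>.
\<close>

abbreviation ext_vanishes where
 "ext_vanishes R M C \<equiv> extends R (free_module R (carrier M)) (carrier (syzygy R M)) C"

lemma zero_Ext1_iff:
 fixes M :: "('a, 'm) module" and C :: "('a, 'c) module"
 assumes M: "module R M" and C: "module R C"
 shows "zero_module (Ext1 R M C) \<longleftrightarrow>
  ext_vanishes R M C"
proof -
 interpret C: module R C by fact
 have R: "cring R" using M by (rule module.axioms)
 define K0 where "K0 = syzygy R M"
 define K1 where "K1 = syzygy R K0"
 define P0 where "P0 = free_module R (carrier M)"
 define P1 where "P1 = free_module R (carrier K0)"
 define P2 where "P2 = free_module R (carrier K1)"
 define d1 where "d1 = free_cover R K0"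
 define d2 where "d2 = free_cover R K1"
 define Z where "Z = {\<phi> \<in> mod_hom R P1 C. compose (carrier P2) \<phi> d2 = (\<lambda>p\<in>carrier P2. \<zero>[C])}"
 define B where "B = {compose (carrier P1) \<psi> d1 | \<psi>. \<psi> \<in> mod_hom R P0 C}"
 define H where "H = sub_module (hom_module R P1 C) Z"
 have E: "Ext1 R M C = quotient_module H B"
  by (simp add: Ext1_def Let_def K0_def K1_def P0_def P1_def P2_def d1_def d2_def Z_def B_def H_def)
 have Hs: "carrier H = Z" "!!f g. f \<oplus>[H] g = (\<lambda>x\<in>carrier P1. f x \<oplus>[C] g x)"
  by (simp_all add: H_def hom_module_def)
 have mK0: "module R K0" and mP0: "module R P0" and mP1: "module R P1" and mK1: "module R K1" and mP2: "module R P2"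
  using M R unfolding K0_def K1_def P0_def P1_def P2_def by (simp_all add: syzygy_module free_module_module)
 have d1: "linear R P1 K0 d1" "!!x. x \<in> carrier K0 ==> d1 (basis_vector R x) = x"
  using free_cover_lin[OF mK0] free_cover_basis[OF mK0] by (simp_all add: d1_def P1_def)
 have d2: "linear R P2 K1 d2" "!!x. x \<in> carrier K1 ==> d2 (basis_vector R x) = x"
  using free_cover_lin[OF mK1] free_cover_basis[OF mK1] by (simp_all add: d2_def P2_def)
 have bv1: "basis_vector R x \<in> carrier P1" if "x \<in> carrier K0" for x
  using that basis_vector_closed[OF R] by (simp add: P1_def)
 have bv2: "basis_vector R x \<in> carrier P2" if "x \<in> carrier K1" for x
  using that basis_vector_closed[OF R] by (simp add: P2_def)
 have K1: "carrier K1 = {f \<in> carrier P1. d1 f = \<zero>[K0]}"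
  unfolding K1_def syzygy_carrier d1_def P1_def ..
 have K0P0: "lin R K0 A N h \<longleftrightarrow> lin R P0 A N h" for A and N :: "('a, 'c) module" and h
  unfolding K0_def P0_def by (rule syzygy_lin)
 have K0sub: "carrier K0 <= carrier P0" by (auto simp: K0_def P0_def syzygy_carrier)
 have d1P0: "d1 x \<in> carrier K0" if "x \<in> carrier P1" for x using lin_closed[OF d1(1) that] .
 have ZI: "compose (carrier P1) f d1 \<in> Z" if f: "lin R P0 (carrier K0) C f" for f
 proof -
  have l: "linear R P1 C (%x. f (d1 x))"
   by (rule lin_compose[OF d1(1) f[folded K0P0] d1P0])
  have 1: "compose (carrier P1) f d1 \<in> mod_hom R P1 C"
   using lin_mod_hom[OF mP1 l] by (simp add: compose_def)
  have f0: "f \<zero>[K0] = \<zero>[C]"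
   by (rule lin_zero[OF mK0 C carrier_submodule[OF mK0] f[folded K0P0]])
  have "d2 p \<in> carrier P1 & d1 (d2 p) = \<zero>[K0]" if "p \<in> carrier P2" for p
   using lin_closed[OF d2(1) that] K1 by auto
  hence "compose (carrier P2) (compose (carrier P1) f d1) d2 = (\<lambda>p\<in>carrier P2. \<zero>[C])"
   using f0 by (intro ext) (simp add: compose_def restrict_def)
  thus ?thesis using 1 by (simp add: Z_def)
 qed
 have ZE: "\<exists>f. lin R P0 (carrier K0) C f & \<phi> = compose (carrier P1) f d1" if \<phi>: "\<phi> \<in> Z" for \<phi>
 proof -
  have \<phi>l: "linear R P1 C \<phi>" and \<phi>e: "\<phi> \<in> extensional (carrier P1)"
   using \<phi> by (auto simp: Z_def mod_hom_iff_lin)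
  have sP1: "submodule (carrier P1) R P1" by (rule carrier_submodule) fact
  have van: "\<phi> p = \<zero>[C]" if p: "p \<in> carrier P1" "d1 p = \<zero>[K0]" for p
  proof -
   have pK: "p \<in> carrier K1" using p K1 by auto
   hence "compose (carrier P2) \<phi> d2 (basis_vector R p) = \<zero>[C]"
    using \<phi> bv2 by (auto simp: Z_def)
   thus ?thesis using bv2[OF pK] d2(2)[OF pK] by (simp add: compose_def)
  qed
  have eq: "\<phi> p = \<phi> p'" if p: "p \<in> carrier P1" "p' \<in> carrier P1" "d1 p = d1 p'" for p p'
  proof -
   interpret P1: module R P1 by fact
   interpret K0: module R K0 by fact
   have "d1 (p \<ominus>[P1] p') = d1 p \<ominus>[K0] d1 p'"
    by (rule lin_minus[OF mP1 mK0 sP1 d1(1) p(1,2)])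
   hence "d1 (p \<ominus>[P1] p') = \<zero>[K0]" using p d1P0 by (simp add: K0.r_neg a_minus_def)
   hence "\<phi> (p \<ominus>[P1] p') = \<zero>[C]" using van p by simp
   hence "\<phi> p \<ominus>[C] \<phi> p' = \<zero>[C]" using lin_minus[OF mP1 C sP1 \<phi>l p(1,2)] by simp
   thus ?thesis using lin_closed[OF \<phi>l] p by (simp add: C.minus_eq_zero_iff)
  qed
  define f where "f x = \<phi> (basis_vector R x)" for x
  have f: "\<phi> p = f (d1 p)" if "p \<in> carrier P1" for p
   unfolding f_def by (rule eq[OF that bv1[OF d1P0[OF that]]]) (simp add: d1(2)[OF d1P0[OF that]])
  have "linear R K0 C f"
  proof (rule linI)
   interpret P1: module R P1 by fact
   fix x assume x: "x \<in> carrier K0"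
   show "f x \<in> carrier C" using lin_closed[OF \<phi>l bv1[OF x]] by (simp add: f_def)
   show "f (r \<odot>[K0] x) = r \<odot>[C] f x" if r: "r \<in> carrier R" for r
   proof -
    have "\<phi> (r \<odot>[P1] basis_vector R x) = f (r \<odot>[K0] x)"
     using f[of "r \<odot>[P1] basis_vector R x"] bv1[OF x] r lin_smult[OF d1(1) r bv1[OF x]] d1(2)[OF x] by simp
    thus ?thesis using lin_smult[OF \<phi>l r bv1[OF x]] by (simp add: f_def)
   qed
   show "f (x \<oplus>[K0] y) = f x \<oplus>[C] f y" if y: "y \<in> carrier K0" for y
   proof -
    have "\<phi> (basis_vector R x \<oplus>[P1] basis_vector R y) = f (x \<oplus>[K0] y)"
     using f[of "basis_vector R x \<oplus>[P1] basis_vector R y"] bv1[OF x] bv1[OF y]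
      lin_add[OF d1(1) bv1[OF x] bv1[OF y]] d1(2)[OF x] d1(2)[OF y] by simp
    thus ?thesis using lin_add[OF \<phi>l bv1[OF x] bv1[OF y]] by (simp add: f_def)
   qed
  qed
  moreover have "\<phi> = compose (carrier P1) f d1"
   using \<phi>e f by (auto simp: compose_def extensional_def fun_eq_iff)
  ultimately show ?thesis using K0P0 by auto
 qed
 have inB: "compose (carrier P1) f d1 \<in> B \<longleftrightarrow> (\<exists>g. linear R P0 C g & (\<forall>x\<in>carrier K0. g x = f x))"
  if f: "lin R P0 (carrier K0) C f" for f
 proof
  assume "compose (carrier P1) f d1 \<in> B"
  then obtain \<psi> where \<psi>: "\<psi> \<in> mod_hom R P0 C" "compose (carrier P1) f d1 = compose (carrier P1) \<psi> d1"
   by (auto simp: B_def)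
  have "\<psi> x = f x" if x: "x \<in> carrier K0" for x
   using fun_cong[OF \<psi>(2), of "basis_vector R x"] bv1[OF x] d1(2)[OF x] by (simp add: compose_def)
  thus "\<exists>g. linear R P0 C g & (\<forall>x\<in>carrier K0. g x = f x)"
   using mod_hom_lin[OF \<psi>(1)] by blast
 next
  assume "\<exists>g. linear R P0 C g & (\<forall>x\<in>carrier K0. g x = f x)"
  then obtain g where g: "linear R P0 C g" "\<forall>x\<in>carrier K0. g x = f x" by blast
  have "compose (carrier P1) f d1 = compose (carrier P1) (restrict g (carrier P0)) d1"
   using g(2) d1P0 K0sub by (auto simp: compose_def fun_eq_iff)
  thus "compose (carrier P1) f d1 \<in> B"
   unfolding B_def using lin_mod_hom[OF mP0 g(1)] by blast
 qed
 have BZ: "B <= Z"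
 proof
  fix b assume "b \<in> B"
  then obtain \<psi> where \<psi>: "\<psi> \<in> mod_hom R P0 C" "b = compose (carrier P1) \<psi> d1" by (auto simp: B_def)
  show "b \<in> Z" unfolding \<psi>(2) by (rule ZI[OF lin_subset[OF mod_hom_lin[OF \<psi>(1)] K0sub]])
 qed
 have Bext: "b \<in> extensional (carrier P1)" "!!p. p \<in> carrier P1 ==> b p \<in> carrier C" if "b \<in> B" for b
  using BZ that by (auto simp: Z_def mod_hom_def PiE_def)
 have Bclosed: "(\<lambda>x\<in>carrier P1. b x \<oplus>[C] c x) \<in> B" if bc: "b \<in> B" "c \<in> B" for b c
 proof -
  obtain \<psi> where \<psi>: "\<psi> \<in> mod_hom R P0 C" "b = compose (carrier P1) \<psi> d1" using bc by (auto simp: B_def)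
  obtain \<chi> where \<chi>: "\<chi> \<in> mod_hom R P0 C" "c = compose (carrier P1) \<chi> d1" using bc by (auto simp: B_def)
  have "linear R P0 C (%x. \<psi> x \<oplus>[C] \<chi> x)"
   by (rule lin_sum[OF C mod_hom_lin[OF \<psi>(1)] mod_hom_lin[OF \<chi>(1)]])
  hence "restrict (%x. \<psi> x \<oplus>[C] \<chi> x) (carrier P0) \<in> mod_hom R P0 C" by (rule lin_mod_hom[OF mP0])
  moreover have "(\<lambda>x\<in>carrier P1. b x \<oplus>[C] c x) = compose (carrier P1) (restrict (%x. \<psi> x \<oplus>[C] \<chi> x) (carrier P0)) d1"
   using d1P0 K0sub by (auto simp: \<psi> \<chi> compose_def fun_eq_iff)
  ultimately show ?thesis unfolding B_def by blast
 qed
 have Bdiff: "(\<lambda>x\<in>carrier P1. b x \<ominus>[C] c x) \<in> B" if bc: "b \<in> B" "c \<in> B" for b c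
 proof -
  obtain \<psi> where \<psi>: "\<psi> \<in> mod_hom R P0 C" "b = compose (carrier P1) \<psi> d1" using bc by (auto simp: B_def)
  obtain \<chi> where \<chi>: "\<chi> \<in> mod_hom R P0 C" "c = compose (carrier P1) \<chi> d1" using bc by (auto simp: B_def)
  have "linear R P0 C (%x. \<psi> x \<ominus>[C] \<chi> x)"
   by (rule lin_diff[OF mP0 C carrier_submodule[OF mP0] mod_hom_lin[OF \<psi>(1)] mod_hom_lin[OF \<chi>(1)]])
  hence "restrict (%x. \<psi> x \<ominus>[C] \<chi> x) (carrier P0) \<in> mod_hom R P0 C" by (rule lin_mod_hom[OF mP0])
  moreover have "(\<lambda>x\<in>carrier P1. b x \<ominus>[C] c x) = compose (carrier P1) (restrict (%x. \<psi> x \<ominus>[C] \<chi> x) (carrier P0)) d1"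
   using d1P0 K0sub by (auto simp: \<psi> \<chi> compose_def fun_eq_iff)
  ultimately show ?thesis unfolding B_def by blast
 qed
 have zero: "(\<lambda>x\<in>carrier P1. \<zero>[C]) \<in> B"
 proof -
  have "linear R P0 C (%x. \<zero>[C])" by (rule linI) auto
  hence "restrict (%x. \<zero>[C]) (carrier P0) \<in> mod_hom R P0 C" by (rule lin_mod_hom[OF mP0])
  moreover have "(\<lambda>x\<in>carrier P1. \<zero>[C]) = compose (carrier P1) (restrict (%x. \<zero>[C]) (carrier P0)) d1"
   using d1P0 K0sub by (auto simp: compose_def fun_eq_iff)
  ultimately show ?thesis unfolding B_def by blast
 qed
 have coset: "B +>[H] z = {b \<oplus>[H] z | b. b \<in> B}" for z
  by (auto simp: a_r_coset_def')
 have key: "zero_module (quotient_module H B) \<longleftrightarrow> Z <= B"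
 proof
  assume "zero_module (quotient_module H B)"
  hence all: "B +>[H] z = B" if "z \<in> Z" for z
   using that Hs(1) by (auto simp: zero_module_def A_RCOSETS_def')
  show "Z <= B"
  proof
   fix z assume z: "z \<in> Z"
   hence ze: "z \<in> extensional (carrier P1)" "!!p. p \<in> carrier P1 ==> z p \<in> carrier C"
    by (auto simp: Z_def mod_hom_def PiE_def)
   have "(\<lambda>x\<in>carrier P1. \<zero>[C]) \<oplus>[H] z = z"
    using ze by (auto simp: Hs(2) fun_eq_iff extensional_def)
   hence "z \<in> B +>[H] z" unfolding coset using zero by force
   thus "z \<in> B" using all[OF z] by simp
  qed
 next
  assume ZB: "Z <= B"
  have "B +>[H] z = B" if z: "z \<in> Z" for z
  proof
   have zB: "z \<in> B" using z ZB by auto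
   show "B +>[H] z <= B" unfolding coset Hs(2) using Bclosed zB by auto
   show "B <= B +>[H] z"
   proof
    fix b assume b: "b \<in> B"
    let ?c = "\<lambda>x\<in>carrier P1. b x \<ominus>[C] z x"
    have "?c \<oplus>[H] z = b"
     using Bext[OF b] Bext[OF zB]
     by (auto simp: Hs(2) fun_eq_iff extensional_def a_minus_def C.a_assoc C.l_neg)
    thus "b \<in> B +>[H] z" unfolding coset using Bdiff[OF b zB] by force
   qed
  qed
  moreover have "Z ~= {}" using zero BZ by auto
  ultimately show "zero_module (quotient_module H B)"
   by (auto simp: zero_module_def A_RCOSETS_def' Hs(1))
 qed
 show ?thesis
  unfolding E key extends_def P0_def[symmetric] K0_def[symmetric]
 proof
  assume ZB: "Z <= B"
  show "\<forall>f. lin R P0 (carrier K0) C f --> (\<exists>g. linear R P0 C g & (\<forall>x\<in>carrier K0. g x = f x))"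
   using ZI inB ZB by blast
 next
  assume "\<forall>f. lin R P0 (carrier K0) C f --> (\<exists>g. linear R P0 C g & (\<forall>x\<in>carrier K0. g x = f x))"
  thus "Z <= B" using ZE inB by blast
 qed
qed

section \<open>Localization at nonzerodivisors\<close>

definition restrict_scalars :: "('a => 'b) => ('b, 'm) module => ('a, 'm) module" where
 "restrict_scalars \<phi> M = \<lparr>carrier = carrier M, mult = undefined, one = undefined,
   zero = zero M, add = add M, smult = (%r x. \<phi> r \<odot>[M] x)\<rparr>"


text \<open>The operations of the ring of fractions are unions over representatives whose value does not depend on the
representatives.\<close>

lemma UN_pair_const:
 assumes "!!a s b t. (a, s) \<in> A ==> (b, t) \<in> B ==> f a s b t = X" "A ~= {}" "B ~= {}"
 shows "(\<Union>(a, s)\<in>A. \<Union>(b, t)\<in>B. f a s b t) = X"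
proof -
 have "(\<Union>(b, t)\<in>B. f a s b t) = X" if "(a, s) \<in> A" for a s
 proof -
  have "(case q of (b, t) => f a s b t) = X" if "q \<in> B" for q
   using assms(1)[OF \<open>(a, s) \<in> A\<close>] that by (cases q) simp
  thus ?thesis using assms(3) by simp
 qed
 hence "(case p of (a, s) => \<Union>(b, t)\<in>B. f a s b t) = X" if "p \<in> A" for p
  using that by (cases p) simp
 thus ?thesis using assms(2) by simp
qed

locale nonzerodivisors = cring R + S: submonoid S R
 for R :: "('a, 'k) ring_scheme" (structure) and S :: "'a set" +
 assumes nzd: "s \<in> S ==> r \<in> carrier R ==> s \<otimes> r = \<zero> ==> r = \<zero>"
begin

lemma S_closed [simp]: "s \<in> S ==> s \<in> carrier R"
 using S.subset by auto

lemma S_mult [simp]: "s \<in> S ==> t \<in> S ==> s \<otimes> t \<in> S"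
 by (rule S.m_closed)

lemma S_one [simp]: "\<one> \<in> S"
 by (rule S.one_closed)

lemma S_cancel:
 assumes "s \<in> S" "a \<in> carrier R" "b \<in> carrier R" "s \<otimes> a = s \<otimes> b"
 shows "a = b"
proof -
 have "s \<otimes> (a \<ominus> b) = s \<otimes> a \<ominus> s \<otimes> b"
  using assms by (simp add: a_minus_def r_distr r_minus)
 hence "s \<otimes> (a \<ominus> b) = \<zero>" using assms by simp
 hence "a \<ominus> b = \<zero>" using nzd[OF assms(1) minus_closed[OF assms(2,3)]] by simp
 thus ?thesis using assms by (simp add: minus_eq_zero_iff)
qed

lemma frac_rel_iff:
 "((a, s), (b, t)) \<in> frac_rel R S \<longleftrightarrow>
  a \<in> carrier R & s \<in> S & b \<in> carrier R & t \<in> S & a \<otimes> t = b \<otimes> s"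
proof -
 have "(\<exists>u\<in>S. u \<otimes> (a \<otimes> t \<ominus> b \<otimes> s) = \<zero>) \<longleftrightarrow> a \<otimes> t = b \<otimes> s"
  if "a \<in> carrier R" "s \<in> S" "b \<in> carrier R" "t \<in> S"
 proof
  assume "\<exists>u\<in>S. u \<otimes> (a \<otimes> t \<ominus> b \<otimes> s) = \<zero>"
  then obtain u where "u \<in> S" "u \<otimes> (a \<otimes> t \<ominus> b \<otimes> s) = \<zero>" by blast
  hence "a \<otimes> t \<ominus> b \<otimes> s = \<zero>" using that by (auto intro: nzd[of u "a \<otimes> t \<ominus> b \<otimes> s"])
  thus "a \<otimes> t = b \<otimes> s" using that by (simp add: minus_eq_zero_iff)
 next
  assume "a \<otimes> t = b \<otimes> s"
  hence "\<one> \<otimes> (a \<otimes> t \<ominus> b \<otimes> s) = \<zero>" using that by simp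
  thus "\<exists>u\<in>S. u \<otimes> (a \<otimes> t \<ominus> b \<otimes> s) = \<zero>" using S_one by blast
 qed
 thus ?thesis unfolding frac_rel_def by auto
qed

lemma fraction_mem:
 "a \<in> carrier R ==> s \<in> S ==> (b, t) \<in> fraction R S a s \<longleftrightarrow> b \<in> carrier R & t \<in> S & a \<otimes> t = b \<otimes> s"
 by (simp add: fraction_def frac_rel_iff)

lemma fraction_eq_iff:
 assumes "a \<in> carrier R" "s \<in> S" "b \<in> carrier R" "t \<in> S"
 shows "fraction R S a s = fraction R S b t \<longleftrightarrow> a \<otimes> t = b \<otimes> s"
proof
 assume "fraction R S a s = fraction R S b t"
 moreover have "(b, t) \<in> fraction R S b t" using assms by (simp add: fraction_mem)
 ultimately show "a \<otimes> t = b \<otimes> s" using assms by (metis fraction_mem)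
next
 assume eq: "a \<otimes> t = b \<otimes> s"
 have aux: "a \<otimes> v = c \<otimes> s" if "a \<otimes> t = b \<otimes> s" "b \<otimes> v = c \<otimes> t"
  "a \<in> carrier R" "s \<in> S" "b \<in> carrier R" "t \<in> S" "c \<in> carrier R" "v \<in> S" for a s b t c v
 proof (rule S_cancel[OF that(6)])
  have "t \<otimes> (a \<otimes> v) = (a \<otimes> t) \<otimes> v" using that(3-8) by (simp add: m_ac)
  also have "\<dots> = s \<otimes> (b \<otimes> v)" unfolding that(1) using that(3-8) by (simp add: m_ac)
  also have "\<dots> = t \<otimes> (c \<otimes> s)" unfolding that(2) using that(3-8) by (simp add: m_ac)
  finally show "t \<otimes> (a \<otimes> v) = t \<otimes> (c \<otimes> s)" .
 qed (use that in auto)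
 have "(c, v) \<in> fraction R S a s \<longleftrightarrow> (c, v) \<in> fraction R S b t" for c v
 proof (cases "c \<in> carrier R & v \<in> S")
  case True
  hence cv: "c \<in> carrier R" "v \<in> S" by auto
  show ?thesis
   using aux[OF eq _ assms cv] aux[OF eq[symmetric] _ assms(3,4,1,2) cv]
   unfolding fraction_mem[OF assms(1,2)] fraction_mem[OF assms(3,4)] using cv by blast
 next
  case False
  thus ?thesis
   unfolding fraction_mem[OF assms(1,2)] fraction_mem[OF assms(3,4)] by blast
 qed
 thus "fraction R S a s = fraction R S b t" by auto
qed

lemma loc_carrier: "carrier (loc_ring R S) = {fraction R S a s | a s. a \<in> carrier R & s \<in> S}"
 by (auto simp: loc_ring_def quotient_def fraction_def)

lemma loc_cases:
 assumes "q \<in> carrier (loc_ring R S)"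
 obtains a s where "a \<in> carrier R" "s \<in> S" "q = fraction R S a s"
 using assms by (auto simp: loc_carrier)

lemma fraction_closed [simp]: "a \<in> carrier R ==> s \<in> S ==> fraction R S a s \<in> carrier (loc_ring R S)"
 by (auto simp: loc_carrier)

lemma loc_mult:
 assumes "a \<in> carrier R" "s \<in> S" "b \<in> carrier R" "t \<in> S"
 shows "fraction R S a s \<otimes>[loc_ring R S] fraction R S b t = fraction R S (a \<otimes> b) (s \<otimes> t)"
proof -
 have *: "fraction R S (a' \<otimes> b') (s' \<otimes> t') = fraction R S (a \<otimes> b) (s \<otimes> t)"
  if a': "(a', s') \<in> fraction R S a s" and b': "(b', t') \<in> fraction R S b t" for a' s' b' t'
 proof -
  have h: "a' \<in> carrier R" "s' \<in> S" "a \<otimes> s' = a' \<otimes> s" "b' \<in> carrier R" "t' \<in> S" "b \<otimes> t' = b' \<otimes> t"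
   using a' b' assms by (auto simp: fraction_mem)
  have "(a' \<otimes> b') \<otimes> (s \<otimes> t) = (a' \<otimes> s) \<otimes> (b' \<otimes> t)" using h(1,2,4,5) assms by (simp add: m_ac)
  also have "\<dots> = (a \<otimes> b) \<otimes> (s' \<otimes> t')" unfolding h(3,6)[symmetric] using h(1,2,4,5) assms by (simp add: m_ac)
  finally show ?thesis using h assms by (simp add: fraction_eq_iff)
 qed
 have m: "(a, s) \<in> fraction R S a s" "(b, t) \<in> fraction R S b t" using assms by (simp_all add: fraction_mem)
 have "fraction R S a s \<otimes>[loc_ring R S] fraction R S b t
   = (\<Union>(a', s')\<in>fraction R S a s. \<Union>(b', t')\<in>fraction R S b t. fraction R S (a' \<otimes> b') (s' \<otimes> t'))"
  by (simp add: loc_ring_def)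
 also have "\<dots> = fraction R S (a \<otimes> b) (s \<otimes> t)" by (rule UN_pair_const[OF *]) (use m in auto)
 finally show ?thesis .
qed

lemma loc_add:
 assumes "a \<in> carrier R" "s \<in> S" "b \<in> carrier R" "t \<in> S"
 shows "fraction R S a s \<oplus>[loc_ring R S] fraction R S b t = fraction R S (a \<otimes> t \<oplus> b \<otimes> s) (s \<otimes> t)"
proof -
 have *: "fraction R S (a' \<otimes> t' \<oplus> b' \<otimes> s') (s' \<otimes> t') = fraction R S (a \<otimes> t \<oplus> b \<otimes> s) (s \<otimes> t)"
  if a': "(a', s') \<in> fraction R S a s" and b': "(b', t') \<in> fraction R S b t" for a' s' b' t'
 proof -
  have h: "a' \<in> carrier R" "s' \<in> S" "a \<otimes> s' = a' \<otimes> s" "b' \<in> carrier R" "t' \<in> S" "b \<otimes> t' = b' \<otimes> t"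
   using a' b' assms by (auto simp: fraction_mem)
  have "(a' \<otimes> t' \<oplus> b' \<otimes> s') \<otimes> (s \<otimes> t) = (a' \<otimes> s) \<otimes> (t' \<otimes> t) \<oplus> (b' \<otimes> t) \<otimes> (s' \<otimes> s)"
   using h(1,2,4,5) assms by (simp add: m_ac l_distr r_distr)
  also have "\<dots> = (a \<otimes> t \<oplus> b \<otimes> s) \<otimes> (s' \<otimes> t')"
   unfolding h(3,6)[symmetric] using h(1,2,4,5) assms by (simp add: m_ac l_distr r_distr)
  finally show ?thesis using h assms by (simp add: fraction_eq_iff)
 qed
 have m: "(a, s) \<in> fraction R S a s" "(b, t) \<in> fraction R S b t" using assms by (simp_all add: fraction_mem)
 have "fraction R S a s \<oplus>[loc_ring R S] fraction R S b t
   = (\<Union>(a', s')\<in>fraction R S a s. \<Union>(b', t')\<in>fraction R S b t. fraction R S (a' \<otimes> t' \<oplus> b' \<otimes> s') (s' \<otimes> t'))"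
  by (simp add: loc_ring_def)
 also have "\<dots> = fraction R S (a \<otimes> t \<oplus> b \<otimes> s) (s \<otimes> t)" by (rule UN_pair_const[OF *]) (use m in auto)
 finally show ?thesis .
qed

lemma loc_zero: "\<zero>[loc_ring R S] = fraction R S \<zero> \<one>"
 and loc_one: "\<one>[loc_ring R S] = fraction R S \<one> \<one>"
 by (simp_all add: loc_ring_def)

lemma loc_ring_cring: "cring (loc_ring R S)"
proof (rule cringI)
 let ?L = "loc_ring R S"
 show "abelian_group ?L"
 proof (rule abelian_groupI)
  fix x y assume "x \<in> carrier ?L" "y \<in> carrier ?L"
  then obtain a s b t where x: "a \<in> carrier R" "s \<in> S" "x = fraction R S a s"
   and y: "b \<in> carrier R" "t \<in> S" "y = fraction R S b t" by (metis loc_cases)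
  show "x \<oplus>[?L] y \<in> carrier ?L" using x y by (simp add: loc_add)
  show "x \<oplus>[?L] y = y \<oplus>[?L] x" using x y by (simp add: loc_add fraction_eq_iff a_ac m_ac)
  fix z assume "z \<in> carrier ?L"
  then obtain c v where z: "c \<in> carrier R" "v \<in> S" "z = fraction R S c v" by (metis loc_cases)
  show "x \<oplus>[?L] y \<oplus>[?L] z = x \<oplus>[?L] (y \<oplus>[?L] z)"
   using x y z by (simp add: loc_add fraction_eq_iff a_ac m_ac l_distr r_distr)
 next
  show "\<zero>[?L] \<in> carrier ?L" by (simp add: loc_zero)
 next
  fix x assume "x \<in> carrier ?L"
  then obtain a s where x: "a \<in> carrier R" "s \<in> S" "x = fraction R S a s" by (metis loc_cases)
  show "\<zero>[?L] \<oplus>[?L] x = x" using x by (simp add: loc_zero loc_add)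
  have "fraction R S (\<ominus> a) s \<oplus>[?L] x = \<zero>[?L]"
   using x by (simp add: loc_zero loc_add fraction_eq_iff l_minus l_neg)
  thus "\<exists>y\<in>carrier ?L. y \<oplus>[?L] x = \<zero>[?L]" using x fraction_closed[of "\<ominus> a" s] by blast
 qed
 show "comm_monoid ?L"
 proof (rule comm_monoidI)
  fix x y assume "x \<in> carrier ?L" "y \<in> carrier ?L"
  then obtain a s b t where x: "a \<in> carrier R" "s \<in> S" "x = fraction R S a s"
   and y: "b \<in> carrier R" "t \<in> S" "y = fraction R S b t" by (metis loc_cases)
  show "x \<otimes>[?L] y \<in> carrier ?L" using x y by (simp add: loc_mult)
  show "x \<otimes>[?L] y = y \<otimes>[?L] x" using x y by (simp add: loc_mult m_ac)
  fix z assume "z \<in> carrier ?L"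
  then obtain c v where z: "c \<in> carrier R" "v \<in> S" "z = fraction R S c v" by (metis loc_cases)
  show "x \<otimes>[?L] y \<otimes>[?L] z = x \<otimes>[?L] (y \<otimes>[?L] z)" using x y z by (simp add: loc_mult m_ac)
 next
  show "\<one>[?L] \<in> carrier ?L" by (simp add: loc_one)
 next
  fix x assume "x \<in> carrier ?L"
  then obtain a s where x: "a \<in> carrier R" "s \<in> S" "x = fraction R S a s" by (metis loc_cases)
  show "\<one>[?L] \<otimes>[?L] x = x" using x by (simp add: loc_one loc_mult)
 qed
 fix x y z assume "x \<in> carrier ?L" "y \<in> carrier ?L" "z \<in> carrier ?L"
 then obtain a s b t c v where x: "a \<in> carrier R" "s \<in> S" "x = fraction R S a s"
  and y: "b \<in> carrier R" "t \<in> S" "y = fraction R S b t"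
  and z: "c \<in> carrier R" "v \<in> S" "z = fraction R S c v" by (metis loc_cases)
 define w where "w = a \<otimes> t \<oplus> b \<otimes> s"
 have w: "w \<in> carrier R" using x y by (simp add: w_def)
 have "(a \<otimes> c) \<otimes> (t \<otimes> v) = (a \<otimes> t) \<otimes> (c \<otimes> v)" "(b \<otimes> c) \<otimes> (s \<otimes> v) = (b \<otimes> s) \<otimes> (c \<otimes> v)"
  using x y z by (simp_all add: m_ac)
 hence d: "(a \<otimes> c) \<otimes> (t \<otimes> v) \<oplus> (b \<otimes> c) \<otimes> (s \<otimes> v) = w \<otimes> (c \<otimes> v)"
  using x y z by (simp add: w_def l_distr)
 have "(x \<oplus>[?L] y) \<otimes>[?L] z = fraction R S (w \<otimes> c) (s \<otimes> t \<otimes> v)"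
  using x y z w by (simp add: loc_add loc_mult w_def)
 also have "\<dots> = fraction R S (w \<otimes> (c \<otimes> v)) (s \<otimes> v \<otimes> (t \<otimes> v))"
  using x(1,2) y(1,2) z(1,2) w by (simp add: fraction_eq_iff m_ac)
 also have "\<dots> = x \<otimes>[?L] z \<oplus>[?L] y \<otimes>[?L] z"
  unfolding d[symmetric] using x y z by (simp add: loc_add loc_mult)
 finally show "(x \<oplus>[?L] y) \<otimes>[?L] z = x \<otimes>[?L] z \<oplus>[?L] y \<otimes>[?L] z" .
qed

definition embed :: "'a => ('a \<times> 'a) set" where
 "embed r = fraction R S r \<one>"

lemma embed_closed [simp]: "r \<in> carrier R ==> embed r \<in> carrier (loc_ring R S)"
 by (simp add: embed_def)

lemma embed_add: "a \<in> carrier R ==> b \<in> carrier R ==> embed (a \<oplus> b) = embed a \<oplus>[loc_ring R S] embed b"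
 and embed_mult: "a \<in> carrier R ==> b \<in> carrier R ==> embed (a \<otimes> b) = embed a \<otimes>[loc_ring R S] embed b"
 and embed_one: "embed \<one> = \<one>[loc_ring R S]"
 and embed_zero: "embed \<zero> = \<zero>[loc_ring R S]"
 by (simp_all add: embed_def loc_add loc_mult loc_one loc_zero)

lemma embed_inverse: "s \<in> S ==> embed s \<otimes>[loc_ring R S] fraction R S \<one> s = \<one>[loc_ring R S]"
 by (simp add: embed_def loc_mult loc_one fraction_eq_iff)

lemma embed_smult: "r \<in> carrier R ==> a \<in> carrier R ==> s \<in> S ==>
  embed r \<otimes>[loc_ring R S] fraction R S a s = fraction R S (r \<otimes> a) s"
 by (simp add: embed_def loc_mult)

lemma loc_as_module_sel [simp]:
 "carrier (loc_as_module R S) = carrier (loc_ring R S)"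
 "add (loc_as_module R S) = add (loc_ring R S)"
 "zero (loc_as_module R S) = zero (loc_ring R S)"
 "mult (loc_as_module R S) = mult (loc_ring R S)"
 "one (loc_as_module R S) = one (loc_ring R S)"
 "r \<odot>[loc_as_module R S] x = embed r \<otimes>[loc_ring R S] x"
 by (simp_all add: loc_as_module_def ring.extend_def embed_def)

lemma loc_as_module_module: "module R (loc_as_module R S)"
proof -
 interpret L: cring "loc_ring R S" by (rule loc_ring_cring)
 show ?thesis
 proof (rule moduleI)
  show "cring R" by (rule is_cring)
  show "abelian_group (loc_as_module R S)"
   by (rule abelian_groupI) (auto simp: L.a_ac L.l_neg intro: L.a_inv_closed bexI[of _ "\<ominus>[loc_ring R S] x" for x])
 qed (auto simp: embed_add embed_mult embed_one L.l_distr L.r_distr L.m_ac)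
qed

end

section \<open>Dual bases\<close>

lemma linear_ext_in_submodule:
 assumes "module R M" "submodule A R M" "!!x. x \<in> X ==> \<phi> x \<in> A" "f \<in> free_set R X"
 shows "linear_ext R X M \<phi> f \<in> A"
proof -
 have R: "cring R" using assms(1) by (rule module.axioms)
 note A = submodule_closed[OF assms(1,2)]
 have c: "!!x. x \<in> X ==> \<phi> x \<in> carrier M" using assms(3) A(1) by auto
 note F = free_module_module[OF R, of X]
 note L = linear_ext_lin[of R M X \<phi>, OF R assms(1) c]
 have "f \<in> {f \<in> free_set R X. linear_ext R X M \<phi> f \<in> A}"
  using R assms(4)
 proof (induction rule: free_module_induct)
  case zero
  thus ?case using submodule_closed(2)[OF F lin_kernel_submodule[OF F assms(1) carrier_submodule[OF F] L assms(2)]]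
   by simp
 next
  case (add f g)
  thus ?case using submodule_closed(4)[OF F lin_kernel_submodule[OF F assms(1) carrier_submodule[OF F] L assms(2)]]
   by blast
 next
  case (smult r f)
  thus ?case using submodule_closed(6)[OF F lin_kernel_submodule[OF F assms(1) carrier_submodule[OF F] L assms(2)]]
   by blast
 next
  case (basis x)
  have "linear_ext R X M \<phi> (basis_vector R x) = \<phi> x"
   by (rule linear_ext_basis[OF R assms(1) _ basis]) (rule c)
  thus ?case using assms(3)[OF basis] basis_vector_closed[OF R basis] by simp
 qed
 thus ?thesis by simp
qed

text \<open>
 The coefficients \<open>i y\<close> express \<open>y\<close> through the elements of \<open>A\<close> and are linear in \<open>y\<close>; by the dual
 basis criterion such an \<open>i\<close> exists iff \<open>A\<close> is projective.
\<close>

definition dual_basis ::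
 "('a, 'k) ring_scheme => ('a, 'm) module => 'm set => ('m => 'm => 'a) => bool" where
 "dual_basis R M A i \<longleftrightarrow> lin R M A (free_module R A) i & (\<forall>y\<in>A. linear_ext R A M (%x. x) (i y) = y)"

lemma dual_basis_selects:
 assumes "module R M" "submodule A R M" "dual_basis R M A i" "module R U"
 shows "selects R M A U"
proof -
 have R: "cring R" using assms(1) by (rule module.axioms)
 note A = submodule_closed[OF assms(1,2)]
 have i: "lin R M A (free_module R A) i" "!!y. y \<in> A ==> linear_ext R A M (%x. x) (i y) = y"
  using assms(3) by (auto simp: dual_basis_def)
 have q: "linear R (free_module R A) M (linear_ext R A M (%x. x))"
  by (rule linear_ext_lin[OF R assms(1)]) (rule A(1))
 show ?thesis
 proof (rule retract_selects[OF free_selects[OF R assms(4)] i(1) q lin_closed[OF i(1)]])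
  show "linear_ext R A M (%x. x) w \<in> A" if "w \<in> free_set R A" for w
   using that by (intro linear_ext_in_submodule[OF assms(1,2)])
 qed (use i(2) in auto)
qed

text \<open>The relation to select from is ``\<open>w\<close> is a family of coefficients of \<open>y\<close>''.\<close>

lemma selects_dual_basis:
 assumes "module R M" "submodule A R M" "selects R M A (free_module R A)"
 shows "\<exists>i. dual_basis R M A i"
proof -
 have R: "cring R" using assms(1) by (rule module.axioms)
 note A = submodule_closed[OF assms(1,2)]
 have q: "linear R (free_module R A) M (linear_ext R A M (%x. x))"
  by (rule linear_ext_lin[OF R assms(1)]) (rule A(1))
 have "linrel R M A (free_module R A) (%y w. linear_ext R A M (%x. x) w = y)"
 proof (rule linrelI)
  fix y assume y: "y \<in> A"
  have "linear_ext R A M (%x. x) (basis_vector R y) = y"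
   by (rule linear_ext_basis[where \<phi> = "%x. x", OF R assms(1) A(1) y])
  thus "\<exists>w\<in>free_set R A. linear_ext R A M (%x. x) w = y"
   using basis_vector_closed[OF R y] by blast
 qed (simp_all only: lin_add[OF q] lin_smult[OF q])
 thus ?thesis using assms(3) unfolding selects_def dual_basis_def by auto
qed

section \<open>Direct powers\<close>

definition direct_power :: "('a, 'm) module => 'x set => ('a, 'x => 'm) module" where
 "direct_power M X = \<lparr>carrier = {f. (\<forall>x\<in>X. f x \<in> carrier M) & (\<forall>x. x \<notin> X --> f x = \<zero>[M])
    & finite {x. f x ~= \<zero>[M]}},
   mult = undefined, one = undefined,
   zero = (%x. \<zero>[M]), add = (%f g x. f x \<oplus>[M] g x), smult = (%r f x. r \<odot>[M] f x)\<rparr>"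

lemma direct_power_sel [simp]:
 "zero (direct_power M X) = (%x. \<zero>[M])"
 "f \<oplus>[direct_power M X] g = (%x. f x \<oplus>[M] g x)"
 "r \<odot>[direct_power M X] f = (%x. r \<odot>[M] f x)"
 by (simp_all add: direct_power_def)

lemma direct_power_mem:
 "f \<in> carrier (direct_power M X) \<longleftrightarrow> (\<forall>x\<in>X. f x \<in> carrier M) & (\<forall>x. x \<notin> X --> f x = \<zero>[M])
   & finite {x. f x ~= \<zero>[M]}"
 by (simp add: direct_power_def)

lemma direct_power_coord:
 assumes "module R M" "f \<in> carrier (direct_power M X)"
 shows "f x \<in> carrier M"
proof -
 interpret module R M by fact
 show ?thesis using assms(2) by (cases "x \<in> X") (auto simp: direct_power_mem)
qed

lemma direct_power_module:
 assumes "module R M"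
 shows "module R (direct_power M X)"
proof -
 interpret M: module R M by fact
 note c = direct_power_coord[OF assms]
 have fin: "finite {x. g x ~= \<zero>[M]}" if "{x. g x ~= \<zero>[M]} <= {x. f x ~= \<zero>[M]} \<union> {x. h x ~= \<zero>[M]}"
  "finite {x. f x ~= \<zero>[M]}" "finite {x. h x ~= \<zero>[M]}" for f g h :: "_ => 'c"
  using that finite_subset by blast
 show ?thesis
 proof (rule moduleI)
  show "cring R" by (rule M.R.is_cring)
  show "abelian_group (direct_power M X)"
  proof (rule abelian_groupI)
   fix f g assume fg: "f \<in> carrier (direct_power M X)" "g \<in> carrier (direct_power M X)"
   have "{x. f x \<oplus>[M] g x ~= \<zero>[M]} <= {x. f x ~= \<zero>[M]} \<union> {x. g x ~= \<zero>[M]}" by auto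
   hence "finite {x. f x \<oplus>[M] g x ~= \<zero>[M]}" using fg fin[of "%x. f x \<oplus>[M] g x" f g] by (simp add: direct_power_mem)
   thus "f \<oplus>[direct_power M X] g \<in> carrier (direct_power M X)"
    using fg by (auto simp: direct_power_mem)
   show "f \<oplus>[direct_power M X] g = g \<oplus>[direct_power M X] f"
    using c[OF fg(1)] c[OF fg(2)] by (auto simp: fun_eq_iff M.a_comm)
   fix h assume h: "h \<in> carrier (direct_power M X)"
   show "f \<oplus>[direct_power M X] g \<oplus>[direct_power M X] h = f \<oplus>[direct_power M X] (g \<oplus>[direct_power M X] h)"
    using c[OF fg(1)] c[OF fg(2)] c[OF h] by (auto simp: fun_eq_iff M.a_assoc)
  next
   show "\<zero>[direct_power M X] \<in> carrier (direct_power M X)" by (simp add: direct_power_mem)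
  next
   fix f assume f: "f \<in> carrier (direct_power M X)"
   show "\<zero>[direct_power M X] \<oplus>[direct_power M X] f = f" using c[OF f] by simp
   have "(%x. \<ominus>[M] f x) \<in> carrier (direct_power M X)"
   proof -
    have "{x. \<ominus>[M] f x ~= \<zero>[M]} <= {x. f x ~= \<zero>[M]}" by auto
    thus ?thesis using f finite_subset by (auto simp: direct_power_mem)
   qed
   moreover have "(%x. \<ominus>[M] f x) \<oplus>[direct_power M X] f = \<zero>[direct_power M X]"
    using c[OF f] by (simp add: M.l_neg)
   ultimately show "\<exists>y\<in>carrier (direct_power M X). y \<oplus>[direct_power M X] f = \<zero>[direct_power M X]"
    by blast
  qed
  fix a f assume a: "a \<in> carrier R" and f: "f \<in> carrier (direct_power M X)"
  have "{x. a \<odot>[M] f x ~= \<zero>[M]} <= {x. f x ~= \<zero>[M]}" using a by auto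
  thus "a \<odot>[direct_power M X] f \<in> carrier (direct_power M X)"
   using a f finite_subset by (auto simp: direct_power_mem)
 qed (auto simp: c fun_eq_iff M.smult_l_distr M.smult_r_distr M.smult_assoc1)
qed

section \<open>Free modules on a product\<close>

definition coord :: "('x \<times> 'z => 'a) => 'z => 'x => 'a" where
 "coord y z = (%x. y (x, z))"

definition inj_coord :: "('a, 'k) ring_scheme => 'z => ('x => 'a) => 'x \<times> 'z => 'a" where
 "inj_coord R z f = (%(x, z'). if z' = z then f x else \<zero>[R])"

context cring
begin

lemma coord_closed:
 assumes "y \<in> free_set R (X \<times> Z)"
 shows "coord y z \<in> free_set R X"
proof -
 have fin: "finite {p. y p ~= \<zero>}" using assms by (simp add: free_module_mem)
 have "{x. y (x, z) ~= \<zero>} <= fst ` {p. y p ~= \<zero>}" by force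
 hence "finite {x. y (x, z) ~= \<zero>}" using finite_imageI[OF fin, of fst] finite_subset by blast
 moreover have "y (x, z) = \<zero>" if "x \<notin> X" for x using assms that by (auto simp: free_module_mem)
 ultimately show ?thesis using free_module_coord[OF is_cring assms]
  by (auto simp: free_module_mem coord_def)
qed

lemma coord_lin:
 "linear R (free_module R (X \<times> Z)) (free_module R X) (%y. coord y z)"
 by (rule linI) (auto simp: coord_closed, auto simp: coord_def)

lemma coord_outside:
 assumes "y \<in> free_set R (X \<times> Z)" "z \<notin> Z"
 shows "coord y z = (%x. \<zero>)"
 using assms by (auto simp: free_module_mem coord_def)

lemma coord_finite:
 assumes "y \<in> free_set R (X \<times> Z)"
 shows "finite {z. coord y z ~= (%x. \<zero>)}"
proof -
 have fin: "finite {p. y p ~= \<zero>}" using assms by (simp add: free_module_mem)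
 have "{z. coord y z ~= (%x. \<zero>)} <= snd ` {p. y p ~= \<zero>}" by (force simp: coord_def fun_eq_iff)
 thus ?thesis using finite_imageI[OF fin, of snd] finite_subset by blast
qed

lemma inj_coord_closed:
 assumes "f \<in> free_set R X" "z \<in> Z"
 shows "inj_coord R z f \<in> free_set R (X \<times> Z)"
proof -
 have fin: "finite {x. f x ~= \<zero>}" using assms by (simp add: free_module_mem)
 have "{p. inj_coord R z f p ~= \<zero>} <= (%x. (x, z)) ` {x. f x ~= \<zero>}"
  by (auto simp: inj_coord_def split: if_splits)
 hence "finite {p. inj_coord R z f p ~= \<zero>}" using finite_imageI[OF fin] finite_subset by blast
 thus ?thesis using assms free_module_coord[OF is_cring assms(1)]
  by (auto simp: free_module_mem inj_coord_def)
qed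

lemma inj_coord_lin:
 assumes "z \<in> Z"
 shows "linear R (free_module R X) (free_module R (X \<times> Z)) (inj_coord R z)"
 by (rule linI) (auto simp: inj_coord_closed[OF _ assms], auto simp: inj_coord_def fun_eq_iff)

lemma coord_inj_coord: "coord (inj_coord R z f) z' = (if z' = z then f else (%x. \<zero>))"
 by (auto simp: coord_def inj_coord_def)

lemma inj_coord_basis: "inj_coord R z (basis_vector R x) = basis_vector R (x, z)"
 by (auto simp: inj_coord_def basis_vector_def fun_eq_iff)

text \<open>
 Let \<open>Y\<close> be a submodule of \<open>R\<^sup>(\<^sup>X\<^sup>)\<close> with a dual basis.  The elements of \<open>R\<^sup>(\<^sup>X\<^sup>\<times>\<^sup>Z\<^sup>)\<close> with all coordinates
 in \<open>Y\<close> form a retract of the free module on \<open>Y \<times> Z\<close>.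
\<close>

context
 fixes X :: "'x set" and Y :: "('x => 'a) set" and i and Z :: "'z set"
 assumes Y: "submodule Y R (free_module R X)" and i: "dual_basis R (free_module R X) Y i"
begin

definition coord_sub :: "('x \<times> 'z => 'a) set" where
 "coord_sub = {y \<in> free_set R (X \<times> Z). \<forall>z\<in>Z. coord y z \<in> Y}"

definition coord_coeff :: "('x \<times> 'z => 'a) => ('x => 'a) \<times> 'z => 'a" where
 "coord_coeff y = (%(n, z). i (coord y z) n)"

definition coord_comb :: "(('x => 'a) \<times> 'z => 'a) => 'x \<times> 'z => 'a" where
 "coord_comb = linear_ext R (Y \<times> Z) (free_module R (X \<times> Z)) (%(n, z). inj_coord R z n)"

lemma Y_closed: "n \<in> Y ==> n \<in> free_set R X"
 using submodule_closed(1)[OF free_module_module[OF is_cring] Y] .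

lemma i_lin: "lin R (free_module R X) Y (free_module R Y) i"
 and i_comb: "y \<in> Y ==> linear_ext R Y (free_module R X) (%x. x) (i y) = y"
 using i by (auto simp: dual_basis_def)

lemma coord_Y: "y \<in> coord_sub ==> coord y z \<in> Y"
 using coord_outside[of y X Z z] submodule_closed(2)[OF free_module_module[OF is_cring] Y]
 by (cases "z \<in> Z") (auto simp: coord_sub_def)

lemma coord_sub_submodule: "submodule coord_sub R (free_module R (X \<times> Z))"
proof (rule submoduleI'[OF free_module_module[OF is_cring]])
 note F = free_module_module[OF is_cring]
 note YY = submodule_closed[OF F Y]
 interpret FF: module R "free_module R (X \<times> Z)" by (rule F)
 show "coord_sub <= free_set R (X \<times> Z)" by (auto simp: coord_sub_def)
 show "\<zero>[free_module R (X \<times> Z)] \<in> coord_sub"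
  using YY(2) FF.zero_closed by (simp add: coord_sub_def coord_def)
 show "y \<oplus>[free_module R (X \<times> Z)] y' \<in> coord_sub" if "y \<in> coord_sub" "y' \<in> coord_sub" for y y'
  using that YY(4) lin_add[OF coord_lin, of y X Z y'] FF.a_closed[of y y']
  by (auto simp: coord_sub_def simp del: free_module_sel)
 show "r \<odot>[free_module R (X \<times> Z)] y \<in> coord_sub" if "r \<in> carrier R" "y \<in> coord_sub" for r y
  using that YY(6) lin_smult[OF coord_lin, of r y X Z] FF.smult_closed[of r y]
  by (auto simp: coord_sub_def simp del: free_module_sel)
qed

lemma coord_coeff_closed:
 assumes "y \<in> coord_sub"
 shows "coord_coeff y \<in> free_set R (Y \<times> Z)"
proof -
 have y: "y \<in> free_set R (X \<times> Z)" using assms by (simp add: coord_sub_def)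
 have ic: "i (coord y z) \<in> free_set R Y" for z
  by (rule lin_closed[OF i_lin coord_Y[OF assms]])
 have i0: "i (%x. \<zero>) = (%n. \<zero>)"
  using lin_zero[OF free_module_module[OF is_cring] free_module_module[OF is_cring] Y i_lin] by simp
 have "{p. coord_coeff y p ~= \<zero>} <= (\<Union>z\<in>{z. coord y z ~= (%x. \<zero>)}. (%n. (n, z)) ` {n. i (coord y z) n ~= \<zero>})"
 proof
  fix p assume "p \<in> {p. coord_coeff y p ~= \<zero>}"
  then obtain n z where p: "p = (n, z)" "i (coord y z) n ~= \<zero>" by (cases p) (auto simp: coord_coeff_def)
  moreover have "coord y z ~= (%x. \<zero>)" using p(2) i0 by metis
  ultimately show "p \<in> (\<Union>z\<in>{z. coord y z ~= (%x. \<zero>)}. (%n. (n, z)) ` {n. i (coord y z) n ~= \<zero>})" by auto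
 qed
 moreover have "finite (\<Union>z\<in>{z. coord y z ~= (%x. \<zero>)}. (%n. (n, z)) ` {n. i (coord y z) n ~= \<zero>})"
  using coord_finite[OF y] ic by (auto simp: free_module_mem)
 ultimately have "finite {p. coord_coeff y p ~= \<zero>}" using finite_subset by blast
 moreover have "coord_coeff y (n, z) = \<zero>" if "(n, z) \<notin> Y \<times> Z" for n z
  using that ic[of z] coord_outside[OF y, of z] i0 by (auto simp: coord_coeff_def free_module_mem)
 moreover have "coord_coeff y (n, z) \<in> carrier R" for n z
  using free_module_coord[OF is_cring ic] by (simp add: coord_coeff_def)
 ultimately show ?thesis unfolding free_module_mem by auto
qed

lemma coord_coeff_lin: "lin R (free_module R (X \<times> Z)) coord_sub (free_module R (Y \<times> Z)) coord_coeff"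
proof (rule linI)
 have ad: "coord (y \<oplus>[free_module R (X \<times> Z)] y') z = coord y z \<oplus>[free_module R X] coord y' z" for y y' z
  by (simp add: coord_def)
 have sm: "coord (r \<odot>[free_module R (X \<times> Z)] y) z = r \<odot>[free_module R X] coord y z" for r y z
  by (simp add: coord_def)
 show "coord_coeff (y \<oplus>[free_module R (X \<times> Z)] y') = coord_coeff y \<oplus>[free_module R (Y \<times> Z)] coord_coeff y'"
  if "y \<in> coord_sub" "y' \<in> coord_sub" for y y'
  unfolding coord_coeff_def ad using lin_add[OF i_lin coord_Y[OF that(1)] coord_Y[OF that(2)]]
  by (auto simp: fun_eq_iff)
 show "coord_coeff (r \<odot>[free_module R (X \<times> Z)] y) = r \<odot>[free_module R (Y \<times> Z)] coord_coeff y"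
  if "r \<in> carrier R" "y \<in> coord_sub" for r y
  unfolding coord_coeff_def sm using lin_smult[OF i_lin that(1) coord_Y[OF that(2)]]
  by (auto simp: fun_eq_iff)
qed (rule coord_coeff_closed)

lemma inj_Y: "p \<in> Y \<times> Z ==> (case p of (n, z) => inj_coord R z n) \<in> coord_sub"
 using submodule_closed(2)[OF free_module_module[OF is_cring] Y]
 by (auto simp: coord_sub_def inj_coord_closed Y_closed coord_inj_coord)

lemma inj_Y_carrier: "p \<in> Y \<times> Z ==> (case p of (n, z) => inj_coord R z n) \<in> free_set R (X \<times> Z)"
 using inj_Y[of p] by (simp add: coord_sub_def)

lemma coord_comb_lin:
 "linear R (free_module R (Y \<times> Z)) (free_module R (X \<times> Z)) coord_comb"
 unfolding coord_comb_def
 by (rule linear_ext_lin[OF is_cring free_module_module[OF is_cring]]) (rule inj_Y_carrier)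

lemma coord_comb_closed: "w \<in> free_set R (Y \<times> Z) ==> coord_comb w \<in> coord_sub"
 unfolding coord_comb_def
 by (rule linear_ext_in_submodule[OF free_module_module[OF is_cring] coord_sub_submodule]) (rule inj_Y)

lemma coord_comb_basis:
 assumes "n \<in> Y" "z \<in> Z"
 shows "coord_comb (basis_vector R (n, z)) = inj_coord R z n"
proof -
 have "coord_comb (basis_vector R (n, z)) = (case (n, z) of (n, z) => inj_coord R z n)"
  unfolding coord_comb_def
  by (rule linear_ext_basis[OF is_cring free_module_module[OF is_cring]]) (use inj_Y_carrier assms in auto)
 thus ?thesis by simp
qed

lemma coord_comb_coeff:
 assumes y: "y \<in> coord_sub"
 shows "coord_comb (coord_coeff y) = y"
proof -
 note F = free_module_module[OF is_cring]
 let ?q = "linear_ext R Y (free_module R X) (%x. x)"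
 have q: "linear R (free_module R Y) (free_module R X) ?q"
  by (rule linear_ext_lin[OF is_cring F]) (rule Y_closed)
 have q0: "?q (%n. \<zero>) = (%x. \<zero>)"
  using lin_zero[OF F F carrier_submodule[OF F] q] by simp
 have key: "coord (coord_comb w) z = ?q (coord w z)" if w: "w \<in> free_set R (Y \<times> Z)" for w z
 proof (rule lin_eq_on_basis[OF is_cring F _ _ _ w])
  show "linear R (free_module R (Y \<times> Z)) (free_module R X) (%w. coord (coord_comb w) z)"
   by (rule lin_compose[OF coord_comb_lin coord_lin]) (rule lin_closed[OF coord_comb_lin])
  show "linear R (free_module R (Y \<times> Z)) (free_module R X) (%w. ?q (coord w z))"
   by (rule lin_compose[OF coord_lin q]) (rule coord_closed)
  fix p assume "p \<in> Y \<times> Z"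
  then obtain n z' where p: "p = (n, z')" "n \<in> Y" "z' \<in> Z" by auto
  have "?q (basis_vector R n) = n"
   by (rule linear_ext_basis[where \<phi> = "%x. x", OF is_cring F _ p(2)]) (rule Y_closed)
  moreover have "coord (basis_vector R p) z = (if z = z' then basis_vector R n else (%x. \<zero>))"
   by (auto simp: p coord_def basis_vector_def fun_eq_iff)
  ultimately show "coord (coord_comb (basis_vector R p)) z = ?q (coord (basis_vector R p) z)"
   using coord_comb_basis[OF p(2,3)] q0 by (auto simp: p coord_inj_coord)
 qed
 have "coord (coord_comb (coord_coeff y)) z = coord y z" for z
 proof -
  have "coord (coord_coeff y) z = i (coord y z)" by (simp add: coord_def coord_coeff_def)
  thus ?thesis using key[OF coord_coeff_closed[OF y], of z] i_comb[OF coord_Y[OF y]] by simp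
 qed
 hence "coord_comb (coord_coeff y) (x, z) = y (x, z)" for x z
  by (metis coord_def)
 thus ?thesis by auto
qed

lemma coord_sub_selects:
 assumes "module R U"
 shows "selects R (free_module R (X \<times> Z)) coord_sub U"
 by (rule retract_selects[OF free_selects[OF is_cring assms] coord_coeff_lin coord_comb_lin])
  (auto simp: coord_coeff_closed coord_comb_closed coord_comb_coeff)

text \<open>The restrictions of a map to the coordinate axes extend one by one, and their extensions add up.\<close>

lemma coord_sub_extends:
 assumes C: "module R C" and ext: "extends R (free_module R X) Y C"
 shows "extends R (free_module R (X \<times> Z)) coord_sub C"
 unfolding extends_def
proof (intro allI impI)
 note F = free_module_module[OF is_cring]
 fix f assume f: "lin R (free_module R (X \<times> Z)) coord_sub C f"
 have fz: "lin R (free_module R X) Y C (%n. f (inj_coord R z n))" if "z \<in> Z" for z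
 proof (rule lin_compose[OF lin_subset[OF inj_coord_lin[OF that]] f])
  show "Y <= free_set R X" using Y_closed by auto
  show "inj_coord R z n \<in> coord_sub" if "n \<in> Y" for n using inj_Y[of "(n, z)"] that \<open>z \<in> Z\<close> by simp
 qed
 have "\<exists>k. linear R (free_module R X) C k & (\<forall>n\<in>Y. k n = f (inj_coord R z n))"
  if "z \<in> Z" for z
  using ext fz[OF that] unfolding extends_def by blast
 then obtain k where k: "!!z. z \<in> Z ==> linear R (free_module R X) C (k z)"
  "!!z n. z \<in> Z ==> n \<in> Y ==> k z n = f (inj_coord R z n)"
  by metis
 let ?\<phi> = "%(x, z). k z (basis_vector R x)"
 let ?g = "linear_ext R (X \<times> Z) C ?\<phi>"
 have \<phi>: "?\<phi> p \<in> carrier C" if p': "p \<in> X \<times> Z" for p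
 proof -
  obtain x z where p: "p = (x, z)" "x \<in> X" "z \<in> Z" using p' by auto
  show ?thesis using lin_closed[OF k(1)[OF p(3)] basis_vector_closed[OF is_cring p(2)]] by (simp add: p(1))
 qed
 have g: "linear R (free_module R (X \<times> Z)) C ?g"
  by (rule linear_ext_lin[OF is_cring C]) (rule \<phi>)
 have gj: "?g (inj_coord R z n) = k z n" if z: "z \<in> Z" and n: "n \<in> free_set R X" for z n
 proof (rule lin_eq_on_basis[OF is_cring C _ k(1)[OF z] _ n])
  show "linear R (free_module R X) C (%n. ?g (inj_coord R z n))"
   by (rule lin_compose[OF inj_coord_lin[OF z] g]) (rule inj_coord_closed[OF _ z])
  fix x assume x: "x \<in> X"
  have "?g (basis_vector R (x, z)) = (case (x, z) of (x, z) => k z (basis_vector R x))"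
   by (rule linear_ext_basis[OF is_cring C]) (use \<phi> x z in auto)
  thus "?g (inj_coord R z (basis_vector R x)) = k z (basis_vector R x)" by (simp add: inj_coord_basis)
 qed
 have "?g y = f y" if y: "y \<in> coord_sub" for y
 proof -
  have "?g (coord_comb w) = f (coord_comb w)" if w: "w \<in> free_set R (Y \<times> Z)" for w
  proof (rule lin_eq_on_basis[OF is_cring C _ _ _ w])
   show "linear R (free_module R (Y \<times> Z)) C (%w. ?g (coord_comb w))"
    by (rule lin_compose[OF coord_comb_lin g]) (rule lin_closed[OF coord_comb_lin])
   show "linear R (free_module R (Y \<times> Z)) C (%w. f (coord_comb w))"
    by (rule lin_compose[OF coord_comb_lin f]) (rule coord_comb_closed)
   fix p assume "p \<in> Y \<times> Z"
   then obtain n z where p: "p = (n, z)" "n \<in> Y" "z \<in> Z" by auto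
   show "?g (coord_comb (basis_vector R p)) = f (coord_comb (basis_vector R p))"
    unfolding p(1) coord_comb_basis[OF p(2,3)] using gj[OF p(3) Y_closed[OF p(2)]] k(2)[OF p(3,2)] by simp
  qed
  thus ?thesis using coord_comb_coeff[OF y] coord_coeff_closed[OF y] by metis
 qed
 thus "\<exists>g. linear R (free_module R (X \<times> Z)) C g & (\<forall>x\<in>coord_sub. g x = f x)"
  using g by blast
qed

end

end

section \<open>Modules of projective dimension at most one\<close>

text \<open>
 Adding a complement of \<open>P\<^sub>0\<close> to both terms of a resolution \<open>0 \<rightarrow> P\<^sub>1 \<rightarrow> P\<^sub>0 \<rightarrow> M\<close> makes \<open>P\<^sub>0\<close> free: the kernel
 of \<open>R\<^sup>(\<^sup>X\<^sup>) \<rightarrow> P\<^sub>0 \<rightarrow> M\<close> is the sum of \<open>P\<^sub>1\<close> and the kernel of \<open>R\<^sup>(\<^sup>X\<^sup>) \<rightarrow> P\<^sub>0\<close>.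
\<close>

lemma proj_dim_le_1_presentation:
 fixes M :: "('a, 'm) module"
 assumes "proj_dim_le TYPE('p) R M 1"
 shows "\<exists>(X :: 'p set) \<epsilon> i. linear R (free_module R X) M \<epsilon> &
  \<epsilon> ` free_set R X = carrier M &
  dual_basis R (free_module R X) {y \<in> free_set R X. \<epsilon> y = \<zero>[M]} i"
proof -
 have M: "module R M" using assms by (simp add: proj_dim_le_def)
 have R: "cring R" using M by (rule module.axioms)
 obtain P :: "nat => ('a, 'p) module" and d \<eta> where res: "projective_resolution R M P d \<eta>"
  and small: "\<forall>i>1. carrier (P i) = {\<zero>[P i]}"
  using assms unfolding proj_dim_le_def by blast
 have proj: "projective_module R (P i)" for i using res by (simp add: projective_resolution_def)
 have mP: "module R (P i)" for i using proj by (simp add: projective_module_def)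
 have d: "d k \<in> mod_hom R (P (Suc k)) (P k)" for k
  using res by (simp add: projective_resolution_def)
 have d0: "linear R (P 1) (P 0) (d 0)" using mod_hom_lin[OF d[of 0]] by simp
 have d1: "linear R (P 2) (P 1) (d 1)" using mod_hom_lin[OF d[of 1]] by (simp add: numeral_2_eq_2)
 have \<eta>: "linear R (P 0) M \<eta>" and \<eta>s: "\<eta> ` carrier (P 0) = carrier M"
  and ex0: "d 0 ` carrier (P 1) = a_kernel (P 0) M \<eta>"
  using res by (simp_all only: projective_resolution_def mod_hom_lin)
 have "d (Suc 0) ` carrier (P (Suc (Suc 0))) = a_kernel (P (Suc 0)) (P 0) (d 0)"
  using res by (simp only: projective_resolution_def)
 hence ex1: "d 1 ` carrier (P 2) = a_kernel (P 1) (P 0) (d 0)" by (simp add: numeral_2_eq_2)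
 define A0 A1 A2 e0 e1 where A: "A0 = P 0" "A1 = P 1" "A2 = P 2" and e: "e0 = d 0" "e1 = d 1"
 note d0 = d0[folded A e] and d1 = d1[folded A e] and \<eta> = \<eta>[folded A e] and \<eta>s = \<eta>s[folded A e]
  and ex0 = ex0[folded A e] and ex1 = ex1[folded A e]
 have mA0: "module R A0" and mA1: "module R A1" and mA2: "module R A2" using mP by (simp_all add: A)
 have proj0: "projective_module R A0" and proj1: "projective_module R A1" using proj by (simp_all add: A)
 have small2: "carrier A2 = {\<zero>[A2]}" using small by (simp add: A)
 interpret P0: module R "A0" by (rule mA0)
 interpret P1: module R "A1" by (rule mA1)
 have inj: "z = z'" if z: "z \<in> carrier A1" "z' \<in> carrier A1" "e0 z = e0 z'" for z z'
 proof -
  have "e0 (z \<ominus>[A1] z') = \<zero>[A0]"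
   using lin_minus[OF mA1 mA0 carrier_submodule[OF mA1] d0 z(1,2)] z lin_closed[OF d0] by simp
  hence "z \<ominus>[A1] z' \<in> a_kernel A1 A0 (e0)"
   using z by (simp add: a_kernel_def')
  then obtain y where y: "y \<in> carrier A2" "z \<ominus>[A1] z' = e1 y" using ex1 by auto
  have "y = \<zero>[A2]" using y(1) small2 by auto
  hence "z \<ominus>[A1] z' = \<zero>[A1]"
   using y(2) lin_zero[OF mA2 mA1 carrier_submodule[OF mA2] d1] by simp
  thus ?thesis using z by (simp add: P1.minus_eq_zero_iff)
 qed
 obtain X :: "'p set" and j q where j: "j \<in> mod_hom R A0 (free_module R X)"
  and q: "q \<in> mod_hom R (free_module R X) A0" and qj: "\<forall>x\<in>carrier A0. q (j x) = x"
  using proj0 unfolding projective_module_def by blast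
 let ?F = "free_module R X"
 have F: "module R ?F" by (rule free_module_module[OF R])
 interpret F: module R ?F by (rule F)
 note j = mod_hom_lin[OF j] and q = mod_hom_lin[OF q]
 have sF: "submodule (carrier ?F) R ?F" by (rule carrier_submodule[OF F])
 define \<epsilon> where "\<epsilon> y = \<eta> (q y)" for y
 have \<epsilon>: "linear R ?F M \<epsilon>"
  unfolding \<epsilon>_def by (rule lin_compose[OF q \<eta> lin_closed[OF q]])
 have \<epsilon>s: "\<epsilon> ` carrier ?F = carrier M"
 proof
  show "\<epsilon> ` carrier ?F <= carrier M" using lin_closed[OF \<epsilon>] by auto
  show "carrier M <= \<epsilon> ` carrier ?F"
  proof
   fix m assume "m \<in> carrier M"
   then obtain p where p: "p \<in> carrier A0" "m = \<eta> p" using \<eta>s by auto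
   hence "m = \<epsilon> (j p)" using qj by (simp add: \<epsilon>_def)
   thus "m \<in> \<epsilon> ` carrier ?F" using lin_closed[OF j p(1)] by auto
  qed
 qed
 let ?N = "{y \<in> carrier ?F. \<epsilon> y = \<zero>[M]}"
 have N: "submodule ?N R ?F"
  using lin_kernel_submodule[OF F M sF \<epsilon> zero_submodule[OF M]] by simp
 have ex: "\<exists>z. z \<in> carrier A1 & e0 z = q y" if "y \<in> ?N" for y
 proof -
  have "q y \<in> a_kernel A0 M \<eta>"
   using that lin_closed[OF q] by (simp add: a_kernel_def' \<epsilon>_def)
  hence "q y \<in> e0 ` carrier A1" using ex0 by simp
  thus ?thesis by auto
 qed
 define \<delta> where "\<delta> y = (SOME z. z \<in> carrier A1 & e0 z = q y)" for y
 have \<delta>: "\<delta> y \<in> carrier A1" "e0 (\<delta> y) = q y" if "y \<in> ?N" for y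
  using someI_ex[OF ex[OF that]] by (auto simp: \<delta>_def)
 have \<delta>l: "lin R ?F ?N A1 \<delta>"
 proof (rule linI)
  note NN = submodule_closed[OF F N]
  show "\<delta> (x \<oplus>[?F] y) = \<delta> x \<oplus>[A1] \<delta> y" if xy: "x \<in> ?N" "y \<in> ?N" for x y
  proof (rule inj)
   have "e0 (\<delta> x \<oplus>[A1] \<delta> y) = q x \<oplus>[A0] q y"
    using lin_add[OF d0 \<delta>(1)[OF xy(1)] \<delta>(1)[OF xy(2)]] \<delta>(2)[OF xy(1)] \<delta>(2)[OF xy(2)] by simp
   thus "e0 (\<delta> (x \<oplus>[?F] y)) = e0 (\<delta> x \<oplus>[A1] \<delta> y)"
    using \<delta>(2)[OF NN(4)[OF xy]] lin_add[OF q NN(1)[OF xy(1)] NN(1)[OF xy(2)]] by simp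
  qed (use \<delta>(1)[OF NN(4)[OF xy]] \<delta>(1)[OF xy(1)] \<delta>(1)[OF xy(2)] in simp_all)
  show "\<delta> (r \<odot>[?F] x) = r \<odot>[A1] \<delta> x" if r: "r \<in> carrier R" and x: "x \<in> ?N" for r x
  proof (rule inj)
   have "e0 (r \<odot>[A1] \<delta> x) = r \<odot>[A0] q x"
    using lin_smult[OF d0 r \<delta>(1)[OF x]] \<delta>(2)[OF x] by simp
   thus "e0 (\<delta> (r \<odot>[?F] x)) = e0 (r \<odot>[A1] \<delta> x)"
    using \<delta>(2)[OF NN(6)[OF r x]] lin_smult[OF q r NN(1)[OF x]] by simp
  qed (use \<delta>(1)[OF NN(6)[OF r x]] \<delta>(1)[OF x] r in simp_all)
 qed (rule \<delta>(1))
 have "selects R ?F ?N (free_module R ?N)"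
  unfolding selects_def
 proof (intro allI impI)
  let ?U = "free_module R ?N"
  have U: "module R ?U" by (rule free_module_module[OF R])
  fix \<Gamma> assume \<Gamma>: "linrel R ?F ?N ?U \<Gamma>"
  note NN = submodule_closed[OF F N]
  have jd: "linear R A1 ?F (%z. j (e0 z))"
   by (rule lin_compose[OF d0 j lin_closed[OF d0]])
  have jdN: "j (e0 z) \<in> ?N" if "z \<in> carrier A1" for z
  proof -
   have "e0 z \<in> a_kernel A0 M \<eta>" using that ex0 by auto
   hence "e0 z \<in> carrier A0" "\<eta> (e0 z) = \<zero>[M]" by (auto simp: a_kernel_def')
   thus ?thesis using qj lin_closed[OF j] by (auto simp: \<epsilon>_def)
  qed
  have jq: "linear R ?F ?F (%y. j (q y))"
   by (rule lin_compose[OF q j lin_closed[OF q]])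
  have pr: "linear R ?F ?F (%y. y \<ominus>[?F] j (q y))"
   by (rule lin_diff[OF F F sF lin_ident[OF subset_refl] jq])
  have prN: "y \<ominus>[?F] j (q y) \<in> ?N" if y: "y \<in> carrier ?F" for y
  proof -
   have qy: "q y \<in> carrier A0" by (rule lin_closed[OF q y])
   have "q (y \<ominus>[?F] j (q y)) = q y \<ominus>[A0] q (j (q y))"
    by (rule lin_minus[OF F mA0 sF q y lin_closed[OF j qy]])
   hence "q (y \<ominus>[?F] j (q y)) = \<zero>[A0]" using qj qy by simp
   thus ?thesis
    using lin_closed[OF pr y] lin_zero[OF mA0 M carrier_submodule[OF mA0] \<eta>] by (simp add: \<epsilon>_def)
  qed
  have g1: "linrel R A1 (carrier A1) ?U (%z. \<Gamma> (j (e0 z)))" by (rule linrel_comp[OF \<Gamma> jd jdN])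
  have g2: "linrel R ?F (carrier ?F) ?U (%y. \<Gamma> (y \<ominus>[?F] j (q y)))" by (rule linrel_comp[OF \<Gamma> pr prN])
  obtain h1 where h1: "linear R A1 ?U h1" "\<forall>z\<in>carrier A1. \<Gamma> (j (e0 z)) (h1 z)"
   by (rule selectsD[OF projective_selects[OF proj1 U] g1])
  obtain h2 where h2: "linear R ?F ?U h2" "\<forall>y\<in>carrier ?F. \<Gamma> (y \<ominus>[?F] j (q y)) (h2 y)"
   by (rule selectsD[OF free_selects[OF R U] g2])
  have NF: "?N <= carrier ?F" by auto
  have "lin R ?F ?N ?U (%y. h1 (\<delta> y) \<oplus>[?U] h2 y)"
   by (rule lin_sum[OF U lin_compose[OF \<delta>l h1(1) \<delta>(1)] lin_subset[OF h2(1) NF]])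
  moreover have "\<Gamma> y (h1 (\<delta> y) \<oplus>[?U] h2 y)" if y: "y \<in> ?N" for y
  proof -
   have yF: "y \<in> carrier ?F" using y by simp
   have jy: "j (q y) \<in> carrier ?F" by (rule lin_closed[OF j lin_closed[OF q yF]])
   have a: "j (e0 (\<delta> y)) = j (q y)" using \<delta>(2)[OF y] by simp
   have "\<Gamma> (j (q y)) (h1 (\<delta> y))" using bspec[OF h1(2) \<delta>(1)[OF y]] unfolding a .
   hence "\<Gamma> (j (q y) \<oplus>[?F] (y \<ominus>[?F] j (q y))) (h1 (\<delta> y) \<oplus>[?U] h2 y)"
    by (intro linrel_add[OF \<Gamma> _ prN[OF yF]] bspec[OF h2(2) yF] lin_closed[OF h1(1)] lin_closed[OF h2(1)] yF \<delta>(1)[OF y])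
     (use jdN[OF \<delta>(1)[OF y]] in "simp only: a")
   thus ?thesis unfolding F.add_minus_cancel[OF jy yF] .
  qed
  ultimately show "\<exists>h. lin R ?F ?N ?U h & (\<forall>y\<in>?N. \<Gamma> y (h y))" by (intro exI conjI ballI)
 qed
 then obtain i where "dual_basis R ?F ?N i" using selects_dual_basis[OF F N] by blast
 thus ?thesis using \<epsilon> \<epsilon>s by blast
qed

section \<open>Modules of fractions\<close>

text \<open>\<open>Q\<close> is a copy of \<open>S\<^sup>-\<^sup>1R\<close> with \<open>u\<close> in the place of \<open>1\<close>.\<close>

locale fraction_module = nonzerodivisors R S
 for R :: "('a, 'k) ring_scheme" (structure) and S :: "'a set" +
 fixes Q :: "('a, 'q) module" and u :: 'q
 assumes Q: "module R Q" and u_closed [simp]: "u \<in> carrier Q"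
  and frac_ex: "q \<in> carrier Q ==> \<exists>s\<in>S. \<exists>a\<in>carrier R. s \<odot>[Q] q = a \<odot>[Q] u"
  and torsion_free: "s \<in> S ==> q \<in> carrier Q ==> s \<odot>[Q] q = \<zero>[Q] ==> q = \<zero>[Q]"
  and divisible: "s \<in> S ==> q \<in> carrier Q ==> \<exists>q'\<in>carrier Q. s \<odot>[Q] q' = q"
  and faithful: "a \<in> carrier R ==> a \<odot>[Q] u = \<zero>[Q] ==> a = \<zero>"
begin

sublocale Q: module R Q by (rule Q)

lemma smult_cancel:
 assumes "s \<in> S" "q \<in> carrier Q" "q' \<in> carrier Q" "s \<odot>[Q] q = s \<odot>[Q] q'"
 shows "q = q'"
proof -
 have "s \<odot>[Q] (q \<ominus>[Q] q') = \<zero>[Q]" using assms by (simp add: Q.smult_minus)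
 hence "q \<ominus>[Q] q' = \<zero>[Q]" using torsion_free[OF assms(1) Q.minus_closed[OF assms(2,3)]] by simp
 thus ?thesis using assms by (simp add: Q.minus_eq_zero_iff)
qed

lemma u_cancel:
 assumes "a \<in> carrier R" "b \<in> carrier R" "a \<odot>[Q] u = b \<odot>[Q] u"
 shows "a = b"
proof -
 have "(a \<ominus> b) \<odot>[Q] u = \<zero>[Q]" using assms by (simp add: Q.minus_smult)
 hence "a \<ominus> b = \<zero>" using faithful[OF minus_closed[OF assms(1,2)]] by simp
 thus ?thesis using assms by (simp add: minus_eq_zero_iff)
qed

definition recip :: "'a => 'q" where
 "recip s = (SOME q. q \<in> carrier Q & s \<odot>[Q] q = u)"

lemma recip:
 assumes "s \<in> S"
 shows recip_closed [simp]: "recip s \<in> carrier Q" and smult_recip [simp]: "s \<odot>[Q] recip s = u"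
proof -
 have "\<exists>q. q \<in> carrier Q & s \<odot>[Q] q = u" using divisible[OF assms u_closed] by blast
 from someI_ex[OF this] show "recip s \<in> carrier Q" "s \<odot>[Q] recip s = u" by (auto simp: recip_def)
qed

lemma recip_unique: "s \<in> S ==> q \<in> carrier Q ==> s \<odot>[Q] q = u ==> q = recip s"
 by (rule smult_cancel[of s]) auto

lemma recip_one: "recip \<one> = u"
 by (rule recip_unique[symmetric]) auto

lemma recip_mult:
 assumes "s \<in> S" "t \<in> S"
 shows "t \<odot>[Q] recip (s \<otimes> t) = recip s"
proof (rule recip_unique)
 have "s \<odot>[Q] (t \<odot>[Q] recip (s \<otimes> t)) = (s \<otimes> t) \<odot>[Q] recip (s \<otimes> t)"
  using assms by (simp only: Q.smult_assoc1 S_closed S_mult recip_closed)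
 thus "s \<odot>[Q] (t \<odot>[Q] recip (s \<otimes> t)) = u" using assms by (simp del: Q.smult_assoc1)
qed (use assms in auto)

lemma recip_divides:
 assumes "s \<in> S" "t \<in> S" "a \<in> carrier R" "s = t \<otimes> a"
 shows "recip t = a \<odot>[Q] recip s"
proof (rule recip_unique[symmetric])
 have "t \<odot>[Q] (a \<odot>[Q] recip s) = (t \<otimes> a) \<odot>[Q] recip s"
  using assms(1-3) by (simp add: Q.smult_assoc1)
 thus "t \<odot>[Q] (a \<odot>[Q] recip s) = u" using assms(1) by (simp add: assms(4)[symmetric])
qed (use assms(1-3) in auto)

end

context nonzerodivisors
begin

lemma loc_fraction_module: "fraction_module R S (loc_as_module R S) \<one>[loc_ring R S]"
proof -
 interpret L: cring "loc_ring R S" by (rule loc_ring_cring)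
 show ?thesis
 proof (intro fraction_module.intro fraction_module_axioms.intro nonzerodivisors_axioms loc_as_module_module)
  show "\<one>[loc_ring R S] \<in> carrier (loc_as_module R S)" by simp
  show "\<exists>s\<in>S. \<exists>a\<in>carrier R. s \<odot>[loc_as_module R S] q = a \<odot>[loc_as_module R S] \<one>[loc_ring R S]"
   if q: "q \<in> carrier (loc_as_module R S)" for q
  proof -
   obtain a s where a: "a \<in> carrier R" "s \<in> S" "q = fraction R S a s" using loc_cases[of q] q by auto
   have "s \<odot>[loc_as_module R S] q = a \<odot>[loc_as_module R S] \<one>[loc_ring R S]"
    using a by (simp add: embed_smult loc_one embed_def loc_mult fraction_eq_iff m_ac)
   thus ?thesis using a by blast
  qed
  show "q = \<zero>[loc_as_module R S]"
   if q: "s \<in> S" "q \<in> carrier (loc_as_module R S)" "s \<odot>[loc_as_module R S] q = \<zero>[loc_as_module R S]" for s q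
  proof -
   obtain a t where a: "a \<in> carrier R" "t \<in> S" "q = fraction R S a t" using loc_cases[of q] q by auto
   have "s \<otimes> a = \<zero>" using q a by (simp add: embed_smult loc_zero fraction_eq_iff)
   hence "a = \<zero>" using nzd[OF q(1) a(1)] by simp
   thus ?thesis using a by (simp add: loc_zero fraction_eq_iff)
  qed
  show "\<exists>q'\<in>carrier (loc_as_module R S). s \<odot>[loc_as_module R S] q' = q"
   if q: "s \<in> S" "q \<in> carrier (loc_as_module R S)" for s q
  proof -
   obtain a t where a: "a \<in> carrier R" "t \<in> S" "q = fraction R S a t" using loc_cases[of q] q by auto
   have "s \<odot>[loc_as_module R S] fraction R S a (s \<otimes> t) = q"
    using q a by (simp add: embed_smult fraction_eq_iff m_ac)
   thus ?thesis using q a by (auto intro!: bexI[of _ "fraction R S a (s \<otimes> t)"])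
  qed
  show "a = \<zero>" if "a \<in> carrier R" "a \<odot>[loc_as_module R S] \<one>[loc_ring R S] = \<zero>[loc_as_module R S]" for a
   using that by (simp add: embed_def loc_one loc_mult loc_zero fraction_eq_iff)
 qed
qed

end

section \<open>Admissible sets of generators\<close>

locale presented_fractions = fraction_module R S Q u
 for R :: "('a, 'k) ring_scheme" (structure) and S :: "'a set" and Q :: "('a, 'q) module" and u :: 'q +
 fixes X :: "'x set" and \<epsilon> :: "('x => 'a) => 'q" and i :: "('x => 'a) => ('x => 'a) => 'a"
 assumes \<epsilon>: "linear R (free_module R X) Q \<epsilon>"
  and \<epsilon>_surj: "\<epsilon> ` free_set R X = carrier Q"
  and i: "dual_basis R (free_module R X) {y \<in> free_set R X. \<epsilon> y = \<zero>[Q]} i"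
begin

abbreviation F where "F \<equiv> free_module R X"
abbreviation N where "N \<equiv> {y \<in> carrier F. \<epsilon> y = \<zero>[Q]}"

abbreviation supp :: "('y => 'a) => 'y set" where "supp f \<equiv> {x. f x ~= \<zero>}"

sublocale F: module R F by (rule free_module_module[OF is_cring])

lemma F_submodule: "submodule (carrier F) R F"
 by (rule carrier_submodule[OF F.module_axioms])

lemma N_submodule: "submodule N R F"
 using lin_kernel_submodule[OF F.module_axioms Q F_submodule \<epsilon> zero_submodule[OF Q]] by simp

lemma i_lin: "lin R F N (free_module R N) i"
 and i_comb: "y \<in> N ==> linear_ext R N F (%x. x) (i y) = y"
 using i by (auto simp: dual_basis_def)

lemma \<epsilon>_closed: "y \<in> carrier F ==> \<epsilon> y \<in> carrier Q"
 by (rule lin_closed[OF \<epsilon>])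

lemma \<epsilon>_zero: "\<epsilon> (%x. \<zero>) = \<zero>[Q]"
 using lin_zero[OF F.module_axioms Q F_submodule \<epsilon>] by simp

text \<open>A chosen preimage of \<open>1 / s\<close>.\<close>

definition pre :: "'a => 'x => 'a" where
 "pre s = (SOME y. y \<in> carrier F & \<epsilon> y = recip s)"

lemma pre:
 assumes "s \<in> S"
 shows pre_closed: "pre s \<in> carrier F" and \<epsilon>_pre: "\<epsilon> (pre s) = recip s"
proof -
 have "recip s \<in> \<epsilon> ` carrier F" using assms by (simp add: \<epsilon>_surj)
 hence "\<exists>y. y \<in> carrier F & \<epsilon> y = recip s" by auto
 from someI_ex[OF this] show "pre s \<in> carrier F" "\<epsilon> (pre s) = recip s" by (auto simp: pre_def)
qed

definition den_num :: "'x => 'a \<times> 'a" where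
 "den_num x = (SOME (s, a). s \<in> S & a \<in> carrier R & s \<odot>[Q] \<epsilon> (basis_vector R x) = a \<odot>[Q] u)"

definition den :: "'x => 'a" where "den x = fst (den_num x)"
definition num :: "'x => 'a" where "num x = snd (den_num x)"

lemma den_num:
 assumes "x \<in> X"
 shows den_S: "den x \<in> S" and num_R: "num x \<in> carrier R"
  and den_\<epsilon>: "den x \<odot>[Q] \<epsilon> (basis_vector R x) = num x \<odot>[Q] u"
proof -
 have "\<exists>p. case p of (s, a) => s \<in> S & a \<in> carrier R & s \<odot>[Q] \<epsilon> (basis_vector R x) = a \<odot>[Q] u"
  using frac_ex[OF \<epsilon>_closed[OF basis_vector_closed[OF is_cring assms]]] by auto
 from someI_ex[OF this] show "den x \<in> S" "num x \<in> carrier R" "den x \<odot>[Q] \<epsilon> (basis_vector R x) = num x \<odot>[Q] u"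
  by (auto simp: den_num_def den_def num_def split: prod.splits)
qed

text \<open>The relation of the presentation that compares the generator \<open>x\<close> with \<open>1\<close>.\<close>

definition rel :: "'x => 'x => 'a" where
 "rel x = den x \<odot>[F] basis_vector R x \<ominus>[F] num x \<odot>[F] pre \<one>"

lemma rel_N:
 assumes "x \<in> X"
 shows "rel x \<in> N"
proof -
 have b: "basis_vector R x \<in> carrier F" by (rule basis_vector_closed[OF is_cring assms])
 have d: "den x \<in> carrier R" and n: "num x \<in> carrier R" using den_num[OF assms] by auto
 have p: "pre \<one> \<in> carrier F" by (rule pre_closed) simp
 have "\<epsilon> (rel x) = den x \<odot>[Q] \<epsilon> (basis_vector R x) \<ominus>[Q] num x \<odot>[Q] \<epsilon> (pre \<one>)"
  unfolding rel_def lin_minus[OF F.module_axioms Q F_submodule \<epsilon> F.smult_closed[OF d b] F.smult_closed[OF n p]]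
   lin_smult[OF \<epsilon> d b] lin_smult[OF \<epsilon> n p] ..
 hence "\<epsilon> (rel x) = \<zero>[Q]" using den_\<epsilon>[OF assms] n by (simp add: \<epsilon>_pre recip_one)
 moreover have "rel x \<in> carrier F" unfolding rel_def using b d n p by blast
 ultimately show ?thesis by simp
qed

text \<open>
 The part of the module of fractions that is generated by a set \<open>A\<close> of generators, and the
 denominators occurring in it.
\<close>

definition fracs :: "'x set => 'q set" where "fracs A = \<epsilon> ` free_set R A"

definition dens :: "'x set => 'a set" where "dens A = {t \<in> S. recip t \<in> fracs A}"

text \<open>The generators that occur in \<open>1 / den x\<close> and in the relations used to express \<open>rel x\<close>.\<close>

definition needs :: "'x => 'x set" where
 "needs x = supp (pre (den x)) \<union> (\<Union>n\<in>supp (i (rel x)). supp n)"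

text \<open>The condition on \<open>needs\<close> makes the relations between generators in \<open>A\<close> a retract of \<open>N\<close> (\<open>retr_id\<close>).  Moreover \<open>fracs A\<close> contains \<open>1\<close>, and its denominators are closed under products.\<close>

definition admissible :: "'x set => bool" where
 "admissible A \<longleftrightarrow> A <= X & supp (pre \<one>) <= A & (\<forall>x\<in>A. needs x <= A) & (\<forall>s\<in>dens A. \<forall>t\<in>dens A. s \<otimes> t \<in> dens A)"

lemma free_mono: "A <= B ==> free_set R A <= free_set R B"
 by (fastforce simp: free_module_mem)

lemma free_memI: "f \<in> carrier F ==> supp f <= A ==> f \<in> free_set R A"
 using free_module_coord[OF is_cring] by (auto simp: free_module_mem)

lemma free_supp: "f \<in> free_set R A ==> supp f <= A"
 by (auto simp: free_module_mem)

lemma free_submodule: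
 assumes "A <= B"
 shows "submodule (free_set R A) R (free_module R B)"
proof (rule submoduleI'[OF free_module_module[OF is_cring] free_mono[OF assms]])
 interpret A: module R "free_module R A" by (rule free_module_module[OF is_cring])
 show "\<zero>[free_module R B] \<in> free_set R A" using A.zero_closed by simp
 show "x \<oplus>[free_module R B] y \<in> free_set R A"
  if "x \<in> free_set R A" "y \<in> free_set R A" for x y
  using A.a_closed[OF that] by simp
 show "r \<odot>[free_module R B] x \<in> free_set R A"
  if "r \<in> carrier R" "x \<in> free_set R A" for r x
  using A.smult_closed[OF that] by simp
qed

lemma free_lin: "lin R (free_module R A) B U h \<longleftrightarrow> lin R (free_module R C) B U h"
 by (simp add: lin_def)

lemma \<epsilon>_lin_sub:
 assumes "A <= X"
 shows "linear R (free_module R A) Q \<epsilon>"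
 using lin_subset[OF \<epsilon> free_mono[OF assms]] free_lin by blast

lemma fracs_submodule:
 assumes "A <= X"
 shows "submodule (fracs A) R Q"
 unfolding fracs_def
 by (rule lin_image_submodule[OF free_module_module[OF is_cring] Q carrier_submodule \<epsilon>_lin_sub])
  (use assms free_module_module[OF is_cring] in auto)

lemma fracs_mono: "A <= B ==> fracs A <= fracs B"
 unfolding fracs_def using free_mono by blast

lemma dens_mono: "A <= B ==> dens A <= dens B"
 unfolding dens_def using fracs_mono by blast

lemma dens_S: "t \<in> dens A ==> t \<in> S"
 by (simp add: dens_def)

lemma pre_fracs:
 assumes "s \<in> S" "supp (pre s) <= A"
 shows "recip s \<in> fracs A"
 using free_memI[OF pre_closed[OF assms(1)] assms(2)] \<epsilon>_pre[OF assms(1)] unfolding fracs_def by force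

context
 fixes A
 assumes A: "admissible A"
begin

lemma A_X: "A <= X" and A_one: "supp (pre \<one>) <= A" and A_needs: "x \<in> A ==> needs x <= A"
 and A_mult: "s \<in> dens A ==> t \<in> dens A ==> s \<otimes> t \<in> dens A"
 using A by (auto simp: admissible_def)

lemma one_dens: "\<one> \<in> dens A"
 using pre_fracs[of "\<one>" A] A_one by (simp add: dens_def)

lemma den_dens: "x \<in> A ==> den x \<in> dens A"
 using pre_fracs[of "den x" A] A_needs[of x] den_S[of x] A_X by (auto simp: dens_def needs_def)

lemma A_sub: "f \<in> free_set R A ==> f \<in> carrier F"
 using free_mono[OF A_X] by blast

lemma common_den:
 assumes "finite B" "B <= A"
 shows "\<exists>t\<in>dens A. \<forall>x\<in>B. \<exists>a\<in>carrier R. t \<odot>[Q] \<epsilon> (basis_vector R x) = a \<odot>[Q] u"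
 using assms
proof (induction B)
 case empty
 thus ?case using one_dens by blast
next
 case (insert x B)
 then obtain t where t: "t \<in> dens A" "\<forall>x\<in>B. \<exists>a\<in>carrier R. t \<odot>[Q] \<epsilon> (basis_vector R x) = a \<odot>[Q] u" by auto
 have xA: "x \<in> A" and xX: "x \<in> X" using insert.prems A_X by auto
 have tR: "t \<in> carrier R" and dR: "den x \<in> carrier R" using dens_S[OF t(1)] den_S[OF xX] by auto
 have c: "\<epsilon> (basis_vector R y) \<in> carrier Q" if "y \<in> insert x B" for y
  using \<epsilon>_closed[OF basis_vector_closed[OF is_cring, of y X]] that insert.prems A_X by blast
 have "\<exists>a\<in>carrier R. (t \<otimes> den x) \<odot>[Q] \<epsilon> (basis_vector R y) = a \<odot>[Q] u" if y: "y \<in> insert x B" for y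
 proof (cases "y = x")
  case True
  have "(t \<otimes> den x) \<odot>[Q] \<epsilon> (basis_vector R y) = (t \<otimes> num x) \<odot>[Q] u"
   using c[OF y] tR dR num_R[OF xX] den_\<epsilon>[OF xX] by (simp add: True Q.smult_assoc1)
  thus ?thesis using tR num_R[OF xX] by blast
 next
  case False
  then obtain a where a: "a \<in> carrier R" "t \<odot>[Q] \<epsilon> (basis_vector R y) = a \<odot>[Q] u" using t(2) y by auto
  have "(t \<otimes> den x) \<odot>[Q] \<epsilon> (basis_vector R y) = den x \<odot>[Q] (t \<odot>[Q] \<epsilon> (basis_vector R y))"
   using c[OF y] tR dR by (simp add: Q.smult_assoc1[symmetric] m_comm)
  hence "(t \<otimes> den x) \<odot>[Q] \<epsilon> (basis_vector R y) = (den x \<otimes> a) \<odot>[Q] u"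
   using a dR by (simp add: Q.smult_assoc1)
  thus ?thesis using a dR by blast
 qed
 thus ?case using A_mult[OF t(1) den_dens[OF xA]] by blast
qed

text \<open>
 Restricting the coefficients \<open>i y\<close> to the relations that are needed for the generators in \<open>A\<close>
 retracts all relations onto those between generators in \<open>A\<close>.
\<close>

definition rels :: "('x => 'a) set" where "rels = (\<Union>x\<in>A. supp (i (rel x)))"

definition retr :: "('x => 'a) => 'x => 'a" where
 "retr y = linear_ext R rels F (%n. n) (%n. if n \<in> rels then i y n else \<zero>)"

lemma i_closed: "y \<in> N ==> i y \<in> free_set R N"
 by (rule lin_closed[OF i_lin])

lemma rels_N: "rels <= N"
 using free_supp[OF i_closed[OF rel_N]] A_X by (auto simp: rels_def)

lemma rels_A:
 assumes "n \<in> rels"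
 shows "n \<in> free_set R A"
proof (rule free_memI)
 show "n \<in> carrier F" using subsetD[OF rels_N assms] by simp
 obtain x where x: "x \<in> A" "n \<in> supp (i (rel x))" using assms unfolding rels_def by blast
 have "supp n <= needs x" unfolding needs_def using x(2) by blast
 thus "supp n <= A" using A_needs[OF x(1)] by (rule subset_trans)
qed

lemma cut_lin: "lin R F N (free_module R rels) (%y n. if n \<in> rels then i y n else \<zero>)"
proof (rule linI)
 show "(%n. if n \<in> rels then i y n else \<zero>) \<in> free_set R rels" if "y \<in> N" for y
 proof -
  have "{n. (if n \<in> rels then i y n else \<zero>) ~= \<zero>} <= supp (i y)" by auto
  moreover have "finite (supp (i y))" using i_closed[OF that] by (simp add: free_module_mem)
  ultimately have "finite {n. (if n \<in> rels then i y n else \<zero>) ~= \<zero>}" by (rule finite_subset)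
  thus ?thesis using free_module_coord[OF is_cring i_closed[OF that]] by (auto simp: free_module_mem)
 qed
qed (auto simp: lin_add[OF i_lin, simplified] lin_smult[OF i_lin, simplified] fun_eq_iff)

lemma retr_lin: "lin R F N F retr"
proof -
 have "linear R (free_module R rels) F (linear_ext R rels F (%n. n))"
  by (rule linear_ext_lin[OF is_cring F.module_axioms]) (use rels_N in auto)
 thus ?thesis unfolding retr_def
  by (rule lin_compose[OF cut_lin]) (rule lin_closed[OF cut_lin])
qed

lemma retr_N: "y \<in> N ==> retr y \<in> N"
 unfolding retr_def
 by (rule linear_ext_in_submodule[OF F.module_axioms N_submodule]) (use rels_N lin_closed[OF cut_lin] in auto)

lemma retr_A: "y \<in> N ==> retr y \<in> free_set R A"
 unfolding retr_def
 by (rule linear_ext_in_submodule[OF F.module_axioms free_submodule[OF A_X]])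
  (use rels_A lin_closed[OF cut_lin] in auto)

text \<open>The coefficients \<open>i y\<close> lie in \<open>rels\<close> because those of some multiple \<open>s y\<close> do, which is a linear combination of the
\<open>rel x\<close> for \<open>x \<in> A\<close>.\<close>

lemma retr_id:
 assumes y: "y \<in> N" "y \<in> free_set R A"
 shows "retr y = y"
proof -
 \<comment> \<open>Some \<open>S\<close>-multiple of an element of \<open>R\<^sup>(\<^sup>A\<^sup>)\<close> is a combination of the \<open>rel x\<close>, up to a multiple of \<open>pre 1\<close>.\<close>
 let ?P = "%y. \<exists>s\<in>S. \<exists>b\<in>carrier R. \<exists>z\<in>N. s \<odot>[F] y = z \<oplus>[F] b \<odot>[F] pre \<one> & supp (i z) <= rels"
 note NN = submodule_closed[OF F.module_axioms N_submodule]
 have p: "pre \<one> \<in> carrier F" by (rule pre_closed) simp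
 have PI: "?P y'" if "s \<in> S" "b \<in> carrier R" "z \<in> N" "s \<odot>[F] y' = z \<oplus>[F] b \<odot>[F] pre \<one>" "supp (i z) <= rels"
  for y' s b z using that by blast
 have "?P y" using is_cring y(2)
 proof (induction rule: free_module_induct)
  case zero
  have i0: "i (%x. \<zero>) = (%n. \<zero>)"
   using lin_zero[OF F.module_axioms free_module_module[OF is_cring] N_submodule i_lin] by simp
  have e: "\<one> \<odot>[F] (%x. \<zero>) = (%x. \<zero>) \<oplus>[F] \<zero> \<odot>[F] pre \<one>"
   using F.smult_l_null[OF p] by (simp add: free_module_coord[OF is_cring p])
  show ?case
  proof (rule bexI[of _ "\<one>"], rule bexI[of _ "\<zero>"], rule bexI[of _ "%x. \<zero>"], rule conjI)
   show "\<one> \<odot>[F] (%x. \<zero>) = (%x. \<zero>) \<oplus>[F] \<zero> \<odot>[F] pre \<one>" by (rule e)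
   show "supp (i (%x. \<zero>)) <= rels" unfolding i0 by simp
   show "(%x. \<zero>) \<in> N" using NN(2) by simp
  qed simp_all
 next
  case (add f g)
  obtain s b z where f: "s \<in> S" "b \<in> carrier R" "z \<in> N" "s \<odot>[F] f = z \<oplus>[F] b \<odot>[F] pre \<one>" "supp (i z) <= rels"
   using add.IH(1) by blast
  obtain s' b' z' where g: "s' \<in> S" "b' \<in> carrier R" "z' \<in> N" "s' \<odot>[F] g = z' \<oplus>[F] b' \<odot>[F] pre \<one>" "supp (i z') <= rels"
   using add.IH(2) by blast
  have fF: "f \<in> carrier F" and gF: "g \<in> carrier F" using add.hyps A_sub by auto
  have z: "z \<in> carrier F" "z' \<in> carrier F" using f g by auto
  have sR: "s \<in> carrier R" "s' \<in> carrier R" using f g by auto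
  define Z where "Z = s' \<odot>[F] z \<oplus>[F] s \<odot>[F] z'"
  have ZN: "Z \<in> N" unfolding Z_def by (intro NN(4) NN(6) sR f g)
  have "(s \<otimes> s') \<odot>[F] (f \<oplus>[F] g) = s' \<odot>[F] (s \<odot>[F] f) \<oplus>[F] s \<odot>[F] (s' \<odot>[F] g)"
  proof -
   have "s' \<odot>[F] (s \<odot>[F] f) = (s \<otimes> s') \<odot>[F] f" by (simp only: F.smult_assoc1[OF sR(2,1) fF, symmetric] m_comm[OF sR])
   moreover have "s \<odot>[F] (s' \<odot>[F] g) = (s \<otimes> s') \<odot>[F] g" by (simp only: F.smult_assoc1[OF sR gF])
   ultimately show ?thesis using F.smult_r_distr[OF m_closed[OF sR] fF gF] by simp
  qed
  also have "\<dots> = (s' \<odot>[F] z \<oplus>[F] (s' \<otimes> b) \<odot>[F] pre \<one>) \<oplus>[F] (s \<odot>[F] z' \<oplus>[F] (s \<otimes> b') \<odot>[F] pre \<one>)"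
   unfolding f(4) g(4) using sR z f(2) g(2) p
   by (simp only: F.smult_r_distr F.smult_assoc1 F.smult_closed)
  also have "\<dots> = Z \<oplus>[F] (s' \<otimes> b \<oplus> s \<otimes> b') \<odot>[F] pre \<one>"
   unfolding Z_def F.smult_l_distr[OF m_closed[OF sR(2) f(2)] m_closed[OF sR(1) g(2)] p]
   using sR z f(2) g(2) p by (simp only: F.a_ac F.smult_closed F.a_closed m_closed)
  finally have eq: "(s \<otimes> s') \<odot>[F] (f \<oplus>[F] g) = Z \<oplus>[F] (s' \<otimes> b \<oplus> s \<otimes> b') \<odot>[F] pre \<one>" .
  have iZ: "i Z = s' \<odot>[free_module R N] i z \<oplus>[free_module R N] s \<odot>[free_module R N] i z'"
   unfolding Z_def lin_add[OF i_lin NN(6)[OF sR(2) f(3)] NN(6)[OF sR(1) g(3)]]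
    lin_smult[OF i_lin sR(2) f(3)] lin_smult[OF i_lin sR(1) g(3)] ..
  have "supp (i Z) <= supp (i z) \<union> supp (i z')" unfolding iZ using sR by auto
  hence su: "supp (i Z) <= rels" using f(5) g(5) by blast
  have "s \<otimes> s' \<in> S" "s' \<otimes> b \<oplus> s \<otimes> b' \<in> carrier R" using f g by auto
  from PI[OF this ZN eq su] show ?case by (simp only: free_module_sel)
 next
  case (smult r f)
  obtain s b z where f: "s \<in> S" "b \<in> carrier R" "z \<in> N" "s \<odot>[F] f = z \<oplus>[F] b \<odot>[F] pre \<one>" "supp (i z) <= rels"
   using smult.IH by blast
  have fF: "f \<in> carrier F" using smult.hyps A_sub by auto
  have z: "z \<in> carrier F" using f by auto
  have sR: "s \<in> carrier R" using f by auto
  have "s \<odot>[F] (r \<odot>[F] f) = r \<odot>[F] (s \<odot>[F] f)"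
   by (simp only: F.smult_assoc1[OF sR smult.hyps(1) fF, symmetric] F.smult_assoc1[OF smult.hyps(1) sR fF, symmetric]
     m_comm[OF sR smult.hyps(1)])
  also have "\<dots> = r \<odot>[F] z \<oplus>[F] (r \<otimes> b) \<odot>[F] pre \<one>"
   unfolding f(4) using smult.hyps(1) z f(2) p by (simp only: F.smult_r_distr F.smult_assoc1 F.smult_closed)
  finally have eq: "s \<odot>[F] (r \<odot>[F] f) = r \<odot>[F] z \<oplus>[F] (r \<otimes> b) \<odot>[F] pre \<one>" .
  have "supp (i (r \<odot>[F] z)) <= supp (i z)"
   unfolding lin_smult[OF i_lin smult.hyps(1) f(3)] using smult.hyps(1) by auto
  hence su: "supp (i (r \<odot>[F] z)) <= rels" using f(5) by blast
  have "r \<otimes> b \<in> carrier R" using f smult.hyps(1) by auto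
  from PI[OF f(1) this NN(6)[OF smult.hyps(1) f(3)] eq su] show ?case by (simp only: free_module_sel)
 next
  case (basis x)
  have x: "x \<in> X" using basis A_X by auto
  have b: "basis_vector R x \<in> carrier F" by (rule basis_vector_closed[OF is_cring x])
  have eq: "den x \<odot>[F] basis_vector R x = rel x \<oplus>[F] num x \<odot>[F] pre \<one>"
   unfolding rel_def
   by (rule F.minus_add_cancel[symmetric, OF F.smult_closed[OF _ b] F.smult_closed[OF _ p]])
    (use den_num[OF x] in auto)
  have su: "supp (i (rel x)) <= rels" using basis by (auto simp: rels_def)
  show ?case by (rule PI[OF den_num(1,2)[OF x] rel_N[OF x] eq su])
 qed
 then obtain s b z where f: "s \<in> S" "b \<in> carrier R" "z \<in> N" "s \<odot>[F] y = z \<oplus>[F] b \<odot>[F] pre \<one>" "supp (i z) <= rels"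
  by blast
 have yF: "y \<in> carrier F" and zF: "z \<in> carrier F" and sR: "s \<in> carrier R" using y f by auto
 have "\<epsilon> (s \<odot>[F] y) = \<zero>[Q]" using NN(6)[OF sR y(1)] by simp
 moreover have "\<epsilon> (z \<oplus>[F] b \<odot>[F] pre \<one>) = b \<odot>[Q] u"
  using lin_add[OF \<epsilon> zF F.smult_closed[OF f(2) p]] lin_smult[OF \<epsilon> f(2) p] f(3) \<epsilon>_pre[of "\<one>"] recip_one f(2) by simp
 ultimately have "b \<odot>[Q] u = \<zero>[Q]" using f(4) by simp
 hence "b = \<zero>" using faithful f(2) by blast
 hence sy: "s \<odot>[F] y = z" using f(4) zF F.smult_l_null[OF p] F.r_zero[OF zF] by metis
 \<comment> \<open>Elements of \<open>S\<close> are nonzerodivisors, hence \<open>i y\<close> and \<open>i (s y)\<close> have the same support.\<close>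
 have "supp (i y) <= rels"
 proof
  fix n assume n: "n \<in> supp (i y)"
  have c: "i y n \<in> carrier R" by (rule free_module_coord[OF is_cring i_closed[OF y(1)]])
  have "s \<otimes> i y n ~= \<zero>" using nzd[OF f(1) c] n by auto
  moreover have "i z n = s \<otimes> i y n" using lin_smult[OF i_lin sR y(1)] unfolding sy by simp
  ultimately show "n \<in> rels" using f(5) by auto
 qed
 hence "i y n = \<zero>" if "n \<notin> rels" for n using that by blast
 hence cut: "(%n. if n \<in> rels then i y n else \<zero>) = i y" by (intro ext) simp
 have "retr y = linear_ext R N F (%n. n) (i y)"
  using lin_closed[OF cut_lin y(1)] i_closed[OF y(1)] unfolding retr_def linear_ext_def cut by simp
 thus ?thesis using i_comb[OF y(1)] by simp
qed

end

end

text \<open>From here on the elements of free modules are no longer treated as functions by default.\<close>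

declare free_module_sel [simp del]

definition ring_module :: "('a, 'k) ring_scheme => ('a, 'a) module" where
 "ring_module R = \<lparr>carrier = carrier R, mult = mult R, one = one R, zero = zero R, add = add R, smult = mult R\<rparr>"

lemma ring_module_sel [simp]:
 "carrier (ring_module R) = carrier R" "zero (ring_module R) = \<zero>[R]" "add (ring_module R) = add R"
 "smult (ring_module R) = mult R"
 by (simp_all add: ring_module_def)

lemma (in cring) ring_module_module: "module R (ring_module R)"
proof (rule moduleI)
 show "abelian_group (ring_module R)"
  by (rule abelian_groupI) (auto simp: a_ac intro: bexI[of _ "\<ominus> x" for x] l_neg)
qed (auto simp: is_cring l_distr r_distr m_assoc)

context presented_fractions
begin

context
 fixes A
 assumes A: "admissible A"
begin

text \<open>
 For \<open>s\<close> in \<open>S\<close> this is a linear map from \<open>fracs A\<close> to \<open>R\<^sup>(\<^sup>A\<^sup>)\<close> modulo \<open>s\<close>, and a section of the presentation.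
 It exists because multiplication by \<open>s\<close> is bijective on the module of fractions, while it kills
 everything modulo \<open>s\<close>: thus the retraction of the relations onto those over \<open>A\<close> extends to all of \<open>R\<^sup>(\<^sup>X\<^sup>)\<close>
 modulo \<open>s\<close>.
\<close>

definition section_mod :: "'a => 'q => ('x => 'a) => bool" where
 "section_mod s v h \<longleftrightarrow> (\<exists>p\<in>free_set R A. \<exists>y\<in>carrier F.
   \<epsilon> p = v & s \<odot>[Q] \<epsilon> y = v & h = p \<ominus>[F] retr A (p \<ominus>[F] s \<odot>[F] y))"

lemma diff_N:
 assumes "s \<in> S" "p \<in> carrier F" "y \<in> carrier F" "s \<odot>[Q] \<epsilon> y = \<epsilon> p"
 shows "p \<ominus>[F] s \<odot>[F] y \<in> N"
proof -
 have sR: "s \<in> carrier R" using assms by simp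
 have "\<epsilon> (p \<ominus>[F] s \<odot>[F] y) = \<epsilon> p \<ominus>[Q] s \<odot>[Q] \<epsilon> y"
  unfolding lin_minus[OF F.module_axioms Q F_submodule \<epsilon> assms(2) F.smult_closed[OF sR assms(3)]]
   lin_smult[OF \<epsilon> sR assms(3)] ..
 thus ?thesis using assms sR \<epsilon>_closed by simp
qed

lemma section_mod_ex:
 assumes "s \<in> S" "v \<in> fracs A"
 shows "\<exists>h. section_mod s v h"
proof -
 obtain p where p: "p \<in> free_set R A" "v = \<epsilon> p" using assms(2) by (auto simp: fracs_def)
 have v: "v \<in> carrier Q" unfolding p(2) by (rule \<epsilon>_closed[OF A_sub[OF A p(1)]])
 obtain q where q: "q \<in> carrier Q" "s \<odot>[Q] q = v" using divisible[OF assms(1) v] by blast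
 have "q \<in> \<epsilon> ` carrier F" using q(1) by (simp add: \<epsilon>_surj)
 then obtain y where y: "y \<in> carrier F" "q = \<epsilon> y" by blast
 have "section_mod s v (p \<ominus>[F] retr A (p \<ominus>[F] s \<odot>[F] y))"
  unfolding section_mod_def using p(1) p(2)[symmetric] q(2) y by blast
 thus ?thesis by (rule exI[where x = "p \<ominus>[F] retr A (p \<ominus>[F] s \<odot>[F] y)"])
qed

lemma section_mod_A:
 assumes "s \<in> S" "section_mod s v h"
 shows "h \<in> free_set R A" and "\<epsilon> h = v"
proof -
 obtain p y where p: "p \<in> free_set R A" and y: "y \<in> carrier F" "\<epsilon> p = v" "s \<odot>[Q] \<epsilon> y = v"
  and h: "h = p \<ominus>[F] retr A (p \<ominus>[F] s \<odot>[F] y)"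
  using assms(2) unfolding section_mod_def by blast
 have pF: "p \<in> carrier F" by (rule A_sub[OF A p])
 have n: "p \<ominus>[F] s \<odot>[F] y \<in> N" by (rule diff_N[OF assms(1) pF y(1)]) (simp add: y)
 note r = retr_N[OF A n] retr_A[OF A n]
 show "h \<in> free_set R A"
  unfolding h by (rule submodule_closed(5)[OF F.module_axioms free_submodule[OF A_X[OF A]] p r(2)])
 have rF: "retr A (p \<ominus>[F] s \<odot>[F] y) \<in> carrier F" using r(1) by simp
 have "\<epsilon> h = \<epsilon> p \<ominus>[Q] \<epsilon> (retr A (p \<ominus>[F] s \<odot>[F] y))"
  unfolding h by (rule lin_minus[OF F.module_axioms Q F_submodule \<epsilon> pF rF])
 thus "\<epsilon> h = v" using r(1) y(2) \<epsilon>_closed[OF pF] by simp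
qed

text \<open>Linearity of the section modulo \<open>s\<close>, in the form that is used: compatibility with \<open>t v' = v\<close>, and for \<open>t = 1\<close>
independence of the choices.\<close>

lemma section_mod_smult:
 assumes "s \<in> S" "t \<in> carrier R" "section_mod s v h" "section_mod s v' h'" "t \<odot>[Q] v' = v"
 shows "\<exists>g\<in>free_set R A. t \<odot>[F] h' \<ominus>[F] h = s \<odot>[F] g"
proof -
 note NN = submodule_closed[OF F.module_axioms N_submodule]
 note AA = submodule_closed[OF F.module_axioms free_submodule[OF A_X[OF A]]]
 obtain p y where p: "p \<in> free_set R A" and y: "y \<in> carrier F" "\<epsilon> p = v" "s \<odot>[Q] \<epsilon> y = v"
  and h: "h = p \<ominus>[F] retr A (p \<ominus>[F] s \<odot>[F] y)"
  using assms(3) unfolding section_mod_def by blast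
 obtain p' y' where p': "p' \<in> free_set R A" and y': "y' \<in> carrier F" "\<epsilon> p' = v'" "s \<odot>[Q] \<epsilon> y' = v'"
  and h': "h' = p' \<ominus>[F] retr A (p' \<ominus>[F] s \<odot>[F] y')"
  using assms(4) unfolding section_mod_def by blast
 have sR: "s \<in> carrier R" using assms by simp
 have pF: "p \<in> carrier F" "p' \<in> carrier F" using A_sub[OF A] p p' by auto
 define P where "P = t \<odot>[F] p' \<ominus>[F] p"
 define Y where "Y = t \<odot>[F] y' \<ominus>[F] y"
 have PA: "P \<in> free_set R A" unfolding P_def by (rule AA(5)[OF AA(6)[OF assms(2) p'] p])
 have PF: "P \<in> carrier F" by (rule AA(1)[OF PA])
 have YF: "Y \<in> carrier F" unfolding Y_def using assms(2) y(1) y'(1) by blast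
 have "\<epsilon> P = t \<odot>[Q] \<epsilon> p' \<ominus>[Q] \<epsilon> p"
  unfolding P_def lin_minus[OF F.module_axioms Q F_submodule \<epsilon> F.smult_closed[OF assms(2) pF(2)] pF(1)]
   lin_smult[OF \<epsilon> assms(2) pF(2)] ..
 hence "\<epsilon> P = \<zero>[Q]" using assms(5) y(2) y'(2) \<epsilon>_closed[OF pF(1)] by simp
 hence PN: "P \<in> N" using PF by simp
 have "\<epsilon> Y = t \<odot>[Q] \<epsilon> y' \<ominus>[Q] \<epsilon> y"
  unfolding Y_def lin_minus[OF F.module_axioms Q F_submodule \<epsilon> F.smult_closed[OF assms(2) y'(1)] y(1)]
   lin_smult[OF \<epsilon> assms(2) y'(1)] ..
 hence "s \<odot>[Q] \<epsilon> Y = t \<odot>[Q] (s \<odot>[Q] \<epsilon> y') \<ominus>[Q] s \<odot>[Q] \<epsilon> y"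
  using sR assms(2) \<epsilon>_closed[OF y(1)] \<epsilon>_closed[OF y'(1)]
  by (simp add: Q.smult_minus Q.smult_assoc1[symmetric] m_comm)
 hence "s \<odot>[Q] \<epsilon> Y = \<zero>[Q]" using y(3) y'(3) assms(5) \<epsilon>_closed[OF pF(1)] y(2) by simp
 hence "\<epsilon> Y = \<zero>[Q]" using torsion_free[OF assms(1) \<epsilon>_closed[OF YF]] by simp
 hence YN: "Y \<in> N" using YF by simp
 have n: "p \<ominus>[F] s \<odot>[F] y \<in> N" by (rule diff_N[OF assms(1) pF(1) y(1)]) (simp add: y)
 have n': "p' \<ominus>[F] s \<odot>[F] y' \<in> N" by (rule diff_N[OF assms(1) pF(2) y'(1)]) (simp add: y')
 have nF: "p \<ominus>[F] s \<odot>[F] y \<in> carrier F" "p' \<ominus>[F] s \<odot>[F] y' \<in> carrier F" using n n' by simp_all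
 have eq: "t \<odot>[F] (p' \<ominus>[F] s \<odot>[F] y') \<ominus>[F] (p \<ominus>[F] s \<odot>[F] y) = P \<ominus>[F] s \<odot>[F] Y"
 proof -
  have a: "t \<odot>[F] (p' \<ominus>[F] s \<odot>[F] y') = t \<odot>[F] p' \<ominus>[F] s \<odot>[F] (t \<odot>[F] y')"
   using assms(2) sR pF y'(1) by (simp add: F.smult_minus F.smult_assoc1[symmetric] m_comm)
  have b: "s \<odot>[F] Y = s \<odot>[F] (t \<odot>[F] y') \<ominus>[F] s \<odot>[F] y"
   unfolding Y_def using assms(2) sR y(1) y'(1) by (simp add: F.smult_minus)
  show ?thesis unfolding a b P_def using assms(2) sR y(1) y'(1) pF
   by (simp add: a_minus_def F.minus_add F.a_ac)
 qed
 have "t \<odot>[F] h' \<ominus>[F] h = P \<ominus>[F] retr A (t \<odot>[F] (p' \<ominus>[F] s \<odot>[F] y') \<ominus>[F] (p \<ominus>[F] s \<odot>[F] y))"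
 proof -
  have r: "retr A (p \<ominus>[F] s \<odot>[F] y) \<in> carrier F" "retr A (p' \<ominus>[F] s \<odot>[F] y') \<in> carrier F"
   using retr_N[OF A n] retr_N[OF A n'] by simp_all
  have "retr A (t \<odot>[F] (p' \<ominus>[F] s \<odot>[F] y') \<ominus>[F] (p \<ominus>[F] s \<odot>[F] y))
    = t \<odot>[F] retr A (p' \<ominus>[F] s \<odot>[F] y') \<ominus>[F] retr A (p \<ominus>[F] s \<odot>[F] y)"
   unfolding lin_minus[OF F.module_axioms F.module_axioms N_submodule retr_lin[OF A] NN(6)[OF assms(2) n'] n]
    lin_smult[OF retr_lin[OF A] assms(2) n'] ..
  moreover have "t \<odot>[F] (p' \<ominus>[F] \<rho>') \<ominus>[F] (p \<ominus>[F] \<rho>) = P \<ominus>[F] (t \<odot>[F] \<rho>' \<ominus>[F] \<rho>)"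
   if "\<rho> \<in> carrier F" "\<rho>' \<in> carrier F" for \<rho> \<rho>'
   unfolding P_def F.smult_minus[OF assms(2) pF(2) that(2)] using that pF assms(2)
   by (simp add: a_minus_def F.minus_add F.a_ac)
  ultimately show ?thesis unfolding h h' using r by simp
 qed
 also have "\<dots> = P \<ominus>[F] (retr A P \<ominus>[F] s \<odot>[F] retr A Y)"
  unfolding eq lin_minus[OF F.module_axioms F.module_axioms N_submodule retr_lin[OF A] PN NN(6)[OF sR YN]]
   lin_smult[OF retr_lin[OF A] sR YN] ..
 also have "\<dots> = s \<odot>[F] retr A Y"
 proof -
  have rY: "retr A Y \<in> carrier F" using retr_N[OF A YN] by simp
  show ?thesis unfolding retr_id[OF A PN PA] using PF rY sR
   by (simp add: a_minus_def F.minus_add F.a_assoc[symmetric] F.r_neg)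
 qed
 finally show ?thesis using retr_A[OF A YN] by blast
qed

text \<open>
 Modulo \<open>s\<close> the element \<open>e\<close> is an idempotent that splits \<open>R / sR\<close> into a part on which the elements of
 \<open>dens A\<close> are invertible and a part on which one of them vanishes.
\<close>

lemma splitting_idempotent:
 assumes s: "s \<in> S"
 shows "\<exists>e\<in>carrier R. \<exists>\<theta>\<in>dens A. (\<exists>c\<in>carrier R. \<theta> \<otimes> (\<one> \<ominus> e) = s \<otimes> c) &
  (\<forall>t\<in>dens A. \<exists>a\<in>carrier R. \<exists>b\<in>carrier R. e = t \<otimes> a \<oplus> s \<otimes> b)"
proof -
 note AA = submodule_closed[OF F.module_axioms free_submodule[OF A_X[OF A]]]
 have sR: "s \<in> carrier R" using s by simp
 have "u \<in> fracs A" using one_dens[OF A] by (simp add: dens_def recip_one)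
 then obtain h where h: "section_mod s u h" using section_mod_ex[OF s] by blast
 note hA = section_mod_A[OF s h]
 have B: "finite (supp h)" "supp h <= A" using hA(1) by (auto simp: free_module_mem)
 obtain \<theta> where \<theta>: "\<theta> \<in> dens A" "\<forall>x\<in>supp h. \<exists>a\<in>carrier R. \<theta> \<odot>[Q] \<epsilon> (basis_vector R x) = a \<odot>[Q] u"
  using common_den[OF A B] by blast
 then obtain \<alpha> where \<alpha>: "!!x. x \<in> supp h ==> \<alpha> x \<in> carrier R"
  "!!x. x \<in> supp h ==> \<theta> \<odot>[Q] \<epsilon> (basis_vector R x) = \<alpha> x \<odot>[Q] u" by metis
 have \<theta>S: "\<theta> \<in> S" and \<theta>R: "\<theta> \<in> carrier R" using dens_S[OF \<theta>(1)] by auto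
 \<comment> \<open>\<open>\<phi>\<close> is the linear form \<open>\<theta> \<epsilon>\<close> on the generators in the support of \<open>h\<close> and zero on the others, so that \<open>\<phi> h = \<theta>\<close>.\<close>
 define \<beta> where "\<beta> x = (if x \<in> supp h then \<alpha> x else \<zero>)" for x
 have \<beta>: "\<beta> x \<in> carrier R" for x using \<alpha>(1) by (simp add: \<beta>_def)
 define \<phi> where "\<phi> = linear_ext R A (ring_module R) \<beta>"
 have \<phi>: "linear R (free_module R A) (ring_module R) \<phi>"
  unfolding \<phi>_def by (rule linear_ext_lin[OF is_cring ring_module_module]) (simp add: \<beta>)
 hence \<phi>F: "lin R F (free_set R A) (ring_module R) \<phi>"
  unfolding lin_def by (simp add: free_module_sel)
 have \<phi>R: "\<phi> f \<in> carrier R" if "f \<in> free_set R A" for f using lin_closed[OF \<phi> that] by simp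
 have \<phi>h: "\<phi> f \<odot>[Q] u = \<theta> \<odot>[Q] \<epsilon> f" if f: "f \<in> free_set R (supp h)" for f
 proof (rule lin_eq_on_basis[OF is_cring Q _ _ _ f])
  have sub: "free_set R (supp h) <= free_set R A" by (rule free_mono[OF B(2)])
  have l: "lin R (ring_module R) (carrier R) Q (%r. r \<odot>[Q] u)"
   by (rule linI) (auto simp: Q.smult_l_distr Q.smult_assoc1)
  have l2: "linear R Q Q (%q. \<theta> \<odot>[Q] q)"
   by (rule linI) (use \<theta>R in "auto simp: Q.smult_r_distr Q.smult_assoc1[symmetric] m_comm")
  have "lin R (free_module R A) (free_set R (supp h)) Q (%f. \<phi> f \<odot>[Q] u)"
   by (rule lin_compose[OF lin_subset[OF \<phi> sub] l]) (use \<phi>R sub in auto)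
  thus "linear R (free_module R (supp h)) Q (%f. \<phi> f \<odot>[Q] u)"
   using free_lin by blast
  have "lin R F (free_set R (supp h)) Q (%f. \<theta> \<odot>[Q] \<epsilon> f)"
   by (rule lin_compose[OF lin_subset[OF \<epsilon>] l2]) (use sub A_sub[OF A] \<epsilon>_closed in auto)
  thus "linear R (free_module R (supp h)) Q (%f. \<theta> \<odot>[Q] \<epsilon> f)"
   using free_lin by blast
  fix x assume x: "x \<in> supp h"
  have "\<phi> (basis_vector R x) = \<beta> x" unfolding \<phi>_def
   by (rule linear_ext_basis[OF is_cring ring_module_module]) (use x B \<beta> in auto)
  thus "\<phi> (basis_vector R x) \<odot>[Q] u = \<theta> \<odot>[Q] \<epsilon> (basis_vector R x)" using \<alpha>(2)[OF x] x by (simp add: \<beta>_def)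
 qed
 have "h \<in> free_set R (supp h)" by (rule free_memI[OF A_sub[OF A hA(1)] subset_refl])
 from \<phi>h[OF this] have "\<phi> h \<odot>[Q] u = \<theta> \<odot>[Q] u" using hA(2) by simp
 hence \<phi>h\<theta>: "\<phi> h = \<theta>" using u_cancel[OF \<phi>R[OF hA(1)] \<theta>R] by simp
 have "recip \<theta> \<in> fracs A" using \<theta>(1) by (simp add: dens_def)
 then obtain k where k: "section_mod s (recip \<theta>) k" using section_mod_ex[OF s] by blast
 note kA = section_mod_A[OF s k]
 \<comment> \<open>Modulo \<open>s\<close>, the composite of \<open>\<phi>\<close> and the section is linear on \<open>fracs A\<close>; its value at \<open>1\<close> is \<open>\<theta>\<close>, and \<open>e\<close> is its value at \<open>1 / \<theta>\<close>, which is \<open>t\<close> times the value at \<open>1 / (\<theta> t)\<close>.\<close>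
 define e where "e = \<phi> k"
 have eR: "e \<in> carrier R" unfolding e_def by (rule \<phi>R[OF kA(1)])
 have \<phi>d: "t \<otimes> \<phi> f' \<ominus> \<phi> f = s \<otimes> \<phi> g"
  if "t \<in> carrier R" "f \<in> free_set R A" "f' \<in> free_set R A" "g \<in> free_set R A"
   "t \<odot>[F] f' \<ominus>[F] f = s \<odot>[F] g" for t f f' g
 proof -
  have "\<phi> (t \<odot>[F] f' \<ominus>[F] f) = \<phi> (t \<odot>[F] f') \<ominus>[ring_module R] \<phi> f"
   by (rule lin_minus[OF F.module_axioms ring_module_module free_submodule[OF A_X[OF A]] \<phi>F AA(6)[OF that(1,3)] that(2)])
  moreover have "\<phi> (t \<odot>[F] f') = t \<otimes> \<phi> f'" using lin_smult[OF \<phi>F that(1,3)] by simp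
  moreover have "\<phi> (s \<odot>[F] g) = s \<otimes> \<phi> g" using lin_smult[OF \<phi>F sR that(4)] by simp
  moreover have "x \<ominus>[ring_module R] y = x \<ominus> y" if "y \<in> carrier R" for x y
  proof -
   interpret RM: module R "ring_module R" by (rule ring_module_module)
   have "\<ominus>[ring_module R] y = (\<ominus> \<one>) \<otimes> y" using RM.smult_l_minus[of "\<one>" y] that by simp
   thus ?thesis using that by (simp add: a_minus_def l_minus)
  qed
  ultimately show ?thesis using that(5) \<phi>R[OF that(2)] by simp
 qed
 have "\<exists>c\<in>carrier R. \<theta> \<otimes> (\<one> \<ominus> e) = s \<otimes> c"
 proof -
  obtain g where g: "g \<in> free_set R A" "\<theta> \<odot>[F] k \<ominus>[F] h = s \<odot>[F] g"
   using section_mod_smult[OF s \<theta>R h k] \<theta>S by auto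
  have "\<theta> \<otimes> e \<ominus> \<theta> = s \<otimes> \<phi> g"
   unfolding e_def using \<phi>d[OF \<theta>R hA(1) kA(1) g] \<phi>h\<theta> by simp
  moreover have "\<theta> \<otimes> (\<one> \<ominus> e) = \<ominus> (\<theta> \<otimes> e \<ominus> \<theta>)"
   using \<theta>R eR by (simp add: a_minus_def r_distr r_minus minus_add a_comm)
  ultimately have "\<theta> \<otimes> (\<one> \<ominus> e) = s \<otimes> (\<ominus> \<phi> g)" using sR \<phi>R[OF g(1)] by (simp add: r_minus)
  thus ?thesis using \<phi>R[OF g(1)] by blast
 qed
 moreover have "\<exists>a\<in>carrier R. \<exists>b\<in>carrier R. e = t \<otimes> a \<oplus> s \<otimes> b" if t: "t \<in> dens A" for t
 proof -
  have tS: "t \<in> S" and tR: "t \<in> carrier R" using dens_S[OF t] by auto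
  have "recip (\<theta> \<otimes> t) \<in> fracs A" using A_mult[OF A \<theta>(1) t] by (simp add: dens_def)
  then obtain l where l: "section_mod s (recip (\<theta> \<otimes> t)) l" using section_mod_ex[OF s] by blast
  note lA = section_mod_A[OF s l]
  obtain g where g: "g \<in> free_set R A" "t \<odot>[F] l \<ominus>[F] k = s \<odot>[F] g"
   using section_mod_smult[OF s tR k l] recip_mult[OF \<theta>S tS] by auto
  have "t \<otimes> \<phi> l \<ominus> e = s \<otimes> \<phi> g" unfolding e_def by (rule \<phi>d[OF tR kA(1) lA(1) g])
  moreover have "e = t \<otimes> \<phi> l \<ominus> (t \<otimes> \<phi> l \<ominus> e)"
   using tR eR \<phi>R[OF lA(1)] by (simp add: a_minus_def minus_add a_assoc[symmetric] r_neg)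
  ultimately have "e = t \<otimes> \<phi> l \<ominus> s \<otimes> \<phi> g" by simp
  hence "e = t \<otimes> \<phi> l \<oplus> s \<otimes> (\<ominus> \<phi> g)" using sR \<phi>R[OF g(1)] by (simp add: a_minus_def r_minus)
  thus ?thesis using \<phi>R[OF lA(1)] \<phi>R[OF g(1)] by blast
 qed
 ultimately show ?thesis using eR \<theta>(1) by blast
qed

end

lemma admissible_Union:
 assumes "!!A. A \<in> \<C> ==> admissible A" "subset.chain UNIV \<C>" "\<C> ~= {}"
 shows "admissible (\<Union>\<C>)" and "dens (\<Union>\<C>) = (\<Union>A\<in>\<C>. dens A)"
proof -
 have "fracs (\<Union>\<C>) <= (\<Union>A\<in>\<C>. fracs A)"
 proof
  fix v assume "v \<in> fracs (\<Union>\<C>)"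
  then obtain y where y: "y \<in> free_set R (\<Union>\<C>)" "v = \<epsilon> y" by (auto simp: fracs_def)
  have fin: "finite (supp y)" "supp y <= \<Union>\<C>" using y(1) by (auto simp: free_module_mem)
  obtain A where "A \<in> \<C>" "supp y <= A"
   using finite_subset_Union_chain[OF fin assms(3,2)] by blast
  hence "y \<in> free_set R A"
   using y(1) free_module_coord[OF is_cring y(1)] by (auto simp: free_module_mem)
  thus "v \<in> (\<Union>A\<in>\<C>. fracs A)" using \<open>A \<in> \<C>\<close> y(2) by (auto simp: fracs_def)
 qed
 moreover have "fracs A <= fracs (\<Union>\<C>)" if "A \<in> \<C>" for A by (rule fracs_mono) (use that in auto)
 ultimately show d: "dens (\<Union>\<C>) = (\<Union>A\<in>\<C>. dens A)" unfolding dens_def by blast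
 have m: "s \<otimes> t \<in> dens (\<Union>\<C>)" if "s \<in> dens (\<Union>\<C>)" "t \<in> dens (\<Union>\<C>)" for s t
 proof -
  obtain A B where AB: "A \<in> \<C>" "B \<in> \<C>" "s \<in> dens A" "t \<in> dens B" using \<open>s \<in> _\<close> \<open>t \<in> _\<close> unfolding d by auto
  have "A <= B \<or> B <= A" using assms(2) AB unfolding subset.chain_def by blast
  then obtain C where "C \<in> \<C>" "s \<in> dens C" "t \<in> dens C" using AB dens_mono by blast
  hence "s \<otimes> t \<in> dens C" using assms(1)[of C] by (simp add: admissible_def)
  thus ?thesis unfolding d using \<open>C \<in> \<C>\<close> by blast
 qed
 have "A <= X" "supp (pre \<one>) <= A" "!!x. x \<in> A ==> needs x <= A" if "A \<in> \<C>" for A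
  using assms(1)[OF that] by (auto simp: admissible_def)
 note * = this
 show "admissible (\<Union>\<C>)"
  unfolding admissible_def
 proof (intro conjI ballI)
  show "\<Union>\<C> <= X" using *(1) by (rule Union_least)
  obtain A where A: "A \<in> \<C>" using assms(3) by auto
  show "supp (pre \<one>) <= \<Union>\<C>" using *(2)[OF A] A by (rule subset_trans[OF _ Union_upper])
  show "needs x <= \<Union>\<C>" if x: "x \<in> \<Union>\<C>" for x
  proof -
   obtain A where A: "A \<in> \<C>" "x \<in> A" using x by auto
   show ?thesis using *(3)[OF A] A(1) by (rule subset_trans[OF _ Union_upper])
  qed
 qed (rule m)
qed

text \<open>An element of \<open>R\<^sup>(\<^sup>A\<^sup>\<union>\<^sup>B\<^sup>)\<close> has a common denominator that is a product of one for its part over \<open>A\<close> and one for its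
part over \<open>B\<close>.\<close>

lemma dens_Un_divides:
 assumes A: "admissible A" and B: "admissible B" and t: "t \<in> dens (A \<union> B)"
 shows "\<exists>\<tau>\<in>dens A. \<exists>\<tau>'\<in>dens B. \<exists>a\<in>carrier R. \<tau> \<otimes> \<tau>' = t \<otimes> a"
proof -
 have X: "A \<union> B <= X" using A_X[OF A] A_X[OF B] by blast
 have cdI: "\<exists>\<tau>\<in>dens A. \<exists>\<tau>'\<in>dens B. \<exists>a\<in>carrier R. (\<tau> \<otimes> \<tau>') \<odot>[Q] \<epsilon> y = a \<odot>[Q] u"
  if "\<tau> \<in> dens A" "\<tau>' \<in> dens B" "a \<in> carrier R" "(\<tau> \<otimes> \<tau>') \<odot>[Q] \<epsilon> y = a \<odot>[Q] u" for y \<tau> \<tau>' a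
  using that by blast
 have cd: "\<exists>\<tau>\<in>dens A. \<exists>\<tau>'\<in>dens B. \<exists>a\<in>carrier R. (\<tau> \<otimes> \<tau>') \<odot>[Q] \<epsilon> y = a \<odot>[Q] u"
  if "y \<in> free_set R (A \<union> B)" for y
  using is_cring that
 proof (induction rule: free_module_induct)
  case zero
  show ?case
   using one_dens[OF A] one_dens[OF B]
   by (intro bexI[of _ "\<one>" "dens A"] bexI[of _ "\<one>" "dens B"] bexI[of _ "\<zero>"]) (auto simp: \<epsilon>_zero)
 next
  case (add f g)
  obtain \<tau> \<tau>' a where f: "\<tau> \<in> dens A" "\<tau>' \<in> dens B" "a \<in> carrier R" "(\<tau> \<otimes> \<tau>') \<odot>[Q] \<epsilon> f = a \<odot>[Q] u"
   using add.IH(1) by blast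
  obtain \<sigma> \<sigma>' b where g: "\<sigma> \<in> dens A" "\<sigma>' \<in> dens B" "b \<in> carrier R" "(\<sigma> \<otimes> \<sigma>') \<odot>[Q] \<epsilon> g = b \<odot>[Q] u"
   using add.IH(2) by blast
  have R: "\<tau> \<in> carrier R" "\<tau>' \<in> carrier R" "\<sigma> \<in> carrier R" "\<sigma>' \<in> carrier R"
   using f(1,2) g(1,2) dens_S by auto
  have fF: "f \<in> carrier F" "g \<in> carrier F" using add.hyps free_mono[OF X] by auto
  have "((\<tau> \<otimes> \<sigma>) \<otimes> (\<tau>' \<otimes> \<sigma>')) \<odot>[Q] \<epsilon> (f \<oplus>[free_module R (A \<union> B)] g)
    = (\<sigma> \<otimes> \<sigma>') \<odot>[Q] ((\<tau> \<otimes> \<tau>') \<odot>[Q] \<epsilon> f) \<oplus>[Q] (\<tau> \<otimes> \<tau>') \<odot>[Q] ((\<sigma> \<otimes> \<sigma>') \<odot>[Q] \<epsilon> g)"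
  proof -
   have "f \<oplus>[free_module R (A \<union> B)] g = f \<oplus>[F] g" by (simp add: free_module_sel)
   moreover have "(\<tau> \<otimes> \<sigma>) \<otimes> (\<tau>' \<otimes> \<sigma>') = (\<sigma> \<otimes> \<sigma>') \<otimes> (\<tau> \<otimes> \<tau>')" using R by (simp add: m_ac)
   moreover have "(\<sigma> \<otimes> \<sigma>') \<otimes> (\<tau> \<otimes> \<tau>') = (\<tau> \<otimes> \<tau>') \<otimes> (\<sigma> \<otimes> \<sigma>')" using R by (simp add: m_comm)
   ultimately show ?thesis
    using lin_add[OF \<epsilon> fF] R \<epsilon>_closed[OF fF(1)] \<epsilon>_closed[OF fF(2)]
    by (simp add: Q.smult_r_distr Q.smult_assoc1[symmetric])
  qed
  also have "\<dots> = ((\<sigma> \<otimes> \<sigma>') \<otimes> a \<oplus> (\<tau> \<otimes> \<tau>') \<otimes> b) \<odot>[Q] u"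
   unfolding f(4) g(4) using R f(3) g(3) by (simp add: Q.smult_l_distr Q.smult_assoc1)
  finally have eq: "((\<tau> \<otimes> \<sigma>) \<otimes> (\<tau>' \<otimes> \<sigma>')) \<odot>[Q] \<epsilon> (f \<oplus>[free_module R (A \<union> B)] g)
   = ((\<sigma> \<otimes> \<sigma>') \<otimes> a \<oplus> (\<tau> \<otimes> \<tau>') \<otimes> b) \<odot>[Q] u" .
  have c: "(\<sigma> \<otimes> \<sigma>') \<otimes> a \<oplus> (\<tau> \<otimes> \<tau>') \<otimes> b \<in> carrier R" using R f(3) g(3) by simp
  show ?case
   by (rule cdI[OF A_mult[OF A f(1) g(1)] A_mult[OF B f(2) g(2)] c eq])
 next
  case (smult r f)
  obtain \<tau> \<tau>' a where f: "\<tau> \<in> dens A" "\<tau>' \<in> dens B" "a \<in> carrier R" "(\<tau> \<otimes> \<tau>') \<odot>[Q] \<epsilon> f = a \<odot>[Q] u"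
   using smult.IH by blast
  have R: "\<tau> \<in> carrier R" "\<tau>' \<in> carrier R" using f(1,2) dens_S by auto
  have fF: "f \<in> carrier F" using smult.hyps free_mono[OF X] by auto
  have "r \<odot>[free_module R (A \<union> B)] f = r \<odot>[F] f" by (simp add: free_module_sel)
  hence "(\<tau> \<otimes> \<tau>') \<odot>[Q] \<epsilon> (r \<odot>[free_module R (A \<union> B)] f) = r \<odot>[Q] ((\<tau> \<otimes> \<tau>') \<odot>[Q] \<epsilon> f)"
   using lin_smult[OF \<epsilon> smult.hyps(1) fF] R smult.hyps(1) \<epsilon>_closed[OF fF]
   by (simp add: Q.smult_assoc1[symmetric] m_comm)
  also have "\<dots> = (r \<otimes> a) \<odot>[Q] u" unfolding f(4) using smult.hyps(1) f(3) by (simp add: Q.smult_assoc1)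
  finally have eq: "(\<tau> \<otimes> \<tau>') \<odot>[Q] \<epsilon> (r \<odot>[free_module R (A \<union> B)] f) = (r \<otimes> a) \<odot>[Q] u" .
  show ?case
   by (rule cdI[OF f(1,2) m_closed[OF smult.hyps(1) f(3)] eq])
 next
  case (basis x)
  hence x: "x \<in> X" using X by auto
  show ?case
  proof (cases "x \<in> A")
   case True
   show ?thesis
    using den_dens[OF A True] one_dens[OF B] num_R[OF x] den_\<epsilon>[OF x] den_S[OF x]
    by (intro bexI[of _ "den x" "dens A"] bexI[of _ "\<one>" "dens B"] bexI[of _ "num x"]) auto
  next
   case False
   hence xB: "x \<in> B" using basis by auto
   show ?thesis
    using den_dens[OF B xB] one_dens[OF A] num_R[OF x] den_\<epsilon>[OF x] den_S[OF x]
    by (intro bexI[of _ "\<one>" "dens A"] bexI[of _ "den x" "dens B"] bexI[of _ "num x"]) auto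
  qed
 qed
 have tS: "t \<in> S" using dens_S[OF t] .
 obtain y where y: "y \<in> free_set R (A \<union> B)" "recip t = \<epsilon> y"
  using t by (auto simp: dens_def fracs_def)
 obtain \<tau> \<tau>' a where f: "\<tau> \<in> dens A" "\<tau>' \<in> dens B" "a \<in> carrier R" "(\<tau> \<otimes> \<tau>') \<odot>[Q] recip t = a \<odot>[Q] u"
  using cd[OF y(1)] y(2) by auto
 have R: "\<tau> \<in> carrier R" "\<tau>' \<in> carrier R" using f(1,2) dens_S by auto
 have "(\<tau> \<otimes> \<tau>') \<odot>[Q] u = t \<odot>[Q] ((\<tau> \<otimes> \<tau>') \<odot>[Q] recip t)"
 proof -
  have "t \<odot>[Q] ((\<tau> \<otimes> \<tau>') \<odot>[Q] recip t) = (\<tau> \<otimes> \<tau>') \<odot>[Q] (t \<odot>[Q] recip t)"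
   using R tS by (simp only: Q.smult_assoc1[symmetric] m_comm m_closed S_closed recip_closed)
  thus ?thesis using tS by simp
 qed
 also have "\<dots> = (t \<otimes> a) \<odot>[Q] u" unfolding f(4) using tS f(3) by (simp add: Q.smult_assoc1)
 finally have "\<tau> \<otimes> \<tau>' = t \<otimes> a" using u_cancel R tS f(3) by simp
 thus ?thesis using f by blast
qed

text \<open>
 A denominator of \<open>A \<union> B\<close> divides a product \<open>s = \<tau> \<tau>'\<close> of denominators of \<open>A\<close> and of \<open>B\<close>, and \<open>1 / s\<close>
 lies in \<open>fracs A + fracs B\<close>: with \<open>e\<close> from \<open>splitting_idempotent\<close>, \<open>(1 - e) / s\<close> is killed by a denominator of \<open>A\<close>
 modulo \<open>R\<close>, and \<open>e / s\<close> is a multiple of \<open>\<tau> / s = 1 / \<tau>'\<close> modulo \<open>R\<close>.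
\<close>

lemma admissible_Un:
 assumes A: "admissible A" and B: "admissible B"
 shows "admissible (A \<union> B)"
proof -
 have X: "A \<union> B <= X" using A_X[OF A] A_X[OF B] by blast
 note V = submodule_closed[OF Q fracs_submodule[OF X]]
 have VA: "fracs A <= fracs (A \<union> B)" "fracs B <= fracs (A \<union> B)" by (rule fracs_mono, simp)+
 have key: "recip (\<tau> \<otimes> \<tau>') \<in> fracs (A \<union> B)" if \<tau>: "\<tau> \<in> dens A" "\<tau>' \<in> dens B" for \<tau> \<tau>'
 proof -
  have \<tau>S: "\<tau> \<in> S" "\<tau>' \<in> S" and \<tau>R: "\<tau> \<in> carrier R" "\<tau>' \<in> carrier R"
   using dens_S[OF \<tau>(1)] dens_S[OF \<tau>(2)] by auto
  define s where "s = \<tau> \<otimes> \<tau>'"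
  have s: "s \<in> S" and sR: "s \<in> carrier R" unfolding s_def using \<tau>S by auto
  obtain e \<theta> c where e: "e \<in> carrier R" "\<theta> \<in> dens A" "c \<in> carrier R" "\<theta> \<otimes> (\<one> \<ominus> e) = s \<otimes> c"
   and div: "\<forall>t\<in>dens A. \<exists>a\<in>carrier R. \<exists>b\<in>carrier R. e = t \<otimes> a \<oplus> s \<otimes> b"
   using splitting_idempotent[OF A s] by blast
  obtain a b where ab: "a \<in> carrier R" "b \<in> carrier R" "e = \<tau> \<otimes> a \<oplus> s \<otimes> b" using div \<tau>(1) by blast
  have \<theta>S: "\<theta> \<in> S" and \<theta>R: "\<theta> \<in> carrier R" using dens_S[OF e(2)] by auto
  have rs: "recip s \<in> carrier Q" using s by simp
  have "(\<one> \<ominus> e) \<odot>[Q] recip s = c \<odot>[Q] recip \<theta>"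
  proof (rule smult_cancel[OF \<theta>S])
   have "\<theta> \<odot>[Q] ((\<one> \<ominus> e) \<odot>[Q] recip s) = (c \<otimes> s) \<odot>[Q] recip s"
    using \<theta>R e(1,3) rs sR by (simp add: Q.smult_assoc1[symmetric] e(4) m_comm)
   also have "\<dots> = c \<odot>[Q] u" using e(3) s sR rs by (simp add: Q.smult_assoc1)
   also have "\<dots> = \<theta> \<odot>[Q] (c \<odot>[Q] recip \<theta>)"
   proof -
    have "\<theta> \<odot>[Q] (c \<odot>[Q] recip \<theta>) = c \<odot>[Q] (\<theta> \<odot>[Q] recip \<theta>)"
     using \<theta>R e(3) \<theta>S by (simp only: Q.smult_assoc1[symmetric] recip_closed m_comm)
    thus ?thesis using \<theta>S by simp
   qed
   finally show "\<theta> \<odot>[Q] ((\<one> \<ominus> e) \<odot>[Q] recip s) = \<theta> \<odot>[Q] (c \<odot>[Q] recip \<theta>)" .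
  qed (use e rs \<theta>S in auto)
  moreover have "recip \<theta> \<in> fracs A" using e(2) by (simp add: dens_def)
  ultimately have 1: "(\<one> \<ominus> e) \<odot>[Q] recip s \<in> fracs (A \<union> B)" using V(6)[OF e(3)] VA(1) by auto
  have "e \<odot>[Q] recip s = (a \<otimes> \<tau>) \<odot>[Q] recip s \<oplus>[Q] (b \<otimes> s) \<odot>[Q] recip s"
   using ab sR \<tau>R rs by (simp add: Q.smult_l_distr m_comm)
  also have "\<dots> = a \<odot>[Q] (\<tau> \<odot>[Q] recip s) \<oplus>[Q] b \<odot>[Q] (s \<odot>[Q] recip s)"
   using ab sR \<tau>R rs by (simp only: Q.smult_assoc1)
  also have "\<tau> \<odot>[Q] recip s = recip \<tau>'"
   using recip_mult[OF \<tau>S(2,1)] \<tau>R by (simp add: s_def m_comm)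
  finally have es: "e \<odot>[Q] recip s = a \<odot>[Q] recip \<tau>' \<oplus>[Q] b \<odot>[Q] u" using s by simp
  have "recip \<tau>' \<in> fracs (A \<union> B)" "u \<in> fracs (A \<union> B)"
   using \<tau>(2) one_dens[OF A] VA by (auto simp: dens_def recip_one)
  hence 2: "e \<odot>[Q] recip s \<in> fracs (A \<union> B)" unfolding es by (intro V(4) V(6) ab)
  have "recip s = (\<one> \<ominus> e) \<odot>[Q] recip s \<oplus>[Q] e \<odot>[Q] recip s"
   using e(1) rs by (simp add: Q.smult_l_distr[symmetric] minus_add_cancel)
  thus ?thesis using V(4)[OF 1 2] by (simp add: s_def)
 qed
 note div = dens_Un_divides[OF A B]
 have "s \<otimes> t \<in> dens (A \<union> B)" if s: "s \<in> dens (A \<union> B)" and t: "t \<in> dens (A \<union> B)" for s t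
 proof -
  have S: "s \<in> S" "t \<in> S" using dens_S s t by auto
  obtain \<tau> \<tau>' a where f: "\<tau> \<in> dens A" "\<tau>' \<in> dens B" "a \<in> carrier R" "\<tau> \<otimes> \<tau>' = s \<otimes> a" using div[OF s] by blast
  obtain \<sigma> \<sigma>' b where g: "\<sigma> \<in> dens A" "\<sigma>' \<in> dens B" "b \<in> carrier R" "\<sigma> \<otimes> \<sigma>' = t \<otimes> b" using div[OF t] by blast
  have R: "\<tau> \<in> carrier R" "\<tau>' \<in> carrier R" "\<sigma> \<in> carrier R" "\<sigma>' \<in> carrier R"
   using f(1,2) g(1,2) dens_S by auto
  have SS: "(\<tau> \<otimes> \<sigma>) \<otimes> (\<tau>' \<otimes> \<sigma>') \<in> S"
   using dens_S[OF A_mult[OF A f(1) g(1)]] dens_S[OF A_mult[OF B f(2) g(2)]] by simp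
  have "(\<tau> \<otimes> \<sigma>) \<otimes> (\<tau>' \<otimes> \<sigma>') = (\<tau> \<otimes> \<tau>') \<otimes> (\<sigma> \<otimes> \<sigma>')" using R by (simp add: m_ac)
  also have "\<dots> = (s \<otimes> t) \<otimes> (a \<otimes> b)" unfolding f(4) g(4) using S f(3) g(3) by (simp add: m_ac)
  finally have "recip (s \<otimes> t) = (a \<otimes> b) \<odot>[Q] recip ((\<tau> \<otimes> \<sigma>) \<otimes> (\<tau>' \<otimes> \<sigma>'))"
   by (intro recip_divides SS) (use S f(3) g(3) in auto)
  hence "recip (s \<otimes> t) \<in> fracs (A \<union> B)"
   using V(6)[OF _ key[OF A_mult[OF A f(1) g(1)] A_mult[OF B f(2) g(2)]]] f(3) g(3) by simp
  thus ?thesis using S by (simp add: dens_def)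
 qed
 moreover have "needs x <= A \<union> B" if "x \<in> A \<union> B" for x
  using that A_needs[OF A, of x] A_needs[OF B, of x] by auto
 moreover have "supp (pre \<one>) <= A \<union> B" using A_one[OF A] by auto
 ultimately show ?thesis using X unfolding admissible_def by simp
qed

end

section \<open>Gluing linear maps\<close>

lemma directed_lin:
 assumes M: "module R M" and B: "module R B" and ne: "I ~= {}"
  and D: "!!k. k \<in> I ==> submodule (D k) R M" and l: "!!k. k \<in> I ==> lin R M (D k) B (f k)"
  and dir: "!!j k. j \<in> I ==> k \<in> I ==> \<exists>m\<in>I. D j <= D m & D k <= D m & (\<forall>x\<in>D j. f m x = f j x) & (\<forall>x\<in>D k. f m x = f k x)"
 shows "\<exists>g. lin R M (\<Union>k\<in>I. D k) B g & (\<forall>k\<in>I. \<forall>x\<in>D k. g x = f k x)"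
proof -
 have agree: "f j x = f k x" if "j \<in> I" "k \<in> I" "x \<in> D j" "x \<in> D k" for j k x
  using dir[OF that(1,2)] that(3,4) by metis
 define g where "g x = f (SOME k. k \<in> I & x \<in> D k) x" for x
 have g: "g x = f k x" if k: "k \<in> I" "x \<in> D k" for k x
 proof -
  have "\<exists>k. k \<in> I & x \<in> D k" using k by auto
  from someI_ex[OF this] have *: "(SOME k. k \<in> I & x \<in> D k) \<in> I" "x \<in> D (SOME k. k \<in> I & x \<in> D k)" by auto
  show ?thesis unfolding g_def by (rule agree[OF *(1) k(1) *(2) k(2)])
 qed
 have "lin R M (\<Union>k\<in>I. D k) B g"
 proof (rule linI)
  fix x assume "x \<in> (\<Union>k\<in>I. D k)"
  then obtain j where j: "j \<in> I" "x \<in> D j" by auto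
  show "g x \<in> carrier B" using g[OF j] lin_closed[OF l[OF j(1)] j(2)] by simp
  show "g (r \<odot>[M] x) = r \<odot>[B] g x" if r: "r \<in> carrier R" for r
   using g[OF j] g[OF j(1) submodule_closed(6)[OF M D[OF j(1)] r j(2)]] lin_smult[OF l[OF j(1)] r j(2)] by simp
  fix y assume "y \<in> (\<Union>k\<in>I. D k)"
  then obtain k where k: "k \<in> I" "y \<in> D k" by auto
  obtain m where m: "m \<in> I" "x \<in> D m" "y \<in> D m" using dir[OF j(1) k(1)] j k by blast
  show "g (x \<oplus>[M] y) = g x \<oplus>[B] g y"
   using g[OF m(1,2)] g[OF m(1,3)] g[OF m(1) submodule_closed(4)[OF M D[OF m(1)] m(2,3)]]
    lin_add[OF l[OF m(1)] m(2,3)] by simp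
 qed
 thus ?thesis using g by blast
qed

lemma direct_sum_lin:
 assumes M: "module R M" and B: "module R B" and U: "submodule U R M" and V: "submodule V R M"
  and UV: "!!x. x \<in> U ==> x \<in> V ==> x = \<zero>[M]" and f: "lin R M U B f" and g: "lin R M V B g"
 shows "\<exists>h. lin R M {x \<oplus>[M] y | x y. x \<in> U & y \<in> V} B h & (\<forall>x\<in>U. \<forall>y\<in>V. h (x \<oplus>[M] y) = f x \<oplus>[B] g y)"
proof -
 interpret M: module R M by fact
 interpret B: module R B by fact
 note UU = submodule_closed[OF M U] and VV = submodule_closed[OF M V]
 have uniq: "x = x' & y = y'"
  if "x \<in> U" "y \<in> V" "x' \<in> U" "y' \<in> V" "x \<oplus>[M] y = x' \<oplus>[M] y'" for x y x' y'
 proof -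
  have c: "x \<in> carrier M" "y \<in> carrier M" "x' \<in> carrier M" "y' \<in> carrier M"
   using that UU(1) VV(1) by auto
  have "(x \<oplus>[M] y) \<ominus>[M] (x' \<oplus>[M] y') = \<zero>[M]" using that(5) c by simp
  hence "(x \<ominus>[M] x') \<oplus>[M] (y \<ominus>[M] y') = \<zero>[M]" using M.add_minus_add[OF c] by simp
  hence eq: "x \<ominus>[M] x' = y' \<ominus>[M] y"
   using c M.minus_equality[of "x \<ominus>[M] x'" "y \<ominus>[M] y'"]
   by (metis M.a_comm M.minus_add M.minus_closed M.minus_minus M.a_inv_closed a_minus_def)
  have "x \<ominus>[M] x' = \<zero>[M]"
   by (rule UV[OF UU(5)[OF that(1,3)]]) (use VV(5)[OF that(4,2)] eq in simp)
  thus ?thesis using eq c by (auto simp: M.minus_eq_zero_iff)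
 qed
 define h where "h z = (let p = SOME p. fst p \<in> U & snd p \<in> V & z = fst p \<oplus>[M] snd p in f (fst p) \<oplus>[B] g (snd p))" for z
 have h: "h (x \<oplus>[M] y) = f x \<oplus>[B] g y" if xy: "x \<in> U" "y \<in> V" for x y
 proof -
  let ?P = "%p. fst p \<in> U & snd p \<in> V & x \<oplus>[M] y = fst p \<oplus>[M] snd p"
  have "?P (x, y)" using xy by simp
  hence "?P (SOME p. ?P p)" by (rule someI)
  hence "x = fst (SOME p. ?P p) & y = snd (SOME p. ?P p)" using uniq[OF xy] by blast
  thus ?thesis unfolding h_def Let_def by simp
 qed
 have "lin R M {x \<oplus>[M] y | x y. x \<in> U & y \<in> V} B h"
 proof (rule linI)
  fix z assume "z \<in> {x \<oplus>[M] y | x y. x \<in> U & y \<in> V}"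
  then obtain x y where z: "z = x \<oplus>[M] y" "x \<in> U" "y \<in> V" by auto
  have c: "x \<in> carrier M" "y \<in> carrier M" using z UU(1) VV(1) by auto
  note fx = lin_closed[OF f z(2)] and gy = lin_closed[OF g z(3)]
  show "h z \<in> carrier B" unfolding z(1) h[OF z(2,3)] using fx gy by simp
  show "h (r \<odot>[M] z) = r \<odot>[B] h z" if r: "r \<in> carrier R" for r
   unfolding z(1) h[OF z(2,3)] M.smult_r_distr[OF r c] h[OF UU(6)[OF r z(2)] VV(6)[OF r z(3)]]
    lin_smult[OF f r z(2)] lin_smult[OF g r z(3)] using r fx gy by (simp add: B.smult_r_distr)
  fix z' assume "z' \<in> {x \<oplus>[M] y | x y. x \<in> U & y \<in> V}"
  then obtain x' y' where z': "z' = x' \<oplus>[M] y'" "x' \<in> U" "y' \<in> V" by auto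
  have c': "x' \<in> carrier M" "y' \<in> carrier M" using z' UU(1) VV(1) by auto
  note fx' = lin_closed[OF f z'(2)] and gy' = lin_closed[OF g z'(3)]
  have "z \<oplus>[M] z' = (x \<oplus>[M] x') \<oplus>[M] (y \<oplus>[M] y')" unfolding z(1) z'(1) using c c' by (simp add: M.a_ac)
  hence "h (z \<oplus>[M] z') = f (x \<oplus>[M] x') \<oplus>[B] g (y \<oplus>[M] y')"
   using h[OF UU(4)[OF z(2) z'(2)] VV(4)[OF z(3) z'(3)]] by simp
  thus "h (z \<oplus>[M] z') = h z \<oplus>[B] h z'"
   unfolding z(1) z'(1) h[OF z(2,3)] h[OF z'(2,3)] lin_add[OF f z(2) z'(2)] lin_add[OF g z(3) z'(3)]
   using fx gy fx' gy' by (simp add: B.a_ac)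
 qed
 thus ?thesis using h by blast
qed

context presented_fractions
begin

lemma fracs_X: "fracs X = carrier Q"
 by (simp add: fracs_def \<epsilon>_surj)

lemma dens_X: "dens X = S"
 by (auto simp: dens_def fracs_X)

lemma admissible_X: "admissible X"
 unfolding admissible_def dens_X
proof (intro conjI ballI)
 show "supp (pre \<one>) <= X" by (rule free_supp[OF pre_closed]) simp
 show "needs x <= X" if x: "x \<in> X" for x
 proof -
  have "supp (pre (den x)) <= X" by (rule free_supp[OF pre_closed[OF den_S[OF x]]])
  moreover have "supp n <= X" if "n \<in> supp (i (rel x))" for n
  proof -
   have "n \<in> N" using free_supp[OF lin_closed[OF i_lin rel_N[OF x]]] that by (rule subsetD)
   hence "n \<in> carrier F" by simp
   thus ?thesis by (rule free_supp)
  qed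
  ultimately show ?thesis unfolding needs_def by (intro Un_least UN_least)
 qed
qed simp_all

lemma needs_finite:
 assumes x: "x \<in> X"
 shows "finite (needs x)"
proof -
 have "finite (supp (pre (den x)))" using pre_closed[OF den_S[OF x]] by (simp add: free_module_mem)
 moreover have ii: "i (rel x) \<in> free_set R N" by (rule lin_closed[OF i_lin rel_N[OF x]])
 hence "finite (supp (i (rel x)))" by (simp add: free_module_mem)
 moreover have "finite (supp n)" if "n \<in> supp (i (rel x))" for n
 proof -
  have "n \<in> N" using free_supp[OF ii] that by (rule subsetD)
  thus ?thesis by (simp add: free_module_mem)
 qed
 ultimately show ?thesis unfolding needs_def by blast
qed

lemma pre_finite: "s \<in> S ==> finite (supp (pre s))"
 using pre_closed[of s] by (simp add: free_module_mem)

definition cden :: "'x set => 'a" where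
 "cden B = (SOME d. d \<in> S & (\<forall>x\<in>B. \<exists>a\<in>carrier R. d \<odot>[Q] \<epsilon> (basis_vector R x) = a \<odot>[Q] u))"

lemma cden:
 assumes "finite B" "B <= X"
 shows "cden B \<in> S" and "\<forall>x\<in>B. \<exists>a\<in>carrier R. cden B \<odot>[Q] \<epsilon> (basis_vector R x) = a \<odot>[Q] u"
proof -
 have "\<exists>d. d \<in> S & (\<forall>x\<in>B. \<exists>a\<in>carrier R. d \<odot>[Q] \<epsilon> (basis_vector R x) = a \<odot>[Q] u)"
  using common_den[OF admissible_X assms] unfolding dens_X by blast
 from someI_ex[OF this] show "cden B \<in> S"
  "\<forall>x\<in>B. \<exists>a\<in>carrier R. cden B \<odot>[Q] \<epsilon> (basis_vector R x) = a \<odot>[Q] u" unfolding cden_def by blast+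
qed

lemma multiple_in_R:
 assumes B: "B <= X" and d: "d \<in> carrier R" "\<forall>x\<in>B. \<exists>a\<in>carrier R. d \<odot>[Q] \<epsilon> (basis_vector R x) = a \<odot>[Q] u"
  and y: "y \<in> free_set R B"
 shows "\<exists>a\<in>carrier R. d \<odot>[Q] \<epsilon> y = a \<odot>[Q] u"
 using is_cring y
proof (induction rule: free_module_induct)
 case zero
 thus ?case using d(1) by (intro bexI[of _ "\<zero>"]) (auto simp: \<epsilon>_zero)
next
 case (add f g)
 have F: "f \<in> carrier F" "g \<in> carrier F" using add.hyps free_mono[OF B] by auto
 obtain a b where ab: "a \<in> carrier R" "b \<in> carrier R" "d \<odot>[Q] \<epsilon> f = a \<odot>[Q] u" "d \<odot>[Q] \<epsilon> g = b \<odot>[Q] u"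
  using add.IH by auto
 have "f \<oplus>[free_module R B] g = f \<oplus>[F] g" by (simp add: free_module_sel)
 hence "d \<odot>[Q] \<epsilon> (f \<oplus>[free_module R B] g) = (a \<oplus> b) \<odot>[Q] u"
  using lin_add[OF \<epsilon> F] d(1) ab \<epsilon>_closed[OF F(1)] \<epsilon>_closed[OF F(2)] by (simp add: Q.smult_r_distr Q.smult_l_distr)
 thus ?case using ab a_closed by blast
next
 case (smult r f)
 have F: "f \<in> carrier F" using smult.hyps free_mono[OF B] by auto
 obtain a where a: "a \<in> carrier R" "d \<odot>[Q] \<epsilon> f = a \<odot>[Q] u" using smult.IH by auto
 have "r \<odot>[free_module R B] f = r \<odot>[F] f" by (simp add: free_module_sel)
 hence "d \<odot>[Q] \<epsilon> (r \<odot>[free_module R B] f) = r \<odot>[Q] (d \<odot>[Q] \<epsilon> f)"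
  using lin_smult[OF \<epsilon> smult.hyps(1) F] d(1) smult.hyps(1) \<epsilon>_closed[OF F]
  by (simp add: Q.smult_assoc1[symmetric] m_comm)
 hence "d \<odot>[Q] \<epsilon> (r \<odot>[free_module R B] f) = (r \<otimes> a) \<odot>[Q] u" using a smult.hyps(1) by (simp add: Q.smult_assoc1)
 thus ?case using a smult.hyps(1) m_closed by blast
next
 case (basis x)
 thus ?case using d(2) by blast
qed

text \<open>
 Putting the generators needed for \<open>1 / \<tau>\<^sub>n\<^sup>2\<close> into the next step makes the union multiplicatively
 closed, because any two denominators divide some \<open>\<tau>\<^sub>n\<close>.
\<close>

lemma countable_admissible:
 assumes s: "s \<in> S"
 shows "\<exists>A \<tau>. admissible A & s \<in> dens A & (\<forall>n::nat. \<tau> n \<in> dens A) &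
  (\<forall>n. \<exists>c\<in>S. \<tau> (Suc n) = \<tau> n \<otimes> c) & (\<forall>t\<in>dens A. \<exists>n. \<exists>a\<in>carrier R. \<tau> n = t \<otimes> a)"
proof -
 define A0 where "A0 = supp (pre \<one>) \<union> supp (pre s)"
 define nx where "nx A t = A \<union> (\<Union>x\<in>A. needs x) \<union> supp (pre (t \<otimes> t))" for A t
 define st where "st = rec_nat (A0, cden A0) (%_ (A, t). (nx A t, t \<otimes> cden (nx A t)))"
 define A where "A n = fst (st n)" for n
 define \<tau> where "\<tau> n = snd (st n)" for n
 have st0: "A 0 = A0" "\<tau> 0 = cden A0" by (simp_all add: A_def \<tau>_def st_def)
 have stS: "A (Suc n) = nx (A n) (\<tau> n)" "\<tau> (Suc n) = \<tau> n \<otimes> cden (A (Suc n))" for n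
  by (simp_all add: A_def \<tau>_def st_def split: prod.split)
 have nxf: "finite (nx B t)" "nx B t <= X" if "finite B" "B <= X" "t \<in> S" for B t
 proof -
  show "finite (nx B t)" unfolding nx_def using that needs_finite pre_finite[of "t \<otimes> t"] by auto
  have "supp (pre (t \<otimes> t)) <= X" by (rule free_supp[OF pre_closed]) (use that in simp)
  thus "nx B t <= X" unfolding nx_def using that(2) A_needs[OF admissible_X] by blast
 qed
 have A0: "finite A0" "A0 <= X"
  unfolding A0_def using pre_finite[OF s] pre_finite[of "\<one>"] free_supp[OF pre_closed[OF s]] free_supp[OF pre_closed[of "\<one>"]]
  by auto
 have inv: "finite (A n) & A n <= X & \<tau> n \<in> S" for n
 proof (induction n)
  case 0
  thus ?case using A0 cden(1)[OF A0] by (simp add: st0)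
 next
  case (Suc n)
  hence "finite (A (Suc n))" "A (Suc n) <= X" unfolding stS(1) using nxf by auto
  thus ?case using cden(1)[of "A (Suc n)"] Suc by (simp add: stS(2))
 qed
 have \<tau>S: "\<tau> n \<in> S" and \<tau>R: "\<tau> n \<in> carrier R" for n using inv[of n] by auto
 have good: "\<forall>x\<in>A n. \<exists>a\<in>carrier R. \<tau> n \<odot>[Q] \<epsilon> (basis_vector R x) = a \<odot>[Q] u" for n
 proof (cases n)
  case 0
  thus ?thesis using cden(2)[OF A0] by (simp add: st0)
 next
  case (Suc m)
  have AS: "finite (A (Suc m))" "A (Suc m) <= X" using inv[of "Suc m"] by auto
  show ?thesis
  proof
   fix x assume x: "x \<in> A n"
   then obtain a where a: "a \<in> carrier R" "cden (A (Suc m)) \<odot>[Q] \<epsilon> (basis_vector R x) = a \<odot>[Q] u"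
    using cden(2)[OF AS] unfolding Suc by blast
   have xX: "x \<in> X" using x AS(2) unfolding Suc by auto
   have "\<tau> n \<odot>[Q] \<epsilon> (basis_vector R x) = (\<tau> m \<otimes> a) \<odot>[Q] u"
    unfolding Suc stS(2) using a \<tau>R[of m] cden(1)[OF AS] \<epsilon>_closed[OF basis_vector_closed[OF is_cring xX]]
    by (simp add: Q.smult_assoc1)
   thus "\<exists>a\<in>carrier R. \<tau> n \<odot>[Q] \<epsilon> (basis_vector R x) = a \<odot>[Q] u" using \<tau>R[of m] a(1) m_closed by blast
  qed
 qed
 have step: "A n <= A (Suc n)" for n unfolding stS(1) nx_def by auto
 have mono: "A m <= A n" if "m \<le> n" for m n using lift_Suc_mono_le[of A, OF step that] .
 define AA where "AA = (\<Union>n. A n)"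
 have AX: "AA <= X" unfolding AA_def using inv by auto
 have divides: "\<exists>a\<in>carrier R. \<tau> n = t \<otimes> a" if t: "t \<in> S" and y: "y \<in> free_set R (A n)" "recip t = \<epsilon> y" for t n y
 proof -
  have "\<exists>a\<in>carrier R. \<tau> n \<odot>[Q] \<epsilon> y = a \<odot>[Q] u"
   by (rule multiple_in_R[OF _ \<tau>R good y(1)]) (use inv in blast)
  then obtain a where a: "a \<in> carrier R" "\<tau> n \<odot>[Q] recip t = a \<odot>[Q] u" using y(2) by auto
  have "\<tau> n \<odot>[Q] u = t \<odot>[Q] (\<tau> n \<odot>[Q] recip t)"
  proof -
   have "t \<odot>[Q] (\<tau> n \<odot>[Q] recip t) = \<tau> n \<odot>[Q] (t \<odot>[Q] recip t)"
    using \<tau>R t by (simp only: Q.smult_assoc1[symmetric] m_comm S_closed recip_closed)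
   thus ?thesis using t by simp
  qed
  also have "\<dots> = (t \<otimes> a) \<odot>[Q] u" unfolding a(2) using a(1) t by (simp add: Q.smult_assoc1)
  finally have "\<tau> n = t \<otimes> a" using u_cancel \<tau>R t a(1) by simp
  thus ?thesis using a(1) by blast
 qed
 have stage: "\<exists>n. y \<in> free_set R (A n)" if y: "y \<in> free_set R AA" for y
 proof -
  have fin: "\<exists>n. B <= A n" if "finite B" "B <= AA" for B
   using that
  proof (induction B)
   case (insert x B)
   then obtain n m where "B <= A n" "x \<in> A m" by (auto simp: AA_def)
   hence "insert x B <= A (max m n)" using mono[of n "max m n"] mono[of m "max m n"] by auto
   thus ?case by (rule exI)
  qed simp
  have "finite (supp y)" "supp y <= AA" using y by (auto simp: free_module_mem)
  then obtain n where "supp y <= A n" using fin by blast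
  hence "y \<in> free_set R (A n)"
   using y free_module_coord[OF is_cring y] by (auto simp: free_module_mem)
  thus ?thesis by (rule exI)
 qed
 have dens_stage: "\<exists>n. \<exists>y\<in>free_set R (A n). recip t = \<epsilon> y" if "t \<in> dens AA" for t
 proof -
  obtain y where y: "y \<in> free_set R AA" "recip t = \<epsilon> y"
   using \<open>t \<in> dens AA\<close> by (auto simp: dens_def fracs_def)
  thus ?thesis using stage[OF y(1)] by blast
 qed
 have sq: "recip (\<tau> n \<otimes> \<tau> n) \<in> fracs AA" for n
 proof (rule pre_fracs)
  have "supp (pre (\<tau> n \<otimes> \<tau> n)) <= A (Suc n)" unfolding stS(1) nx_def by auto
  thus "supp (pre (\<tau> n \<otimes> \<tau> n)) <= AA" unfolding AA_def by auto
 qed (use \<tau>S in simp)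
 note fr = submodule_closed(6)[OF Q fracs_submodule[OF AX]]
 have \<tau>d: "\<tau> n \<in> dens AA" for n
  using fr[OF \<tau>R[of n] sq[of n]] recip_mult[OF \<tau>S \<tau>S, of n n] \<tau>S[of n] by (simp add: dens_def)
 have A0AA: "A0 <= AA" using st0(1) unfolding AA_def by auto
 have sd: "s \<in> dens AA"
  using pre_fracs[OF s, of AA] A0AA s by (auto simp: dens_def A0_def)
 have cof: "\<exists>n. \<exists>a\<in>carrier R. \<tau> n = t \<otimes> a" if t: "t \<in> dens AA" for t
  using dens_stage[OF t] divides[OF dens_S[OF t]] by blast
 have prod: "t \<otimes> t' \<in> dens AA" if t: "t \<in> dens AA" and t': "t' \<in> dens AA" for t t'
 proof -
  obtain n y where n: "y \<in> free_set R (A n)" "recip t = \<epsilon> y" using dens_stage[OF t] by blast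
  obtain n' y' where n': "y' \<in> free_set R (A n')" "recip t' = \<epsilon> y'" using dens_stage[OF t'] by blast
  define m where "m = max n n'"
  have "y \<in> free_set R (A m)" "y' \<in> free_set R (A m)"
   using n(1) n'(1) free_mono[OF mono[of n m]] free_mono[OF mono[of n' m]] by (auto simp: m_def)
  then obtain a a' where aa: "a \<in> carrier R" "\<tau> m = t \<otimes> a" "a' \<in> carrier R" "\<tau> m = t' \<otimes> a'"
   using divides[OF dens_S[OF t] _ n(2)] divides[OF dens_S[OF t'] _ n'(2)] by blast
  have R: "t \<in> carrier R" "t' \<in> carrier R" using dens_S t t' by auto
  have "\<tau> m \<otimes> \<tau> m = (t \<otimes> a) \<otimes> (t' \<otimes> a')" using aa by simp
  also have "\<dots> = (t \<otimes> t') \<otimes> (a \<otimes> a')" using aa(1,3) R by (simp add: m_ac)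
  finally have "\<tau> m \<otimes> \<tau> m = (t \<otimes> t') \<otimes> (a \<otimes> a')" .
  hence "recip (t \<otimes> t') = (a \<otimes> a') \<odot>[Q] recip (\<tau> m \<otimes> \<tau> m)"
   by (rule recip_divides[OF S_mult[OF \<tau>S \<tau>S] S_mult[OF dens_S[OF t] dens_S[OF t']] m_closed[OF aa(1,3)]])
  thus ?thesis using fr[OF m_closed[OF aa(1,3)] sq] dens_S[OF t] dens_S[OF t'] by (simp add: dens_def)
 qed
 have nd: "needs x <= AA" if x: "x \<in> AA" for x
 proof -
  obtain n where "x \<in> A n" using x by (auto simp: AA_def)
  hence "needs x <= A (Suc n)" unfolding stS(1) nx_def by auto
  thus ?thesis unfolding AA_def by auto
 qed
 have adm: "admissible AA"
  unfolding admissible_def using AX A0AA nd prod by (simp add: A0_def)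
 have "\<exists>c\<in>S. \<tau> (Suc n) = \<tau> n \<otimes> c" for n
  using cden(1)[of "A (Suc n)"] inv[of "Suc n"] stS(2)[of n] by blast
 thus ?thesis using adm sd \<tau>d cof by (intro exI[of _ AA] exI[of _ \<tau>]) simp
qed

section \<open>Splitting surjections between torsion modules\<close>

context
 fixes B :: "('a, 'b) module" and M :: "('a, 'm) module" and p
 assumes B: "module R B" and M: "module R M" and p: "linear R B M p"
begin

interpretation B: module R B by (rule B)
interpretation M: module R M by (rule M)

definition kill :: "'a => 'm set" where "kill t = {m \<in> carrier M. t \<odot>[M] m = \<zero>[M]}"

definition tor :: "'x set => 'm set" where "tor A = {m \<in> carrier M. \<exists>t\<in>dens A. t \<odot>[M] m = \<zero>[M]}"

definition splits :: "'m set => ('m => 'b) => bool" where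
 "splits D \<sigma> \<longleftrightarrow> lin R M D B \<sigma> & (\<forall>m\<in>D. p (\<sigma> m) = m)"

lemma kill_submodule:
 assumes "t \<in> carrier R"
 shows "submodule (kill t) R M"
 by (rule submoduleI'[OF M])
  (use assms in \<open>auto simp: kill_def M.smult_r_distr M.smult_assoc1[symmetric] m_comm\<close>,
   simp add: M.smult_assoc1)

lemma tor_submodule:
 assumes A: "admissible A"
 shows "submodule (tor A) R M"
proof (rule submoduleI'[OF M])
 show "tor A <= carrier M" by (auto simp: tor_def)
 show "\<zero>[M] \<in> tor A" using one_dens[OF A] by (auto simp: tor_def intro!: bexI[of _ "\<one>"])
 show "x \<oplus>[M] y \<in> tor A" if xy: "x \<in> tor A" "y \<in> tor A" for x y
 proof -
  obtain s t where st: "s \<in> dens A" "s \<odot>[M] x = \<zero>[M]" "t \<in> dens A" "t \<odot>[M] y = \<zero>[M]"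
   using xy by (auto simp: tor_def)
  have R: "s \<in> carrier R" "t \<in> carrier R" using st dens_S by auto
  have c: "x \<in> carrier M" "y \<in> carrier M" using xy by (auto simp: tor_def)
  have "(s \<otimes> t) \<odot>[M] (x \<oplus>[M] y) = t \<odot>[M] (s \<odot>[M] x) \<oplus>[M] s \<odot>[M] (t \<odot>[M] y)"
   using R c by (simp add: M.smult_r_distr M.smult_assoc1[symmetric] m_comm)
  hence "(s \<otimes> t) \<odot>[M] (x \<oplus>[M] y) = \<zero>[M]" using st R by simp
  thus ?thesis using A_mult[OF A st(1,3)] c by (auto simp: tor_def)
 qed
 show "r \<odot>[M] x \<in> tor A" if r: "r \<in> carrier R" and x: "x \<in> tor A" for r x
 proof -
  obtain s where s: "s \<in> dens A" "s \<odot>[M] x = \<zero>[M]" "x \<in> carrier M" using x by (auto simp: tor_def)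
  have R: "s \<in> carrier R" using s dens_S by auto
  have "s \<odot>[M] (r \<odot>[M] x) = r \<odot>[M] (s \<odot>[M] x)" using R r s(3) by (simp add: M.smult_assoc1[symmetric] m_comm)
  hence "s \<odot>[M] (r \<odot>[M] x) = \<zero>[M]" using s(2) r by simp
  thus ?thesis using s(1,3) r by (auto simp: tor_def)
 qed
qed

context
 assumes torsion: "!!m. m \<in> carrier M ==> \<exists>s\<in>S. s \<odot>[M] m = \<zero>[M]"
  and ext: "!!s t \<sigma>. s \<in> S ==> t \<in> S ==> splits (kill s) \<sigma> ==>
   \<exists>\<sigma>'. splits (kill (s \<otimes> t)) \<sigma>' & (\<forall>m\<in>kill s. \<sigma>' m = \<sigma> m)"
begin

text \<open>Along a sequence of successively divisible denominators the section is extended step by step.\<close>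

lemma countable_splits:
 assumes \<tau>S: "!!n::nat. \<tau> n \<in> S" and step: "!!n. \<exists>c\<in>S. \<tau> (Suc n) = \<tau> n \<otimes> c"
 shows "\<exists>\<sigma>. splits (\<Union>n. kill (\<tau> n)) \<sigma>"
proof -
 have k1: "kill \<one> = {\<zero>[M]}" by (auto simp: kill_def)
 have p0: "p \<zero>[B] = \<zero>[M]" by (rule lin_zero[OF B M carrier_submodule[OF B] p])
 have "splits (kill \<one>) (%m. \<zero>[B])" unfolding k1 splits_def lin_def using p0 by auto
 from ext[OF S_one \<tau>S[of 0] this] obtain \<sigma>0 where "splits (kill (\<one> \<otimes> \<tau> 0)) \<sigma>0" by blast
 hence \<sigma>0: "splits (kill (\<tau> 0)) \<sigma>0" using \<tau>S[of 0] by simp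
 have "\<exists>\<sigma>. \<forall>n. splits (kill (\<tau> n)) (\<sigma> n) & (\<forall>m\<in>kill (\<tau> n). \<sigma> (Suc n) m = \<sigma> n m)"
 proof (rule dependent_nat_choice)
  show "\<exists>\<sigma>. splits (kill (\<tau> 0)) \<sigma>" by (rule exI[of _ \<sigma>0]) (rule \<sigma>0)
  show "\<exists>\<sigma>'. splits (kill (\<tau> (Suc n))) \<sigma>' & (\<forall>m\<in>kill (\<tau> n). \<sigma>' m = \<sigma> m)"
   if "splits (kill (\<tau> n)) \<sigma>" for \<sigma> n
  proof -
   obtain c where c: "c \<in> S" "\<tau> (Suc n) = \<tau> n \<otimes> c" using step by blast
   show ?thesis unfolding c(2) by (rule ext[OF \<tau>S c(1) that])
  qed
 qed
 then obtain \<sigma> where \<sigma>: "!!n. splits (kill (\<tau> n)) (\<sigma> n)" "!!n m. m \<in> kill (\<tau> n) ==> \<sigma> (Suc n) m = \<sigma> n m" by blast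
 have ks: "kill (\<tau> n) <= kill (\<tau> (Suc n))" for n
 proof
  fix m assume m: "m \<in> kill (\<tau> n)"
  obtain c where c: "c \<in> S" "\<tau> (Suc n) = \<tau> n \<otimes> c" using step by blast
  have mc: "m \<in> carrier M" using m by (simp add: kill_def)
  have "(\<tau> n \<otimes> c) \<odot>[M] m = c \<odot>[M] (\<tau> n \<odot>[M] m)"
   using mc c(1) \<tau>S[of n] by (simp add: M.smult_assoc1[symmetric] m_comm)
  thus "m \<in> kill (\<tau> (Suc n))" using m c by (simp add: kill_def)
 qed
 have mono: "kill (\<tau> j) <= kill (\<tau> k)" if "j \<le> k" for j k
  using lift_Suc_mono_le[of "%n. kill (\<tau> n)", OF ks that] .
 have agree: "\<sigma> (j + k) m = \<sigma> j m" if "m \<in> kill (\<tau> j)" for j k m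
  using that
 proof (induction k)
  case (Suc k)
  hence "m \<in> kill (\<tau> (j + k))" using mono[of j "j + k"] by auto
  thus ?case using \<sigma>(2) Suc by simp
 qed simp
 have "\<exists>g. lin R M (\<Union>n\<in>UNIV. kill (\<tau> n)) B g & (\<forall>n\<in>UNIV. \<forall>x\<in>kill (\<tau> n). g x = \<sigma> n x)"
 proof (rule directed_lin[OF M B])
  show "submodule (kill (\<tau> k)) R M" for k using \<tau>S by (intro kill_submodule) simp
  show "lin R M (kill (\<tau> k)) B (\<sigma> k)" for k using \<sigma>(1) by (simp add: splits_def)
  show "\<exists>m\<in>UNIV. kill (\<tau> j) <= kill (\<tau> m) & kill (\<tau> k) <= kill (\<tau> m) & (\<forall>x\<in>kill (\<tau> j). \<sigma> m x = \<sigma> j x) & (\<forall>x\<in>kill (\<tau> k). \<sigma> m x = \<sigma> k x)"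
   for j k
   using mono[of j "j + k"] mono[of k "j + k"] agree[of _ j k] agree[of _ k j]
   by (intro bexI[of _ "j + k"] conjI ballI) (auto simp: add.commute)
 qed simp
 then obtain g where g: "lin R M (\<Union>n. kill (\<tau> n)) B g" "!!n x. x \<in> kill (\<tau> n) ==> g x = \<sigma> n x" by auto
 have "\<forall>m\<in>(\<Union>n. kill (\<tau> n)). p (g m) = m" using g(2) \<sigma>(1) by (auto simp: splits_def)
 thus ?thesis using g(1) unfolding splits_def by blast
qed

text \<open>The elements that are divisible by every denominator of \<open>A\<close> within the submodule they generate.\<close>

definition divis :: "'x set => 'm set" where
 "divis A = {m \<in> carrier M. \<forall>t\<in>dens A. \<exists>a\<in>carrier R. (t \<otimes> a) \<odot>[M] m = m}"

lemma divis_submodule: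
 assumes A: "admissible A"
 shows "submodule (divis A) R M"
proof (rule submoduleI'[OF M])
 show "divis A <= carrier M" by (auto simp: divis_def)
 show "\<zero>[M] \<in> divis A" using dens_S[of _ A] by (auto simp: divis_def intro!: bexI[of _ "\<one>"])
 show "x \<oplus>[M] y \<in> divis A" if xy: "x \<in> divis A" "y \<in> divis A" for x y
 proof -
  have c: "x \<in> carrier M" "y \<in> carrier M" using xy by (auto simp: divis_def)
  have "\<exists>a\<in>carrier R. (t \<otimes> a) \<odot>[M] (x \<oplus>[M] y) = x \<oplus>[M] y" if t: "t \<in> dens A" for t
  proof -
   have tR: "t \<in> carrier R" using dens_S[OF t] by simp
   obtain a where a: "a \<in> carrier R" "(t \<otimes> a) \<odot>[M] x = x" using xy(1) t by (auto simp: divis_def)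
   obtain b where b: "b \<in> carrier R" "(t \<otimes> b) \<odot>[M] y = y" using xy(2) t by (auto simp: divis_def)
   note ab = a b
   have ta: "t \<otimes> a \<in> carrier R" "t \<otimes> b \<in> carrier R" using tR ab by auto
   define k where "k = a \<oplus> b \<ominus> a \<otimes> (t \<otimes> b)"
   have kR: "k \<in> carrier R" using tR ab by (simp add: k_def)
   have tk: "t \<otimes> k = t \<otimes> a \<oplus> t \<otimes> b \<ominus> (t \<otimes> a) \<otimes> (t \<otimes> b)"
    using tR ab by (simp add: k_def a_minus_def r_distr r_minus m_assoc)
   have px: "((t \<otimes> a) \<otimes> (t \<otimes> b)) \<odot>[M] x = (t \<otimes> b) \<odot>[M] x"
    using ta c ab by (simp add: m_comm[of "t \<otimes> a" "t \<otimes> b"] M.smult_assoc1)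
   have py: "((t \<otimes> a) \<otimes> (t \<otimes> b)) \<odot>[M] y = (t \<otimes> a) \<odot>[M] y"
    using ta c ab by (simp add: M.smult_assoc1)
   have "(t \<otimes> k) \<odot>[M] x = x \<oplus>[M] (t \<otimes> b) \<odot>[M] x \<ominus>[M] (t \<otimes> b) \<odot>[M] x"
    unfolding tk using ta c ab px by (simp add: M.minus_smult M.smult_l_distr)
   hence kx: "(t \<otimes> k) \<odot>[M] x = x" using ta c by (simp add: a_minus_def M.a_assoc M.r_neg)
   have "(t \<otimes> k) \<odot>[M] y = (t \<otimes> a) \<odot>[M] y \<oplus>[M] y \<ominus>[M] (t \<otimes> a) \<odot>[M] y"
    unfolding tk using ta c ab py by (simp add: M.minus_smult M.smult_l_distr)
   hence ky: "(t \<otimes> k) \<odot>[M] y = y"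
    using ta c by (simp add: a_minus_def M.a_comm[of "(t \<otimes> a) \<odot>[M] y" y] M.a_assoc M.r_neg)
   have "(t \<otimes> k) \<odot>[M] (x \<oplus>[M] y) = x \<oplus>[M] y"
    using M.smult_r_distr[of "t \<otimes> k" x y] kx ky tR kR c by simp
   thus ?thesis using kR by blast
  qed
  thus ?thesis using c by (simp add: divis_def)
 qed
 show "r \<odot>[M] x \<in> divis A" if r: "r \<in> carrier R" and x: "x \<in> divis A" for r x
 proof -
  have c: "x \<in> carrier M" using x by (auto simp: divis_def)
  have "\<exists>a\<in>carrier R. (t \<otimes> a) \<odot>[M] (r \<odot>[M] x) = r \<odot>[M] x" if t: "t \<in> dens A" for t
  proof -
   have tR: "t \<in> carrier R" using dens_S[OF t] by simp
   obtain a where a: "a \<in> carrier R" "(t \<otimes> a) \<odot>[M] x = x" using x t by (auto simp: divis_def)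
   have "(t \<otimes> a) \<odot>[M] (r \<odot>[M] x) = r \<odot>[M] ((t \<otimes> a) \<odot>[M] x)"
    using tR a(1) r c M.smult_assoc1[of "t \<otimes> a" r x] M.smult_assoc1[of r "t \<otimes> a" x] m_comm[of "t \<otimes> a" r] by simp
   thus ?thesis using a by auto
  qed
  thus ?thesis using r c by (simp add: divis_def)
 qed
qed

lemma tor_divis:
 assumes "m \<in> tor A" "m \<in> divis A"
 shows "m = \<zero>[M]"
proof -
 obtain t where t: "t \<in> dens A" "t \<odot>[M] m = \<zero>[M]" "m \<in> carrier M" using assms(1) by (auto simp: tor_def)
 have tR: "t \<in> carrier R" using dens_S[OF t(1)] by simp
 obtain a where a: "a \<in> carrier R" "(t \<otimes> a) \<odot>[M] m = m" using assms(2) t(1) by (auto simp: divis_def)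
 have "(t \<otimes> a) \<odot>[M] m = a \<odot>[M] (t \<odot>[M] m)" using tR a(1) t(3) by (simp add: M.smult_assoc1[symmetric] m_comm)
 thus ?thesis using a t by simp
qed

text \<open>The idempotent \<open>e\<close> modulo \<open>t\<close> splits \<open>m\<close> into \<open>(1 - e) m\<close>, which a denominator of \<open>A\<close> kills, and \<open>e m\<close>, on which the
denominators of \<open>A\<close> are invertible; if \<open>\<tau> \<tau>'\<close> kills \<open>e m\<close>, then already \<open>\<tau>'\<close> does.\<close>

lemma tor_Un:
 assumes A: "admissible A" and C: "admissible C" and m: "m \<in> tor (A \<union> C)"
 shows "\<exists>x\<in>tor A. \<exists>y\<in>divis A \<inter> tor C. m = x \<oplus>[M] y"
proof -
 obtain t where t: "t \<in> dens (A \<union> C)" "t \<odot>[M] m = \<zero>[M]" and mc: "m \<in> carrier M" using m by (auto simp: tor_def)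
 have s: "t \<in> S" and sR: "t \<in> carrier R" using dens_S[OF t(1)] by auto
 obtain \<tau> \<tau>' r where \<tau>: "\<tau> \<in> dens A" "\<tau>' \<in> dens C" "r \<in> carrier R" "\<tau> \<otimes> \<tau>' = t \<otimes> r"
  using dens_Un_divides[OF A C t(1)] by blast
 have \<tau>R: "\<tau> \<in> carrier R" "\<tau>' \<in> carrier R" using dens_S[OF \<tau>(1)] dens_S[OF \<tau>(2)] by auto
 obtain e \<theta> c where e: "e \<in> carrier R" "\<theta> \<in> dens A" "c \<in> carrier R" "\<theta> \<otimes> (\<one> \<ominus> e) = t \<otimes> c"
  and div: "\<forall>q\<in>dens A. \<exists>a\<in>carrier R. \<exists>b\<in>carrier R. e = q \<otimes> a \<oplus> t \<otimes> b"
  using splitting_idempotent[OF A s] by blast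
 have \<theta>R: "\<theta> \<in> carrier R" using dens_S[OF e(2)] by simp
 have fR: "\<one> \<ominus> e \<in> carrier R" using e(1) by simp
 have tk: "(t \<otimes> k) \<odot>[M] m = \<zero>[M]" "(t \<otimes> k) \<odot>[M] (k' \<odot>[M] m) = \<zero>[M]" if "k \<in> carrier R" "k' \<in> carrier R" for k k'
 proof -
  have "(t \<otimes> k) \<odot>[M] m = k \<odot>[M] (t \<odot>[M] m)" using that sR mc by (simp add: M.smult_assoc1[symmetric] m_comm)
  thus z: "(t \<otimes> k) \<odot>[M] m = \<zero>[M]" using t that by simp
  have "(t \<otimes> k) \<odot>[M] (k' \<odot>[M] m) = k' \<odot>[M] ((t \<otimes> k) \<odot>[M] m)"
   using that sR mc M.smult_assoc1[of "t \<otimes> k" k' m] M.smult_assoc1[of k' "t \<otimes> k" m] m_comm[of "t \<otimes> k" k'] by simp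
  thus "(t \<otimes> k) \<odot>[M] (k' \<odot>[M] m) = \<zero>[M]" using z that by simp
 qed
 define x where "x = (\<one> \<ominus> e) \<odot>[M] m"
 define y where "y = e \<odot>[M] m"
 have xc: "x \<in> carrier M" and yc: "y \<in> carrier M" using fR e(1) mc by (simp_all add: x_def y_def)
 have mxy: "m = x \<oplus>[M] y"
  unfolding x_def y_def using e(1) mc by (simp add: M.smult_l_distr[symmetric] minus_add_cancel)
 have \<theta>x: "\<theta> \<odot>[M] x = \<zero>[M]"
  unfolding x_def M.smult_assoc1[OF \<theta>R fR mc, symmetric] e(4) by (rule tk(1)[OF e(3,3)])
 have xA: "x \<in> tor A" using \<theta>x e(2) xc by (auto simp: tor_def)
 have ey: "e \<odot>[M] y = y"
 proof -
  obtain a b where ab: "a \<in> carrier R" "b \<in> carrier R" "e = \<theta> \<otimes> a \<oplus> t \<otimes> b" using div e(2) by blast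
  have "e \<odot>[M] x = a \<odot>[M] (\<theta> \<odot>[M] x) \<oplus>[M] (t \<otimes> b) \<odot>[M] x"
   using ab \<theta>R sR xc by (simp add: M.smult_l_distr M.smult_assoc1[symmetric] m_comm)
  hence "e \<odot>[M] x = \<zero>[M]" using \<theta>x ab tk(2)[OF ab(2) fR] by (simp add: x_def)
  moreover have "e \<odot>[M] m = e \<odot>[M] x \<oplus>[M] e \<odot>[M] y" by (subst mxy) (use e(1) xc yc in "simp add: M.smult_r_distr")
  ultimately show ?thesis using e(1) yc by (simp add: y_def)
 qed
 have yA: "y \<in> divis A"
 proof -
  have "\<exists>a\<in>carrier R. (q \<otimes> a) \<odot>[M] y = y" if q: "q \<in> dens A" for q
  proof -
   obtain a b where ab: "a \<in> carrier R" "b \<in> carrier R" "e = q \<otimes> a \<oplus> t \<otimes> b" using div q by blast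
   have qR: "q \<in> carrier R" using dens_S[OF q] by simp
   have "e \<odot>[M] y = (q \<otimes> a) \<odot>[M] y \<oplus>[M] (t \<otimes> b) \<odot>[M] y"
    using ab qR sR yc M.smult_l_distr[of "q \<otimes> a" "t \<otimes> b" y] by simp
   hence "(q \<otimes> a) \<odot>[M] y = y" using ey tk(2)[OF ab(2) e(1)] ab qR yc by (simp add: y_def)
   thus ?thesis using ab(1) by blast
  qed
  thus ?thesis using yc by (simp add: divis_def)
 qed
 have "\<tau>' \<odot>[M] y = \<zero>[M]"
 proof (rule tor_divis)
  have "\<tau> \<odot>[M] (\<tau>' \<odot>[M] y) = (t \<otimes> r) \<odot>[M] y" using \<tau>R yc by (simp add: M.smult_assoc1[symmetric] \<tau>(4))
  hence "\<tau> \<odot>[M] (\<tau>' \<odot>[M] y) = \<zero>[M]" using tk(2)[OF \<tau>(3) e(1)] by (simp add: y_def)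
  thus "\<tau>' \<odot>[M] y \<in> tor A" using \<tau>(1) \<tau>R yc by (auto simp: tor_def)
  show "\<tau>' \<odot>[M] y \<in> divis A" by (rule submodule_closed(6)[OF M divis_submodule[OF A] \<tau>R(2) yA])
 qed
 hence "y \<in> tor C" using \<tau>(2) yc by (auto simp: tor_def)
 thus ?thesis using xA yA mxy by blast
qed

lemma tor_mono: "A <= C ==> tor A <= tor C"
 unfolding tor_def using dens_mono by blast

text \<open>On \<open>tor (A \<union> C) = tor A \<oplus> (divis A \<inter> tor C)\<close> take the first section on the first summand and the second on the other.\<close>

lemma splits_Un:
 assumes A: "admissible A" and C: "admissible C" and \<sigma>: "splits (tor A) \<sigma>" and \<rho>: "splits (tor C) \<rho>"
 shows "\<exists>\<sigma>'. splits (tor (A \<union> C)) \<sigma>' & (\<forall>m\<in>tor A. \<sigma>' m = \<sigma> m)"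
proof -
 let ?V = "divis A \<inter> tor C"
 note tA = submodule_closed[OF M tor_submodule[OF A]] and dA = submodule_closed[OF M divis_submodule[OF A]]
  and tC = submodule_closed[OF M tor_submodule[OF C]]
 have V: "submodule ?V R M"
  by (rule submoduleI'[OF M]) (use dA tC in auto)
 have \<sigma>l: "lin R M (tor A) B \<sigma>" and \<sigma>p: "!!m. m \<in> tor A ==> p (\<sigma> m) = m" using \<sigma> by (auto simp: splits_def)
 have \<rho>l: "lin R M (tor C) B \<rho>" and \<rho>p: "!!m. m \<in> tor C ==> p (\<rho> m) = m" using \<rho> by (auto simp: splits_def)
 have "\<exists>h. lin R M {x \<oplus>[M] y | x y. x \<in> tor A & y \<in> ?V} B h & (\<forall>x\<in>tor A. \<forall>y\<in>?V. h (x \<oplus>[M] y) = \<sigma> x \<oplus>[B] \<rho> y)"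
  by (rule direct_sum_lin[OF M B tor_submodule[OF A] V _ \<sigma>l lin_subset[OF \<rho>l]]) (use tor_divis in auto)
 then obtain h where h: "lin R M {x \<oplus>[M] y | x y. x \<in> tor A & y \<in> ?V} B h"
  "!!x y. x \<in> tor A ==> y \<in> ?V ==> h (x \<oplus>[M] y) = \<sigma> x \<oplus>[B] \<rho> y" by blast
 have sub: "tor (A \<union> C) <= {x \<oplus>[M] y | x y. x \<in> tor A & y \<in> ?V}"
  using tor_Un[OF A C] by blast
 have "p (h m) = m" if m: "m \<in> tor (A \<union> C)" for m
 proof -
  obtain x y where xy: "x \<in> tor A" "y \<in> ?V" "m = x \<oplus>[M] y" using tor_Un[OF A C m] by blast
  have yC: "y \<in> tor C" using xy(2) by simp
  have "p (h m) = p (\<sigma> x) \<oplus>[M] p (\<rho> y)"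
   unfolding xy(3) h(2)[OF xy(1,2)] by (rule lin_add[OF p lin_closed[OF \<sigma>l xy(1)] lin_closed[OF \<rho>l yC]])
  thus ?thesis using \<sigma>p[OF xy(1)] \<rho>p[OF yC] xy(3) by simp
 qed
 moreover have "h m = \<sigma> m" if m: "m \<in> tor A" for m
 proof -
  have z: "\<zero>[M] \<in> ?V" using dA(2) tC(2) by simp
  have "\<rho> \<zero>[M] = \<zero>[B]" by (rule lin_zero[OF M B tor_submodule[OF C] \<rho>l])
  thus ?thesis using h(2)[OF m z] lin_closed[OF \<sigma>l m] tA(1)[OF m] by simp
 qed
 ultimately show ?thesis using lin_subset[OF h(1) sub] unfolding splits_def by blast
qed

text \<open>Zorn's lemma for sections over \<open>tor A\<close> with \<open>A\<close> admissible.  A maximal one is defined everywhere, since for each \<open>s\<close> it can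
be combined with a section over the torsion of a countable admissible set that has \<open>s\<close> among its denominators.\<close>

theorem torsion_splits: "\<exists>\<sigma>. splits (carrier M) \<sigma>"
proof -
 define pairs where "pairs = {(A, \<sigma>). admissible A & splits (tor A) \<sigma> & \<sigma> \<in> extensional (tor A)}"
 define le :: "'x set \<times> ('m => 'b) => 'x set \<times> ('m => 'b) => bool" where "le = (%(A, \<sigma>) (A', \<sigma>'). A <= A' & (\<forall>m\<in>tor A. \<sigma>' m = \<sigma> m))"
 have le_iff: "le a b \<longleftrightarrow> fst a <= fst b & (\<forall>m\<in>tor (fst a). snd b m = snd a m)" for a b
  by (simp add: le_def case_prod_unfold)
 have countable: "\<exists>A \<sigma>. admissible A & splits (tor A) \<sigma> & s \<in> dens A" if s: "s \<in> S" for s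
 proof -
  obtain A \<tau> where A: "admissible A" "s \<in> dens A" "\<forall>n::nat. \<tau> n \<in> dens A"
   "\<forall>n. \<exists>c\<in>S. \<tau> (Suc n) = \<tau> n \<otimes> c" "\<forall>t\<in>dens A. \<exists>n. \<exists>a\<in>carrier R. \<tau> n = t \<otimes> a"
   using countable_admissible[OF s] by blast
  have \<tau>S: "\<tau> n \<in> S" for n using A(3) dens_S by blast
  have "tor A = (\<Union>n. kill (\<tau> n))"
  proof
   show "(\<Union>n. kill (\<tau> n)) <= tor A" using A(3) by (auto simp: kill_def tor_def)
   show "tor A <= (\<Union>n. kill (\<tau> n))"
   proof
    fix m assume "m \<in> tor A"
    then obtain t where t: "t \<in> dens A" "t \<odot>[M] m = \<zero>[M]" "m \<in> carrier M" by (auto simp: tor_def)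
    obtain n a where a: "a \<in> carrier R" "\<tau> n = t \<otimes> a" using A(5) t(1) by blast
    have "\<tau> n \<odot>[M] m = a \<odot>[M] (t \<odot>[M] m)"
     unfolding a(2) using a(1) dens_S[OF t(1)] t(3) by (simp add: M.smult_assoc1[symmetric] m_comm)
    thus "m \<in> (\<Union>n. kill (\<tau> n))" using t a(1) by (auto simp: kill_def)
   qed
  qed
  moreover obtain \<sigma> where "splits (\<Union>n. kill (\<tau> n)) \<sigma>"
   using countable_splits[of \<tau>] \<tau>S A(4) by blast
  ultimately show ?thesis using A(1,2) by metis
 qed
 have restr: "splits (tor A) (restrict \<sigma> (tor A))" if A: "admissible A" and \<sigma>: "splits (tor A) \<sigma>" for A \<sigma>
  using lin_cong[OF _ tor_submodule[OF A] M, of B \<sigma> "restrict \<sigma> (tor A)"] \<sigma> by (auto simp: splits_def)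
 have ex: "\<exists>m\<in>pairs. \<forall>a\<in>pairs. le m a --> a = m"
 proof (rule predicate_Zorn)
  show "partial_order_on pairs (relation_of le pairs)"
  proof (rule partial_order_on_relation_ofI)
   show "le a a" for a by (auto simp: le_def)
   show "le a c" if "le a b" "le b c" for a b c
   proof -
    have "tor (fst a) <= tor (fst b)" using that by (intro tor_mono) (simp add: le_iff)
    hence "snd c m = snd a m" if m: "m \<in> tor (fst a)" for m
     using \<open>le a b\<close> \<open>le b c\<close> m unfolding le_iff by (metis subsetD)
    thus ?thesis using that unfolding le_iff by (meson subset_trans)
   qed
   show "a = b" if ab: "a \<in> pairs" "b \<in> pairs" "le a b" "le b a" for a b
   proof -
    obtain A \<sigma> A' \<sigma>' where p: "a = (A, \<sigma>)" "b = (A', \<sigma>')" by (cases a, cases b)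
    have "A = A'" using ab p by (auto simp: le_def)
    moreover have "\<sigma> = \<sigma>'"
     by (rule extensionalityI[of _ "tor A"]) (use ab p \<open>A = A'\<close> in "auto simp: le_def pairs_def")
    ultimately show ?thesis using p by simp
   qed
  qed
  show "\<exists>u\<in>pairs. \<forall>a\<in>\<C>. le a u" if \<C>: "\<C> \<in> Chains (relation_of le pairs)" for \<C>
  proof (cases "\<C> = {}")
   case True
   obtain A \<sigma> where A: "admissible A" "splits (tor A) \<sigma>" using countable[OF S_one] by blast
   hence "(A, restrict \<sigma> (tor A)) \<in> pairs" using restr[OF A] by (simp add: pairs_def)
   thus ?thesis using True by blast
  next
   case False
   have chp: "a \<in> pairs" if "a \<in> \<C>" for a
    using \<C> that by (auto simp: Chains_def relation_of_def)
   have chl: "le a b \<or> le b a" if "a \<in> \<C>" "b \<in> \<C>" for a b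
    using \<C> that by (auto simp: Chains_def relation_of_def)
   have adm: "admissible (fst a)" "splits (tor (fst a)) (snd a)" if "a \<in> \<C>" for a
    using chp[OF that] by (auto simp: pairs_def)
   define U where "U = \<Union>(fst ` \<C>)"
   have ch: "subset.chain UNIV (fst ` \<C>)"
    unfolding subset.chain_def using chl unfolding le_iff by blast
   have adm': "admissible A" if "A \<in> fst ` \<C>" for A using that adm(1) by blast
   have ne: "fst ` \<C> ~= {}" using False by simp
   have U: "admissible U" "dens U = (\<Union>A\<in>fst ` \<C>. dens A)"
    unfolding U_def by (rule admissible_Union[OF adm' ch ne], assumption)+
   have tU: "tor U = (\<Union>a\<in>\<C>. tor (fst a))" unfolding tor_def U(2) by blast
   have "\<exists>g. lin R M (\<Union>a\<in>\<C>. tor (fst a)) B g & (\<forall>a\<in>\<C>. \<forall>x\<in>tor (fst a). g x = snd a x)"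
   proof (rule directed_lin[OF M B False])
    show "submodule (tor (fst a)) R M" if "a \<in> \<C>" for a using adm(1)[OF that] by (rule tor_submodule)
    show "lin R M (tor (fst a)) B (snd a)" if "a \<in> \<C>" for a using adm(2)[OF that] by (simp add: splits_def)
    show "\<exists>m\<in>\<C>. tor (fst a) <= tor (fst m) & tor (fst b) <= tor (fst m) &
      (\<forall>x\<in>tor (fst a). snd m x = snd a x) & (\<forall>x\<in>tor (fst b). snd m x = snd b x)"
     if ab: "a \<in> \<C>" "b \<in> \<C>" for a b
    proof -
     have *: "tor (fst c) <= tor (fst d) & (\<forall>x\<in>tor (fst c). snd d x = snd c x)" if "le c d" for c d
      using that tor_mono[of "fst c" "fst d"] unfolding le_iff by simp
     show ?thesis using chl[OF ab] * ab by blast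
    qed
   qed
   then obtain g where g: "lin R M (tor U) B g" "!!a x. a \<in> \<C> ==> x \<in> tor (fst a) ==> g x = snd a x"
    unfolding tU by blast
   have "p (g m) = m" if m: "m \<in> tor U" for m
   proof -
    obtain a where a: "a \<in> \<C>" "m \<in> tor (fst a)" using m unfolding tU by blast
    show ?thesis using g(2)[OF a] adm(2)[OF a(1)] a(2) by (simp add: splits_def)
   qed
   hence sg: "splits (tor U) g" using g(1) by (simp add: splits_def)
   have up: "(U, restrict g (tor U)) \<in> pairs"
    using U(1) restr[OF U(1) sg] by (simp add: pairs_def)
   have "le a (U, restrict g (tor U))" if a: "a \<in> \<C>" for a
   proof -
    have "tor (fst a) <= tor U" using a unfolding tU by blast
    hence "\<forall>m\<in>tor (fst a). restrict g (tor U) m = snd a m" using g(2)[OF a] by auto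
    moreover have "fst a <= U" using a unfolding U_def by blast
    ultimately show ?thesis unfolding le_iff by simp
   qed
   thus ?thesis using up by blast
  qed
 qed
 then obtain A \<sigma> where mx: "(A, \<sigma>) \<in> pairs" "!!a. a \<in> pairs ==> le (A, \<sigma>) a ==> a = (A, \<sigma>)" by auto
 have A: "admissible A" "splits (tor A) \<sigma>" using mx(1) by (auto simp: pairs_def)
 have "tor A = carrier M"
 proof
  show "tor A <= carrier M" by (auto simp: tor_def)
  show "carrier M <= tor A"
  proof
   fix m assume m: "m \<in> carrier M"
   obtain s where s: "s \<in> S" "s \<odot>[M] m = \<zero>[M]" using torsion[OF m] by blast
   obtain C \<rho> where C: "admissible C" "splits (tor C) \<rho>" "s \<in> dens C" using countable[OF s(1)] by blast
   obtain \<sigma>' where \<sigma>': "splits (tor (A \<union> C)) \<sigma>'" "\<forall>m\<in>tor A. \<sigma>' m = \<sigma> m"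
    using splits_Un[OF A(1) C(1) A(2) C(2)] by blast
   have AC: "admissible (A \<union> C)" by (rule admissible_Un[OF A(1) C(1)])
   have "(A \<union> C, restrict \<sigma>' (tor (A \<union> C))) \<in> pairs"
    using AC restr[OF AC \<sigma>'(1)] by (simp add: pairs_def)
   moreover have "le (A, \<sigma>) (A \<union> C, restrict \<sigma>' (tor (A \<union> C)))"
    using \<sigma>'(2) tor_mono[of A "A \<union> C"] by (auto simp: le_def)
   ultimately have "A \<union> C = A" using mx(2) by blast
   hence "dens C <= dens A" using dens_mono[of C A] by blast
   thus "m \<in> tor A" using s m C(3) by (auto simp: tor_def)
  qed
 qed
 thus ?thesis using A(2) by auto
qed

end

end

end

declare direct_power_sel [simp del]

text \<open>A relation that relates zero to zero only is the graph of a linear map.\<close>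

lemma linrel_function:
 assumes M: "module R M" and U: "module R U" and A: "submodule A R M" and \<Gamma>: "linrel R M A U \<Gamma>"
  and z: "!!w. w \<in> carrier U ==> \<Gamma> \<zero>[M] w ==> w = \<zero>[U]"
 shows "\<exists>h. lin R M A U h & (\<forall>x\<in>A. \<Gamma> x (h x)) & (\<forall>x\<in>A. \<forall>w\<in>carrier U. \<Gamma> x w --> w = h x)"
proof -
 interpret M: module R M by fact
 interpret U: module R U by fact
 note AA = submodule_closed[OF M A]
 have uniq: "w = w'" if "x \<in> A" "w \<in> carrier U" "w' \<in> carrier U" "\<Gamma> x w" "\<Gamma> x w'" for x w w'
 proof -
  have "\<Gamma> (x \<ominus>[M] x) (w \<ominus>[U] w')" by (rule linrel_minus[OF M U A \<Gamma> that(1,1,2,3,4,5)])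
  hence "w \<ominus>[U] w' = \<zero>[U]" using z[OF U.minus_closed[OF that(2,3)]] AA(1)[OF that(1)] by simp
  thus ?thesis using that by (simp add: U.minus_eq_zero_iff)
 qed
 have "\<exists>h. \<forall>x\<in>A. h x \<in> carrier U & \<Gamma> x (h x)"
 proof (rule bchoice, rule ballI)
  fix x assume "x \<in> A"
  from linrel_total[OF \<Gamma> this] show "\<exists>y. y \<in> carrier U & \<Gamma> x y" unfolding Bex_def .
 qed
 then obtain h where h: "\<forall>x\<in>A. h x \<in> carrier U & \<Gamma> x (h x)" ..
 have hc: "h x \<in> carrier U" and h\<Gamma>: "\<Gamma> x (h x)" if "x \<in> A" for x using bspec[OF h that] by simp_all
 have "lin R M A U h"
 proof (rule linI)
  show "h (x \<oplus>[M] y) = h x \<oplus>[U] h y" if "x \<in> A" "y \<in> A" for x y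
   by (rule uniq[OF AA(4)[OF that] hc[OF AA(4)[OF that]] U.a_closed[OF hc[OF that(1)] hc[OF that(2)]] h\<Gamma>[OF AA(4)[OF that]]
      linrel_add[OF \<Gamma> that hc[OF that(1)] hc[OF that(2)] h\<Gamma>[OF that(1)] h\<Gamma>[OF that(2)]]])
  show "h (r \<odot>[M] x) = r \<odot>[U] h x" if "r \<in> carrier R" "x \<in> A" for r x
   by (rule uniq[OF AA(6)[OF that] hc[OF AA(6)[OF that]] U.smult_closed[OF that(1) hc[OF that(2)]] h\<Gamma>[OF AA(6)[OF that]]
      linrel_smult[OF \<Gamma> that hc[OF that(2)] h\<Gamma>[OF that(2)]]])
 qed (rule hc)
 moreover have "\<forall>x\<in>A. \<Gamma> x (h x)" by (rule ballI) (rule h\<Gamma>)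
 moreover have "\<forall>x\<in>A. \<forall>w\<in>carrier U. \<Gamma> x w --> w = h x"
 proof (intro ballI impI)
  fix x w assume "x \<in> A" "w \<in> carrier U" "\<Gamma> x w"
  thus "w = h x" by (intro uniq[OF _ _ hc _ h\<Gamma>])
 qed
 ultimately show ?thesis by (intro exI[of _ h] conjI)
qed

lemma submodule_sum:
 assumes M: "module R M" and U: "submodule U R M" and V: "submodule V R M"
 shows "submodule {x \<oplus>[M] y | x y. x \<in> U & y \<in> V} R M"
proof (rule submoduleI'[OF M])
 interpret M: module R M by fact
 note UU = submodule_closed[OF M U] and VV = submodule_closed[OF M V]
 show "{x \<oplus>[M] y | x y. x \<in> U & y \<in> V} <= carrier M" using UU(1) VV(1) by auto
 have "\<zero>[M] = \<zero>[M] \<oplus>[M] \<zero>[M]" by simp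
 thus "\<zero>[M] \<in> {x \<oplus>[M] y | x y. x \<in> U & y \<in> V}" using UU(2) VV(2) by blast
 show "z \<oplus>[M] z' \<in> {x \<oplus>[M] y | x y. x \<in> U & y \<in> V}"
  if "z \<in> {x \<oplus>[M] y | x y. x \<in> U & y \<in> V}" "z' \<in> {x \<oplus>[M] y | x y. x \<in> U & y \<in> V}" for z z'
 proof -
  obtain x y x' y' where z: "z = x \<oplus>[M] y" "x \<in> U" "y \<in> V" "z' = x' \<oplus>[M] y'" "x' \<in> U" "y' \<in> V"
   using \<open>z \<in> _\<close> \<open>z' \<in> _\<close> by blast
  have "z \<oplus>[M] z' = (x \<oplus>[M] x') \<oplus>[M] (y \<oplus>[M] y')"
   using UU(1)[OF z(2)] UU(1)[OF z(5)] VV(1)[OF z(3)] VV(1)[OF z(6)] by (simp add: z(1,4) M.a_ac)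
  thus ?thesis using UU(4)[OF z(2,5)] VV(4)[OF z(3,6)] by blast
 qed
 show "r \<odot>[M] z \<in> {x \<oplus>[M] y | x y. x \<in> U & y \<in> V}"
  if r: "r \<in> carrier R" and "z \<in> {x \<oplus>[M] y | x y. x \<in> U & y \<in> V}" for r z
 proof -
  obtain x y where z: "z = x \<oplus>[M] y" "x \<in> U" "y \<in> V" using \<open>z \<in> _\<close> by blast
  have "r \<odot>[M] z = r \<odot>[M] x \<oplus>[M] r \<odot>[M] y" using UU(1)[OF z(2)] VV(1)[OF z(3)] r by (simp add: z(1) M.smult_r_distr)
  thus ?thesis using UU(6)[OF r z(2)] VV(6)[OF r z(3)] by blast
 qed
qed

definition quotient_map :: "('a, 'm) module => 'm set => 'm set => 'm set" where
 "quotient_map M N C = (\<Union>x\<in>C. N +>[M] x)"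

lemma quotient_map_coset:
 assumes M: "module R M" and N: "submodule N R M" and N': "submodule N' R M" and sub: "N <= N'" and x: "x \<in> carrier M"
 shows "quotient_map M N' (N +>[M] x) = N' +>[M] x"
proof -
 interpret M: module R M by fact
 have "N' +>[M] y = N' +>[M] x" if y: "y \<in> N +>[M] x" for y
 proof -
  obtain n where n: "n \<in> N" "y = n \<oplus>[M] x" using y by (auto simp: a_r_coset_def')
  have nc: "n \<in> carrier M" using submodule_closed(1)[OF M N n(1)] .
  have "y \<ominus>[M] x = n" using n nc x by (simp add: a_minus_def M.a_assoc M.r_neg)
  thus ?thesis using coset_eq_iff[OF M N', of y x] n nc x sub by auto
 qed
 moreover have "N +>[M] x ~= {}"
  using submodule_closed(2)[OF M N] by (auto simp: a_r_coset_def')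
 ultimately show ?thesis unfolding quotient_map_def by auto
qed

lemma quotient_map_lin:
 assumes M: "module R M" and N: "submodule N R M" and N': "submodule N' R M" and sub: "N <= N'"
 shows "linear R (quotient_module M N) (quotient_module M N') (quotient_map M N')"
proof -
 interpret M: module R M by fact
 note q = quotient_map_coset[OF M N N' sub]
 show ?thesis
 proof (rule linI)
  fix C assume "C \<in> carrier (quotient_module M N)"
  then obtain x where x: "x \<in> carrier M" "C = N +>[M] x" by (rule coset_cases)
  show "quotient_map M N' C \<in> carrier (quotient_module M N')"
   unfolding x(2) q[OF x(1)] by (rule coset_closed[OF x(1)])
  show "quotient_map M N' (r \<odot>[quotient_module M N] C) = r \<odot>[quotient_module M N'] quotient_map M N' C"
   if r: "r \<in> carrier R" for r
   unfolding x(2) q[OF x(1)] coset_smult[OF M N x(1) r] coset_smult[OF M N' x(1) r] q[OF M.smult_closed[OF r x(1)]] ..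
  fix D assume "D \<in> carrier (quotient_module M N)"
  then obtain y where y: "y \<in> carrier M" "D = N +>[M] y" by (rule coset_cases)
  show "quotient_map M N' (C \<oplus>[quotient_module M N] D) = quotient_map M N' C \<oplus>[quotient_module M N'] quotient_map M N' D"
   unfolding x(2) y(2) q[OF x(1)] q[OF y(1)] coset_add[OF M N x(1) y(1)] coset_add[OF M N' x(1) y(1)]
    q[OF M.a_closed[OF x(1) y(1)]] ..
 qed
qed

section \<open>Powers of the module of fractions\<close>

context fraction_module
begin

abbreviation pow where "pow Y \<equiv> direct_power Q Y"

lemma pow_module: "module R (pow Y)"
 by (rule direct_power_module[OF Q])

lemma pow_coord: "d \<in> carrier (pow Y) ==> d y \<in> carrier Q"
 by (rule direct_power_coord[OF Q])

lemma pow_divisible: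
 assumes "s \<in> S" "d \<in> carrier (pow Y)"
 shows "\<exists>d'\<in>carrier (pow Y). s \<odot>[pow Y] d' = d"
proof -
 have "\<exists>f. \<forall>q. q \<in> carrier Q --> f q \<in> carrier Q & s \<odot>[Q] f q = q"
  by (rule choice) (use divisible[OF assms(1)] in blast)
 then obtain f where f: "!!q. q \<in> carrier Q ==> f q \<in> carrier Q" "!!q. q \<in> carrier Q ==> s \<odot>[Q] f q = q" by blast
 have f0: "f \<zero>[Q] = \<zero>[Q]" using torsion_free[OF assms(1) f(1)] f(2) by simp
 have "{y. f (d y) ~= \<zero>[Q]} <= {y. d y ~= \<zero>[Q]}" using f0 by auto
 moreover have "finite {y. d y ~= \<zero>[Q]}" using assms(2) by (simp add: direct_power_mem)
 ultimately have "finite {y. f (d y) ~= \<zero>[Q]}" by (rule finite_subset)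
 hence "(%y. f (d y)) \<in> carrier (pow Y)"
  using assms(2) f f0 pow_coord[OF assms(2)] by (simp add: direct_power_mem)
 moreover have "s \<odot>[pow Y] (%y. f (d y)) = d"
  using f(2) pow_coord[OF assms(2)] by (simp add: direct_power_sel fun_eq_iff)
 ultimately show ?thesis by blast
qed

definition scale :: "('y => 'a) => 'y => 'q" where "scale f = (%y. f y \<odot>[Q] u)"

lemma scale_closed:
 assumes "f \<in> free_set R Y"
 shows "scale f \<in> carrier (pow Y)"
proof -
 have "{y. scale f y ~= \<zero>[Q]} <= {y. f y ~= \<zero>}" by (auto simp: scale_def)
 moreover have "finite {y. f y ~= \<zero>}" using assms by (simp add: free_module_mem)
 ultimately have "finite {y. scale f y ~= \<zero>[Q]}" by (rule finite_subset)
 thus ?thesis using assms free_module_coord[OF is_cring assms] by (auto simp: direct_power_mem scale_def free_module_mem)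
qed

lemma scale_lin: "linear R (free_module R Y) (pow Y) scale"
 by (rule linI) (auto simp: scale_closed, auto simp: scale_def free_module_sel direct_power_sel fun_eq_iff
   Q.smult_l_distr Q.smult_assoc1 free_module_coord[OF is_cring])

lemma scale_inj:
 assumes "f \<in> free_set R Y" "g \<in> free_set R Y" "scale f = scale g"
 shows "f = g"
proof
 fix y
 show "f y = g y"
  using u_cancel[OF free_module_coord[OF is_cring assms(1)] free_module_coord[OF is_cring assms(2)]]
   fun_cong[OF assms(3), of y] by (simp add: scale_def)
qed

lemma pow_frac_ex:
 assumes d: "d \<in> carrier (pow Y)"
 shows "\<exists>s\<in>S. \<exists>f\<in>free_set R Y. s \<odot>[pow Y] d = scale f"
proof -
 have fin: "\<exists>s\<in>S. \<forall>y\<in>B. \<exists>a\<in>carrier R. s \<odot>[Q] d y = a \<odot>[Q] u" if "finite B" for B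
  using that
 proof (induction B)
  case empty
  thus ?case using S_one by blast
 next
  case (insert y B)
  then obtain s where s: "s \<in> S" "\<forall>y\<in>B. \<exists>a\<in>carrier R. s \<odot>[Q] d y = a \<odot>[Q] u" by blast
  obtain t b where t: "t \<in> S" "b \<in> carrier R" "t \<odot>[Q] d y = b \<odot>[Q] u" using frac_ex[OF pow_coord[OF d]] by blast
  have R: "s \<in> carrier R" "t \<in> carrier R" using s t by auto
  have "\<exists>a\<in>carrier R. (s \<otimes> t) \<odot>[Q] d z = a \<odot>[Q] u" if z: "z \<in> insert y B" for z
  proof (cases "z = y")
   case True
   have "(s \<otimes> t) \<odot>[Q] d z = (s \<otimes> b) \<odot>[Q] u"
    using R t pow_coord[OF d] True by (simp add: Q.smult_assoc1)
   thus ?thesis using R t by blast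
  next
   case False
   then obtain a where a: "a \<in> carrier R" "s \<odot>[Q] d z = a \<odot>[Q] u" using s(2) z by blast
   have "(s \<otimes> t) \<odot>[Q] d z = t \<odot>[Q] (s \<odot>[Q] d z)" using R pow_coord[OF d] by (simp add: Q.smult_assoc1[symmetric] m_comm)
   hence "(s \<otimes> t) \<odot>[Q] d z = (t \<otimes> a) \<odot>[Q] u" using R a by (simp add: Q.smult_assoc1)
   thus ?thesis using R a by blast
  qed
  thus ?case using S_mult[OF s(1) t(1)] by blast
 qed
 have "finite {y. d y ~= \<zero>[Q]}" using d by (simp add: direct_power_mem)
 from fin[OF this] obtain s where s: "s \<in> S" "\<forall>y\<in>{y. d y ~= \<zero>[Q]}. \<exists>a\<in>carrier R. s \<odot>[Q] d y = a \<odot>[Q] u" by blast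
 have "\<exists>a. a \<in> carrier R & s \<odot>[Q] d y = a \<odot>[Q] u & (d y = \<zero>[Q] --> a = \<zero>)" for y
 proof (cases "d y = \<zero>[Q]")
  case True
  thus ?thesis using s(1) by (intro exI[of _ "\<zero>"]) simp
 next
  case False
  thus ?thesis using s(2) by auto
 qed
 then obtain f where f: "!!y. f y \<in> carrier R" "!!y. s \<odot>[Q] d y = f y \<odot>[Q] u" "!!y. d y = \<zero>[Q] ==> f y = \<zero>" by metis
 have "finite {y. f y ~= \<zero>}" using f(3) by (intro finite_subset[OF _ \<open>finite {y. d y ~= \<zero>[Q]}\<close>]) auto
 hence "f \<in> free_set R Y" using f d by (auto simp: free_module_mem direct_power_mem)
 moreover have "s \<odot>[pow Y] d = scale f" using f(2) by (simp add: direct_power_sel scale_def fun_eq_iff)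
 ultimately show ?thesis using s(1) by blast
qed

end

section \<open>Presentations of powers of the module of fractions\<close>

context presented_fractions
begin

definition proj :: "'y set => ('x \<times> 'y => 'a) => 'y => 'q" where
 "proj Y g = (%y. \<epsilon> (coord g y))"

abbreviation G where "G Y \<equiv> free_module R (X \<times> Y)"

lemma G_module: "module R (G Y)"
 by (rule free_module_module[OF is_cring])

lemma proj_closed:
 assumes "g \<in> carrier (G Y)"
 shows "proj Y g \<in> carrier (pow Y)"
proof -
 have "{y. proj Y g y ~= \<zero>[Q]} <= {y. coord g y ~= (%x. \<zero>)}" using \<epsilon>_zero by (auto simp: proj_def)
 hence "finite {y. proj Y g y ~= \<zero>[Q]}" using coord_finite[OF assms] by (rule finite_subset)
 thus ?thesis using \<epsilon>_closed[OF coord_closed[OF assms]] coord_outside[OF assms] \<epsilon>_zero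
  by (auto simp: direct_power_mem proj_def)
qed

lemma proj_lin: "linear R (G Y) (pow Y) (proj Y)"
proof (rule linI)
 show "proj Y (g \<oplus>[G Y] h) = proj Y g \<oplus>[pow Y] proj Y h" if "g \<in> carrier (G Y)" "h \<in> carrier (G Y)" for g h
  unfolding proj_def direct_power_sel
  by (intro ext, subst lin_add[OF coord_lin that], rule lin_add[OF \<epsilon> coord_closed[OF that(1)] coord_closed[OF that(2)]])
 show "proj Y (r \<odot>[G Y] g) = r \<odot>[pow Y] proj Y g" if "r \<in> carrier R" "g \<in> carrier (G Y)" for r g
  unfolding proj_def direct_power_sel
  by (intro ext, subst lin_smult[OF coord_lin that], rule lin_smult[OF \<epsilon> that(1) coord_closed[OF that(2)]])
qed (rule proj_closed)

lemma proj_surj: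
 assumes d: "d \<in> carrier (pow Y)"
 shows "\<exists>g\<in>carrier (G Y). proj Y g = d"
proof -
 have "\<exists>f. f \<in> carrier F & \<epsilon> f = d y & (d y = \<zero>[Q] --> f = (%x. \<zero>))" for y
 proof (cases "d y = \<zero>[Q]")
  case True
  have "(%x. \<zero>) \<in> carrier F" by (simp add: free_module_mem)
  thus ?thesis by (intro exI[of _ "%x. \<zero>"]) (simp add: True \<epsilon>_zero)
 next
  case False
  have "d y \<in> \<epsilon> ` carrier F" using pow_coord[OF d] by (simp add: \<epsilon>_surj)
  thus ?thesis using False by auto
 qed
 then obtain f where f: "!!y. f y \<in> carrier F" "!!y. \<epsilon> (f y) = d y" "!!y. d y = \<zero>[Q] ==> f y = (%x. \<zero>)" by metis
 define g where "g = (%(x, y). f y x)"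
 have "{p. g p ~= \<zero>} <= (\<Union>y\<in>{y. d y ~= \<zero>[Q]}. (%x. (x, y)) ` supp (f y))"
  using f(3) by (fastforce simp: g_def)
 moreover have "finite (\<Union>y\<in>{y. d y ~= \<zero>[Q]}. (%x. (x, y)) ` supp (f y))"
  using d f(1) by (auto simp: direct_power_mem free_module_mem)
 ultimately have "finite {p. g p ~= \<zero>}" by (rule finite_subset)
 moreover have "g (x, y) \<in> carrier R" for x y
  using free_module_coord[OF is_cring f(1)] by (simp add: g_def)
 moreover have "g (x, y) = \<zero>" if "(x, y) \<notin> X \<times> Y" for x y
 proof (cases "x \<in> X")
  case True
  hence "d y = \<zero>[Q]" using that d by (auto simp: direct_power_mem)
  thus ?thesis using f(3) by (simp add: g_def)
 next
  case False
  thus ?thesis using f(1)[of y] by (simp add: g_def free_module_mem)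
 qed
 ultimately have "g \<in> carrier (G Y)" by (auto simp: free_module_mem)
 moreover have "proj Y g = d" using f(2) by (simp add: proj_def coord_def g_def)
 ultimately show ?thesis by blast
qed

lemma kernel_extends:
 assumes C: "module R C" and ext: "extends R F N C"
 shows "extends R (G Y) {g \<in> carrier (G Y). proj Y g = \<zero>[pow Y]} C"
proof -
 have "coord_sub X N Y = {g \<in> carrier (G Y). proj Y g = \<zero>[pow Y]}"
 proof -
  have "(\<forall>y\<in>Y. coord g y \<in> N) \<longleftrightarrow> proj Y g = \<zero>[pow Y]" if g: "g \<in> carrier (G Y)" for g
  proof -
   have "\<epsilon> (coord g y) = \<zero>[Q]" if "y \<notin> Y" for y using coord_outside[OF g that] \<epsilon>_zero by simp
   hence "(\<forall>y\<in>Y. \<epsilon> (coord g y) = \<zero>[Q]) \<longleftrightarrow> (\<forall>y. \<epsilon> (coord g y) = \<zero>[Q])" by blast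
   thus ?thesis using coord_closed[OF g] by (simp add: proj_def direct_power_sel fun_eq_iff)
  qed
  thus ?thesis unfolding coord_sub_def[OF N_submodule i] by blast
 qed
 thus ?thesis using coord_sub_extends[OF N_submodule i C ext, of Y] by simp
qed

definition int_part :: "('x => 'a) set" where
 "int_part = {f \<in> carrier F. \<exists>r\<in>carrier R. \<epsilon> f = r \<odot>[Q] u}"

lemma int_part_submodule: "submodule int_part R F"
proof -
 have "linear R (ring_module R) Q (%r. r \<odot>[Q] u)"
  by (rule linI) (auto simp: Q.smult_l_distr Q.smult_assoc1)
 hence "submodule ((%r. r \<odot>[Q] u) ` carrier (ring_module R)) R Q"
  by (rule lin_image_submodule[OF ring_module_module Q carrier_submodule[OF ring_module_module]])
 from lin_kernel_submodule[OF F.module_axioms Q F_submodule \<epsilon> this]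
 have "submodule {f \<in> carrier F. \<epsilon> f \<in> (%r. r \<odot>[Q] u) ` carrier (ring_module R)} R F" .
 moreover have "{f \<in> carrier F. \<epsilon> f \<in> (%r. r \<odot>[Q] u) ` carrier (ring_module R)} = int_part"
  by (auto simp: int_part_def)
 ultimately show ?thesis by simp
qed

text \<open>An element of \<open>int_part\<close> is the sum of a multiple of \<open>pre 1\<close> and an element of \<open>N\<close>, which is projective.\<close>

lemma int_part_selects:
 assumes U: "module R U"
 shows "selects R F int_part U"
 unfolding selects_def
proof (intro allI impI)
 interpret U: module R U by fact
 fix \<Gamma> assume \<Gamma>: "linrel R F int_part U \<Gamma>"
 note PP = submodule_closed[OF F.module_axioms int_part_submodule]
 have p1: "pre \<one> \<in> carrier F" "\<epsilon> (pre \<one>) = u" using pre_closed[of "\<one>"] \<epsilon>_pre[of "\<one>"] recip_one by auto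
 have p1i: "pre \<one> \<in> int_part" using p1 by (auto simp: int_part_def intro!: bexI[of _ "\<one>"])
 obtain w1 where w1: "w1 \<in> carrier U" "\<Gamma> (pre \<one>) w1"
  using linrel_total[OF \<Gamma> p1i] by (elim bexE) (rule that)
 define c where "c f = (SOME r. r \<in> carrier R & \<epsilon> f = r \<odot>[Q] u)" for f
 have c: "c f \<in> carrier R" "\<epsilon> f = c f \<odot>[Q] u" if "f \<in> int_part" for f
 proof -
  have "\<exists>r. r \<in> carrier R & \<epsilon> f = r \<odot>[Q] u" using that by (auto simp: int_part_def)
  from someI_ex[OF this] show "c f \<in> carrier R" "\<epsilon> f = c f \<odot>[Q] u" by (auto simp: c_def)
 qed
 have cl: "lin R F int_part (ring_module R) c"
 proof (rule linI)
  show "c (f \<oplus>[F] g) = c f \<oplus>[ring_module R] c g" if fg: "f \<in> int_part" "g \<in> int_part" for f g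
  proof -
   have "c (f \<oplus>[F] g) \<odot>[Q] u = \<epsilon> f \<oplus>[Q] \<epsilon> g"
    using c(2)[OF PP(4)[OF fg]] lin_add[OF \<epsilon> PP(1)[OF fg(1)] PP(1)[OF fg(2)]] by simp
   also have "\<dots> = (c f \<oplus> c g) \<odot>[Q] u" using c[OF fg(1)] c[OF fg(2)] by (simp add: Q.smult_l_distr)
   finally show ?thesis using u_cancel c(1)[OF PP(4)[OF fg]] c(1)[OF fg(1)] c(1)[OF fg(2)] by simp
  qed
  show "c (r \<odot>[F] f) = r \<odot>[ring_module R] c f" if r: "r \<in> carrier R" and f: "f \<in> int_part" for r f
  proof -
   have "c (r \<odot>[F] f) \<odot>[Q] u = r \<odot>[Q] \<epsilon> f"
    using c(2)[OF PP(6)[OF r f]] lin_smult[OF \<epsilon> r PP(1)[OF f]] by simp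
   also have "\<dots> = (r \<otimes> c f) \<odot>[Q] u" using c[OF f] r by (simp add: Q.smult_assoc1)
   finally show ?thesis using u_cancel c(1)[OF PP(6)[OF r f]] c(1)[OF f] r by simp
  qed
 qed (use c in simp)
 have rl: "lin R (ring_module R) (carrier R) V (%r. r \<odot>[V] z)" if "module R V" "z \<in> carrier V" for V :: "('a, 'v) module" and z
 proof -
  interpret V: module R V by fact
  show ?thesis by (rule linI) (use that in "auto simp: V.smult_l_distr V.smult_assoc1")
 qed
 have l1: "lin R F int_part F (%f. c f \<odot>[F] pre \<one>)"
  by (rule lin_compose[OF cl rl[OF F.module_axioms p1(1)]]) (rule c(1))
 have idl: "lin R F int_part F (%f. f)" using PP(1) by (intro lin_ident) auto
 have l2: "lin R F int_part F (%f. f \<ominus>[F] c f \<odot>[F] pre \<one>)"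
  by (rule lin_diff[OF F.module_axioms F.module_axioms int_part_submodule idl l1])
 have l2N: "f \<ominus>[F] c f \<odot>[F] pre \<one> \<in> N" if f: "f \<in> int_part" for f
 proof -
  have "\<epsilon> (f \<ominus>[F] c f \<odot>[F] pre \<one>) = \<epsilon> f \<ominus>[Q] c f \<odot>[Q] u"
   unfolding lin_minus[OF F.module_axioms Q F_submodule \<epsilon> PP(1)[OF f] F.smult_closed[OF c(1)[OF f] p1(1)]]
    lin_smult[OF \<epsilon> c(1)[OF f] p1(1)] p1(2) ..
  thus ?thesis using c[OF f] lin_closed[OF l2 f] by simp
 qed
 have NP: "N <= int_part" by (auto simp: int_part_def intro!: bexI[of _ "\<zero>"])
 have idN: "lin R F N F (%f. f)" by (rule lin_ident) auto
 have gN: "linrel R F N U \<Gamma>" using linrel_comp[OF \<Gamma> idN] NP by blast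
 obtain h where h: "lin R F N U h" "\<forall>f\<in>N. \<Gamma> f (h f)"
  by (rule selectsD[OF dual_basis_selects[OF F.module_axioms N_submodule i U] gN])
 have "lin R F int_part U (%f. h (f \<ominus>[F] c f \<odot>[F] pre \<one>) \<oplus>[U] c f \<odot>[U] w1)"
  by (rule lin_sum[OF U lin_compose[OF l2 h(1) l2N] lin_compose[OF cl rl[OF U w1(1)]]]) (assumption | rule c(1))+
 moreover have "\<Gamma> f (h (f \<ominus>[F] c f \<odot>[F] pre \<one>) \<oplus>[U] c f \<odot>[U] w1)" if f: "f \<in> int_part" for f
 proof -
  have cp: "c f \<odot>[F] pre \<one> \<in> carrier F" using c(1)[OF f] p1(1) by blast
  have s: "\<Gamma> (c f \<odot>[F] pre \<one>) (c f \<odot>[U] w1)"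
   by (rule linrel_smult[OF \<Gamma> c(1)[OF f] p1i w1(1)]) (rule w1(2))
  have "\<Gamma> (f \<ominus>[F] c f \<odot>[F] pre \<one> \<oplus>[F] c f \<odot>[F] pre \<one>) (h (f \<ominus>[F] c f \<odot>[F] pre \<one>) \<oplus>[U] c f \<odot>[U] w1)"
   by (rule linrel_add[OF \<Gamma> subsetD[OF NP l2N[OF f]] PP(6)[OF c(1)[OF f] p1i] lin_closed[OF h(1) l2N[OF f]]
      U.smult_closed[OF c(1)[OF f] w1(1)]]) (rule bspec[OF h(2) l2N[OF f]], rule s)
  thus ?thesis unfolding F.minus_add_cancel[OF PP(1)[OF f] cp] .
 qed
 ultimately show "\<exists>h. lin R F int_part U h & (\<forall>f\<in>int_part. \<Gamma> f (h f))" by (intro exI conjI ballI)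
qed

lemma preimage_free_selects:
 fixes U :: "('a, 'n) module" and Y :: "'y set"
 assumes U: "module R U"
 shows "selects R (G Y) {g \<in> carrier (G Y). proj Y g \<in> scale ` free_set R Y} U"
proof -
 have "\<exists>k. dual_basis R F int_part k"
  by (rule selects_dual_basis[OF F.module_axioms int_part_submodule int_part_selects[OF free_module_module[OF is_cring]]])
 then obtain k where k: "dual_basis R F int_part k" ..
 have "(\<forall>y\<in>Y. coord g y \<in> int_part) \<longleftrightarrow> proj Y g \<in> scale ` free_set R Y" if g: "g \<in> carrier (G Y)" for g
 proof
  assume "proj Y g \<in> scale ` free_set R Y"
  then obtain f where f: "f \<in> free_set R Y" "proj Y g = scale f" by blast
  show "\<forall>y\<in>Y. coord g y \<in> int_part"
  proof
   fix y
   have "\<epsilon> (coord g y) = f y \<odot>[Q] u" using fun_cong[OF f(2), of y] by (simp add: proj_def scale_def)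
   thus "coord g y \<in> int_part"
    using coord_closed[OF g] free_module_coord[OF is_cring f(1)] by (auto simp: int_part_def)
  qed
 next
  assume as: "\<forall>y\<in>Y. coord g y \<in> int_part"
  have "\<exists>r. r \<in> carrier R & proj Y g y = r \<odot>[Q] u & (proj Y g y = \<zero>[Q] --> r = \<zero>)" for y
  proof (cases "proj Y g y = \<zero>[Q]")
   case True
   thus ?thesis by (intro exI[of _ "\<zero>"]) simp
  next
   case False
   hence "y \<in> Y" using proj_closed[OF g] by (auto simp: direct_power_mem)
   thus ?thesis using as False by (auto simp: int_part_def proj_def)
  qed
  then obtain f where f: "!!y. f y \<in> carrier R" "!!y. proj Y g y = f y \<odot>[Q] u" "!!y. proj Y g y = \<zero>[Q] ==> f y = \<zero>" by metis
  have pg: "finite {y. proj Y g y ~= \<zero>[Q]}" "!!y. y \<notin> Y ==> proj Y g y = \<zero>[Q]"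
   using proj_closed[OF g] by (auto simp: direct_power_mem)
  have "finite {y. f y ~= \<zero>}" using f(3) by (intro finite_subset[OF _ pg(1)]) auto
  hence "f \<in> free_set R Y" using f pg(2) by (auto simp: free_module_mem)
  moreover have "proj Y g = scale f" using f(2) by (simp add: scale_def fun_eq_iff)
  ultimately show "proj Y g \<in> scale ` free_set R Y" by blast
 qed
 hence "coord_sub X int_part Y = {g \<in> carrier (G Y). proj Y g \<in> scale ` free_set R Y}"
  unfolding coord_sub_def[OF int_part_submodule k] by blast
 thus ?thesis using coord_sub_selects[OF int_part_submodule k U, of Y] by simp
qed

end

declare quotient_module_sel [simp del]

section \<open>Strong flatness from local projectivity\<close>

context presented_fractions
begin

context
 fixes E :: "('a, 'm) module"
 assumes E: "module R E"
  and tf: "!!s x. s \<in> S ==> x \<in> carrier E ==> s \<odot>[E] x = \<zero>[E] ==> x = \<zero>[E]"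
begin

interpretation E: module R E by (rule E)

abbreviation FY where "FY \<equiv> free_module R (carrier E)"
abbreviation D where "D \<equiv> pow (carrier E)"
abbreviation cov where "cov \<equiv> free_cover R E"

lemma FY: "module R FY" by (rule free_module_module[OF is_cring])
lemma DM: "module R D" by (rule pow_module)

interpretation FY: module R FY by (rule FY)
interpretation D: module R D by (rule DM)

lemma cov_lin: "linear R FY E cov"
 by (rule free_cover_lin[OF E])

lemma cov_surj: "x \<in> carrier E ==> \<exists>y\<in>carrier FY. cov y = x"
 by (rule bexI[of _ "basis_vector R x"]) (rule free_cover_basis[OF E], assumption, rule basis_vector_closed[OF is_cring])

text \<open>The kernel of the natural map from \<open>Q\<^sup>(\<^sup>E\<^sup>)\<close> to the module of fractions of \<open>E\<close>.\<close>

definition sat :: "('m => 'q) set" where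
 "sat = {d \<in> carrier D. \<exists>s\<in>S. \<exists>y\<in>carrier FY. s \<odot>[D] d = scale y & cov y = \<zero>[E]}"

lemma sat_submodule: "submodule sat R D"
proof (rule submoduleI'[OF DM])
 show "sat <= carrier D" by (auto simp: sat_def)
 have z: "cov \<zero>[FY] = \<zero>[E]" by (rule lin_zero[OF FY E carrier_submodule[OF FY] cov_lin])
 have "scale \<zero>[FY] = \<zero>[D]" by (rule lin_zero[OF FY DM carrier_submodule[OF FY] scale_lin])
 hence "\<one> \<odot>[D] \<zero>[D] = scale \<zero>[FY]" by simp
 thus "\<zero>[D] \<in> sat" using z S_one FY.zero_closed D.zero_closed unfolding sat_def by blast
 show "d \<oplus>[D] d' \<in> sat" if dd: "d \<in> sat" "d' \<in> sat" for d d'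
 proof -
  obtain s y where s: "s \<in> S" "y \<in> carrier FY" "s \<odot>[D] d = scale y" "cov y = \<zero>[E]" "d \<in> carrier D"
   using dd(1) by (auto simp: sat_def)
  obtain s' y' where s': "s' \<in> S" "y' \<in> carrier FY" "s' \<odot>[D] d' = scale y'" "cov y' = \<zero>[E]" "d' \<in> carrier D"
   using dd(2) by (auto simp: sat_def)
  have R: "s \<in> carrier R" "s' \<in> carrier R" using s s' by auto
  have c: "s' \<odot>[FY] y \<in> carrier FY" "s \<odot>[FY] y' \<in> carrier FY" using R s(2) s'(2) by blast+
  have "(s \<otimes> s') \<odot>[D] (d \<oplus>[D] d') = s' \<odot>[D] (s \<odot>[D] d) \<oplus>[D] s \<odot>[D] (s' \<odot>[D] d')"
   using R s(5) s'(5) by (simp add: D.smult_r_distr D.smult_assoc1[symmetric] m_comm)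
  also have "\<dots> = scale (s' \<odot>[FY] y \<oplus>[FY] s \<odot>[FY] y')"
   unfolding lin_add[OF scale_lin c] lin_smult[OF scale_lin R(2) s(2)] lin_smult[OF scale_lin R(1) s'(2)] s(3) s'(3) ..
  finally have 1: "(s \<otimes> s') \<odot>[D] (d \<oplus>[D] d') = scale (s' \<odot>[FY] y \<oplus>[FY] s \<odot>[FY] y')" .
  have 2: "cov (s' \<odot>[FY] y \<oplus>[FY] s \<odot>[FY] y') = \<zero>[E]"
   unfolding lin_add[OF cov_lin c] lin_smult[OF cov_lin R(2) s(2)] lin_smult[OF cov_lin R(1) s'(2)] s(4) s'(4)
   using R by simp
  show ?thesis
   unfolding sat_def using 1 2 S_mult[OF s(1) s'(1)] FY.a_closed[OF c] D.a_closed[OF s(5) s'(5)] by blast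
 qed
 show "r \<odot>[D] d \<in> sat" if r: "r \<in> carrier R" and d: "d \<in> sat" for r d
 proof -
  obtain s y where s: "s \<in> S" "y \<in> carrier FY" "s \<odot>[D] d = scale y" "cov y = \<zero>[E]" "d \<in> carrier D"
   using d by (auto simp: sat_def)
  have R: "s \<in> carrier R" using s by auto
  have "s \<odot>[D] (r \<odot>[D] d) = r \<odot>[D] (s \<odot>[D] d)"
   using R r s(5) by (simp add: D.smult_assoc1[symmetric] m_comm)
  hence 1: "s \<odot>[D] (r \<odot>[D] d) = scale (r \<odot>[FY] y)" unfolding s(3) lin_smult[OF scale_lin r s(2)] .
  have 2: "cov (r \<odot>[FY] y) = \<zero>[E]" unfolding lin_smult[OF cov_lin r s(2)] s(4) using r by simp
  show ?thesis
   unfolding sat_def using 1 2 s(1) FY.smult_closed[OF r s(2)] D.smult_closed[OF r s(5)] by blast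
 qed
qed

lemma sat_closed: "d \<in> sat ==> d \<in> carrier D"
 by (simp add: sat_def)

lemma sat_saturated:
 assumes "s \<in> S" "d \<in> carrier D" "s \<odot>[D] d \<in> sat"
 shows "d \<in> sat"
proof -
 obtain t y where t: "t \<in> S" "y \<in> carrier FY" "t \<odot>[D] (s \<odot>[D] d) = scale y" "cov y = \<zero>[E]"
  using assms(3) by (auto simp: sat_def)
 have "(t \<otimes> s) \<odot>[D] d = scale y" using t assms by (simp add: D.smult_assoc1)
 thus ?thesis unfolding sat_def using t S_mult[OF t(1) assms(1)] assms(2) by blast
qed

lemma sat_scale:
 assumes y: "y \<in> carrier FY"
 shows "scale y \<in> sat \<longleftrightarrow> cov y = \<zero>[E]"
proof
 assume "scale y \<in> sat"
 then obtain s z where s: "s \<in> S" "z \<in> carrier FY" "s \<odot>[D] scale y = scale z" "cov z = \<zero>[E]"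
  by (auto simp: sat_def)
 have sR: "s \<in> carrier R" using s by simp
 have "scale (s \<odot>[FY] y) = scale z" unfolding lin_smult[OF scale_lin sR y] s(3) ..
 hence "s \<odot>[FY] y = z" by (rule scale_inj[OF FY.smult_closed[OF sR y] s(2)])
 hence "s \<odot>[E] cov y = \<zero>[E]" using lin_smult[OF cov_lin sR y] s(4) by simp
 thus "cov y = \<zero>[E]" by (rule tf[OF s(1) lin_closed[OF cov_lin y]])
next
 assume z: "cov y = \<zero>[E]"
 have "\<one> \<odot>[D] scale y = scale y" using scale_closed[OF y] by simp
 thus "scale y \<in> sat" unfolding sat_def using z y S_one scale_closed[OF y] by blast
qed

lemma sat_divisible:
 assumes "s \<in> S" "n \<in> sat"
 shows "\<exists>n'\<in>sat. s \<odot>[D] n' = n"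
proof -
 obtain d where d: "d \<in> carrier D" "s \<odot>[D] d = n" using pow_divisible[OF assms(1) sat_closed[OF assms(2)]] by blast
 thus ?thesis using sat_saturated[OF assms(1) d(1)] assms(2) by blast
qed

definition ints :: "('m => 'q) set" where "ints = scale ` carrier FY"

definition sums :: "('m => 'q) set" where "sums = {d \<oplus>[D] n | d n. d \<in> ints & n \<in> sat}"

lemma ints_submodule: "submodule ints R D"
 unfolding ints_def by (rule lin_image_submodule[OF FY DM carrier_submodule[OF FY] scale_lin])

lemma sums_submodule: "submodule sums R D"
 unfolding sums_def by (rule submodule_sum[OF DM ints_submodule sat_submodule])

lemma ints_sums: "ints <= sums" and sat_sums: "sat <= sums"
proof -
 note i = submodule_closed[OF DM ints_submodule] and n = submodule_closed[OF DM sat_submodule]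
 show "ints <= sums"
 proof
  fix d assume d: "d \<in> ints"
  have "d = d \<oplus>[D] \<zero>[D]" using i(1)[OF d] by simp
  thus "d \<in> sums" unfolding sums_def using d n(2) by blast
 qed
 show "sat <= sums"
 proof
  fix d assume d: "d \<in> sat"
  have "d = \<zero>[D] \<oplus>[D] d" using n(1)[OF d] by simp
  thus "d \<in> sums" unfolding sums_def using d i(2) by blast
 qed
qed

abbreviation Bq where "Bq \<equiv> quotient_module D ints"
abbreviation Mq where "Mq \<equiv> quotient_module D sums"
abbreviation pq where "pq \<equiv> quotient_map D sums"

lemma Bq: "module R Bq" by (rule quotient_module_module[OF DM ints_submodule])
lemma Mq: "module R Mq" by (rule quotient_module_module[OF DM sums_submodule])
lemma pq: "linear R Bq Mq pq" by (rule quotient_map_lin[OF DM ints_submodule sums_submodule ints_sums])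
lemma pq_coset: "d \<in> carrier D ==> pq (ints +>[D] d) = sums +>[D] d"
 by (rule quotient_map_coset[OF DM ints_submodule sums_submodule ints_sums])

interpretation Bq: module R Bq by (rule Bq)
interpretation Mq: module R Mq by (rule Mq)

lemmas Bs = coset_smult[OF DM ints_submodule] and Ba = coset_add[OF DM ints_submodule]
 and Ms = coset_smult[OF DM sums_submodule] and Ma = coset_add[OF DM sums_submodule]

lemma B_zero: "d \<in> carrier D ==> ints +>[D] d = \<zero>[Bq] \<longleftrightarrow> d \<in> ints"
 using coset_eq_zero[OF DM ints_submodule, of d] by (simp add: quotient_module_sel)

lemma M_zero: "d \<in> carrier D ==> sums +>[D] d = \<zero>[Mq] \<longleftrightarrow> d \<in> sums"
 using coset_eq_zero[OF DM sums_submodule, of d] by (simp add: quotient_module_sel)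

lemma Mq_torsion:
 assumes "m \<in> carrier Mq"
 shows "\<exists>s\<in>S. s \<odot>[Mq] m = \<zero>[Mq]"
proof -
 obtain d where d: "d \<in> carrier D" "m = sums +>[D] d" using assms by (rule coset_cases)
 obtain s y where s: "s \<in> S" "y \<in> carrier FY" "s \<odot>[D] d = scale y" using pow_frac_ex[OF d(1)] by blast
 have sR: "s \<in> carrier R" using s by simp
 have "s \<odot>[D] d \<in> sums" unfolding s(3) using ints_sums s(2) by (auto simp: ints_def)
 hence "s \<odot>[Mq] m = \<zero>[Mq]"
  unfolding d(2) Ms[OF d(1) sR] M_zero[OF D.smult_closed[OF sR d(1)]] .
 thus ?thesis using s(1) by blast
qed

context
 assumes sel: "!!v (\<Gamma> :: 'm => ('m => 'q) set => bool). v \<in> S ==> linrel R E (carrier E) Bq \<Gamma> ==>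
  (!!x w. \<Gamma> x w ==> v \<odot>[Bq] w = \<zero>[Bq]) ==> \<exists>h. linear R E Bq h & (\<forall>x\<in>carrier E. \<Gamma> x (h x))"
begin

text \<open>
 The elements of \<open>E\<^sub>S / E\<close> killed by \<open>v = s t\<close> are the fractions \<open>x / v\<close> and form a copy of \<open>E / v E\<close>, which is
 projective modulo \<open>v\<close>.  The values at \<open>x / v\<close> that are compatible with \<open>p\<close> and with \<open>\<sigma>\<close> (on \<open>t (x / v) = x / s\<close>)
 exist because the kernel of \<open>p\<close> is \<open>t\<close>-divisible.
\<close>

lemma extend_section:
 assumes s: "s \<in> S" and t: "t \<in> S" and \<sigma>: "splits Bq Mq pq (kill Mq s) \<sigma>"
 shows "\<exists>\<sigma>'. splits Bq Mq pq (kill Mq (s \<otimes> t)) \<sigma>' & (\<forall>m\<in>kill Mq s. \<sigma>' m = \<sigma> m)"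
proof -
 define v where "v = s \<otimes> t"
 have v: "v \<in> S" using s t by (simp add: v_def)
 have sR: "s \<in> carrier R" and tR: "t \<in> carrier R" and vR: "v \<in> carrier R" using s t v by auto
 have \<sigma>l: "lin R Mq (kill Mq s) Bq \<sigma>" and \<sigma>p: "!!m. m \<in> kill Mq s ==> pq (\<sigma> m) = m"
  using \<sigma> unfolding splits_def[OF Bq Mq pq] by blast+
 have \<sigma>0: "\<sigma> \<zero>[Mq] = \<zero>[Bq]" by (rule lin_zero[OF Mq Bq kill_submodule[OF Bq Mq pq sR] \<sigma>l])
 let ?c = "%d. sums +>[D] d"
 have cM: "?c d \<in> carrier Mq" if "d \<in> carrier D" for d by (rule coset_closed[OF that])
 have tk: "t \<odot>[Mq] ?c d \<in> kill Mq s" if d: "d \<in> carrier D" "v \<odot>[D] d = scale y" "y \<in> carrier FY" for d y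
 proof -
  have "s \<odot>[Mq] (t \<odot>[Mq] ?c d) = ?c (v \<odot>[D] d)"
   using Ms[OF d(1) vR] Mq.smult_assoc1[OF sR tR cM[OF d(1)]] by (simp add: v_def)
  also have "\<dots> = \<zero>[Mq]"
   by (rule iffD2[OF M_zero[OF D.smult_closed[OF vR d(1)]]]) (use d(2,3) ints_sums in "auto simp: ints_def")
  finally show ?thesis unfolding kill_def[OF Bq Mq pq] using Mq.smult_closed[OF tR cM[OF d(1)]] by simp
 qed
 \<comment> \<open>\<open>x\<close> is related to the possible values of \<open>\<sigma>'\<close> at \<open>d = x / v\<close>.\<close>
 define \<Gamma> where "\<Gamma> x b \<longleftrightarrow> v \<odot>[Bq] b = \<zero>[Bq] & (\<exists>y\<in>carrier FY. \<exists>d\<in>carrier D. cov y = x & v \<odot>[D] d = scale y &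
  pq b = ?c d & t \<odot>[Bq] b = \<sigma> (t \<odot>[Mq] ?c d))" for x b
 have \<Gamma>rel: "linrel R E (carrier E) Bq \<Gamma>"
 proof (rule linrelI)
  fix x assume x: "x \<in> carrier E"
  obtain y where y: "y \<in> carrier FY" "cov y = x" using cov_surj[OF x] by blast
  obtain d where d: "d \<in> carrier D" "v \<odot>[D] d = scale y" using pow_divisible[OF v scale_closed[OF y(1)]] by blast
  let ?a = "\<sigma> (t \<odot>[Mq] ?c d)" and ?b = "ints +>[D] d"
  have a: "?a \<in> carrier Bq" by (rule lin_closed[OF \<sigma>l tk[OF d y(1)]])
  have b: "?b \<in> carrier Bq" by (rule coset_closed[OF d(1)])
  have ab: "?a \<ominus>[Bq] t \<odot>[Bq] ?b \<in> carrier Bq" using a b tR by blast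
  then obtain d' where d': "d' \<in> carrier D" "?a \<ominus>[Bq] t \<odot>[Bq] ?b = ints +>[D] d'" by (rule coset_cases)
  have "pq (?a \<ominus>[Bq] t \<odot>[Bq] ?b) = pq ?a \<ominus>[Mq] t \<odot>[Mq] pq ?b"
   unfolding lin_minus[OF Bq Mq carrier_submodule[OF Bq] pq a Bq.smult_closed[OF tR b]] lin_smult[OF pq tR b] ..
  also have "\<dots> = \<zero>[Mq]"
   unfolding \<sigma>p[OF tk[OF d y(1)]] pq_coset[OF d(1)] by (rule Mq.minus_self[OF Mq.smult_closed[OF tR cM[OF d(1)]]])
  finally have "?c d' = \<zero>[Mq]" unfolding d'(2) pq_coset[OF d'(1)] .
  hence "d' \<in> sums" unfolding M_zero[OF d'(1)] .
  then obtain e n where en: "e \<in> ints" "n \<in> sat" "d' = e \<oplus>[D] n" unfolding sums_def by blast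
  have nD: "n \<in> carrier D" and eD: "e \<in> carrier D"
   using sat_closed[OF en(2)] submodule_closed(1)[OF DM ints_submodule en(1)] by auto
  have dn: "ints +>[D] d' = ints +>[D] n"
  proof -
   have "d' \<ominus>[D] n = e" unfolding en(3) using nD eD by (simp add: a_minus_def D.a_assoc D.r_neg)
   thus ?thesis using coset_eq_iff[OF DM ints_submodule d'(1) nD] en(1) by simp
  qed
  obtain n' where n': "n' \<in> sat" "t \<odot>[D] n' = n" using sat_divisible[OF t en(2)] by blast
  have n'D: "n' \<in> carrier D" by (rule sat_closed[OF n'(1)])
  let ?k = "ints +>[D] n'"
  have k: "?k \<in> carrier Bq" by (rule coset_closed[OF n'D])
  have tkk: "t \<odot>[Bq] ?k = ?a \<ominus>[Bq] t \<odot>[Bq] ?b" unfolding Bs[OF n'D tR] n'(2) d'(2) dn ..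
  have vb: "v \<odot>[Bq] ?b = \<zero>[Bq]"
   unfolding Bs[OF d(1) vR]
   by (rule iffD2[OF B_zero[OF D.smult_closed[OF vR d(1)]]]) (use d(2) y(1) in "simp add: ints_def")
  have sa: "s \<odot>[Bq] ?a = \<zero>[Bq]"
  proof -
   have "s \<odot>[Bq] ?a = \<sigma> (s \<odot>[Mq] (t \<odot>[Mq] ?c d))" by (rule lin_smult[OF \<sigma>l sR tk[OF d y(1)], symmetric])
   thus ?thesis using tk[OF d y(1)] \<sigma>0 by (simp add: kill_def[OF Bq Mq pq])
  qed
  have "v \<odot>[Bq] ?k = s \<odot>[Bq] (t \<odot>[Bq] ?k)" unfolding v_def by (rule Bq.smult_assoc1[OF sR tR k])
  also have "\<dots> = s \<odot>[Bq] ?a \<ominus>[Bq] s \<odot>[Bq] (t \<odot>[Bq] ?b)"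
   unfolding tkk by (rule Bq.smult_minus[OF sR a Bq.smult_closed[OF tR b]])
  also have "s \<odot>[Bq] (t \<odot>[Bq] ?b) = v \<odot>[Bq] ?b" unfolding v_def by (rule Bq.smult_assoc1[OF sR tR b, symmetric])
  finally have vk: "v \<odot>[Bq] ?k = \<zero>[Bq]" unfolding sa vb using Bq.minus_self[OF Bq.zero_closed] by simp
  have "v \<odot>[Bq] (?b \<oplus>[Bq] ?k) = \<zero>[Bq]"
   unfolding Bq.smult_r_distr[OF vR b k] vb vk by (rule Bq.l_zero[OF Bq.zero_closed])
  moreover have "pq (?b \<oplus>[Bq] ?k) = ?c d"
  proof -
   have "pq ?k = \<zero>[Mq]" unfolding pq_coset[OF n'D] M_zero[OF n'D] using n'(1) sat_sums by blast
   thus ?thesis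
    unfolding lin_add[OF pq b k] pq_coset[OF d(1)] using Mq.r_zero[OF cM[OF d(1)]] by simp
  qed
  moreover have "t \<odot>[Bq] (?b \<oplus>[Bq] ?k) = ?a"
   unfolding Bq.smult_r_distr[OF tR b k] tkk by (rule Bq.add_minus_cancel[OF Bq.smult_closed[OF tR b] a])
  ultimately have "\<Gamma> x (?b \<oplus>[Bq] ?k)" unfolding \<Gamma>_def using y d by blast
  thus "\<exists>w\<in>carrier Bq. \<Gamma> x w" by (rule bexI[OF _ Bq.a_closed[OF b k]])
 next
  fix x x' b b' assume b: "b \<in> carrier Bq" "b' \<in> carrier Bq" and g: "\<Gamma> x b" "\<Gamma> x' b'"
  obtain y d where yd: "v \<odot>[Bq] b = \<zero>[Bq]" "y \<in> carrier FY" "d \<in> carrier D" "cov y = x" "v \<odot>[D] d = scale y"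
   "pq b = ?c d" "t \<odot>[Bq] b = \<sigma> (t \<odot>[Mq] ?c d)" using g(1) unfolding \<Gamma>_def by blast
  obtain y' d' where yd': "v \<odot>[Bq] b' = \<zero>[Bq]" "y' \<in> carrier FY" "d' \<in> carrier D" "cov y' = x'" "v \<odot>[D] d' = scale y'"
   "pq b' = ?c d'" "t \<odot>[Bq] b' = \<sigma> (t \<odot>[Mq] ?c d')" using g(2) unfolding \<Gamma>_def by blast
  have "v \<odot>[Bq] (b \<oplus>[Bq] b') = \<zero>[Bq]"
   unfolding Bq.smult_r_distr[OF vR b] yd(1) yd'(1) by (rule Bq.l_zero[OF Bq.zero_closed])
  moreover have "cov (y \<oplus>[FY] y') = x \<oplus>[E] x'" unfolding lin_add[OF cov_lin yd(2) yd'(2)] yd(4) yd'(4) ..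
  moreover have "v \<odot>[D] (d \<oplus>[D] d') = scale (y \<oplus>[FY] y')"
   unfolding lin_add[OF scale_lin yd(2) yd'(2)] D.smult_r_distr[OF vR yd(3) yd'(3)] yd(5) yd'(5) ..
  moreover have "pq (b \<oplus>[Bq] b') = ?c (d \<oplus>[D] d')"
   unfolding lin_add[OF pq b] yd(6) yd'(6) by (rule Ma[OF yd(3) yd'(3)])
  moreover have "t \<odot>[Bq] (b \<oplus>[Bq] b') = \<sigma> (t \<odot>[Mq] ?c (d \<oplus>[D] d'))"
   unfolding Bq.smult_r_distr[OF tR b] yd(7) yd'(7) Ma[OF yd(3) yd'(3), symmetric]
    Mq.smult_r_distr[OF tR cM[OF yd(3)] cM[OF yd'(3)]]
   by (rule lin_add[OF \<sigma>l tk[OF yd(3,5,2)] tk[OF yd'(3,5,2)], symmetric])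
  ultimately show "\<Gamma> (x \<oplus>[E] x') (b \<oplus>[Bq] b')"
   unfolding \<Gamma>_def using FY.a_closed[OF yd(2) yd'(2)] D.a_closed[OF yd(3) yd'(3)] by blast
 next
  fix r x b assume r: "r \<in> carrier R" and b: "b \<in> carrier Bq" and g: "\<Gamma> x b"
  obtain y d where yd: "v \<odot>[Bq] b = \<zero>[Bq]" "y \<in> carrier FY" "d \<in> carrier D" "cov y = x" "v \<odot>[D] d = scale y"
   "pq b = ?c d" "t \<odot>[Bq] b = \<sigma> (t \<odot>[Mq] ?c d)" using g unfolding \<Gamma>_def by blast
  have sw: "k \<odot>[Bq] (r \<odot>[Bq] b) = r \<odot>[Bq] (k \<odot>[Bq] b)" if "k \<in> carrier R" for k
   using Bq.smult_assoc1[OF that r b] Bq.smult_assoc1[OF r that b] m_comm[OF that r] by simp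
  have "v \<odot>[Bq] (r \<odot>[Bq] b) = \<zero>[Bq]" unfolding sw[OF vR] yd(1) by (rule Bq.smult_r_null[OF r])
  moreover have "cov (r \<odot>[FY] y) = r \<odot>[E] x" unfolding lin_smult[OF cov_lin r yd(2)] yd(4) ..
  moreover have "v \<odot>[D] (r \<odot>[D] d) = scale (r \<odot>[FY] y)"
   unfolding lin_smult[OF scale_lin r yd(2)] yd(5)[symmetric] using r vR yd(3) by (simp add: D.smult_assoc1[symmetric] m_comm)
  moreover have "pq (r \<odot>[Bq] b) = ?c (r \<odot>[D] d)"
   unfolding lin_smult[OF pq r b] yd(6) by (rule Ms[OF yd(3) r])
  moreover have "t \<odot>[Bq] (r \<odot>[Bq] b) = \<sigma> (t \<odot>[Mq] ?c (r \<odot>[D] d))"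
  proof -
   have "t \<odot>[Mq] ?c (r \<odot>[D] d) = r \<odot>[Mq] (t \<odot>[Mq] ?c d)"
    unfolding Ms[OF yd(3) r, symmetric]
    using Mq.smult_assoc1[OF tR r cM[OF yd(3)]] Mq.smult_assoc1[OF r tR cM[OF yd(3)]] m_comm[OF tR r] by simp
   thus ?thesis unfolding sw[OF tR] yd(7) using lin_smult[OF \<sigma>l r tk[OF yd(3,5,2)]] by simp
  qed
  ultimately show "\<Gamma> (r \<odot>[E] x) (r \<odot>[Bq] b)"
   unfolding \<Gamma>_def using FY.smult_closed[OF r yd(2)] D.smult_closed[OF r yd(3)] by blast
 qed
 have \<Gamma>v: "v \<odot>[Bq] w = \<zero>[Bq]" if "\<Gamma> x w" for x w using that unfolding \<Gamma>_def by blast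
 have "\<exists>h. linear R E Bq h & (\<forall>x\<in>carrier E. \<Gamma> x (h x))"
  by (rule sel[OF v \<Gamma>rel]) (rule \<Gamma>v)
 then obtain h where h: "linear R E Bq h" "\<forall>x\<in>carrier E. \<Gamma> x (h x)"
  by (elim exE conjE) (rule that)
 have hv: "v \<odot>[Bq] h x = \<zero>[Bq]" if "x \<in> carrier E" for x by (rule \<Gamma>v[OF bspec[OF h(2) that]])
 \<comment> \<open>The class \<open>m\<close> is of the form \<open>x / v\<close> with \<open>x = cov y\<close>, and gets the value \<open>h x\<close>.\<close>
 define \<Sigma> where "\<Sigma> m b \<longleftrightarrow> (\<exists>d\<in>carrier D. \<exists>y\<in>carrier FY. \<exists>n\<in>sat. m = ?c d & v \<odot>[D] d = scale y \<oplus>[D] n & b = h (cov y))" for m b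
 have \<Sigma>rel: "linrel R Mq (kill Mq v) Bq \<Sigma>"
 proof (rule linrelI)
  fix m assume m: "m \<in> kill Mq v"
  hence "m \<in> carrier Mq" "v \<odot>[Mq] m = \<zero>[Mq]" by (simp_all only: kill_def[OF Bq Mq pq] mem_Collect_eq)
  then obtain d where d: "d \<in> carrier D" "m = ?c d" by (elim coset_cases) (rule that)
  have "v \<odot>[D] d \<in> sums"
   using \<open>v \<odot>[Mq] m = \<zero>[Mq]\<close> unfolding d(2) Ms[OF d(1) vR] M_zero[OF D.smult_closed[OF vR d(1)]] .
  then obtain y n where y: "y \<in> carrier FY" "n \<in> sat" "v \<odot>[D] d = scale y \<oplus>[D] n"
   unfolding sums_def ints_def by blast
  hence "\<Sigma> m (h (cov y))" unfolding \<Sigma>_def using d by blast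
  thus "\<exists>w\<in>carrier Bq. \<Sigma> m w" by (rule bexI[OF _ lin_closed[OF h(1) lin_closed[OF cov_lin y(1)]]])
 next
  fix m m' b b' assume g: "\<Sigma> m b" "\<Sigma> m' b'"
  obtain d y n where d: "d \<in> carrier D" "y \<in> carrier FY" "n \<in> sat" "m = ?c d" "v \<odot>[D] d = scale y \<oplus>[D] n" "b = h (cov y)"
   using g(1) unfolding \<Sigma>_def by blast
  obtain d' y' n' where d': "d' \<in> carrier D" "y' \<in> carrier FY" "n' \<in> sat" "m' = ?c d'" "v \<odot>[D] d' = scale y' \<oplus>[D] n'" "b' = h (cov y')"
   using g(2) unfolding \<Sigma>_def by blast
  have "m \<oplus>[Mq] m' = ?c (d \<oplus>[D] d')" unfolding d(4) d'(4) by (rule Ma[OF d(1) d'(1)])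
  moreover have "v \<odot>[D] (d \<oplus>[D] d') = scale (y \<oplus>[FY] y') \<oplus>[D] (n \<oplus>[D] n')"
   unfolding D.smult_r_distr[OF vR d(1) d'(1)] d(5) d'(5) lin_add[OF scale_lin d(2) d'(2)]
   using scale_closed[OF d(2)] scale_closed[OF d'(2)] sat_closed[OF d(3)] sat_closed[OF d'(3)] by (simp add: D.a_ac)
  moreover have "b \<oplus>[Bq] b' = h (cov (y \<oplus>[FY] y'))"
   unfolding d(6) d'(6) lin_add[OF cov_lin d(2) d'(2)]
   by (rule lin_add[OF h(1) lin_closed[OF cov_lin d(2)] lin_closed[OF cov_lin d'(2)], symmetric])
  ultimately show "\<Sigma> (m \<oplus>[Mq] m') (b \<oplus>[Bq] b')"
   unfolding \<Sigma>_def using D.a_closed[OF d(1) d'(1)] FY.a_closed[OF d(2) d'(2)]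
    submodule_closed(4)[OF DM sat_submodule d(3) d'(3)] by blast
 next
  fix r m b assume r: "r \<in> carrier R" and g: "\<Sigma> m b"
  obtain d y n where d: "d \<in> carrier D" "y \<in> carrier FY" "n \<in> sat" "m = ?c d" "v \<odot>[D] d = scale y \<oplus>[D] n" "b = h (cov y)"
   using g unfolding \<Sigma>_def by blast
  have "r \<odot>[Mq] m = ?c (r \<odot>[D] d)" unfolding d(4) by (rule Ms[OF d(1) r])
  moreover have "v \<odot>[D] (r \<odot>[D] d) = scale (r \<odot>[FY] y) \<oplus>[D] r \<odot>[D] n"
  proof -
   have "v \<odot>[D] (r \<odot>[D] d) = r \<odot>[D] (v \<odot>[D] d)" using r vR d(1) by (simp add: D.smult_assoc1[symmetric] m_comm)
   thus ?thesis
    unfolding d(5) lin_smult[OF scale_lin r d(2)] D.smult_r_distr[OF r scale_closed[OF d(2)] sat_closed[OF d(3)]] .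
  qed
  moreover have "r \<odot>[Bq] b = h (cov (r \<odot>[FY] y))"
   unfolding d(6) lin_smult[OF cov_lin r d(2)] by (rule lin_smult[OF h(1) r lin_closed[OF cov_lin d(2)], symmetric])
  ultimately show "\<Sigma> (r \<odot>[Mq] m) (r \<odot>[Bq] b)"
   unfolding \<Sigma>_def using D.smult_closed[OF r d(1)] FY.smult_closed[OF r d(2)]
    submodule_closed(6)[OF DM sat_submodule r d(3)] by blast
 qed
 have \<Sigma>0: "w = \<zero>[Bq]" if g: "\<Sigma> \<zero>[Mq] w" for w
 proof -
  obtain d y n where d: "d \<in> carrier D" "y \<in> carrier FY" "n \<in> sat" "\<zero>[Mq] = ?c d" "v \<odot>[D] d = scale y \<oplus>[D] n" "w = h (cov y)"
   using g unfolding \<Sigma>_def by blast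
  have "d \<in> sums" using d(4) M_zero[OF d(1)] by simp
  then obtain z k where z: "z \<in> carrier FY" "k \<in> sat" "d = scale z \<oplus>[D] k" unfolding sums_def ints_def by blast
  have c: "scale z \<in> carrier D" "k \<in> carrier D" "scale y \<in> carrier D" "n \<in> carrier D"
   using scale_closed z d sat_closed by auto
  have "v \<odot>[D] scale z \<oplus>[D] v \<odot>[D] k = scale y \<oplus>[D] n"
   using d(5) unfolding z(3) D.smult_r_distr[OF vR c(1,2)] .
  hence "v \<odot>[D] scale z \<ominus>[D] scale y = n \<ominus>[D] v \<odot>[D] k"
  proof -
   assume a: "v \<odot>[D] scale z \<oplus>[D] v \<odot>[D] k = scale y \<oplus>[D] n"
   have "v \<odot>[D] scale z \<ominus>[D] scale y = (v \<odot>[D] scale z \<oplus>[D] v \<odot>[D] k) \<ominus>[D] (scale y \<oplus>[D] v \<odot>[D] k)"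
    using c vR by (simp add: D.add_minus_add)
   also have "\<dots> = (scale y \<oplus>[D] n) \<ominus>[D] (scale y \<oplus>[D] v \<odot>[D] k)" unfolding a ..
   also have "\<dots> = n \<ominus>[D] v \<odot>[D] k" using c vR by (simp add: D.add_minus_add)
   finally show ?thesis .
  qed
  moreover have "scale (v \<odot>[FY] z \<ominus>[FY] y) = v \<odot>[D] scale z \<ominus>[D] scale y"
   unfolding lin_minus[OF FY DM carrier_submodule[OF FY] scale_lin FY.smult_closed[OF vR z(1)] d(2)]
    lin_smult[OF scale_lin vR z(1)] ..
  ultimately have "scale (v \<odot>[FY] z \<ominus>[FY] y) \<in> sat"
   using submodule_closed(5)[OF DM sat_submodule d(3) submodule_closed(6)[OF DM sat_submodule vR z(2)]] by simp
  hence "cov (v \<odot>[FY] z \<ominus>[FY] y) = \<zero>[E]"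
   using sat_scale[OF FY.minus_closed[OF FY.smult_closed[OF vR z(1)] d(2)]] by simp
  hence "v \<odot>[E] cov z \<ominus>[E] cov y = \<zero>[E]"
   unfolding lin_minus[OF FY E carrier_submodule[OF FY] cov_lin FY.smult_closed[OF vR z(1)] d(2)]
    lin_smult[OF cov_lin vR z(1)] .
  hence "cov y = v \<odot>[E] cov z"
   using E.minus_eq_zero_iff[OF E.smult_closed[OF vR lin_closed[OF cov_lin z(1)]] lin_closed[OF cov_lin d(2)]] by simp
  thus ?thesis
   unfolding d(6) using lin_smult[OF h(1) vR lin_closed[OF cov_lin z(1)]] hv[OF lin_closed[OF cov_lin z(1)]] by simp
 qed
 have "\<exists>h. lin R Mq (kill Mq v) Bq h & (\<forall>x\<in>kill Mq v. \<Sigma> x (h x)) & (\<forall>x\<in>kill Mq v. \<forall>w\<in>carrier Bq. \<Sigma> x w --> w = h x)"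
  by (rule linrel_function[OF Mq Bq kill_submodule[OF Bq Mq pq vR] \<Sigma>rel]) (rule \<Sigma>0)
 then obtain \<sigma>' where \<sigma>'l: "lin R Mq (kill Mq v) Bq \<sigma>'" and \<sigma>'\<Sigma>: "\<forall>m\<in>kill Mq v. \<Sigma> m (\<sigma>' m)"
  by (elim exE conjE) (rule that)
 have key: "pq (\<sigma>' m) = m & t \<odot>[Bq] \<sigma>' m = \<sigma> (t \<odot>[Mq] m)" if m: "m \<in> kill Mq v" for m
 proof -
  obtain d y n where d: "d \<in> carrier D" "y \<in> carrier FY" "n \<in> sat" "m = ?c d" "v \<odot>[D] d = scale y \<oplus>[D] n" "\<sigma>' m = h (cov y)"
   using bspec[OF \<sigma>'\<Sigma> m] unfolding \<Sigma>_def by blast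
  have "\<Gamma> (cov y) (h (cov y))" by (rule bspec[OF h(2) lin_closed[OF cov_lin d(2)]])
  then obtain y' d' where yd: "y' \<in> carrier FY" "d' \<in> carrier D" "cov y' = cov y" "v \<odot>[D] d' = scale y'"
   "pq (h (cov y)) = ?c d'" "t \<odot>[Bq] h (cov y) = \<sigma> (t \<odot>[Mq] ?c d')" unfolding \<Gamma>_def by blast
  have c: "scale y \<in> carrier D" "scale y' \<in> carrier D" "n \<in> carrier D" using scale_closed d yd sat_closed by auto
  have "v \<odot>[D] (d \<ominus>[D] d') = (scale y \<ominus>[D] scale y') \<oplus>[D] n"
   unfolding D.smult_minus[OF vR d(1) yd(2)] d(5) yd(4) using c by (simp add: a_minus_def D.a_ac)
  moreover have "scale y \<ominus>[D] scale y' = scale (y \<ominus>[FY] y')"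
   by (rule lin_minus[OF FY DM carrier_submodule[OF FY] scale_lin d(2) yd(1), symmetric])
  moreover have "scale (y \<ominus>[FY] y') \<in> sat"
  proof -
   have "cov (y \<ominus>[FY] y') = cov y \<ominus>[E] cov y'"
    by (rule lin_minus[OF FY E carrier_submodule[OF FY] cov_lin d(2) yd(1)])
   hence "cov (y \<ominus>[FY] y') = \<zero>[E]" using yd(3) lin_closed[OF cov_lin d(2)] by simp
   thus ?thesis using sat_scale[OF FY.minus_closed[OF d(2) yd(1)]] by simp
  qed
  ultimately have "v \<odot>[D] (d \<ominus>[D] d') \<in> sat" using submodule_closed(4)[OF DM sat_submodule _ d(3)] by simp
  hence "d \<ominus>[D] d' \<in> sums" using sat_saturated[OF v D.minus_closed[OF d(1) yd(2)]] sat_sums by blast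
  hence "m = ?c d'" unfolding d(4) using coset_eq_iff[OF DM sums_submodule d(1) yd(2)] by simp
  thus ?thesis unfolding d(6) using yd(5,6) by simp
 qed
 have "\<sigma>' m = \<sigma> m" if m: "m \<in> kill Mq s" for m
 proof -
  have "m \<in> carrier Mq" "s \<odot>[Mq] m = \<zero>[Mq]" using m by (simp_all only: kill_def[OF Bq Mq pq] mem_Collect_eq)
  then obtain d where d: "d \<in> carrier D" "m = ?c d" by (elim coset_cases) (rule that)
  obtain d' where d': "d' \<in> carrier D" "t \<odot>[D] d' = d" using pow_divisible[OF t d(1)] by blast
  have tm: "t \<odot>[Mq] ?c d' = m" unfolding Ms[OF d'(1) tR] d'(2) d(2) ..
  have "v \<odot>[Mq] ?c d' = \<zero>[Mq]"
   using Mq.smult_assoc1[OF sR tR cM[OF d'(1)]] tm \<open>s \<odot>[Mq] m = \<zero>[Mq]\<close> by (simp only: v_def)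
  hence k: "?c d' \<in> kill Mq v" unfolding kill_def[OF Bq Mq pq] using cM[OF d'(1)] by simp
  have "\<sigma>' m = t \<odot>[Bq] \<sigma>' (?c d')" unfolding tm[symmetric] by (rule lin_smult[OF \<sigma>'l tR k])
  thus ?thesis using key[OF k] tm by simp
 qed
 thus ?thesis using \<sigma>'l key unfolding splits_def[OF Bq Mq pq] v_def by blast
qed

lemma torsion_section: "\<exists>\<sigma>. splits Bq Mq pq (carrier Mq) \<sigma>"
 by (rule torsion_splits[OF Bq Mq pq Mq_torsion extend_section])

abbreviation GE where "GE \<equiv> G (carrier E)"
abbreviation \<pi>E where "\<pi>E \<equiv> proj (carrier E)"

lemma GE: "module R GE" by (rule G_module)

interpretation GE: module R GE by (rule GE)

definition GF :: "('x \<times> 'm => 'a) set" where "GF = {g \<in> carrier GE. \<pi>E g \<in> sums}"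

lemma GF_submodule: "submodule GF R GE"
 unfolding GF_def by (rule lin_kernel_submodule[OF GE DM carrier_submodule[OF GE] proj_lin sums_submodule])

text \<open>
 \<open>GF\<close> is the kernel of the presentation of \<open>E\<^sub>S / E\<close> by a free module.  Its projectivity comes from that of the
 corresponding kernel \<open>GB\<close> for the direct sum of copies of \<open>Q / R\<close>: lifting the section of the surjection onto
 \<open>E\<^sub>S / E\<close> to a map \<open>a\<close> of free modules, \<open>z = a z - (a z - z)\<close> with \<open>a z\<close> in \<open>GB\<close> and \<open>a z - z\<close> the value of a map
 that sends the whole free module to \<open>GF\<close>.
\<close>

lemma GF_selects:
 fixes U :: "('a, 'n) module"
 assumes U: "module R U"
 shows "selects R GE GF U"
 unfolding selects_def
proof (intro allI impI)
 fix \<Gamma> assume \<Gamma>: "linrel R GE GF U \<Gamma>"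
 define GB where "GB = {g \<in> carrier GE. \<pi>E g \<in> scale ` carrier FY}"
 have GB: "selects R GE GB U" unfolding GB_def by (rule preimage_free_selects[OF U])
 have GBF: "GB <= GF" using ints_sums by (auto simp: GB_def GF_def ints_def)
 have GBc: "GB <= carrier GE" by (auto simp: GB_def)
 obtain \<sigma> where "splits Bq Mq pq (carrier Mq) \<sigma>" using torsion_section ..
 hence \<sigma>l: "linear R Mq Bq \<sigma>" and \<sigma>p: "\<forall>m\<in>carrier Mq. pq (\<sigma> m) = m"
  unfolding splits_def[OF Bq Mq pq] by blast+
 have \<pi>c: "\<pi>E g \<in> carrier D" if "g \<in> carrier GE" for g by (rule proj_closed[OF that])
 let ?c = "%d. sums +>[D] d" and ?i = "%d. ints +>[D] d"
 have l1: "linear R GE Bq (%g. \<sigma> (?c (\<pi>E g)))"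
  by (rule lin_compose[OF lin_compose[OF proj_lin coset_lin[OF DM sums_submodule] \<pi>c] \<sigma>l])
   (assumption | rule coset_closed[OF \<pi>c])+
 have l2: "linear R GE Bq (%g. ?i (\<pi>E g))"
  by (rule lin_compose[OF proj_lin coset_lin[OF DM ints_submodule] \<pi>c])
 have rel: "linrel R GE (carrier GE) GE (%g g'. g' \<in> carrier GE & ?i (\<pi>E g') = \<sigma> (?c (\<pi>E g)))"
 proof (rule linrelI)
  fix g assume g: "g \<in> carrier GE"
  obtain d where d: "d \<in> carrier D" "\<sigma> (?c (\<pi>E g)) = ?i d" using lin_closed[OF l1 g] by (rule coset_cases)
  obtain g' where "g' \<in> carrier GE" "\<pi>E g' = d" using proj_surj[OF d(1)] by blast
  thus "\<exists>g'\<in>carrier GE. g' \<in> carrier GE & ?i (\<pi>E g') = \<sigma> (?c (\<pi>E g))" using d by auto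
 next
  fix g h g' h' assume c: "g \<in> carrier GE" "h \<in> carrier GE" "g' \<in> carrier GE" "h' \<in> carrier GE"
   and e: "g' \<in> carrier GE & ?i (\<pi>E g') = \<sigma> (?c (\<pi>E g))" "h' \<in> carrier GE & ?i (\<pi>E h') = \<sigma> (?c (\<pi>E h))"
  have "?i (\<pi>E (g' \<oplus>[GE] h')) = \<sigma> (?c (\<pi>E (g \<oplus>[GE] h)))"
   unfolding lin_add[OF l1 c(1,2)] lin_add[OF l2 c(3,4)] using e by simp
  thus "g' \<oplus>[GE] h' \<in> carrier GE & ?i (\<pi>E (g' \<oplus>[GE] h')) = \<sigma> (?c (\<pi>E (g \<oplus>[GE] h)))"
   using GE.a_closed[OF c(3,4)] by simp
 next
  fix r g g' assume c: "r \<in> carrier R" "g \<in> carrier GE" "g' \<in> carrier GE"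
   and e: "g' \<in> carrier GE & ?i (\<pi>E g') = \<sigma> (?c (\<pi>E g))"
  have "?i (\<pi>E (r \<odot>[GE] g')) = \<sigma> (?c (\<pi>E (r \<odot>[GE] g)))"
   unfolding lin_smult[OF l1 c(1,2)] lin_smult[OF l2 c(1,3)] using e by simp
  thus "r \<odot>[GE] g' \<in> carrier GE & ?i (\<pi>E (r \<odot>[GE] g')) = \<sigma> (?c (\<pi>E (r \<odot>[GE] g)))"
   using GE.smult_closed[OF c(1,3)] by simp
 qed
 obtain a where a: "linear R GE GE a"
  "\<forall>g\<in>carrier GE. a g \<in> carrier GE & ?i (\<pi>E (a g)) = \<sigma> (?c (\<pi>E g))"
  by (rule selectsD[OF free_selects[OF is_cring GE] rel])
 have ac: "a g \<in> carrier GE" and ai: "?i (\<pi>E (a g)) = \<sigma> (?c (\<pi>E g))" if "g \<in> carrier GE" for g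
  using bspec[OF a(2) that] by simp_all
 have diffF: "a g \<ominus>[GE] g \<in> GF" if g: "g \<in> carrier GE" for g
 proof -
  have cm: "?c (\<pi>E g) \<in> carrier Mq" by (rule coset_closed[OF \<pi>c[OF g]])
  have "?c (\<pi>E (a g)) = pq (?i (\<pi>E (a g)))" by (rule pq_coset[OF \<pi>c[OF ac[OF g]], symmetric])
  also have "\<dots> = ?c (\<pi>E g)" unfolding ai[OF g] by (rule bspec[OF \<sigma>p cm])
  finally have "\<pi>E (a g) \<ominus>[D] \<pi>E g \<in> sums"
   using coset_eq_iff[OF DM sums_submodule \<pi>c[OF ac[OF g]] \<pi>c[OF g]] by simp
  moreover have "\<pi>E (a g \<ominus>[GE] g) = \<pi>E (a g) \<ominus>[D] \<pi>E g"
   by (rule lin_minus[OF GE DM carrier_submodule[OF GE] proj_lin ac[OF g] g])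
  ultimately show ?thesis using GE.minus_closed[OF ac[OF g] g] by (simp add: GF_def)
 qed
 have aB: "a g \<in> GB" if g: "g \<in> GF" for g
 proof -
  have gc: "g \<in> carrier GE" and gs: "\<pi>E g \<in> sums" using g by (simp_all add: GF_def)
  have "?c (\<pi>E g) = \<zero>[Mq]" by (rule iffD2[OF M_zero[OF \<pi>c[OF gc]] gs])
  hence "?i (\<pi>E (a g)) = \<zero>[Bq]"
   unfolding ai[OF gc] using lin_zero[OF Mq Bq carrier_submodule[OF Mq] \<sigma>l] by simp
  hence "\<pi>E (a g) \<in> ints" using B_zero[OF \<pi>c[OF ac[OF gc]]] by simp
  thus ?thesis using ac[OF gc] by (simp add: GB_def ints_def)
 qed
 have \<Gamma>B: "linrel R GE GB U \<Gamma>"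
  using linrel_comp[OF \<Gamma> lin_ident[OF GBc]] GBF by blast
 obtain b where b: "lin R GE GB U b" "\<forall>g\<in>GB. \<Gamma> g (b g)"
  by (rule selectsD[OF GB \<Gamma>B])
 have l3: "linear R GE GE (%g. a g \<ominus>[GE] g)"
  by (rule lin_diff[OF GE GE carrier_submodule[OF GE] a(1) lin_ident[OF subset_refl]])
 have \<Gamma>C: "linrel R GE (carrier GE) U (%g. \<Gamma> (a g \<ominus>[GE] g))" by (rule linrel_comp[OF \<Gamma> l3 diffF])
 obtain c where c: "linear R GE U c" "\<forall>g\<in>carrier GE. \<Gamma> (a g \<ominus>[GE] g) (c g)"
  by (rule selectsD[OF free_selects[OF is_cring U] \<Gamma>C])
 have GFc: "GF <= carrier GE" by (auto simp: GF_def)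
 have "lin R GE GF U (%z. b (a z) \<ominus>[U] c z)"
  by (rule lin_diff[OF GE U GF_submodule lin_compose[OF lin_subset[OF a(1) GFc] b(1) aB] lin_subset[OF c(1) GFc]])
 moreover have "\<Gamma> z (b (a z) \<ominus>[U] c z)" if z: "z \<in> GF" for z
 proof -
  have zc: "z \<in> carrier GE" using z GFc by blast
  have "\<Gamma> (a z \<ominus>[GE] (a z \<ominus>[GE] z)) (b (a z) \<ominus>[U] c z)"
   by (rule linrel_minus[OF GE U GF_submodule \<Gamma> subsetD[OF GBF aB[OF z]] diffF[OF zc] lin_closed[OF b(1) aB[OF z]]
      lin_closed[OF c(1) zc]]) (rule bspec[OF b(2) aB[OF z]], rule bspec[OF c(2) zc])
  moreover have "a z \<ominus>[GE] (a z \<ominus>[GE] z) = z"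
   using ac[OF zc] zc by (simp add: a_minus_def GE.minus_add GE.a_assoc[symmetric] GE.r_neg)
  ultimately show ?thesis by simp
 qed
 ultimately show "\<exists>h. lin R GE GF U h & (\<forall>x\<in>GF. \<Gamma> x (h x))" by (intro exI conjI ballI)
qed

text \<open>  \<open>P\<close> is the module of fractions of \<open>E\<close>, given as a quotient of \<open>Q\<^sup>(\<^sup>E\<^sup>)\<close> by \<open>q\<close>; the maps \<open>\<alpha>\<close> and \<open>\<beta>\<close> make it a retract
 of \<open>Q\<^sup>(\<^sup>Z\<^sup>)\<close>.  Let \<open>HE\<close> be the preimage of \<open>sat\<close> in the free module \<open>R\<^sup>(\<^sup>X\<^sup>\<times>\<^sup>E\<^sup>)\<close>, so that the quotient is \<open>P\<close>.  Linear maps from \<open>HE\<close> into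
 \<open>C\<close> extend to the free module, by comparison with the presentation of \<open>Q\<^sup>(\<^sup>Z\<^sup>)\<close>.  But \<open>HE\<close> is also the kernel of a map from
 \<open>GF\<close> onto \<open>E\<close>, and \<open>GF\<close> is projective; a second comparison, with the free cover of \<open>E\<close>, gives the claim.\<close>

theorem syzygy_extends:
 fixes C :: "('a, 'c) module" and P :: "('a, 'p) module" and Z :: "'z set"
 assumes C: "module R C" and ext0: "extends R F N C" and P: "module R P"
  and q: "linear R D P q" "!!m. m \<in> carrier P ==> \<exists>d\<in>carrier D. q d = m"
   "!!d. d \<in> carrier D ==> q d = \<zero>[P] \<longleftrightarrow> d \<in> sat"
  and \<alpha>: "linear R D (pow Z) \<alpha>" "!!n. n \<in> sat ==> \<alpha> n = \<zero>[pow Z]"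
  and \<beta>: "linear R (pow Z) P \<beta>" "!!d. d \<in> carrier D ==> \<beta> (\<alpha> d) = q d"
 shows "extends R FY (carrier (syzygy R E)) C"
proof -
 interpret P: module R P by fact
 have GZ: "module R (G Z)" by (rule G_module)
 have pZ: "module R (pow Z)" by (rule pow_module)
 define HE where "HE = {g \<in> carrier GE. \<pi>E g \<in> sat}"
 define HZ where "HZ = {g \<in> carrier (G Z). proj Z g = \<zero>[pow Z]}"
 have HE: "submodule HE R GE"
  unfolding HE_def by (rule lin_kernel_submodule[OF GE DM carrier_submodule[OF GE] proj_lin sat_submodule])
 have \<pi>c: "\<pi>E g \<in> carrier D" if "g \<in> carrier GE" for g by (rule proj_closed[OF that])
 have q\<pi>: "linear R GE P (%g. q (\<pi>E g))" by (rule lin_compose[OF proj_lin q(1) \<pi>c])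
 have \<alpha>\<pi>: "linear R GE (pow Z) (%g. \<alpha> (\<pi>E g))" by (rule lin_compose[OF proj_lin \<alpha>(1) \<pi>c])
 have \<beta>\<pi>: "linear R (G Z) P (%g. \<beta> (proj Z g))" by (rule lin_compose[OF proj_lin \<beta>(1) proj_closed])
 have rela: "linrel R GE (carrier GE) (G Z) (%g g'. g' \<in> carrier (G Z) & proj Z g' = \<alpha> (\<pi>E g))"
 proof (rule linrelI)
  show "\<exists>g'\<in>carrier (G Z). g' \<in> carrier (G Z) & proj Z g' = \<alpha> (\<pi>E g)" if "g \<in> carrier GE" for g
   using proj_surj[OF lin_closed[OF \<alpha>\<pi> that]] by blast
  show "g' \<oplus>[G Z] h' \<in> carrier (G Z) & proj Z (g' \<oplus>[G Z] h') = \<alpha> (\<pi>E (g \<oplus>[GE] h))"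
   if "g \<in> carrier GE" "h \<in> carrier GE" "g' \<in> carrier (G Z)" "h' \<in> carrier (G Z)"
    "g' \<in> carrier (G Z) & proj Z g' = \<alpha> (\<pi>E g)" "h' \<in> carrier (G Z) & proj Z h' = \<alpha> (\<pi>E h)" for g h g' h'
   unfolding lin_add[OF \<alpha>\<pi> that(1,2)] lin_add[OF proj_lin that(3,4)]
   using that module.axioms(2)[OF GZ] by (simp add: abelian_groupE(1))
  show "r \<odot>[G Z] g' \<in> carrier (G Z) & proj Z (r \<odot>[G Z] g') = \<alpha> (\<pi>E (r \<odot>[GE] g))"
   if "r \<in> carrier R" "g \<in> carrier GE" "g' \<in> carrier (G Z)" "g' \<in> carrier (G Z) & proj Z g' = \<alpha> (\<pi>E g)" for r g g'
   unfolding lin_smult[OF \<alpha>\<pi> that(1,2)] lin_smult[OF proj_lin that(1,3)]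
   using that module.smult_closed[OF GZ] by simp
 qed
 obtain a where a: "linear R GE (G Z) a" "\<forall>g\<in>carrier GE. a g \<in> carrier (G Z) & proj Z (a g) = \<alpha> (\<pi>E g)"
  by (rule selectsD[OF free_selects[OF is_cring GZ] rela])
 have relb: "linrel R (G Z) (carrier (G Z)) GE (%g' g. g \<in> carrier GE & q (\<pi>E g) = \<beta> (proj Z g'))"
 proof (rule linrelI)
  show "\<exists>g\<in>carrier GE. g \<in> carrier GE & q (\<pi>E g) = \<beta> (proj Z g')" if g': "g' \<in> carrier (G Z)" for g'
  proof -
   obtain d where d: "d \<in> carrier D" "q d = \<beta> (proj Z g')" using q(2)[OF lin_closed[OF \<beta>\<pi> g']] by blast
   show ?thesis using proj_surj[OF d(1)] d(2) by blast
  qed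
  show "g \<oplus>[GE] h \<in> carrier GE & q (\<pi>E (g \<oplus>[GE] h)) = \<beta> (proj Z (g' \<oplus>[G Z] h'))"
   if "g' \<in> carrier (G Z)" "h' \<in> carrier (G Z)" "g \<in> carrier GE" "h \<in> carrier GE"
    "g \<in> carrier GE & q (\<pi>E g) = \<beta> (proj Z g')" "h \<in> carrier GE & q (\<pi>E h) = \<beta> (proj Z h')" for g h g' h'
   unfolding lin_add[OF \<beta>\<pi> that(1,2)] lin_add[OF q\<pi> that(3,4)]
   using that GE.a_closed by simp
  show "r \<odot>[GE] g \<in> carrier GE & q (\<pi>E (r \<odot>[GE] g)) = \<beta> (proj Z (r \<odot>[G Z] g'))"
   if "r \<in> carrier R" "g' \<in> carrier (G Z)" "g \<in> carrier GE" "g \<in> carrier GE & q (\<pi>E g) = \<beta> (proj Z g')" for r g g'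
   unfolding lin_smult[OF \<beta>\<pi> that(1,2)] lin_smult[OF q\<pi> that(1,3)]
   using that GE.smult_closed by simp
 qed
 obtain b where b: "linear R (G Z) GE b" "\<forall>g'\<in>carrier (G Z). b g' \<in> carrier GE & q (\<pi>E (b g')) = \<beta> (proj Z g')"
  by (rule selectsD[OF free_selects[OF is_cring GE] relb])
 have extH: "extends R GE HE C"
 proof (rule extends_transfer[OF GE GZ C HE a(1) _ _ b(1)])
  show "a g \<in> carrier (G Z)" if "g \<in> carrier GE" for g using a(2) that by blast
  show "a g \<in> HZ" if g: "g \<in> HE" for g
  proof -
   have "g \<in> carrier GE" "\<pi>E g \<in> sat" using g by (simp_all add: HE_def)
   thus ?thesis using a(2) \<alpha>(2) by (simp add: HZ_def)
  qed
  show "b g' \<in> HE" if g': "g' \<in> HZ" for g'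
  proof -
   have c: "g' \<in> carrier (G Z)" "proj Z g' = \<zero>[pow Z]" using g' by (simp_all add: HZ_def)
   have bc: "b g' \<in> carrier GE" "q (\<pi>E (b g')) = \<beta> (proj Z g')" using b(2) c(1) by blast+
   have "q (\<pi>E (b g')) = \<zero>[P]" unfolding bc(2) c(2) by (rule lin_zero[OF pZ P carrier_submodule[OF pZ] \<beta>(1)])
   thus ?thesis using q(3)[OF \<pi>c[OF bc(1)]] bc(1) by (simp add: HE_def)
  qed
  show "HZ <= carrier (G Z)" by (auto simp: HZ_def)
  show "b (a g) \<ominus>[GE] g \<in> HE" if g: "g \<in> carrier GE" for g
  proof -
   have ag: "a g \<in> carrier (G Z)" "proj Z (a g) = \<alpha> (\<pi>E g)" using a(2) g by blast+
   have bc: "b (a g) \<in> carrier GE" "q (\<pi>E (b (a g))) = \<beta> (proj Z (a g))" using b(2) ag(1) by blast+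
   have "q (\<pi>E (b (a g) \<ominus>[GE] g)) = q (\<pi>E (b (a g))) \<ominus>[P] q (\<pi>E g)"
    by (rule lin_minus[OF GE P carrier_submodule[OF GE] q\<pi> bc(1) g])
   also have "\<dots> = \<zero>[P]" unfolding bc(2) ag(2) \<beta>(2)[OF \<pi>c[OF g]] using lin_closed[OF q\<pi> g] by simp
   finally show ?thesis using q(3)[OF \<pi>c[OF GE.minus_closed[OF bc(1) g]]] GE.minus_closed[OF bc(1) g] by (simp add: HE_def)
  qed
  show "\<exists>k. linear R (G Z) C k & (\<forall>x\<in>HZ. k x = f x)" if "lin R (G Z) HZ C f" for f
   using kernel_extends[OF C ext0, of Z] that unfolding extends_def HZ_def by blast
 qed
 have rele: "linrel R FY (carrier FY) GE (%y g. g \<in> carrier GE & \<pi>E g = scale y)"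
 proof (rule linrelI)
  show "\<exists>g\<in>carrier GE. g \<in> carrier GE & \<pi>E g = scale y" if "y \<in> carrier FY" for y
   using proj_surj[OF scale_closed[OF that]] by blast
  show "g \<oplus>[GE] h \<in> carrier GE & \<pi>E (g \<oplus>[GE] h) = scale (y \<oplus>[FY] z)"
   if "y \<in> carrier FY" "z \<in> carrier FY" "g \<in> carrier GE" "h \<in> carrier GE"
    "g \<in> carrier GE & \<pi>E g = scale y" "h \<in> carrier GE & \<pi>E h = scale z" for g h y z
   unfolding lin_add[OF scale_lin that(1,2)] lin_add[OF proj_lin that(3,4)]
   using that GE.a_closed by simp
  show "r \<odot>[GE] g \<in> carrier GE & \<pi>E (r \<odot>[GE] g) = scale (r \<odot>[FY] y)"
   if "r \<in> carrier R" "y \<in> carrier FY" "g \<in> carrier GE" "g \<in> carrier GE & \<pi>E g = scale y" for r g y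
   unfolding lin_smult[OF scale_lin that(1,2)] lin_smult[OF proj_lin that(1,3)]
   using that GE.smult_closed by simp
 qed
 obtain e where e: "linear R FY GE e" "\<forall>y\<in>carrier FY. e y \<in> carrier GE & \<pi>E (e y) = scale y"
  by (rule selectsD[OF free_selects[OF is_cring GE] rele])
 have sc: "scale y \<in> sums" if "y \<in> carrier FY" for y using ints_sums that by (auto simp: ints_def)
 have relw: "linrel R GE GF FY (%g y. \<pi>E g \<ominus>[D] scale y \<in> sat)"
 proof (rule linrelI)
  note SS = submodule_closed[OF DM sat_submodule]
  show "\<exists>y\<in>carrier FY. \<pi>E g \<ominus>[D] scale y \<in> sat" if g: "g \<in> GF" for g
  proof -
   have "\<pi>E g \<in> sums" using g by (simp add: GF_def)
   then obtain y n where y: "y \<in> carrier FY" "n \<in> sat" "\<pi>E g = scale y \<oplus>[D] n"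
    unfolding sums_def ints_def by blast
   have "\<pi>E g \<ominus>[D] scale y = n"
    unfolding y(3) using scale_closed[OF y(1)] sat_closed[OF y(2)]
    by (simp add: a_minus_def D.a_comm[of "scale y" n] D.a_assoc D.r_neg)
   hence "\<pi>E g \<ominus>[D] scale y \<in> sat" using y(2) by simp
   thus ?thesis using y(1) by blast
  qed
  show "\<pi>E (g \<oplus>[GE] h) \<ominus>[D] scale (y \<oplus>[FY] z) \<in> sat"
   if "g \<in> GF" "h \<in> GF" "y \<in> carrier FY" "z \<in> carrier FY" "\<pi>E g \<ominus>[D] scale y \<in> sat" "\<pi>E h \<ominus>[D] scale z \<in> sat" for g h y z
  proof -
   have c: "g \<in> carrier GE" "h \<in> carrier GE" using that(1,2) by (simp_all add: GF_def)
   show ?thesis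
    unfolding lin_add[OF scale_lin that(3,4)] lin_add[OF proj_lin c]
     D.add_minus_add[OF \<pi>c[OF c(1)] \<pi>c[OF c(2)] scale_closed[OF that(3)] scale_closed[OF that(4)]]
    by (rule SS(4)[OF that(5,6)])
  qed
  show "\<pi>E (r \<odot>[GE] g) \<ominus>[D] scale (r \<odot>[FY] y) \<in> sat"
   if "r \<in> carrier R" "g \<in> GF" "y \<in> carrier FY" "\<pi>E g \<ominus>[D] scale y \<in> sat" for r g y
  proof -
   have c: "g \<in> carrier GE" using that(2) by (simp add: GF_def)
   show ?thesis
    unfolding lin_smult[OF scale_lin that(1,3)] lin_smult[OF proj_lin that(1) c]
     D.smult_minus[OF that(1) \<pi>c[OF c] scale_closed[OF that(3)], symmetric]
    by (rule SS(6)[OF that(1,4)])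
  qed
 qed
 obtain w where w: "lin R GE GF FY w" "\<forall>g\<in>GF. \<pi>E g \<ominus>[D] scale (w g) \<in> sat"
  by (rule selectsD[OF GF_selects[OF FY] relw])
 have K: "carrier (syzygy R E) = {y \<in> carrier FY. cov y = \<zero>[E]}" by (rule syzygy_carrier)
 have eGF: "e y \<in> GF" if "y \<in> carrier FY" for y
  using e(2) that sc[OF that] by (simp add: GF_def)
 note SS = submodule_closed[OF DM sat_submodule]
 show ?thesis
 proof (rule extends_transfer[OF FY GE C syzygy_submodule[OF E] e(1) eGF _ w(1)])
  show "e y \<in> HE" if y: "y \<in> carrier (syzygy R E)" for y
   using y e(2) sat_scale[of y] unfolding K HE_def by auto
  show "w g \<in> carrier (syzygy R E)" if g: "g \<in> HE" for g
  proof -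
   have gc: "g \<in> carrier GE" "\<pi>E g \<in> sat" using g by (simp_all add: HE_def)
   hence gF: "g \<in> GF" using sat_sums by (auto simp: GF_def)
   have wc: "w g \<in> carrier FY" by (rule lin_closed[OF w(1) gF])
   have "\<pi>E g \<ominus>[D] (\<pi>E g \<ominus>[D] scale (w g)) \<in> sat" by (rule SS(5)[OF gc(2) bspec[OF w(2) gF]])
   moreover have "\<pi>E g \<ominus>[D] (\<pi>E g \<ominus>[D] scale (w g)) = scale (w g)"
    using \<pi>c[OF gc(1)] scale_closed[OF wc] by (simp add: a_minus_def D.minus_add D.a_assoc[symmetric] D.r_neg)
   ultimately show ?thesis using sat_scale[OF wc] wc by (simp add: K)
  qed
  show "HE <= GF" using sat_sums by (auto simp: HE_def GF_def)
  show "w (e y) \<ominus>[FY] y \<in> carrier (syzygy R E)" if y: "y \<in> carrier FY" for y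
  proof -
   have ey: "\<pi>E (e y) = scale y" using e(2) y by blast
   have wc: "w (e y) \<in> carrier FY" by (rule lin_closed[OF w(1) eGF[OF y]])
   have "scale y \<ominus>[D] scale (w (e y)) \<in> sat" using bspec[OF w(2) eGF[OF y]] unfolding ey .
   hence "\<ominus>[D] (scale y \<ominus>[D] scale (w (e y))) \<in> sat" by (rule SS(3))
   moreover have "\<ominus>[D] (scale y \<ominus>[D] scale (w (e y))) = scale (w (e y)) \<ominus>[D] scale y"
    using scale_closed[OF y] scale_closed[OF wc] by (simp add: a_minus_def D.minus_add D.a_comm)
   moreover have "scale (w (e y) \<ominus>[FY] y) = scale (w (e y)) \<ominus>[D] scale y"
    by (rule lin_minus[OF FY DM carrier_submodule[OF FY] scale_lin wc y])
   ultimately show ?thesis using sat_scale[OF FY.minus_closed[OF wc y]] FY.minus_closed[OF wc y] by (simp add: K)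
  qed
  show "\<exists>k. lin R GE GF C k & (\<forall>x\<in>HE. k x = f x)" if f: "lin R GE HE C f" for f
  proof -
   obtain k where k: "linear R GE C k" "\<forall>x\<in>HE. k x = f x"
    using extH f unfolding extends_def by blast
   have "lin R GE GF C k" by (rule lin_subset[OF k(1)]) (auto simp: GF_def)
   thus ?thesis using k(2) by blast
  qed
 qed
qed

end

end

end

section \<open>Tensor products\<close>

definition bilin ::
 "('a, 'k) ring_scheme => ('a, 'm) module => ('a, 'n) module => ('a, 'v) module => ('m => 'n => 'v) => bool" where
 "bilin R M N V \<beta> \<longleftrightarrow> (\<forall>y\<in>carrier N. linear R M V (%x. \<beta> x y)) &
   (\<forall>x\<in>carrier M. linear R N V (\<beta> x))"

lemma bilinI:
 assumes "!!y. y \<in> carrier N ==> linear R M V (%x. \<beta> x y)"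
  and "!!x. x \<in> carrier M ==> linear R N V (\<beta> x)"
 shows "bilin R M N V \<beta>"
 using assms by (auto simp: bilin_def)

context
 fixes R :: "('a, 'k) ring_scheme" (structure) and M :: "('a, 'm) module" and N :: "('a, 'n) module"
 assumes M: "module R M" and N: "module R N"
begin

interpretation M: module R M by (rule M)
interpretation N: module R N by (rule N)

abbreviation FMN where "FMN \<equiv> free_module R (carrier M \<times> carrier N)"
abbreviation TR where "TR \<equiv> tensor_relations R M N"
abbreviation T where "T \<equiv> tensor R M N"
abbreviation pure where "pure \<equiv> pure_tensor R M N"
abbreviation bv :: "'m \<times> 'n => 'm \<times> 'n => 'a" where "bv \<equiv> basis_vector R"

interpretation FMN: module R FMN by (rule free_module_module[OF M.R.is_cring])

definition gens :: "('m \<times> 'n => 'a) set" where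
 "gens = {bv (x \<oplus>[M] x', y) \<ominus>[FMN] (bv (x, y) \<oplus>[FMN] bv (x', y)) | x x' y.
      x \<in> carrier M & x' \<in> carrier M & y \<in> carrier N}
   \<union> {bv (x, y \<oplus>[N] y') \<ominus>[FMN] (bv (x, y) \<oplus>[FMN] bv (x, y')) | x y y'.
      x \<in> carrier M & y \<in> carrier N & y' \<in> carrier N}
   \<union> {bv (r \<odot>[M] x, y) \<ominus>[FMN] r \<odot>[FMN] bv (x, y) | r x y.
      r \<in> carrier R & x \<in> carrier M & y \<in> carrier N}
   \<union> {bv (x, r \<odot>[N] y) \<ominus>[FMN] r \<odot>[FMN] bv (x, y) | r x y.
      r \<in> carrier R & x \<in> carrier M & y \<in> carrier N}"

lemma TR_span: "TR = submodule_span R FMN gens"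
 unfolding tensor_relations_def Let_def gens_def ..

lemma bv_closed: "x \<in> carrier M ==> y \<in> carrier N ==> bv (x, y) \<in> carrier FMN"
 by (rule basis_vector_closed[OF M.R.is_cring]) simp

lemma gens_closed: "gens <= carrier FMN"
proof
 fix g assume "g \<in> gens"
 thus "g \<in> carrier FMN"
  unfolding gens_def
  by (elim UnE CollectE exE conjE) (simp_all only: FMN.minus_closed FMN.a_closed FMN.smult_closed bv_closed
   M.a_closed N.a_closed M.smult_closed N.smult_closed)
qed

lemma TR_submodule: "submodule TR R FMN"
proof (rule submoduleI'[OF FMN.module_axioms])
 note s = submodule_closed[OF FMN.module_axioms]
 have c: "submodule (carrier FMN) R FMN" by (rule carrier_submodule[OF FMN.module_axioms])
 show "TR <= carrier FMN" unfolding TR_span submodule_span_def using c gens_closed by blast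
 show "\<zero>[FMN] \<in> TR" unfolding TR_span submodule_span_def using s(2) by blast
 show "x \<oplus>[FMN] y \<in> TR" if "x \<in> TR" "y \<in> TR" for x y
  using that unfolding TR_span submodule_span_def using s(4) by blast
 show "r \<odot>[FMN] x \<in> TR" if "r \<in> carrier R" "x \<in> TR" for r x
  using that unfolding TR_span submodule_span_def using s(6) by blast
qed

lemma gens_TR: "gens <= TR"
 unfolding TR_span submodule_span_def by blast

lemma TR_least: "submodule A R FMN ==> gens <= A ==> TR <= A"
 unfolding TR_span submodule_span_def by blast

lemma T_eq: "T = quotient_module FMN TR"
 by (simp add: tensor_def)

lemma T_module: "module R T"
 unfolding T_eq by (rule quotient_module_module[OF FMN.module_axioms TR_submodule])

lemma pure_eq: "pure x y = TR +>[FMN] bv (x, y)"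
 by (simp add: pure_tensor_def)

lemma pure_closed: "x \<in> carrier M ==> y \<in> carrier N ==> pure x y \<in> carrier T"
 unfolding pure_eq T_eq by (rule coset_closed[OF bv_closed])

lemma coset_T_lin: "linear R FMN T (%f. TR +>[FMN] f)"
 unfolding T_eq by (rule coset_lin[OF FMN.module_axioms TR_submodule])

lemma pure_bilin: "bilin R M N T pure"
proof (rule bilinI; rule linI)
 note ceq = iffD2[OF coset_eq_iff[OF FMN.module_axioms TR_submodule]]
 show "pure x y \<in> carrier T" "pure x y \<in> carrier T" if "x \<in> carrier M" "y \<in> carrier N" for x y
  using that by (simp_all add: pure_closed)
 show "pure (x \<oplus>[M] x') y = pure x y \<oplus>[T] pure x' y"
  if c: "y \<in> carrier N" "x \<in> carrier M" "x' \<in> carrier M" for x x' y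
  unfolding pure_eq lin_add[OF coset_T_lin bv_closed[OF c(2,1)] bv_closed[OF c(3,1)], symmetric]
 proof (rule ceq)
  show "bv (x \<oplus>[M] x', y) \<ominus>[FMN] (bv (x, y) \<oplus>[FMN] bv (x', y)) \<in> TR"
   by (rule subsetD[OF gens_TR]) (use c in "unfold gens_def, blast")
 qed (use c in "simp_all add: bv_closed del: free_module_sel")
 show "pure x (y \<oplus>[N] y') = pure x y \<oplus>[T] pure x y'"
  if c: "x \<in> carrier M" "y \<in> carrier N" "y' \<in> carrier N" for x y y'
  unfolding pure_eq lin_add[OF coset_T_lin bv_closed[OF c(1,2)] bv_closed[OF c(1,3)], symmetric]
 proof (rule ceq)
  show "bv (x, y \<oplus>[N] y') \<ominus>[FMN] (bv (x, y) \<oplus>[FMN] bv (x, y')) \<in> TR"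
   by (rule subsetD[OF gens_TR]) (use c in "unfold gens_def, blast")
 qed (use c in "simp_all add: bv_closed del: free_module_sel")
 show "pure (r \<odot>[M] x) y = r \<odot>[T] pure x y"
  if c: "y \<in> carrier N" "r \<in> carrier R" "x \<in> carrier M" for r x y
  unfolding pure_eq lin_smult[OF coset_T_lin c(2) bv_closed[OF c(3,1)], symmetric]
 proof (rule ceq)
  show "bv (r \<odot>[M] x, y) \<ominus>[FMN] r \<odot>[FMN] bv (x, y) \<in> TR"
   by (rule subsetD[OF gens_TR]) (use c in "unfold gens_def, blast")
 qed (use c in "simp_all add: bv_closed del: free_module_sel")
 show "pure x (r \<odot>[N] y) = r \<odot>[T] pure x y"
  if c: "x \<in> carrier M" "r \<in> carrier R" "y \<in> carrier N" for r x y
  unfolding pure_eq lin_smult[OF coset_T_lin c(2) bv_closed[OF c(1,3)], symmetric]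
 proof (rule ceq)
  show "bv (x, r \<odot>[N] y) \<ominus>[FMN] r \<odot>[FMN] bv (x, y) \<in> TR"
   by (rule subsetD[OF gens_TR]) (use c in "unfold gens_def, blast")
 qed (use c in "simp_all add: bv_closed del: free_module_sel")
qed

lemma pure_add_left: "x \<in> carrier M ==> x' \<in> carrier M ==> y \<in> carrier N ==> pure (x \<oplus>[M] x') y = pure x y \<oplus>[T] pure x' y"
 and pure_add_right: "x \<in> carrier M ==> y \<in> carrier N ==> y' \<in> carrier N ==> pure x (y \<oplus>[N] y') = pure x y \<oplus>[T] pure x y'"
 and pure_smult_left: "r \<in> carrier R ==> x \<in> carrier M ==> y \<in> carrier N ==> pure (r \<odot>[M] x) y = r \<odot>[T] pure x y"
 and pure_smult_right: "r \<in> carrier R ==> x \<in> carrier M ==> y \<in> carrier N ==> pure x (r \<odot>[N] y) = r \<odot>[T] pure x y"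
 using pure_bilin unfolding bilin_def lin_def by simp_all

lemma tensor_generated:
 assumes A: "submodule A R T" and p: "!!x y. x \<in> carrier M ==> y \<in> carrier N ==> pure x y \<in> A" and t: "t \<in> carrier T"
 shows "t \<in> A"
proof -
 note AA = submodule_closed[OF T_module A]
 obtain f where f: "f \<in> carrier FMN" "t = TR +>[FMN] f"
  using t unfolding T_eq by (rule coset_cases)
 have "TR +>[FMN] f \<in> A" using M.R.is_cring f(1)
 proof (induction rule: free_module_induct)
  case zero
  have "TR +>[FMN] \<zero>[FMN] = \<zero>[T]"
   by (rule lin_zero[OF FMN.module_axioms T_module carrier_submodule[OF FMN.module_axioms] coset_T_lin])
  thus ?case using AA(2) by (simp add: free_module_sel)
 next
  case (add f g)
  thus ?case using AA(4) by (simp only: lin_add[OF coset_T_lin])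
 next
  case (smult r f)
  thus ?case using AA(6) by (simp only: lin_smult[OF coset_T_lin])
 next
  case (basis z)
  thus ?case using p by (auto simp: pure_eq)
 qed
 thus ?thesis using f(2) by simp
qed

lemma lin_eq_on_tensor:
 assumes V: "module R V" and g: "linear R T V g" and h: "linear R T V h"
  and eq: "!!x y. x \<in> carrier M ==> y \<in> carrier N ==> g (pure x y) = h (pure x y)" and t: "t \<in> carrier T"
 shows "g t = h t"
proof -
 interpret V: module R V by (rule V)
 have d: "linear R T V (%t. g t \<ominus>[V] h t)"
  by (rule lin_diff[OF T_module V carrier_submodule[OF T_module] g h])
 have "t \<in> {t \<in> carrier T. g t \<ominus>[V] h t \<in> {\<zero>[V]}}"
 proof (rule tensor_generated[OF lin_kernel_submodule[OF T_module V carrier_submodule[OF T_module] d zero_submodule[OF V]] _ t])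
  fix x y assume "x \<in> carrier M" "y \<in> carrier N"
  thus "pure x y \<in> {t \<in> carrier T. g t \<ominus>[V] h t \<in> {\<zero>[V]}}"
   using eq lin_closed[OF h pure_closed] pure_closed by simp
 qed
 thus ?thesis using lin_closed[OF g t] lin_closed[OF h t] by (simp add: V.minus_eq_zero_iff)
qed

definition lift :: "('a, 'v) module => ('m \<times> 'n => 'v) => ('m \<times> 'n => 'a) set => 'v" where
 "lift V b C = the_elem (linear_ext R (carrier M \<times> carrier N) V b ` C)"

lemma tensor_lift:
 fixes V :: "('a, 'v) module"
 assumes V: "module R V" and \<beta>: "bilin R M N V \<beta>" and b: "!!x y. x \<in> carrier M ==> y \<in> carrier N ==> b (x, y) = \<beta> x y"
 shows lift_lin: "linear R T V (lift V b)"
  and lift_pure: "!!x y. x \<in> carrier M ==> y \<in> carrier N ==> lift V b (pure x y) = \<beta> x y"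
proof -
 interpret V: module R V by (rule V)
 have \<beta>1: "linear R M V (%x. \<beta> x y)" if "y \<in> carrier N" for y using \<beta> that by (simp add: bilin_def)
 have \<beta>2: "linear R N V (\<beta> x)" if "x \<in> carrier M" for x using \<beta> that by (simp add: bilin_def)
 have bc: "b z \<in> carrier V" if "z \<in> carrier M \<times> carrier N" for z
  using that b lin_closed[OF \<beta>2] by auto
 let ?l = "linear_ext R (carrier M \<times> carrier N) V b"
 have l: "linear R FMN V ?l"
  by (rule linear_ext_lin[OF M.R.is_cring V]) (rule bc)
 have lb: "?l (bv (x, y)) = \<beta> x y" if "x \<in> carrier M" "y \<in> carrier N" for x y
 proof -
  have "?l (bv (x, y)) = b (x, y)"
   by (rule linear_ext_basis[OF M.R.is_cring V]) (use bc that in auto)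
  thus ?thesis using b that by simp
 qed
 note K = lin_kernel_submodule[OF FMN.module_axioms V carrier_submodule[OF FMN.module_axioms] l zero_submodule[OF V]]
 note lm = lin_minus[OF FMN.module_axioms V carrier_submodule[OF FMN.module_axioms] l]
 have z: "v \<ominus>[V] v' = \<zero>[V]" if "v = v'" "v' \<in> carrier V" for v v' using that by simp
 have "gens <= {f \<in> carrier FMN. ?l f \<in> {\<zero>[V]}}"
 proof
  fix g assume g: "g \<in> gens"
  have "?l g = \<zero>[V]"
   using g unfolding gens_def
  proof (elim UnE CollectE exE conjE)
   fix x x' y assume c: "g = bv (x \<oplus>[M] x', y) \<ominus>[FMN] (bv (x, y) \<oplus>[FMN] bv (x', y))" "x \<in> carrier M" "x' \<in> carrier M" "y \<in> carrier N"
   show ?thesis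
    unfolding c(1) lm[OF bv_closed[OF M.a_closed[OF c(2,3)] c(4)] FMN.a_closed[OF bv_closed[OF c(2,4)] bv_closed[OF c(3,4)]]]
     lin_add[OF l bv_closed[OF c(2,4)] bv_closed[OF c(3,4)]] lb[OF M.a_closed[OF c(2,3)] c(4)] lb[OF c(2,4)] lb[OF c(3,4)]
    by (rule z[OF lin_add[OF \<beta>1[OF c(4)] c(2,3)] V.a_closed[OF lin_closed[OF \<beta>1[OF c(4)] c(2)] lin_closed[OF \<beta>1[OF c(4)] c(3)]]])
  next
   fix x y y' assume c: "g = bv (x, y \<oplus>[N] y') \<ominus>[FMN] (bv (x, y) \<oplus>[FMN] bv (x, y'))" "x \<in> carrier M" "y \<in> carrier N" "y' \<in> carrier N"
   show ?thesis
    unfolding c(1) lm[OF bv_closed[OF c(2) N.a_closed[OF c(3,4)]] FMN.a_closed[OF bv_closed[OF c(2,3)] bv_closed[OF c(2,4)]]]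
     lin_add[OF l bv_closed[OF c(2,3)] bv_closed[OF c(2,4)]] lb[OF c(2) N.a_closed[OF c(3,4)]] lb[OF c(2,3)] lb[OF c(2,4)]
    by (rule z[OF lin_add[OF \<beta>2[OF c(2)] c(3,4)] V.a_closed[OF lin_closed[OF \<beta>2[OF c(2)] c(3)] lin_closed[OF \<beta>2[OF c(2)] c(4)]]])
  next
   fix r x y assume c: "g = bv (r \<odot>[M] x, y) \<ominus>[FMN] r \<odot>[FMN] bv (x, y)" "r \<in> carrier R" "x \<in> carrier M" "y \<in> carrier N"
   show ?thesis
    unfolding c(1) lm[OF bv_closed[OF M.smult_closed[OF c(2,3)] c(4)] FMN.smult_closed[OF c(2) bv_closed[OF c(3,4)]]]
     lin_smult[OF l c(2) bv_closed[OF c(3,4)]] lb[OF M.smult_closed[OF c(2,3)] c(4)] lb[OF c(3,4)]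
    by (rule z[OF lin_smult[OF \<beta>1[OF c(4)] c(2,3)] V.smult_closed[OF c(2) lin_closed[OF \<beta>1[OF c(4)] c(3)]]])
  next
   fix r x y assume c: "g = bv (x, r \<odot>[N] y) \<ominus>[FMN] r \<odot>[FMN] bv (x, y)" "r \<in> carrier R" "x \<in> carrier M" "y \<in> carrier N"
   show ?thesis
    unfolding c(1) lm[OF bv_closed[OF c(3) N.smult_closed[OF c(2,4)]] FMN.smult_closed[OF c(2) bv_closed[OF c(3,4)]]]
     lin_smult[OF l c(2) bv_closed[OF c(3,4)]] lb[OF c(3) N.smult_closed[OF c(2,4)]] lb[OF c(3,4)]
    by (rule z[OF lin_smult[OF \<beta>2[OF c(3)] c(2,4)] V.smult_closed[OF c(2) lin_closed[OF \<beta>2[OF c(3)] c(4)]]])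
  qed
  thus "g \<in> {f \<in> carrier FMN. ?l f \<in> {\<zero>[V]}}" using gens_closed g by auto
 qed
 hence TRK: "TR <= {f \<in> carrier FMN. ?l f \<in> {\<zero>[V]}}" by (rule TR_least[OF K])
 have lc: "lift V b (TR +>[FMN] f) = ?l f" if f: "f \<in> carrier FMN" for f
 proof -
  have fm: "f \<in> TR +>[FMN] f"
   unfolding a_r_coset_def'
   by (rule UN_I[OF submodule_closed(2)[OF FMN.module_axioms TR_submodule]]) (use FMN.l_zero[OF f] in simp)
  show ?thesis unfolding lift_def
  proof (rule the_elem_image_unique)
   show "TR +>[FMN] f ~= {}" using fm by force
   fix g assume g: "g \<in> TR +>[FMN] f"
   then obtain k where k: "k \<in> TR" "g = k \<oplus>[FMN] f" unfolding a_r_coset_def' by blast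
   have kc: "k \<in> carrier FMN" "?l k = \<zero>[V]" using subsetD[OF TRK k(1)] by auto
   show "?l g = ?l f" unfolding k(2) lin_add[OF l kc(1) f] kc(2) by (rule V.l_zero[OF lin_closed[OF l f]])
  qed
 qed
 show "linear R T V (lift V b)"
 proof (rule linI)
  fix C assume "C \<in> carrier T"
  then obtain f where f: "f \<in> carrier FMN" "C = TR +>[FMN] f" unfolding T_eq by (rule coset_cases)
  show "lift V b C \<in> carrier V" unfolding f(2) lc[OF f(1)] by (rule lin_closed[OF l f(1)])
  show "lift V b (r \<odot>[T] C) = r \<odot>[V] lift V b C" if r: "r \<in> carrier R" for r
   unfolding f(2) lin_smult[OF coset_T_lin r f(1), symmetric] lc[OF f(1)] lc[OF FMN.smult_closed[OF r f(1)]]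
   by (rule lin_smult[OF l r f(1)])
  fix C' assume "C' \<in> carrier T"
  then obtain f' where f': "f' \<in> carrier FMN" "C' = TR +>[FMN] f'" unfolding T_eq by (rule coset_cases)
  show "lift V b (C \<oplus>[T] C') = lift V b C \<oplus>[V] lift V b C'"
   unfolding f(2) f'(2) lin_add[OF coset_T_lin f(1) f'(1), symmetric] lc[OF f(1)] lc[OF f'(1)] lc[OF FMN.a_closed[OF f(1) f'(1)]]
   by (rule lin_add[OF l f(1) f'(1)])
 qed
 show "lift V b (pure x y) = \<beta> x y" if "x \<in> carrier M" "y \<in> carrier N" for x y
  unfolding pure_eq lc[OF bv_closed[OF that]] by (rule lb[OF that])
qed

end

lemma tensor_map_lin:
 assumes M: "module R M" and N: "module R N" and M': "module R M'" and N': "module R N'"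
  and f: "linear R M M' f" and g: "linear R N N' g"
 shows "linear R (tensor R M N) (tensor R M' N') (tensor_map R M N M' N' f g)"
  and "!!x y. x \<in> carrier M ==> y \<in> carrier N ==>
   tensor_map R M N M' N' f g (pure_tensor R M N x y) = pure_tensor R M' N' (f x) (g y)"
proof -
 let ?b = "%(x, y). pure_tensor R M' N' (f x) (g y)"
 have T': "module R (tensor R M' N')" by (rule T_module[OF M' N'])
 have fc: "f x \<in> carrier M'" if "x \<in> carrier M" for x by (rule lin_closed[OF f that])
 have gc: "g y \<in> carrier N'" if "y \<in> carrier N" for y by (rule lin_closed[OF g that])
 have bl: "bilin R M N (tensor R M' N') (%x y. pure_tensor R M' N' (f x) (g y))"
 proof (rule bilinI)
  show "linear R M (tensor R M' N') (%x. pure_tensor R M' N' (f x) (g y))" if y: "y \<in> carrier N" for y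
   using pure_bilin[OF M' N'] gc[OF y] by (intro lin_compose[OF f _ fc]) (auto simp: bilin_def)
  show "linear R N (tensor R M' N') (%y. pure_tensor R M' N' (f x) (g y))" if x: "x \<in> carrier M" for x
   using pure_bilin[OF M' N'] fc[OF x] by (intro lin_compose[OF g _ gc]) (auto simp: bilin_def)
 qed
 have eq: "tensor_map R M N M' N' f g C = lift R M N (tensor R M' N') ?b C" if "C \<in> carrier (tensor R M N)" for C
  using that by (simp add: tensor_map_def lift_def[OF M N])
 note L = tensor_lift[OF M N T' bl, of ?b]
 have "linear R (tensor R M N) (tensor R M' N') (lift R M N (tensor R M' N') ?b)"
  by (rule L(1)) simp
 thus "linear R (tensor R M N) (tensor R M' N') (tensor_map R M N M' N' f g)"
  by (rule lin_cong[OF _ carrier_submodule[OF T_module[OF M N]] T_module[OF M N]]) (rule eq)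
 show "tensor_map R M N M' N' f g (pure_tensor R M N x y) = pure_tensor R M' N' (f x) (g y)"
  if "x \<in> carrier M" "y \<in> carrier N" for x y
  unfolding eq[OF pure_closed[OF M N that]] by (rule L(2)[OF _ that]) simp
qed

text \<open>Tensoring the injective multiplication by \<open>s\<close> on \<open>R\<close> with a flat module.\<close>

lemma flat_torsion_free:
 fixes R :: "('a, 'k) ring_scheme" and E :: "('a, 'm) module"
 assumes flat: "flat_module TYPE('a) R E" and s: "s \<in> carrier R"
  and nz: "!!r. r \<in> carrier R ==> s \<otimes>[R] r = \<zero>[R] ==> r = \<zero>[R]"
  and x: "x \<in> carrier E" "s \<odot>[E] x = \<zero>[E]"
 shows "x = \<zero>[E]"
proof -
 have E: "module R E" using flat by (simp add: flat_module_def)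
 interpret E: module R E by (rule E)
 let ?R = "ring_module R"
 have RM: "module R ?R" by (rule E.R.ring_module_module)
 let ?h = "\<lambda>r\<in>carrier ?R. s \<otimes>[R] r" and ?i = "\<lambda>y\<in>carrier E. y"
 have h: "?h \<in> mod_hom R ?R ?R"
  using s by (intro mod_homI) (auto simp: E.R.r_distr E.R.m_lcomm)
 have "inj_on ?h (carrier ?R)"
 proof (rule inj_onI)
  fix a b assume a: "a \<in> carrier ?R" and b: "b \<in> carrier ?R" and eq: "?h a = ?h b"
  have "s \<otimes>[R] (a \<ominus>[R] b) = s \<otimes>[R] a \<ominus>[R] s \<otimes>[R] b" using a b s by (simp add: a_minus_def E.R.r_distr E.R.r_minus)
  also have "\<dots> = \<zero>[R]" using eq a b s by simp
  finally have "a \<ominus>[R] b = \<zero>[R]" by (rule nz[OF E.R.minus_closed[OF a[simplified] b[simplified]]])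
  thus "a = b" using a b by (simp add: E.R.minus_eq_zero_iff)
 qed
 hence inj: "inj_on (tensor_map R ?R E ?R E ?h ?i) (carrier (tensor R ?R E))"
  using flat h RM unfolding flat_module_def by blast
 have il: "linear R E E ?i" by (rule linI) auto
 note tm = tensor_map_lin[OF RM E RM E mod_hom_lin[OF h] il]
 have one: "\<one>[R] \<in> carrier ?R" and sc: "s \<in> carrier ?R" using s by simp_all
 have T: "module R (tensor R ?R E)" by (rule T_module[OF RM E])
 interpret T: module R "tensor R ?R E" by (rule T)
 have p0: "pure_tensor R ?R E a \<zero>[E] = \<zero>[tensor R ?R E]" if "a \<in> carrier ?R" for a
  using pure_smult_right[OF RM E E.R.zero_closed that E.zero_closed] pure_closed[OF RM E that E.zero_closed] by simp
 have "tensor_map R ?R E ?R E ?h ?i (pure_tensor R ?R E \<one>[R] x) = pure_tensor R ?R E s x"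
  using tm(2)[OF one x(1)] x(1) s by simp
 also have "\<dots> = pure_tensor R ?R E (s \<odot>[?R] \<one>[R]) x" using s by simp
 also have "\<dots> = pure_tensor R ?R E \<one>[R] (s \<odot>[E] x)"
  unfolding pure_smult_left[OF RM E s one x(1)] pure_smult_right[OF RM E s one x(1)] ..
 also have "\<dots> = \<zero>[tensor R ?R E]" unfolding x(2) by (rule p0[OF one])
 also have "\<dots> = tensor_map R ?R E ?R E ?h ?i \<zero>[tensor R ?R E]"
  by (rule lin_zero[OF T T carrier_submodule[OF T] tm(1), symmetric])
 finally have z: "pure_tensor R ?R E \<one>[R] x = \<zero>[tensor R ?R E]"
  by (rule inj_onD[OF inj _ pure_closed[OF RM E one x(1)] T.zero_closed])
 have bl: "bilin R ?R E E (%r y. r \<odot>[E] y)"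
  by (rule bilinI; rule linI)
   (auto simp: E.smult_l_distr E.smult_r_distr E.smult_assoc1, metis E.R.m_comm E.smult_assoc1)
 note L = tensor_lift[OF RM E E bl, of "%(r, y). r \<odot>[E] y"]
 have "lift R ?R E E (%(r, y). r \<odot>[E] y) (pure_tensor R ?R E \<one>[R] x) = \<one>[R] \<odot>[E] x"
  by (rule L(2)[OF _ one x(1)]) simp
 moreover have "lift R ?R E E (%(r, y). r \<odot>[E] y) \<zero>[tensor R ?R E] = \<zero>[E]"
  by (rule lin_zero[OF T E carrier_submodule[OF T] L(1)]) simp
 ultimately have "\<one>[R] \<odot>[E] x = \<zero>[E]" unfolding z by (rule trans[OF sym])
 thus ?thesis unfolding E.smult_one[OF x(1)] .
qed

section \<open>Vanishing of Ext and selections\<close>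

lemma lin_into_sub_module:
 "lin R M A U h ==> (!!x. x \<in> A ==> h x \<in> K) ==> lin R M A (sub_module U K) h"
 by (simp add: lin_def)

text \<open>
 Pulled back to the free cover, the relation has a linear selection \<open>g0\<close>.  On the syzygies \<open>g0\<close> takes values related
 to zero, and an extension of this restriction can be subtracted from \<open>g0\<close>.
\<close>

lemma ext_selects:
 assumes E: "module R E" and U: "module R U" and \<Gamma>: "linrel R E (carrier E) U \<Gamma>"
  and ext: "ext_vanishes R E (sub_module U {w \<in> carrier U. \<Gamma> \<zero>[E] w})"
 shows "\<exists>h. linear R E U h & (\<forall>x\<in>carrier E. \<Gamma> x (h x))"
proof -
 interpret E: module R E by fact
 interpret U: module R U by fact
 let ?F = "free_module R (carrier E)" and ?c = "free_cover R E"
 interpret F: module R ?F by (rule free_module_module[OF E.R.is_cring])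
 note Fs = carrier_submodule[OF F.module_axioms]
 note c = free_cover_lin[OF E]
 have "linrel R ?F (carrier ?F) U (%p. \<Gamma> (?c p))" by (rule linrel_comp[OF \<Gamma> c]) (rule lin_closed[OF c])
 then obtain g0 where g0: "linear R ?F U g0" "\<forall>p\<in>carrier ?F. \<Gamma> (?c p) (g0 p)"
  by (rule selectsD[OF free_selects[OF E.R.is_cring U]])
 have syz: "carrier (syzygy R E) <= carrier ?F" by (auto simp: syzygy_carrier)
 have "lin R ?F (carrier (syzygy R E)) (sub_module U {w \<in> carrier U. \<Gamma> \<zero>[E] w}) g0"
 proof (rule lin_into_sub_module[OF lin_subset[OF g0(1) syz]])
  fix p assume p: "p \<in> carrier (syzygy R E)"
  hence "\<Gamma> (?c p) (g0 p)" using g0(2) syz by blast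
  thus "g0 p \<in> {w \<in> carrier U. \<Gamma> \<zero>[E] w}" using p lin_closed[OF g0(1)] by (simp add: syzygy_carrier)
 qed
 from extendsD[OF ext this] obtain g
  where g: "linear R ?F (sub_module U {w \<in> carrier U. \<Gamma> \<zero>[E] w}) g" "!!p. p \<in> carrier (syzygy R E) ==> g p = g0 p"
  by blast
 have gU: "linear R ?F U g" using g(1) by (simp add: lin_def)
 have gK: "\<Gamma> \<zero>[E] (g p)" if "p \<in> carrier ?F" for p using lin_closed[OF g(1) that] by simp
 define k where "k p = g0 p \<ominus>[U] g p" for p
 have k: "linear R ?F U k"
  unfolding k_def by (rule lin_diff[OF F.module_axioms U Fs g0(1) gU])
 have k\<Gamma>: "\<Gamma> (?c p) (k p)" if p: "p \<in> carrier ?F" for p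
 proof -
  have cp: "?c p \<in> carrier E" by (rule lin_closed[OF c p])
  have "\<Gamma> (?c p \<ominus>[E] \<zero>[E]) (g0 p \<ominus>[U] g p)"
   by (rule linrel_minus[OF E U carrier_submodule[OF E] \<Gamma> cp E.zero_closed lin_closed[OF g0(1) p] lin_closed[OF gU p]
      bspec[OF g0(2) p] gK[OF p]])
  thus ?thesis using cp by (simp add: k_def)
 qed
 have k0: "k p = \<zero>[U]" if "p \<in> carrier ?F" "?c p = \<zero>[E]" for p
  using that g(2)[of p] lin_closed[OF g0(1) that(1)] by (simp add: k_def syzygy_carrier)
 define \<Delta> where "\<Delta> x w \<longleftrightarrow> (\<exists>p\<in>carrier ?F. ?c p = x & w = k p)" for x w
 have tot: "\<exists>w\<in>carrier U. \<Delta> x w" if "x \<in> carrier E" for x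
  unfolding \<Delta>_def using free_cover_basis[OF E that] basis_vector_closed[OF E.R.is_cring that] lin_closed[OF k] by blast
 have "linrel R E (carrier E) U \<Delta>"
 proof (rule linrelI[OF tot], assumption)
  show "\<Delta> (x \<oplus>[E] y) (w \<oplus>[U] w')" if "\<Delta> x w" "\<Delta> y w'" for x y w w'
   using that unfolding \<Delta>_def by (metis F.a_closed lin_add[OF c] lin_add[OF k])
  show "\<Delta> (r \<odot>[E] x) (r \<odot>[U] w)" if "r \<in> carrier R" "\<Delta> x w" for r x w
   using that unfolding \<Delta>_def by (metis F.smult_closed lin_smult[OF c] lin_smult[OF k])
 qed
 hence "\<exists>h. linear R E U h & (\<forall>x\<in>carrier E. \<Delta> x (h x)) & (\<forall>x\<in>carrier E. \<forall>w\<in>carrier U. \<Delta> x w --> w = h x)"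
  by (rule linrel_function[OF E U carrier_submodule[OF E]]) (use k0 in "auto simp: \<Delta>_def")
 then obtain h where h: "linear R E U h" "\<forall>x\<in>carrier E. \<Delta> x (h x)" by blast
 have "\<forall>x\<in>carrier E. \<Gamma> x (h x)"
 proof
  fix x assume "x \<in> carrier E"
  then obtain p where p: "p \<in> carrier ?F" "?c p = x" "h x = k p" using h(2) unfolding \<Delta>_def by blast
  show "\<Gamma> x (h x)" using k\<Gamma>[OF p(1)] unfolding p(2,3) .
 qed
 thus ?thesis using h(1) by blast
qed

section \<open>Weakly cotorsion modules\<close>

definition transport :: "('m => 'n) => ('a, 'm) module => ('a, 'n) module" where
 "transport \<kappa> M = (let c = the_inv_into (carrier M) \<kappa> in
  \<lparr>carrier = \<kappa> ` carrier M, mult = undefined, one = undefined, zero = \<kappa> \<zero>[M],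
   add = (%x y. \<kappa> (c x \<oplus>[M] c y)), smult = (%r x. \<kappa> (r \<odot>[M] c x))\<rparr>)"

lemma transport_sel:
 assumes "inj_on \<kappa> (carrier M)"
 shows "carrier (transport \<kappa> M) = \<kappa> ` carrier M" "\<zero>[transport \<kappa> M] = \<kappa> \<zero>[M]"
  "x \<in> carrier M ==> y \<in> carrier M ==> \<kappa> x \<oplus>[transport \<kappa> M] \<kappa> y = \<kappa> (x \<oplus>[M] y)"
  "x \<in> carrier M ==> r \<odot>[transport \<kappa> M] \<kappa> x = \<kappa> (r \<odot>[M] x)"
 using assms by (simp_all add: transport_def Let_def the_inv_into_f_f)

lemma transport_module:
 fixes R :: "('a, 'k) ring_scheme" (structure)
 assumes M: "module R M" and \<kappa>: "inj_on \<kappa> (carrier M)"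
 shows "module R (transport \<kappa> M)"
proof -
 interpret M: module R M by (rule M)
 let ?T = "transport \<kappa> M"
 note s = transport_sel[OF \<kappa>]
 have c: "\<exists>z\<in>carrier M. x = \<kappa> z" if "x \<in> carrier ?T" for x using that unfolding s(1) by blast
 show ?thesis
 proof (rule moduleI)
  show "cring R" by (rule M.R.is_cring)
  show "abelian_group ?T"
  proof (rule abelian_groupI)
   show "\<zero>[?T] \<in> carrier ?T" by (simp add: s(1,2))
   fix x assume "x \<in> carrier ?T"
   then obtain x' where x: "x' \<in> carrier M" "x = \<kappa> x'" using c by blast
   show "\<zero>[?T] \<oplus>[?T] x = x" using x by (simp add: s(2,3))
   show "\<exists>y\<in>carrier ?T. y \<oplus>[?T] x = \<zero>[?T]"
    unfolding x(2) s(1,2) by (rule bexI[of _ "\<kappa> (\<ominus>[M] x')"]) (use x(1) in "simp_all add: s(3) M.l_neg")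
   fix y assume "y \<in> carrier ?T"
   then obtain y' where y: "y' \<in> carrier M" "y = \<kappa> y'" using c by blast
   show "x \<oplus>[?T] y \<in> carrier ?T" using x y by (simp add: s(1,3))
   show "x \<oplus>[?T] y = y \<oplus>[?T] x" using x y by (simp add: s(3) M.a_comm)
   fix z assume "z \<in> carrier ?T"
   then obtain z' where z: "z' \<in> carrier M" "z = \<kappa> z'" using c by blast
   show "x \<oplus>[?T] y \<oplus>[?T] z = x \<oplus>[?T] (y \<oplus>[?T] z)" using x y z by (simp add: s(3) M.a_assoc)
  qed
  fix a x assume a: "a \<in> carrier R" and "x \<in> carrier ?T"
  then obtain x' where x: "x' \<in> carrier M" "x = \<kappa> x'" using c by blast
  show "a \<odot>[?T] x \<in> carrier ?T" using a x by (simp add: s(1,4))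
  fix b assume b: "b \<in> carrier R"
  show "(a \<oplus> b) \<odot>[?T] x = a \<odot>[?T] x \<oplus>[?T] b \<odot>[?T] x" using a b x by (simp add: s(3,4) M.smult_l_distr)
  show "(a \<otimes> b) \<odot>[?T] x = a \<odot>[?T] (b \<odot>[?T] x)" using a b x by (simp add: s(4) M.smult_assoc1)
 next
  show "\<one> \<odot>[?T] x = x" if "x \<in> carrier ?T" for x using c[OF that] by (auto simp: s(4))
  fix a x y assume a: "a \<in> carrier R" and "x \<in> carrier ?T" "y \<in> carrier ?T"
  then obtain x' y' where x: "x' \<in> carrier M" "x = \<kappa> x'" and y: "y' \<in> carrier M" "y = \<kappa> y'" using c by metis
  show "a \<odot>[?T] (x \<oplus>[?T] y) = a \<odot>[?T] x \<oplus>[?T] a \<odot>[?T] y" using a x y by (simp add: s(3,4) M.smult_r_distr)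
 qed
qed

lemma transport_lin:
 assumes \<kappa>: "inj_on \<kappa> (carrier M)"
 shows "linear R M (transport \<kappa> M) \<kappa>"
  and "module R M ==> linear R (transport \<kappa> M) M (the_inv_into (carrier M) \<kappa>)"
proof -
 note s = transport_sel[OF \<kappa>]
 show "linear R M (transport \<kappa> M) \<kappa>" by (rule linI) (simp_all add: s)
 assume "module R M"
 then interpret M: module R M .
 show "linear R (transport \<kappa> M) M (the_inv_into (carrier M) \<kappa>)"
  by (rule linI) (auto simp: s the_inv_into_f_f[OF \<kappa>])
qed

lemma transport_extends:
 assumes M: "module R M" and \<kappa>: "inj_on \<kappa> (carrier M)"
 shows "extends R P A (transport \<kappa> M) \<longleftrightarrow> extends R P A M"
proof
 note s = transport_sel[OF \<kappa>]
 note t = transport_lin[OF \<kappa>] transport_lin(2)[OF \<kappa> M]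
 have c: "the_inv_into (carrier M) \<kappa> y \<in> carrier M" "\<kappa> (the_inv_into (carrier M) \<kappa> y) = y" if "y \<in> carrier (transport \<kappa> M)" for y
  using that by (auto simp: s the_inv_into_f_f[OF \<kappa>])
 show "extends R P A (transport \<kappa> M)" if e: "extends R P A M"
  unfolding extends_def
 proof (intro allI impI)
  fix f assume f: "lin R P A (transport \<kappa> M) f"
  from extendsD[OF e lin_compose[OF f t(3) lin_closed[OF f]]] obtain g
   where g: "linear R P M g" "!!x. x \<in> A ==> g x = the_inv_into (carrier M) \<kappa> (f x)" by blast
  show "\<exists>g. linear R P (transport \<kappa> M) g & (\<forall>x\<in>A. g x = f x)"
   using lin_compose[OF g(1) t(1) lin_closed[OF g(1)]] g(2) c(2)[OF lin_closed[OF f]]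
   by (intro exI[of _ "%x. \<kappa> (g x)"]) simp
 qed
 show "extends R P A M" if e: "extends R P A (transport \<kappa> M)"
  unfolding extends_def
 proof (intro allI impI)
  fix f assume f: "lin R P A M f"
  from extendsD[OF e lin_compose[OF f t(1) lin_closed[OF f]]] obtain g
   where g: "linear R P (transport \<kappa> M) g" "!!x. x \<in> A ==> g x = \<kappa> (f x)" by blast
  show "\<exists>g. linear R P M g & (\<forall>x\<in>A. g x = f x)"
   using lin_compose[OF g(1) t(3) lin_closed[OF g(1)]] g(2) lin_closed[OF f]
   by (intro exI[of _ "%x. the_inv_into (carrier M) \<kappa> (g x)"]) (simp add: the_inv_into_f_f[OF \<kappa>])
 qed
qed

text \<open>Only the cardinality of the modules quantified over in the definition of strong flatness matters.\<close>

lemma strongly_flat_extends: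
 fixes \<kappa> :: "'m => 'u" and K :: "('a, 'm) module"
 assumes sf: "strongly_flat TYPE('u) R S E" and Q: "module R (loc_as_module R S)" and K: "module R K"
  and \<kappa>: "inj_on \<kappa> (carrier K)"
  and ext: "ext_vanishes R (loc_as_module R S) K"
 shows "ext_vanishes R E K"
proof -
 note t = transport_module[OF K \<kappa>]
 have E: "module R E" using sf by (simp add: strongly_flat_def)
 have "weakly_cotorsion R S (transport \<kappa> K)"
  unfolding weakly_cotorsion_def zero_Ext1_iff[OF Q t] transport_extends[OF K \<kappa>] using t ext by blast
 hence "zero_module (Ext1 R E (transport \<kappa> K))" using sf unfolding strongly_flat_def by blast
 thus ?thesis unfolding zero_Ext1_iff[OF E t] transport_extends[OF K \<kappa>] .
qed

context fraction_module
begin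

abbreviation FQ where "FQ \<equiv> free_module R (carrier Q)"
abbreviation SQ where "SQ \<equiv> carrier (syzygy R Q)"

lemma FQ: "module R FQ" by (rule free_module_module[OF is_cring])

interpretation FQ: module R FQ by (rule FQ)

lemma SQ_iff: "p \<in> SQ \<longleftrightarrow> p \<in> carrier FQ & free_cover R Q p = \<zero>[Q]"
 by (simp add: syzygy_carrier)

lemma cov_Q: "linear R FQ Q (free_cover R Q)"
 by (rule free_cover_lin[OF Q])

lemma cov_Q_minus: "p \<in> carrier FQ ==> p' \<in> carrier FQ ==>
  free_cover R Q (p \<ominus>[FQ] p') = free_cover R Q p \<ominus>[Q] free_cover R Q p'"
 by (rule lin_minus[OF FQ Q carrier_submodule[OF FQ] cov_Q])

text \<open>
 A linear \<open>f\<close> on the syzygies of \<open>Q\<close> extends by \<open>f (p - s p')\<close>, where \<open>p'\<close> maps to the \<open>s\<close>-th part of the image of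
 \<open>p\<close>; the choice of \<open>p'\<close> does not matter because \<open>s\<close> kills the values.
\<close>

lemma killed_weakly_cotorsion:
 assumes C: "module R C" and s: "s \<in> S" and kill: "!!c. c \<in> carrier C ==> s \<odot>[C] c = \<zero>[C]"
 shows "extends R FQ SQ C"
 unfolding extends_def
proof (intro allI impI)
 fix f assume f: "lin R FQ SQ C f"
 interpret C: module R C by fact
 have sR: "s \<in> carrier R" using s by simp
 note SS = submodule_closed[OF FQ syzygy_submodule[OF Q]]
 define \<Gamma> where "\<Gamma> p c \<longleftrightarrow> (\<exists>p'\<in>carrier FQ. p \<ominus>[FQ] s \<odot>[FQ] p' \<in> SQ & c = f (p \<ominus>[FQ] s \<odot>[FQ] p'))" for p c
 have "linrel R FQ (carrier FQ) C \<Gamma>"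
 proof (rule linrelI)
  show "\<exists>c\<in>carrier C. \<Gamma> p c" if p: "p \<in> carrier FQ" for p
  proof -
   obtain q where q: "q \<in> carrier Q" "s \<odot>[Q] q = free_cover R Q p" using divisible[OF s lin_closed[OF cov_Q p]] by blast
   have b: "basis_vector R q \<in> carrier FQ" by (rule basis_vector_closed[OF is_cring q(1)])
   have "free_cover R Q (p \<ominus>[FQ] s \<odot>[FQ] basis_vector R q) = \<zero>[Q]"
    unfolding cov_Q_minus[OF p FQ.smult_closed[OF sR b]] lin_smult[OF cov_Q sR b] free_cover_basis[OF Q q(1)] q(2)
    by (rule Q.minus_self[OF lin_closed[OF cov_Q p]])
   hence "p \<ominus>[FQ] s \<odot>[FQ] basis_vector R q \<in> SQ" unfolding SQ_iff using p b sR by blast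
   thus ?thesis unfolding \<Gamma>_def using b lin_closed[OF f] by blast
  qed
  show "\<Gamma> (p \<oplus>[FQ] r) (c \<oplus>[C] d)" if pr: "p \<in> carrier FQ" "r \<in> carrier FQ" "\<Gamma> p c" "\<Gamma> r d" for p r c d
  proof -
   obtain p' where p': "p' \<in> carrier FQ" "p \<ominus>[FQ] s \<odot>[FQ] p' \<in> SQ" "c = f (p \<ominus>[FQ] s \<odot>[FQ] p')"
    using pr(3) unfolding \<Gamma>_def by blast
   obtain r' where r': "r' \<in> carrier FQ" "r \<ominus>[FQ] s \<odot>[FQ] r' \<in> SQ" "d = f (r \<ominus>[FQ] s \<odot>[FQ] r')"
    using pr(4) unfolding \<Gamma>_def by blast
   have e: "(p \<oplus>[FQ] r) \<ominus>[FQ] s \<odot>[FQ] (p' \<oplus>[FQ] r') = (p \<ominus>[FQ] s \<odot>[FQ] p') \<oplus>[FQ] (r \<ominus>[FQ] s \<odot>[FQ] r')"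
    unfolding FQ.smult_r_distr[OF sR p'(1) r'(1)]
    by (rule FQ.add_minus_add[OF pr(1,2) FQ.smult_closed[OF sR p'(1)] FQ.smult_closed[OF sR r'(1)]])
   show ?thesis unfolding \<Gamma>_def
    by (rule bexI[OF _ FQ.a_closed[OF p'(1) r'(1)]])
     (unfold e lin_add[OF f p'(2) r'(2)] p'(3) r'(3), use SS(4)[OF p'(2) r'(2)] in simp)
  qed
  show "\<Gamma> (a \<odot>[FQ] p) (a \<odot>[C] c)" if pr: "a \<in> carrier R" "p \<in> carrier FQ" "\<Gamma> p c" for a p c
  proof -
   obtain p' where p': "p' \<in> carrier FQ" "p \<ominus>[FQ] s \<odot>[FQ] p' \<in> SQ" "c = f (p \<ominus>[FQ] s \<odot>[FQ] p')"
    using pr(3) unfolding \<Gamma>_def by blast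
   have "s \<odot>[FQ] (a \<odot>[FQ] p') = a \<odot>[FQ] (s \<odot>[FQ] p')"
    unfolding FQ.smult_assoc1[OF sR pr(1) p'(1), symmetric] FQ.smult_assoc1[OF pr(1) sR p'(1), symmetric] m_comm[OF sR pr(1)] ..
   hence e: "a \<odot>[FQ] p \<ominus>[FQ] s \<odot>[FQ] (a \<odot>[FQ] p') = a \<odot>[FQ] (p \<ominus>[FQ] s \<odot>[FQ] p')"
    using FQ.smult_minus[OF pr(1,2) FQ.smult_closed[OF sR p'(1)]] by simp
   show ?thesis unfolding \<Gamma>_def
    by (rule bexI[OF _ FQ.smult_closed[OF pr(1) p'(1)]])
     (unfold e lin_smult[OF f pr(1) p'(2)] p'(3), use SS(6)[OF pr(1) p'(2)] in simp)
  qed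
 qed
 then obtain g where g: "linear R FQ C g" "\<forall>p\<in>carrier FQ. \<Gamma> p (g p)"
  by (rule selectsD[OF free_selects[OF is_cring C]])
 have "g p = f p" if p: "p \<in> SQ" for p
 proof -
  have pF: "p \<in> carrier FQ" by (rule SS(1)[OF p])
  have "\<Gamma> p (g p)" by (rule bspec[OF g(2) pF])
  then obtain p' where p': "p' \<in> carrier FQ" "p \<ominus>[FQ] s \<odot>[FQ] p' \<in> SQ" "g p = f (p \<ominus>[FQ] s \<odot>[FQ] p')"
   unfolding \<Gamma>_def by blast
  have "p \<ominus>[FQ] (p \<ominus>[FQ] s \<odot>[FQ] p') = s \<odot>[FQ] p'"
   using pF FQ.smult_closed[OF sR p'(1)] by (simp add: a_minus_def FQ.minus_add FQ.r_neg2 del: FQ.smult_closed)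
  hence sp: "s \<odot>[FQ] p' \<in> SQ" using SS(5)[OF p p'(2)] by simp
  hence "s \<odot>[Q] free_cover R Q p' = \<zero>[Q]" unfolding SQ_iff lin_smult[OF cov_Q sR p'(1)] by blast
  hence p's: "p' \<in> SQ" unfolding SQ_iff using torsion_free[OF s lin_closed[OF cov_Q p'(1)]] p'(1) by blast
  have "f (s \<odot>[FQ] p') = \<zero>[C]" unfolding lin_smult[OF f sR p's] by (rule kill[OF lin_closed[OF f p's]])
  thus ?thesis
   unfolding p'(3) lin_minus[OF FQ C syzygy_submodule[OF Q] f p sp] using lin_closed[OF f p] by simp
 qed
 thus "\<exists>g. linear R FQ C g & (\<forall>x\<in>SQ. g x = f x)" using g(1) by blast
qed

text \<open>Where \<open>S\<close> acts bijectively, the values of an extension are determined by clearing denominators.\<close>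

lemma divisible_weakly_cotorsion:
 assumes C: "module R C" and inj: "!!s c. s \<in> S ==> c \<in> carrier C ==> s \<odot>[C] c = \<zero>[C] ==> c = \<zero>[C]"
  and surj: "!!s c. s \<in> S ==> c \<in> carrier C ==> \<exists>c'\<in>carrier C. s \<odot>[C] c' = c"
 shows "extends R FQ SQ C"
 unfolding extends_def
proof (intro allI impI)
 fix f assume f: "lin R FQ SQ C f"
 interpret C: module R C by fact
 note SS = submodule_closed[OF FQ syzygy_submodule[OF Q]]
 let ?e = "basis_vector R u"
 have e: "?e \<in> carrier FQ" by (rule basis_vector_closed[OF is_cring u_closed])
 define w where "w t p a = t \<odot>[FQ] p \<ominus>[FQ] a \<odot>[FQ] ?e" for t p a
 have wadd: "w (t \<otimes> s) (p \<oplus>[FQ] r) (s \<otimes> a \<oplus> t \<otimes> b) = s \<odot>[FQ] w t p a \<oplus>[FQ] t \<odot>[FQ] w s r b"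
  if "t \<in> carrier R" "s \<in> carrier R" "a \<in> carrier R" "b \<in> carrier R" "p \<in> carrier FQ" "r \<in> carrier FQ" for t s p r a b
 proof -
  note c = that
  have "w (t \<otimes> s) (p \<oplus>[FQ] r) (s \<otimes> a \<oplus> t \<otimes> b) =
    (s \<odot>[FQ] (t \<odot>[FQ] p) \<oplus>[FQ] t \<odot>[FQ] (s \<odot>[FQ] r)) \<ominus>[FQ] (s \<odot>[FQ] (a \<odot>[FQ] ?e) \<oplus>[FQ] t \<odot>[FQ] (b \<odot>[FQ] ?e))"
   unfolding w_def using c e
   by (simp add: FQ.smult_r_distr FQ.smult_l_distr FQ.smult_assoc1[symmetric] m_comm)
  also have "\<dots> = s \<odot>[FQ] w t p a \<oplus>[FQ] t \<odot>[FQ] w s r b"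
   unfolding w_def using c e by (simp add: FQ.smult_minus FQ.add_minus_add)
  finally show ?thesis .
 qed
 have wsm: "w t (r \<odot>[FQ] p) (r \<otimes> a) = r \<odot>[FQ] w t p a"
  if c: "t \<in> carrier R" "r \<in> carrier R" "a \<in> carrier R" "p \<in> carrier FQ" for t r a p
 proof -
  have "t \<odot>[FQ] (r \<odot>[FQ] p) = r \<odot>[FQ] (t \<odot>[FQ] p)"
   using c by (simp add: FQ.smult_assoc1[symmetric] m_comm)
  thus ?thesis unfolding w_def using c e by (simp add: FQ.smult_minus FQ.smult_assoc1)
 qed
 define \<Gamma> where "\<Gamma> p c \<longleftrightarrow> (\<exists>t\<in>S. \<exists>a\<in>carrier R. w t p a \<in> SQ & t \<odot>[C] c = f (w t p a))" for p c
 have "linrel R FQ (carrier FQ) C \<Gamma>"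
 proof (rule linrelI)
  show "\<exists>c\<in>carrier C. \<Gamma> p c" if p: "p \<in> carrier FQ" for p
  proof -
   obtain t a where t: "t \<in> S" "a \<in> carrier R" "t \<odot>[Q] free_cover R Q p = a \<odot>[Q] u"
    using frac_ex[OF lin_closed[OF cov_Q p]] by blast
   have tR: "t \<in> carrier R" using t by simp
   have "free_cover R Q (w t p a) = \<zero>[Q]"
    unfolding w_def cov_Q_minus[OF FQ.smult_closed[OF tR p] FQ.smult_closed[OF t(2) e]] lin_smult[OF cov_Q tR p]
     lin_smult[OF cov_Q t(2) e] free_cover_basis[OF Q u_closed] t(3)
    by (rule Q.minus_self[OF Q.smult_closed[OF t(2) u_closed]])
   moreover have "w t p a \<in> carrier FQ"
    unfolding w_def by (rule FQ.minus_closed[OF FQ.smult_closed[OF tR p] FQ.smult_closed[OF t(2) e]])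
   ultimately have wS: "w t p a \<in> SQ" unfolding SQ_iff by blast
   show ?thesis using surj[OF t(1) lin_closed[OF f wS]] t wS unfolding \<Gamma>_def by blast
  qed
  show "\<Gamma> (p \<oplus>[FQ] r) (c \<oplus>[C] d)"
   if pr: "p \<in> carrier FQ" "r \<in> carrier FQ" "c \<in> carrier C" "d \<in> carrier C" "\<Gamma> p c" "\<Gamma> r d" for p r c d
  proof -
   obtain t a where t: "t \<in> S" "a \<in> carrier R" "w t p a \<in> SQ" "t \<odot>[C] c = f (w t p a)" using pr(5) unfolding \<Gamma>_def by blast
   obtain s b where s: "s \<in> S" "b \<in> carrier R" "w s r b \<in> SQ" "s \<odot>[C] d = f (w s r b)" using pr(6) unfolding \<Gamma>_def by blast
   have R: "t \<in> carrier R" "s \<in> carrier R" using t s by auto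
   note eq = wadd[OF R t(2) s(2) pr(1,2)]
   have "f (w (t \<otimes> s) (p \<oplus>[FQ] r) (s \<otimes> a \<oplus> t \<otimes> b)) = s \<odot>[C] (t \<odot>[C] c) \<oplus>[C] t \<odot>[C] (s \<odot>[C] d)"
    unfolding eq lin_add[OF f SS(6)[OF R(2) t(3)] SS(6)[OF R(1) s(3)]] lin_smult[OF f R(2) t(3)] lin_smult[OF f R(1) s(3)] t(4) s(4) ..
   also have "\<dots> = (t \<otimes> s) \<odot>[C] (c \<oplus>[C] d)"
    using R pr(3,4) by (simp add: C.smult_r_distr C.smult_assoc1[symmetric] m_comm)
   finally have 1: "(t \<otimes> s) \<odot>[C] (c \<oplus>[C] d) = f (w (t \<otimes> s) (p \<oplus>[FQ] r) (s \<otimes> a \<oplus> t \<otimes> b))" ..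
   have 2: "w (t \<otimes> s) (p \<oplus>[FQ] r) (s \<otimes> a \<oplus> t \<otimes> b) \<in> SQ"
    unfolding eq by (rule SS(4)[OF SS(6)[OF R(2) t(3)] SS(6)[OF R(1) s(3)]])
   have 3: "s \<otimes> a \<oplus> t \<otimes> b \<in> carrier R" using R t s by simp
   show ?thesis unfolding \<Gamma>_def using 1 2 3 S_mult[OF t(1) s(1)] by blast
  qed
  show "\<Gamma> (r \<odot>[FQ] p) (r \<odot>[C] c)" if pr: "r \<in> carrier R" "p \<in> carrier FQ" "c \<in> carrier C" "\<Gamma> p c" for r p c
  proof -
   obtain t a where t: "t \<in> S" "a \<in> carrier R" "w t p a \<in> SQ" "t \<odot>[C] c = f (w t p a)" using pr(4) unfolding \<Gamma>_def by blast
   have R: "t \<in> carrier R" using t by auto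
   note eq = wsm[OF R pr(1) t(2) pr(2)]
   have "t \<odot>[C] (r \<odot>[C] c) = r \<odot>[C] (t \<odot>[C] c)" using R pr(1,3) by (simp add: C.smult_assoc1[symmetric] m_comm)
   hence 1: "t \<odot>[C] (r \<odot>[C] c) = f (w t (r \<odot>[FQ] p) (r \<otimes> a))" unfolding eq lin_smult[OF f pr(1) t(3)] t(4) .
   have 2: "w t (r \<odot>[FQ] p) (r \<otimes> a) \<in> SQ" unfolding eq by (rule SS(6)[OF pr(1) t(3)])
   show ?thesis unfolding \<Gamma>_def using 1 2 t(1) m_closed[OF pr(1) t(2)] by blast
  qed
 qed
 then obtain g where g: "linear R FQ C g" "\<forall>p\<in>carrier FQ. \<Gamma> p (g p)"
  by (rule selectsD[OF free_selects[OF is_cring C]])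
 have "g p = f p" if p: "p \<in> SQ" for p
 proof -
  have pF: "p \<in> carrier FQ" and p0: "free_cover R Q p = \<zero>[Q]" using p unfolding SQ_iff by auto
  have "\<Gamma> p (g p)" by (rule bspec[OF g(2) pF])
  then obtain t a where t: "t \<in> S" "a \<in> carrier R" "w t p a \<in> SQ" "t \<odot>[C] g p = f (w t p a)" unfolding \<Gamma>_def by blast
  have R: "t \<in> carrier R" using t by simp
  have "t \<odot>[Q] \<zero>[Q] \<ominus>[Q] a \<odot>[Q] u = \<zero>[Q]"
   using t(3) unfolding SQ_iff w_def cov_Q_minus[OF FQ.smult_closed[OF R pF] FQ.smult_closed[OF t(2) e]]
    lin_smult[OF cov_Q R pF] lin_smult[OF cov_Q t(2) e] free_cover_basis[OF Q u_closed] p0 by blast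
  hence "a \<odot>[Q] u = \<zero>[Q]" using R Q.minus_eq_zero_iff[OF Q.zero_closed Q.smult_closed[OF t(2) u_closed]] by simp
  hence "a = \<zero>" by (rule faithful[OF t(2)])
  hence "w t p a = t \<odot>[FQ] p" unfolding w_def using FQ.smult_closed[OF R pF] e by simp
  hence "t \<odot>[C] g p = t \<odot>[C] f p" using t(4) lin_smult[OF f R p] by simp
  hence "t \<odot>[C] (g p \<ominus>[C] f p) = \<zero>[C]"
   using C.smult_minus[OF R lin_closed[OF g(1) pF] lin_closed[OF f p]] C.smult_closed[OF R lin_closed[OF f p]] by simp
  hence "g p \<ominus>[C] f p = \<zero>[C]" by (rule inj[OF t(1) C.minus_closed[OF lin_closed[OF g(1) pF] lin_closed[OF f p]]])
  thus ?thesis using C.minus_eq_zero_iff[OF lin_closed[OF g(1) pF] lin_closed[OF f p]] by blast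
 qed
 thus "\<exists>g. linear R FQ C g & (\<forall>x\<in>SQ. g x = f x)" using g(1) by blast
qed

end

text \<open>Two free covers of \<open>Q\<close> map to each other, so weak cotorsion can be tested on the given presentation.\<close>

lemma (in presented_fractions) weakly_cotorsion_presentation:
 fixes C :: "('a, 'c) module"
 assumes C: "module R C" and ext: "extends R FQ SQ C"
 shows "extends R F N C"
proof -
 note cr = is_cring
 have "linrel R F (carrier F) FQ (%x y. free_cover R Q y = \<epsilon> x)"
 proof (rule linrelI)
  show "\<exists>y\<in>carrier FQ. free_cover R Q y = \<epsilon> x" if "x \<in> carrier F" for x
   using basis_vector_closed[OF cr lin_closed[OF \<epsilon> that]] free_cover_basis[OF Q lin_closed[OF \<epsilon> that]] by blast
 qed (simp_all only: lin_add[OF cov_Q] lin_add[OF \<epsilon>] lin_smult[OF cov_Q] lin_smult[OF \<epsilon>])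
 then obtain a where a: "linear R F FQ a" "\<forall>x\<in>carrier F. free_cover R Q (a x) = \<epsilon> x"
  by (rule selectsD[OF free_selects[OF cr FQ]])
 have "linrel R FQ (carrier FQ) F (%y x. \<epsilon> x = free_cover R Q y)"
 proof (rule linrelI)
  show "\<exists>x\<in>carrier F. \<epsilon> x = free_cover R Q y" if "y \<in> carrier FQ" for y
   using lin_closed[OF cov_Q that] \<epsilon>_surj by (metis imageE)
 qed (simp_all only: lin_add[OF cov_Q] lin_add[OF \<epsilon>] lin_smult[OF cov_Q] lin_smult[OF \<epsilon>])
 then obtain b where b: "linear R FQ F b" "\<forall>y\<in>carrier FQ. \<epsilon> (b y) = free_cover R Q y"
  by (rule selectsD[OF free_selects[OF cr F.module_axioms]])
 show ?thesis
 proof (rule extends_transfer[OF F.module_axioms FQ C N_submodule a(1) lin_closed[OF a(1)] _ b(1)])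
  show "a x \<in> SQ" if "x \<in> N" for x using that a(2) lin_closed[OF a(1)] by (auto simp: SQ_iff)
  show "b y \<in> N" if "y \<in> SQ" for y using that b(2) lin_closed[OF b(1)] by (auto simp: SQ_iff)
  show "SQ <= carrier FQ" by (auto simp: SQ_iff)
  show "b (a x) \<ominus>[F] x \<in> N" if x: "x \<in> carrier F" for x
  proof -
   have c: "a x \<in> carrier FQ" "b (a x) \<in> carrier F" using lin_closed[OF a(1) x] lin_closed[OF b(1)] by auto
   have "\<epsilon> (b (a x) \<ominus>[F] x) = \<epsilon> (b (a x)) \<ominus>[Q] \<epsilon> x" by (rule lin_minus[OF F.module_axioms Q F_submodule \<epsilon> c(2) x])
   also have "\<dots> = \<zero>[Q]" using bspec[OF a(2) x] bspec[OF b(2) c(1)] lin_closed[OF \<epsilon> x] by simp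
   finally show ?thesis using F.minus_closed[OF c(2) x] by simp
  qed
  show "\<exists>g. linear R FQ C g & (\<forall>x\<in>SQ. g x = f x)" if "lin R FQ SQ C f" for f
   using ext that unfolding extends_def by blast
 qed
qed

section \<open>Change of rings\<close>

lemma restrict_scalars_sel [simp]:
 "carrier (restrict_scalars \<phi> M) = carrier M" "add (restrict_scalars \<phi> M) = add M"
 "zero (restrict_scalars \<phi> M) = zero M" "r \<odot>[restrict_scalars \<phi> M] x = \<phi> r \<odot>[M] x"
 by (simp_all add: restrict_scalars_def)

lemma restrict_scalars_sub_module:
 "restrict_scalars \<phi> (sub_module M K) = sub_module (restrict_scalars \<phi> M) K"
 by (simp add: restrict_scalars_def sub_module_def)

lemma (in ring_hom_cring) restrict_scalars_module:
 assumes M: "module S M"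
 shows "module R (restrict_scalars h M)"
proof -
 interpret M: module S M by (rule M)
 show ?thesis
 proof (rule moduleI)
  show "cring R" by (rule R.is_cring)
  show "abelian_group (restrict_scalars h M)"
  proof (rule abelian_groupI)
   show "\<exists>y\<in>carrier (restrict_scalars h M). y \<oplus>[restrict_scalars h M] x = \<zero>[restrict_scalars h M]"
    if "x \<in> carrier (restrict_scalars h M)" for x
    using that by (intro bexI[of _ "\<ominus>[M] x"]) (simp_all add: M.l_neg)
  qed (simp_all add: M.a_ac)
 qed (simp_all add: M.smult_l_distr M.smult_r_distr M.smult_assoc1)
qed

lemma (in ring_hom_cring) restrict_scalars_lin:
 "lin S M A N f ==> lin R (restrict_scalars h M) A (restrict_scalars h N) f"
 by (simp add: lin_def)

locale base_change = ring_hom_cring R R' \<phi>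
 for R :: "('a, 'k) ring_scheme" (structure) and R' :: "('b, 'l) ring_scheme" and \<phi> :: "'a => 'b" +
 fixes E :: "('a, 'm) module" and E' :: "('b, 'e) module" and \<iota> :: "'m => 'e"
 assumes E: "module R E" and E': "module R' E'" and \<iota>: "linear R E (restrict_scalars \<phi> E') \<iota>"
  and generated: "submodule A R' E' ==> (!!x. x \<in> carrier E ==> \<iota> x \<in> A) ==> carrier E' <= A"
begin

sublocale E: module R E by (rule E)
sublocale E': module R' E' by (rule E')

abbreviation V where "V \<equiv> free_module R' (carrier E)"
abbreviation V' where "V' \<equiv> free_module R' (carrier E')"
abbreviation cov' where "cov' \<equiv> linear_ext R' (carrier E) E' \<iota>"

lemma VM: "module R' V" and V'M: "module R' V'"
 by (rule free_module_module[OF S.is_cring])+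

lemma \<iota>_closed: "x \<in> carrier E ==> \<iota> x \<in> carrier E'"
 using lin_closed[OF \<iota>] by simp

lemma \<iota>_zero: "\<iota> \<zero>[E] = \<zero>[E']"
 using lin_zero[OF E restrict_scalars_module[OF E'] carrier_submodule[OF E] \<iota>] by simp

lemma cov'_lin: "linear R' V E' cov'"
 by (rule linear_ext_lin[OF S.is_cring E' \<iota>_closed])

lemma cov'_basis: "x \<in> carrier E ==> cov' (basis_vector R' x) = \<iota> x"
 by (rule linear_ext_basis[OF S.is_cring E' \<iota>_closed])

lemma lin_eq_on_generators:
 assumes "module R' U" "linear R' E' U f" "linear R' E' U g"
  and eq: "!!x. x \<in> carrier E ==> f (\<iota> x) = g (\<iota> x)" and y: "y \<in> carrier E'"
 shows "f y = g y"
proof -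
 interpret U: module R' U by fact
 note c = carrier_submodule[OF E']
 note fc = lin_closed[OF assms(2)] and gc = lin_closed[OF assms(3)]
 note d = lin_diff[OF E' assms(1) c assms(2,3)]
 have "carrier E' <= {y \<in> carrier E'. f y \<ominus>[U] g y \<in> {\<zero>[U]}}"
  by (rule generated[OF lin_kernel_submodule[OF E' assms(1) c d zero_submodule[OF assms(1)]]])
   (use eq gc \<iota>_closed in auto)
 hence "f y \<ominus>[U] g y = \<zero>[U]" using y by blast
 thus ?thesis using U.minus_eq_zero_iff[OF fc[OF y] gc[OF y]] by blast
qed

text \<open>
 A lift \<open>\<gamma>\<close> of \<open>\<iota>\<close> to a free \<open>R'\<close>-module over \<open>E'\<close> exists as soon as the kernel admits extensions; by the universal
 property of \<open>E'\<close> it splits the free cover of \<open>E'\<close>.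
\<close>

lemma projective_of_extends:
 assumes ext: "extends R (free_module R (carrier E)) (carrier (syzygy R E))
   (restrict_scalars \<phi> (sub_module V {d \<in> carrier V. cov' d = \<zero>[E']}))"
  and universal: "!!g. linear R E (restrict_scalars \<phi> V') g ==>
   \<exists>i. linear R' E' V' i & (\<forall>x\<in>carrier E. i (\<iota> x) = g x)"
 shows "projective_module R' E'"
proof -
 note rc = S.is_cring
 have U: "module R (restrict_scalars \<phi> V)" by (rule restrict_scalars_module[OF VM])
 have "linrel R E (carrier E) (restrict_scalars \<phi> V) (%x d. cov' d = \<iota> x)"
 proof (rule linrelI)
  show "\<exists>d\<in>carrier (restrict_scalars \<phi> V). cov' d = \<iota> x" if "x \<in> carrier E" for x
   using cov'_basis[OF that] basis_vector_closed[OF rc that] by auto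
  show "cov' (d \<oplus>[restrict_scalars \<phi> V] d') = \<iota> (x \<oplus>[E] x')"
   if "x \<in> carrier E" "x' \<in> carrier E" "d \<in> carrier (restrict_scalars \<phi> V)" "d' \<in> carrier (restrict_scalars \<phi> V)"
    "cov' d = \<iota> x" "cov' d' = \<iota> x'" for x x' d d'
   using that lin_add[OF cov'_lin] lin_add[OF \<iota>] by simp
  show "cov' (r \<odot>[restrict_scalars \<phi> V] d) = \<iota> (r \<odot>[E] x)"
   if "r \<in> carrier R" "x \<in> carrier E" "d \<in> carrier (restrict_scalars \<phi> V)" "cov' d = \<iota> x" for r x d
   using that lin_smult[OF cov'_lin] lin_smult[OF \<iota>] by simp
 qed
 from ext_selects[OF E U this] obtain \<gamma>
  where \<gamma>: "linear R E (restrict_scalars \<phi> V) \<gamma>" "!!x. x \<in> carrier E ==> cov' (\<gamma> x) = \<iota> x"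
  using ext unfolding restrict_scalars_sub_module restrict_scalars_sel \<iota>_zero by blast
 define push where "push = linear_ext R' (carrier E) V' (%x. basis_vector R' (\<iota> x))"
 have bc: "basis_vector R' (\<iota> x) \<in> carrier V'" if "x \<in> carrier E" for x
  by (rule basis_vector_closed[OF rc \<iota>_closed[OF that]])
 have push: "linear R' V V' push"
  unfolding push_def by (rule linear_ext_lin[OF rc V'M bc])
 have push_basis: "push (basis_vector R' x) = basis_vector R' (\<iota> x)" if "x \<in> carrier E" for x
  unfolding push_def by (rule linear_ext_basis[OF rc V'M bc that])
 have cp: "free_cover R' E' (push d) = cov' d" if "d \<in> carrier V" for d
 proof (rule lin_eq_on_basis[OF rc E' lin_compose[OF push free_cover_lin[OF E'] lin_closed[OF push]] cov'_lin _ that])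
  show "free_cover R' E' (push (basis_vector R' x)) = cov' (basis_vector R' x)" if x: "x \<in> carrier E" for x
   unfolding cov'_basis[OF x] push_basis[OF x] by (rule free_cover_basis[OF E' \<iota>_closed[OF x]])
 qed
 have \<gamma>c: "\<gamma> x \<in> carrier V" if "x \<in> carrier E" for x using lin_closed[OF \<gamma>(1) that] by simp
 have "linear R E (restrict_scalars \<phi> V') (%x. push (\<gamma> x))"
  by (rule lin_compose[OF \<gamma>(1) restrict_scalars_lin[OF push] \<gamma>c])
 from universal[OF this] obtain i
  where i: "linear R' E' V' i" "!!x. x \<in> carrier E ==> i (\<iota> x) = push (\<gamma> x)" by blast
 have "free_cover R' E' (i y) = y" if "y \<in> carrier E'" for y
 proof (rule lin_eq_on_generators[OF E' lin_compose[OF i(1) free_cover_lin[OF E'] lin_closed[OF i(1)]] lin_ident[OF subset_refl] _ that])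
  show "free_cover R' E' (i (\<iota> x)) = \<iota> x" if "x \<in> carrier E" for x
   unfolding i(2)[OF that] cp[OF \<gamma>c[OF that]] by (rule \<gamma>(2)[OF that])
 qed
 thus ?thesis
  unfolding projective_module_def
  using E' lin_mod_hom[OF E' i(1)] lin_mod_hom[OF V'M free_cover_lin[OF E']] lin_closed[OF i(1)]
  by (intro conjI exI[of _ "carrier E'"] bexI[of _ "restrict i (carrier E')"] bexI[of _ "restrict (free_cover R' E') (carrier V')"]) auto
qed

text \<open>
 When \<open>R'\<close> is \<open>R\<close> modulo \<open>v\<close> and \<open>E'\<close> is \<open>E\<close> modulo \<open>v\<close>, the values of the relation are killed by \<open>v\<close>, so that a
 selection on a free \<open>R\<close>-module descends to the free \<open>R'\<close>-module and then to its direct summand \<open>E'\<close>.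
\<close>

lemma projective_quotient_selects:
 assumes P: "projective_module R' E'" and v: "v \<in> carrier R"
  and \<phi>_surj: "!!r'. r' \<in> carrier R' ==> \<exists>r\<in>carrier R. \<phi> r = r'"
  and \<phi>_ker: "!!r. r \<in> carrier R ==> \<phi> r = \<zero>[R'] ==> \<exists>r'\<in>carrier R. r = v \<otimes> r'"
  and \<iota>_surj: "!!y. y \<in> carrier E' ==> \<exists>x\<in>carrier E. \<iota> x = y"
  and \<iota>_ker: "!!x. x \<in> carrier E ==> \<iota> x = \<zero>[E'] ==> \<exists>x'\<in>carrier E. x = v \<odot>[E] x'"
  and U: "module R U" and \<Gamma>: "linrel R E (carrier E) U \<Gamma>" and kill: "!!x w. \<Gamma> x w ==> v \<odot>[U] w = \<zero>[U]"
 shows "\<exists>h. linear R E U h & (\<forall>x\<in>carrier E. \<Gamma> x (h x))"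
proof -
 interpret U: module R U by fact
 obtain Z :: "'e set" and i q where iq: "i \<in> mod_hom R' E' (free_module R' Z)" "q \<in> mod_hom R' (free_module R' Z) E'"
  "\<forall>y\<in>carrier E'. q (i y) = y"
  using P unfolding projective_module_def by blast
 note i = mod_hom_lin[OF iq(1)] and q = mod_hom_lin[OF iq(2)]
 let ?F = "free_module R Z" and ?F' = "free_module R' Z"
 interpret F: module R ?F by (rule free_module_module[OF R.is_cring])
 interpret F': module R' ?F' by (rule free_module_module[OF S.is_cring])
 define \<pi> where "\<pi> f = (%z. \<phi> (f z))" for f :: "'e => 'a"
 note fc = free_module_coord[OF R.is_cring] and fc' = free_module_coord[OF S.is_cring]
 have \<pi>_closed: "\<pi> f \<in> carrier ?F'" if f: "f \<in> carrier ?F" for f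
 proof -
  have "{z. \<phi> (f z) ~= \<zero>[R']} <= {z. f z ~= \<zero>}" by auto
  hence "finite {z. \<phi> (f z) ~= \<zero>[R']}" by (rule finite_subset) (use f in "simp add: free_module_mem")
  thus ?thesis using f fc[OF f] by (auto simp: \<pi>_def free_module_mem)
 qed
 have \<pi>: "linear R ?F (restrict_scalars \<phi> ?F') \<pi>"
  by (rule linI) (simp_all add: \<pi>_closed, simp_all add: \<pi>_def free_module_sel fc)
 have \<pi>_add: "\<pi> (f \<oplus>[?F] g) = \<pi> f \<oplus>[?F'] \<pi> g" if "f \<in> carrier ?F" "g \<in> carrier ?F" for f g
  using lin_add[OF \<pi> that] by simp
 have \<pi>_smult: "\<pi> (r \<odot>[?F] f) = \<phi> r \<odot>[?F'] \<pi> f" if "r \<in> carrier R" "f \<in> carrier ?F" for r f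
  using lin_smult[OF \<pi> that] by simp
 have \<pi>_surj: "\<exists>f\<in>carrier ?F. \<pi> f = g" if g: "g \<in> carrier ?F'" for g
 proof -
  have "\<exists>r. r \<in> carrier R & \<phi> r = g z & (g z = \<zero>[R'] --> r = \<zero>)" for z
   using \<phi>_surj[OF fc'[OF g], of z] R.zero_closed hom_zero by metis
  then obtain f where f: "!!z. f z \<in> carrier R" "!!z. \<phi> (f z) = g z" "!!z. g z = \<zero>[R'] ==> f z = \<zero>" by metis
  have "finite {z. f z ~= \<zero>}" by (rule finite_subset[of _ "{z. g z ~= \<zero>[R']}"]) (use f(3) g in "auto simp: free_module_mem")
  hence "f \<in> carrier ?F" using f g by (auto simp: free_module_mem)
  thus ?thesis using f(2) by (auto simp: \<pi>_def)
 qed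
 have \<pi>_ker: "\<exists>f'\<in>carrier ?F. f = v \<odot>[?F] f'" if f: "f \<in> carrier ?F" "\<pi> f = \<zero>[?F']" for f
 proof -
  have "\<phi> (f z) = \<zero>[R']" for z using fun_cong[OF f(2), of z] by (simp add: \<pi>_def free_module_sel)
  hence "\<exists>r. r \<in> carrier R & f z = v \<otimes> r & (f z = \<zero> --> r = \<zero>)" for z
   using \<phi>_ker[OF fc[OF f(1)], of z] R.r_null[OF v] R.zero_closed by metis
  then obtain f' where f': "!!z. f' z \<in> carrier R" "!!z. f z = v \<otimes> f' z" "!!z. f z = \<zero> ==> f' z = \<zero>" by metis
  have "finite {z. f' z ~= \<zero>}" by (rule finite_subset[of _ "{z. f z ~= \<zero>}"]) (use f'(3) f in "auto simp: free_module_mem")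
  moreover have "f' z = \<zero>" if "z \<notin> Z" for z using f'(3)[of z] f(1) that by (simp add: free_module_mem)
  ultimately have "f' \<in> carrier ?F" using f'(1) by (simp add: free_module_mem)
  moreover have "f = v \<odot>[?F] f'" using f'(2) by (simp add: free_module_sel fun_eq_iff)
  ultimately show ?thesis by blast
 qed
 have qc: "q (\<pi> y) \<in> carrier E'" if "y \<in> carrier ?F" for y by (rule lin_closed[OF q \<pi>_closed[OF that]])
 define \<Gamma>' where "\<Gamma>' y w \<longleftrightarrow> (\<exists>x\<in>carrier E. q (\<pi> y) = \<iota> x & \<Gamma> x w)" for y w
 have \<iota>_add: "\<iota> (x \<oplus>[E] x') = \<iota> x \<oplus>[E'] \<iota> x'" if "x \<in> carrier E" "x' \<in> carrier E" for x x'
  using lin_add[OF \<iota> that] by simp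
 have \<iota>_smult: "\<iota> (r \<odot>[E] x) = \<phi> r \<odot>[E'] \<iota> x" if "r \<in> carrier R" "x \<in> carrier E" for r x
  using lin_smult[OF \<iota> that] by simp
 have "linrel R ?F (carrier ?F) U \<Gamma>'"
 proof (rule linrelI)
  show "\<exists>w\<in>carrier U. \<Gamma>' y w" if y: "y \<in> carrier ?F" for y
  proof -
   obtain x where x: "x \<in> carrier E" "\<iota> x = q (\<pi> y)" using \<iota>_surj[OF qc[OF y]] by blast
   obtain w where "w \<in> carrier U" "\<Gamma> x w" using linrel_total[OF \<Gamma> x(1)] by blast
   thus ?thesis unfolding \<Gamma>'_def using x by (intro bexI[of _ w] bexI[of _ x]) auto
  qed
  show "\<Gamma>' (y \<oplus>[?F] y') (w \<oplus>[U] w')"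
   if c: "y \<in> carrier ?F" "y' \<in> carrier ?F" "w \<in> carrier U" "w' \<in> carrier U" "\<Gamma>' y w" "\<Gamma>' y' w'" for y y' w w'
  proof -
   obtain x where x: "x \<in> carrier E" "q (\<pi> y) = \<iota> x" "\<Gamma> x w" using c(5) unfolding \<Gamma>'_def by blast
   obtain x' where x': "x' \<in> carrier E" "q (\<pi> y') = \<iota> x'" "\<Gamma> x' w'" using c(6) unfolding \<Gamma>'_def by blast
   have "q (\<pi> (y \<oplus>[?F] y')) = \<iota> (x \<oplus>[E] x')"
    unfolding \<pi>_add[OF c(1,2)] lin_add[OF q \<pi>_closed[OF c(1)] \<pi>_closed[OF c(2)]] x(2) x'(2) \<iota>_add[OF x(1) x'(1)] ..
   moreover have "\<Gamma> (x \<oplus>[E] x') (w \<oplus>[U] w')" by (rule linrel_add[OF \<Gamma> x(1) x'(1) c(3,4) x(3) x'(3)])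
   ultimately show ?thesis unfolding \<Gamma>'_def using E.a_closed[OF x(1) x'(1)] by blast
  qed
  show "\<Gamma>' (r \<odot>[?F] y) (r \<odot>[U] w)" if c: "r \<in> carrier R" "y \<in> carrier ?F" "w \<in> carrier U" "\<Gamma>' y w" for r y w
  proof -
   obtain x where x: "x \<in> carrier E" "q (\<pi> y) = \<iota> x" "\<Gamma> x w" using c(4) unfolding \<Gamma>'_def by blast
   have "q (\<pi> (r \<odot>[?F] y)) = \<iota> (r \<odot>[E] x)"
    unfolding \<pi>_smult[OF c(1,2)] lin_smult[OF q hom_closed[OF c(1)] \<pi>_closed[OF c(2)]] x(2) \<iota>_smult[OF c(1) x(1)] ..
   moreover have "\<Gamma> (r \<odot>[E] x) (r \<odot>[U] w)" by (rule linrel_smult[OF \<Gamma> c(1) x(1) c(3) x(3)])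
   ultimately show ?thesis unfolding \<Gamma>'_def using E.smult_closed[OF c(1) x(1)] by blast
  qed
 qed
 then obtain h' where h': "linear R ?F U h'" "\<forall>y\<in>carrier ?F. \<Gamma>' y (h' y)"
  by (rule selectsD[OF free_selects[OF R.is_cring U]])
 have h'_kill: "v \<odot>[U] h' y = \<zero>[U]" if y: "y \<in> carrier ?F" for y
 proof -
  have "\<Gamma>' y (h' y)" by (rule bspec[OF h'(2) y])
  then obtain x where "\<Gamma> x (h' y)" unfolding \<Gamma>'_def by blast
  thus ?thesis by (rule kill)
 qed
 define \<Delta> where "\<Delta> x w \<longleftrightarrow> (\<exists>y\<in>carrier ?F. \<pi> y = i (\<iota> x) & w = h' y)" for x w
 have "linrel R E (carrier E) U \<Delta>"
 proof (rule linrelI)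
  show "\<exists>w\<in>carrier U. \<Delta> x w" if "x \<in> carrier E" for x
   using \<pi>_surj[OF lin_closed[OF i \<iota>_closed[OF that]]] lin_closed[OF h'(1)] unfolding \<Delta>_def by blast
  show "\<Delta> (x \<oplus>[E] x') (w \<oplus>[U] w')" if c: "x \<in> carrier E" "x' \<in> carrier E" "\<Delta> x w" "\<Delta> x' w'" for x x' w w'
  proof -
   obtain y where y: "y \<in> carrier ?F" "\<pi> y = i (\<iota> x)" "w = h' y" using c(3) unfolding \<Delta>_def by blast
   obtain y' where y': "y' \<in> carrier ?F" "\<pi> y' = i (\<iota> x')" "w' = h' y'" using c(4) unfolding \<Delta>_def by blast
   show ?thesis unfolding \<Delta>_def
    by (rule bexI[OF _ F.a_closed[OF y(1) y'(1)]]) (unfold \<pi>_add[OF y(1) y'(1)] y(2,3) y'(2,3) \<iota>_add[OF c(1,2)]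
      lin_add[OF i \<iota>_closed[OF c(1)] \<iota>_closed[OF c(2)]] lin_add[OF h'(1) y(1) y'(1)], simp)
  qed
  show "\<Delta> (r \<odot>[E] x) (r \<odot>[U] w)" if c: "r \<in> carrier R" "x \<in> carrier E" "\<Delta> x w" for r x w
  proof -
   obtain y where y: "y \<in> carrier ?F" "\<pi> y = i (\<iota> x)" "w = h' y" using c(3) unfolding \<Delta>_def by blast
   show ?thesis unfolding \<Delta>_def
    by (rule bexI[OF _ F.smult_closed[OF c(1) y(1)]]) (unfold \<pi>_smult[OF c(1) y(1)] y(2,3) \<iota>_smult[OF c(1,2)]
      lin_smult[OF i hom_closed[OF c(1)] \<iota>_closed[OF c(2)]] lin_smult[OF h'(1) c(1) y(1)], simp)
  qed
 qed
 hence "\<exists>h. linear R E U h & (\<forall>x\<in>carrier E. \<Delta> x (h x)) & (\<forall>x\<in>carrier E. \<forall>w\<in>carrier U. \<Delta> x w --> w = h x)"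
 proof (rule linrel_function[OF E U carrier_submodule[OF E]])
  fix w assume "\<Delta> \<zero>[E] w"
  then obtain y where y: "y \<in> carrier ?F" "\<pi> y = i (\<iota> \<zero>[E])" "w = h' y" unfolding \<Delta>_def by blast
  have "\<pi> y = \<zero>[?F']"
   unfolding y(2) \<iota>_zero by (rule lin_zero[OF E' F'.module_axioms carrier_submodule[OF E'] i])
  then obtain y' where y': "y' \<in> carrier ?F" "y = v \<odot>[?F] y'" using \<pi>_ker[OF y(1)] by blast
  show "w = \<zero>[U]" unfolding y(3) y'(2) lin_smult[OF h'(1) v y'(1)] by (rule h'_kill[OF y'(1)])
 qed
 then obtain h where h: "linear R E U h" "\<forall>x\<in>carrier E. \<Delta> x (h x)" by blast
 have "\<forall>x\<in>carrier E. \<Gamma> x (h x)"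
 proof
  fix x assume x: "x \<in> carrier E"
  have hx: "h x \<in> carrier U" by (rule lin_closed[OF h(1) x])
  have "\<Delta> x (h x)" by (rule bspec[OF h(2) x])
  then obtain y where y: "y \<in> carrier ?F" "\<pi> y = i (\<iota> x)" "h x = h' y" unfolding \<Delta>_def by blast
  have "\<Gamma>' y (h x)" unfolding y(3) by (rule bspec[OF h'(2) y(1)])
  then obtain x' where x': "x' \<in> carrier E" "q (\<pi> y) = \<iota> x'" "\<Gamma> x' (h x)" unfolding \<Gamma>'_def by blast
  have ee: "\<iota> x = \<iota> x'" using x'(2) iq(3) \<iota>_closed[OF x] unfolding y(2) by simp
  have "\<iota> (x \<ominus>[E] x') = \<zero>[E']"
   using lin_minus[OF E restrict_scalars_module[OF E'] carrier_submodule[OF E] \<iota> x x'(1)] ee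
    abelian_group.minus_self[OF module.axioms(2)[OF restrict_scalars_module[OF E']], of "\<iota> x'"] \<iota>_closed[OF x'(1)] by simp
  then obtain x'' where x'': "x'' \<in> carrier E" "x \<ominus>[E] x' = v \<odot>[E] x''" using \<iota>_ker[OF E.minus_closed[OF x x'(1)]] by blast
  obtain w where w: "w \<in> carrier U" "\<Gamma> x'' w" using linrel_total[OF \<Gamma> x''(1)] by blast
  have "\<Gamma> (v \<odot>[E] x'') (v \<odot>[U] w)" by (rule linrel_smult[OF \<Gamma> v x''(1) w])
  hence z: "\<Gamma> (x \<ominus>[E] x') \<zero>[U]" unfolding x''(2) kill[OF w(2)] .
  have "\<Gamma> (x \<ominus>[E] x' \<oplus>[E] x') (\<zero>[U] \<oplus>[U] h x)"
   by (rule linrel_add[OF \<Gamma> E.minus_closed[OF x x'(1)] x'(1) U.zero_closed hx z x'(3)])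
  thus "\<Gamma> x (h x)" unfolding E.minus_add_cancel[OF x x'(1)] U.l_zero[OF hx] .
 qed
 thus ?thesis using h(1) by blast
qed

end

section \<open>Reduction modulo an element\<close>

context
 fixes R :: "('a, 'k) ring_scheme" (structure) and M :: "('a, 'm) module" and s :: 'a
 assumes M: "module R M" and s: "s \<in> carrier R"
begin

interpretation module R M by (rule M)

abbreviation I where "I \<equiv> PIdl\<^bsub>R\<^esub> s"
abbreviation sM where "sM \<equiv> (%x. s \<odot>[M] x) ` carrier M"

interpretation I: ideal I R by (rule R.cgenideal_ideal[OF s])

lemma sM_submodule: "submodule sM R M"
proof (rule lin_image_submodule[OF module_axioms module_axioms carrier_submodule[OF module_axioms]])
 show "linear R M M ((\<odot>\<^bsub>M\<^esub>) s)"
  by (rule linI) (use s in "simp_all add: smult_r_distr smult_assoc1[symmetric] R.m_comm")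
qed

lemma reduced_sel:
 "carrier (reduced_module M s) = carrier (quotient_module M sM)"
 "add (reduced_module M s) = add (quotient_module M sM)"
 "zero (reduced_module M s) = zero (quotient_module M sM)"
 by (simp_all add: reduced_module_def Let_def)

lemma sM_coset_self: "x \<in> carrier M ==> x \<in> sM +>[M] x"
 unfolding a_r_coset_def' by (rule UN_I[OF submodule_closed(2)[OF module_axioms sM_submodule]]) (simp add: l_zero)

lemma reduced_smult:
 assumes r: "r \<in> carrier R" and x: "x \<in> carrier M"
 shows "(I +>[R] r) \<odot>[reduced_module M s] (sM +>[M] x) = sM +>[M] (r \<odot>[M] x)"
proof -
 have "sM +>[M] (a \<odot>[M] y) = sM +>[M] (r \<odot>[M] x)" if a: "a \<in> I +>[R] r" and y: "y \<in> sM +>[M] x" for a y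
 proof -
  obtain b where b: "b \<in> carrier R" "a = b \<otimes> s \<oplus> r" using a unfolding a_r_coset_def' cgenideal_def by blast
  obtain z where z: "z \<in> carrier M" "y = s \<odot>[M] z \<oplus>[M] x" using y unfolding a_r_coset_def' by blast
  have ac: "a \<in> carrier R" and yc: "y \<in> carrier M" using b z r x s by simp_all
  have "a \<odot>[M] y = s \<odot>[M] (b \<odot>[M] y \<oplus>[M] r \<odot>[M] z) \<oplus>[M] r \<odot>[M] x"
  proof -
   have "a \<odot>[M] y = s \<odot>[M] (b \<odot>[M] y) \<oplus>[M] r \<odot>[M] (s \<odot>[M] z \<oplus>[M] x)"
    unfolding b(2) using b(1) r s x z yc by (simp add: smult_l_distr smult_assoc1[symmetric] R.m_comm)
   thus ?thesis using b(1) r s x z(1) yc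
    by (simp add: smult_r_distr smult_assoc1[symmetric] R.m_comm a_assoc)
  qed
  hence "a \<odot>[M] y \<ominus>[M] r \<odot>[M] x = s \<odot>[M] (b \<odot>[M] y \<oplus>[M] r \<odot>[M] z)"
   using b(1) r s x z(1) yc by (simp add: a_minus_def a_assoc r_neg)
  hence "a \<odot>[M] y \<ominus>[M] r \<odot>[M] x \<in> sM" using b(1) r z(1) yc by simp
  thus ?thesis using coset_eq_iff[OF module_axioms sM_submodule] ac yc r x by simp
 qed
 note eq = this
 have "(\<Union>a\<in>I +>[R] r. \<Union>y\<in>sM +>[M] x. sM +>[M] (a \<odot>[M] y)) = sM +>[M] (r \<odot>[M] x)"
 proof (rule SUP_eq_const)
  show "I +>[R] r ~= {}" using I.a_rcos_self[OF r] by force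
  show "(\<Union>y\<in>sM +>[M] x. sM +>[M] (a \<odot>[M] y)) = sM +>[M] (r \<odot>[M] x)" if a: "a \<in> I +>[R] r" for a
   by (rule SUP_eq_const) (use sM_coset_self[OF x] in force, rule eq[OF a])
 qed
 thus ?thesis by (simp add: reduced_module_def Let_def)
qed

lemma reduced_cases:
 assumes "C \<in> carrier (reduced_module M s)"
 obtains x where "x \<in> carrier M" "C = sM +>[M] x"
 using assms unfolding reduced_sel by (rule coset_cases)

lemma quot_cases:
 assumes "r' \<in> carrier (R Quot I)"
 shows "\<exists>r\<in>carrier R. I +>[R] r = r'"
 using assms unfolding FactRing_simps by auto

lemma reduced_module_module: "module (R Quot I) (reduced_module M s)"
proof -
 note hom = ring_hom_add[OF I.rcos_ring_hom, symmetric] ring_hom_mult[OF I.rcos_ring_hom, symmetric] ring_hom_one[OF I.rcos_ring_hom]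
 let ?N = "reduced_module M s"
 have Q: "module R (quotient_module M sM)" by (rule quotient_module_module[OF module_axioms sM_submodule])
 interpret Q: module R "quotient_module M sM" by (rule Q)
 note add = coset_add[OF module_axioms sM_submodule, folded reduced_sel(2)]
 note closed = coset_closed[of _ M sM, folded reduced_sel(1)]
 show ?thesis
 proof (rule moduleI)
  show "cring (R Quot I)" by (rule I.quotient_is_cring[OF R.is_cring])
  show "abelian_group ?N"
  proof (rule abelian_groupI, unfold reduced_sel)
   show "\<exists>y\<in>carrier (quotient_module M sM). y \<oplus>[quotient_module M sM] x = \<zero>[quotient_module M sM]"
    if "x \<in> carrier (quotient_module M sM)" for x using Q.l_neg[OF that] Q.a_inv_closed[OF that] by blast
  qed (simp_all add: Q.a_ac)
  fix a C assume "a \<in> carrier (R Quot I)" "C \<in> carrier ?N"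
  then obtain r x where r: "r \<in> carrier R" "a = I +>[R] r" and x: "x \<in> carrier M" "C = sM +>[M] x"
   using quot_cases reduced_cases by metis
  show "a \<odot>[?N] C \<in> carrier ?N" unfolding r(2) x(2) reduced_smult[OF r(1) x(1)] by (rule closed[OF smult_closed[OF r(1) x(1)]])
  fix b assume "b \<in> carrier (R Quot I)"
  then obtain t where t: "t \<in> carrier R" "b = I +>[R] t" using quot_cases by metis
  show "(a \<oplus>[R Quot I] b) \<odot>[?N] C = a \<odot>[?N] C \<oplus>[?N] b \<odot>[?N] C"
   unfolding r(2) x(2) t(2) hom(1)[OF r(1) t(1)] using r(1) t(1) x(1) by (simp add: reduced_smult add smult_l_distr)
  show "(a \<otimes>[R Quot I] b) \<odot>[?N] C = a \<odot>[?N] (b \<odot>[?N] C)"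
   unfolding r(2) x(2) t(2) hom(2)[OF r(1) t(1)] using r(1) t(1) x(1) by (simp add: reduced_smult smult_assoc1)
 next
  fix a C D assume "a \<in> carrier (R Quot I)" "C \<in> carrier ?N" "D \<in> carrier ?N"
  then obtain r x y where r: "r \<in> carrier R" "a = I +>[R] r" and x: "x \<in> carrier M" "C = sM +>[M] x"
   and y: "y \<in> carrier M" "D = sM +>[M] y"
   using quot_cases reduced_cases by metis
  show "a \<odot>[?N] (C \<oplus>[?N] D) = a \<odot>[?N] C \<oplus>[?N] a \<odot>[?N] D"
   unfolding r(2) x(2) y(2) using r(1) x(1) y(1) by (simp add: reduced_smult add smult_r_distr)
 next
  fix C assume "C \<in> carrier ?N"
  then obtain x where x: "x \<in> carrier M" "C = sM +>[M] x" by (rule reduced_cases)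
  show "\<one>[R Quot I] \<odot>[?N] C = C"
   unfolding hom(3)[symmetric] x(2) reduced_smult[OF R.one_closed x(1)] smult_one[OF x(1)] ..
 qed
qed

lemma reduced_base_change:
 "base_change R (R Quot I) (%r. I +>[R] r) M (reduced_module M s) (%x. sM +>[M] x)"
proof (intro base_change.intro base_change_axioms.intro)
 show "ring_hom_cring R (R Quot I) (%r. I +>[R] r)" by (rule I.rcos_ring_hom_cring[OF R.is_cring])
 show "linear R M (restrict_scalars (%r. I +>[R] r) (reduced_module M s)) (%x. sM +>[M] x)"
  by (rule linI) (simp_all add: reduced_smult reduced_sel coset_closed coset_add[OF module_axioms sM_submodule])
 show "carrier (reduced_module M s) <= A" if "!!x. x \<in> carrier M ==> sM +>[M] x \<in> A" for A
  using that by (auto elim: reduced_cases)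
qed (rule module_axioms reduced_module_module)+

lemma reduced_zero_iff: "x \<in> carrier M ==> sM +>[M] x = \<zero>[reduced_module M s] \<longleftrightarrow> x \<in> sM"
 unfolding reduced_sel quotient_module_sel by (rule coset_eq_zero[OF module_axioms sM_submodule])

text \<open>A linear map into an \<open>R / sR\<close>-module kills \<open>s M\<close>.\<close>

lemma reduced_universal:
 assumes V: "module (R Quot I) V" and g: "linear R M (restrict_scalars (%r. I +>[R] r) V) g"
 shows "\<exists>i. linear (R Quot I) (reduced_module M s) V i & (\<forall>x\<in>carrier M. i (sM +>[M] x) = g x)"
proof -
 interpret b: base_change R "R Quot I" "%r. I +>[R] r" M "reduced_module M s" "%x. sM +>[M] x" by (rule reduced_base_change)
 interpret V: module "R Quot I" V by (rule V)
 let ?V = "restrict_scalars (%r. I +>[R] r) V"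
 have gc: "g x \<in> carrier V" if "x \<in> carrier M" for x using lin_closed[OF g that] by simp
 have Is: "I +>[R] s = \<zero>[R Quot I]"
  unfolding I.a_rcos_const[OF R.cgenideal_self[OF s]] FactRing_def by (simp only: ring.simps)
 have gs: "g (s \<odot>[M] x) = \<zero>[V]" if "x \<in> carrier M" for x
  unfolding lin_smult[OF g s that] restrict_scalars_sel Is by (rule V.smult_l_null[OF gc[OF that]])
 have eq: "g x = g y" if c: "x \<in> carrier M" "y \<in> carrier M" "sM +>[M] x = sM +>[M] y" for x y
 proof -
  have "x \<ominus>[M] y \<in> sM" using c coset_eq_iff[OF module_axioms sM_submodule] by blast
  hence "g (x \<ominus>[M] y) = \<zero>[V]" using gs by auto
  hence "g (x \<ominus>[M] y \<oplus>[M] y) = \<zero>[V] \<oplus>[V] g y" using lin_add[OF g minus_closed[OF c(1,2)] c(2)] by simp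
  thus ?thesis unfolding minus_add_cancel[OF c(1,2)] V.l_zero[OF gc[OF c(2)]] .
 qed
 define i where "i C = g (SOME x. x \<in> carrier M & C = sM +>[M] x)" for C
 have i: "i (sM +>[M] x) = g x" if "x \<in> carrier M" for x
 proof -
  have "\<exists>y. y \<in> carrier M & sM +>[M] x = sM +>[M] y" using that by blast
  from someI_ex[OF this] show ?thesis unfolding i_def by (intro eq) (use that in auto)
 qed
 have "linear (R Quot I) (reduced_module M s) V i"
 proof (rule linI)
  fix C assume "C \<in> carrier (reduced_module M s)"
  then obtain x where x: "x \<in> carrier M" "C = sM +>[M] x" by (rule reduced_cases)
  show "i C \<in> carrier V" unfolding x(2) i[OF x(1)] by (rule gc[OF x(1)])
  show "i (a \<odot>[reduced_module M s] C) = a \<odot>[V] i C" if a: "a \<in> carrier (R Quot I)" for a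
  proof -
   obtain r where r: "r \<in> carrier R" "a = I +>[R] r" using quot_cases[OF a] by blast
   show ?thesis unfolding x(2) r(2) reduced_smult[OF r(1) x(1)] i[OF smult_closed[OF r(1) x(1)]] i[OF x(1)]
    using lin_smult[OF g r(1) x(1)] by simp
  qed
  fix D assume "D \<in> carrier (reduced_module M s)"
  then obtain y where y: "y \<in> carrier M" "D = sM +>[M] y" by (rule reduced_cases)
  show "i (C \<oplus>[reduced_module M s] D) = i C \<oplus>[V] i D"
   unfolding x(2) y(2) reduced_sel coset_add[OF module_axioms sM_submodule x(1) y(1)] i[OF a_closed[OF x(1) y(1)]] i[OF x(1)] i[OF y(1)]
   using lin_add[OF g x(1) y(1)] by simp
 qed
 thus ?thesis using i by blast
qed

end

section \<open>Localization of modules\<close>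

context nonzerodivisors
begin

abbreviation L where "L \<equiv> loc_as_module R S"
abbreviation LR where "LR \<equiv> loc_ring R S"

interpretation LR: cring LR by (rule loc_ring_cring)

lemma embed_hom: "ring_hom_cring R LR embed"
 by (rule ring_hom_cring.intro[OF is_cring loc_ring_cring ring_hom_cring_axioms.intro[OF ring_hom_memI]])
  (simp_all only: embed_closed embed_add embed_mult embed_one)

interpretation emb: ring_hom_cring R LR embed by (rule embed_hom)

lemma inverse_smult:
 assumes M: "module LR M" and s: "s \<in> S" and m: "m \<in> carrier M"
 shows "embed s \<odot>[M] (fraction R S \<one> s \<odot>[M] m) = m" "fraction R S \<one> s \<odot>[M] (embed s \<odot>[M] m) = m"
proof -
 interpret M: module LR M by (rule M)
 have c: "embed s \<in> carrier LR" "fraction R S \<one> s \<in> carrier LR" using s by simp_all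
 show "embed s \<odot>[M] (fraction R S \<one> s \<odot>[M] m) = m"
  unfolding M.smult_assoc1[OF c m, symmetric] embed_inverse[OF s] by (rule M.smult_one[OF m])
 show "fraction R S \<one> s \<odot>[M] (embed s \<odot>[M] m) = m"
  unfolding M.smult_assoc1[OF c(2,1) m, symmetric] LR.m_comm[OF c(2,1)] embed_inverse[OF s] by (rule M.smult_one[OF m])
qed

lemma loc_torsion_free:
 assumes M: "module LR M" and s: "s \<in> S" and m: "m \<in> carrier M" "embed s \<odot>[M] m = \<zero>[M]"
 shows "m = \<zero>[M]"
proof -
 interpret M: module LR M by (rule M)
 have "fraction R S \<one> s \<odot>[M] (embed s \<odot>[M] m) = \<zero>[M]"
  unfolding m(2) by (rule M.smult_r_null) (simp add: s)
 thus ?thesis unfolding inverse_smult(2)[OF M s m(1)] .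
qed

lemma loc_module_weakly_cotorsion:
 assumes M: "module LR M"
 shows "ext_vanishes R L (restrict_scalars embed M)"
proof -
 interpret fraction_module R S L "\<one>[LR]" by (rule loc_fraction_module)
 interpret M: module LR M by (rule M)
 show ?thesis
 proof (rule divisible_weakly_cotorsion[OF emb.restrict_scalars_module[OF M]])
  show "c = \<zero>[restrict_scalars embed M]"
   if "s \<in> S" "c \<in> carrier (restrict_scalars embed M)" "s \<odot>[restrict_scalars embed M] c = \<zero>[restrict_scalars embed M]" for s c
   using loc_torsion_free[OF M, of s c] that by simp
  show "\<exists>c'\<in>carrier (restrict_scalars embed M). s \<odot>[restrict_scalars embed M] c' = c"
   if "s \<in> S" "c \<in> carrier (restrict_scalars embed M)" for s c
   using inverse_smult(1)[OF M, of s c] that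
   by (intro bexI[of _ "fraction R S \<one> s \<odot>[M] c"]) simp_all
 qed
qed

lemma quot_module_weakly_cotorsion:
 assumes s: "s \<in> S" and M: "module (R Quot PIdl\<^bsub>R\<^esub> s) M"
 shows "ext_vanishes R L (restrict_scalars (%r. PIdl\<^bsub>R\<^esub> s +>[R] r) M)"
proof -
 interpret fraction_module R S L "\<one>[LR]" by (rule loc_fraction_module)
 interpret I: ideal "PIdl\<^bsub>R\<^esub> s" R by (rule cgenideal_ideal) (simp add: s)
 interpret q: ring_hom_cring R "R Quot PIdl\<^bsub>R\<^esub> s" "%r. PIdl\<^bsub>R\<^esub> s +>[R] r" by (rule I.rcos_ring_hom_cring[OF is_cring])
 interpret M: module "R Quot PIdl\<^bsub>R\<^esub> s" M by (rule M)
 have Is: "PIdl\<^bsub>R\<^esub> s +>[R] s = \<zero>[R Quot PIdl\<^bsub>R\<^esub> s]"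
  unfolding I.a_rcos_const[OF cgenideal_self[OF S_closed[OF s]]] FactRing_def by (simp only: ring.simps)
 show ?thesis
  by (rule killed_weakly_cotorsion[OF q.restrict_scalars_module[OF M] s])
   (unfold restrict_scalars_sel Is, rule M.smult_l_null)
qed

context
 fixes E :: "('a, 'm) module"
 assumes E: "module R E"
begin

interpretation E: module R E by (rule E)

abbreviation TE where "TE \<equiv> tensor R L E"
abbreviation LE where "LE \<equiv> localized_module R S E"
abbreviation pu where "pu \<equiv> pure_tensor R L E"

lemma TE: "module R TE" by (rule T_module[OF loc_as_module_module E])

interpretation TE: module R TE by (rule TE)

lemma LE_sel: "carrier LE = carrier TE" "add LE = add TE" "zero LE = zero TE"
 by (simp_all add: localized_module_def Let_def)

lemma LE_smult: "l \<odot>[LE] t = tensor_map R L E L E (\<lambda>x\<in>carrier L. l \<otimes>[LR] x) (\<lambda>y\<in>carrier E. y) t"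
 by (simp add: localized_module_def Let_def)

lemma LE_smult_tensor:
 assumes l: "l \<in> carrier LR"
 shows "linear R TE TE (%t. l \<odot>[LE] t)"
  and "l' \<in> carrier LR ==> x \<in> carrier E ==> l \<odot>[LE] pu l' x = pu (l \<otimes>[LR] l') x"
proof -
 have f: "linear R L L (\<lambda>x\<in>carrier L. l \<otimes>[LR] x)"
  by (rule linI) (use l in "simp_all add: LR.r_distr LR.m_lcomm")
 have g: "linear R E E (\<lambda>y\<in>carrier E. y)" by (rule linI) simp_all
 note t = tensor_map_lin[OF loc_as_module_module E loc_as_module_module E f g]
 show "linear R TE TE (%t. l \<odot>[LE] t)" unfolding LE_smult by (rule t(1))
 show "l \<odot>[LE] pu l' x = pu (l \<otimes>[LR] l') x" if "l' \<in> carrier LR" "x \<in> carrier E"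
  unfolding LE_smult using t(2)[of l' x] that by simp
qed

lemma pu_closed: "l \<in> carrier LR ==> x \<in> carrier E ==> pu l x \<in> carrier TE"
 using pure_closed[OF loc_as_module_module E, of l x] by simp

lemma lin_eq_on_pu:
 assumes "module R V" "linear R TE V g" "linear R TE V h"
  and "!!l x. l \<in> carrier LR ==> x \<in> carrier E ==> g (pu l x) = h (pu l x)" and "t \<in> carrier TE"
 shows "g t = h t"
 by (rule lin_eq_on_tensor[OF loc_as_module_module E assms(1-3) _ assms(5)]) (simp add: assms(4))

lemma TE_smult_lin: "r \<in> carrier R ==> linear R TE TE (%t. r \<odot>[TE] t)"
 by (rule linI) (simp_all add: TE.smult_r_distr TE.smult_assoc1[symmetric] m_comm)

lemma embed_smult_LE:
 assumes r: "r \<in> carrier R" and t: "t \<in> carrier TE"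
 shows "embed r \<odot>[LE] t = r \<odot>[TE] t"
proof (rule lin_eq_on_pu[OF TE LE_smult_tensor(1)[OF embed_closed[OF r]] TE_smult_lin[OF r] _ t])
 show "embed r \<odot>[LE] pu l x = r \<odot>[TE] pu l x" if "l \<in> carrier LR" "x \<in> carrier E" for l x
  using LE_smult_tensor(2)[OF embed_closed[OF r] that] pure_smult_left[OF loc_as_module_module E r, of l x] that by simp
qed

lemma LE_module: "module LR LE"
proof (rule moduleI)
 note sl = LE_smult_tensor(1) and sp = LE_smult_tensor(2)
 show "cring LR" by (rule loc_ring_cring)
 show "abelian_group LE"
 proof (rule abelian_groupI, unfold LE_sel)
  show "\<exists>y\<in>carrier TE. y \<oplus>[TE] x = \<zero>[TE]" if "x \<in> carrier TE" for x using TE.l_neg[OF that] TE.a_inv_closed[OF that] by blast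
 qed (simp_all add: TE.a_ac)
 fix a t assume a: "a \<in> carrier LR" and "t \<in> carrier LE"
 hence t: "t \<in> carrier TE" by (simp add: LE_sel)
 show "a \<odot>[LE] t \<in> carrier LE" unfolding LE_sel by (rule lin_closed[OF sl[OF a] t])
 fix b assume b: "b \<in> carrier LR"
 show "(a \<oplus>[LR] b) \<odot>[LE] t = a \<odot>[LE] t \<oplus>[LE] b \<odot>[LE] t" unfolding LE_sel
 proof (rule lin_eq_on_pu[OF TE sl[OF LR.a_closed[OF a b]] lin_sum[OF TE sl[OF a] sl[OF b]] _ t])
  show "(a \<oplus>[LR] b) \<odot>[LE] pu l x = a \<odot>[LE] pu l x \<oplus>[TE] b \<odot>[LE] pu l x" if c: "l \<in> carrier LR" "x \<in> carrier E" for l x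
   unfolding sp[OF LR.a_closed[OF a b] c] sp[OF a c] sp[OF b c] LR.l_distr[OF a b c(1)]
   using pure_add_left[OF loc_as_module_module E, of "a \<otimes>[LR] l" "b \<otimes>[LR] l" x] a b c by simp
 qed
 show "(a \<otimes>[LR] b) \<odot>[LE] t = a \<odot>[LE] (b \<odot>[LE] t)"
 proof (rule lin_eq_on_pu[OF TE sl[OF LR.m_closed[OF a b]] lin_compose[OF sl[OF b] sl[OF a] lin_closed[OF sl[OF b]]] _ t])
  show "(a \<otimes>[LR] b) \<odot>[LE] pu l x = a \<odot>[LE] (b \<odot>[LE] pu l x)" if c: "l \<in> carrier LR" "x \<in> carrier E" for l x
   unfolding sp[OF LR.m_closed[OF a b] c] sp[OF b c] sp[OF a LR.m_closed[OF b c(1)] c(2)] LR.m_assoc[OF a b c(1)] ..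
 qed
next
 fix a t t' assume "a \<in> carrier LR" "t \<in> carrier LE" "t' \<in> carrier LE"
 thus "a \<odot>[LE] (t \<oplus>[LE] t') = a \<odot>[LE] t \<oplus>[LE] a \<odot>[LE] t'"
  unfolding LE_sel by (rule lin_add[OF LE_smult_tensor(1)])
next
 fix t assume "t \<in> carrier LE"
 hence t: "t \<in> carrier TE" by (simp add: LE_sel)
 show "\<one>[LR] \<odot>[LE] t = t"
  by (rule lin_eq_on_pu[OF TE LE_smult_tensor(1)[OF LR.one_closed] lin_ident[OF subset_refl] _ t])
   (simp add: LE_smult_tensor(2))
qed

lemma localized_base_change: "base_change R LR embed E LE (pu \<one>[LR])"
proof (intro base_change.intro base_change_axioms.intro)
 have one: "\<one>[LR] \<in> carrier L" by simp
 show "linear R E (restrict_scalars embed LE) (pu \<one>[LR])"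
  by (rule linI) (simp_all add: LE_sel pu_closed pure_add_right[OF loc_as_module_module E one]
   pure_smult_right[OF loc_as_module_module E _ one] embed_smult_LE)
 show "carrier LE <= A" if A: "submodule A LR LE" and g: "!!x. x \<in> carrier E ==> pu \<one>[LR] x \<in> A" for A
 proof
  note AA = submodule_closed[OF LE_module A]
  have AT: "submodule A R TE"
  proof (rule submoduleI'[OF TE])
   show "A <= carrier TE" using AA(1) by (auto simp: LE_sel)
   show "\<zero>[TE] \<in> A" using AA(2) by (simp add: LE_sel)
   show "x \<oplus>[TE] y \<in> A" if "x \<in> A" "y \<in> A" for x y using AA(4)[OF that] by (simp add: LE_sel)
   show "r \<odot>[TE] x \<in> A" if "r \<in> carrier R" "x \<in> A" for r x
    using AA(6)[OF embed_closed[OF that(1)] that(2)] embed_smult_LE[OF that(1)] AA(1)[OF that(2)] by (simp add: LE_sel)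
  qed
  fix t assume "t \<in> carrier LE"
  hence t: "t \<in> carrier TE" by (simp add: LE_sel)
  show "t \<in> A"
  proof (rule tensor_generated[OF loc_as_module_module E AT _ t])
   fix l x assume "l \<in> carrier L" and x: "x \<in> carrier E"
   hence l: "l \<in> carrier LR" by simp
   show "pu l x \<in> A"
    using AA(6)[OF l g[OF x]] LE_smult_tensor(2)[OF l LR.one_closed x] l by simp
  qed
 qed
qed (rule embed_hom E LE_module)+

text \<open>The universal property of \<open>S\<^sup>-\<^sup>1E\<close>, by way of the bilinear map \<open>(l, x) \<mapsto> l \<cdot> g x\<close>.\<close>

lemma localized_universal:
 assumes V: "module LR V" and g: "linear R E (restrict_scalars embed V) g"
 shows "\<exists>i. linear LR LE V i & (\<forall>x\<in>carrier E. i (pu \<one>[LR] x) = g x)"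
proof -
 interpret V: module LR V by (rule V)
 let ?V = "restrict_scalars embed V" and ?b = "%(l, x). l \<odot>[V] g x"
 have VR: "module R ?V" by (rule emb.restrict_scalars_module[OF V])
 have gc: "g x \<in> carrier V" if "x \<in> carrier E" for x using lin_closed[OF g that] by simp
 have bl: "bilin R L E ?V (%l x. l \<odot>[V] g x)"
 proof (rule bilinI)
  show "linear R L ?V (%l. l \<odot>[V] g x)" if "x \<in> carrier E" for x
   by (rule linI) (use gc[OF that] in "simp_all add: V.smult_l_distr V.smult_assoc1")
  show "linear R E ?V (%x. l \<odot>[V] g x)" if "l \<in> carrier L" for l
   by (rule linI) (use that gc in "simp_all add: lin_add[OF g] lin_smult[OF g] V.smult_r_distr
    V.smult_assoc1[symmetric] LR.m_comm")
 qed
 note Lf = tensor_lift[OF loc_as_module_module E VR bl, of ?b]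
 define i where "i = lift R L E ?V ?b"
 have i: "linear R TE ?V i" unfolding i_def by (rule Lf(1)) simp
 have ip: "i (pu l x) = l \<odot>[V] g x" if "l \<in> carrier LR" "x \<in> carrier E" for l x
  unfolding i_def by (rule Lf(2)) (use that in simp_all)
 have ic: "i t \<in> carrier V" if "t \<in> carrier TE" for t using lin_closed[OF i that] by simp
 have "linear LR LE V i"
 proof (rule linI, unfold LE_sel)
  show "i t \<in> carrier V" if "t \<in> carrier TE" for t by (rule ic[OF that])
  show "i (t \<oplus>[TE] t') = i t \<oplus>[V] i t'" if "t \<in> carrier TE" "t' \<in> carrier TE" for t t' using lin_add[OF i that] by simp
  show "i (l \<odot>[LE] t) = l \<odot>[V] i t" if l: "l \<in> carrier LR" and t: "t \<in> carrier TE" for l t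
  proof (rule lin_eq_on_pu[OF VR lin_compose[OF LE_smult_tensor(1)[OF l] i lin_closed[OF LE_smult_tensor(1)[OF l]]] _ _ t])
   show "linear R TE ?V (%t. l \<odot>[V] i t)"
    by (rule linI) (use l ic in "simp_all add: lin_add[OF i] lin_smult[OF i] V.smult_r_distr
     V.smult_assoc1[symmetric] LR.m_comm")
   show "i (l \<odot>[LE] pu l' x) = l \<odot>[V] i (pu l' x)" if c: "l' \<in> carrier LR" "x \<in> carrier E" for l' x
    unfolding LE_smult_tensor(2)[OF l c] ip[OF c] ip[OF LR.m_closed[OF l c(1)] c(2)] by (rule V.smult_assoc1[OF l c(1) gc[OF c(2)]])
  qed
 qed
 moreover have "i (pu \<one>[LR] x) = g x" if "x \<in> carrier E" for x
  unfolding ip[OF LR.one_closed that] by (rule V.smult_one[OF gc[OF that]])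
 ultimately show ?thesis by blast
qed

end

lemma direct_power_eq_restrict: "direct_power L Z = restrict_scalars embed (free_module LR Z)"
 by (simp add: restrict_scalars_def direct_power_def free_module_def)

end

section \<open>The criterion\<close>

locale localized_presentation = presented_fractions R S "loc_as_module R S" "\<one>[loc_ring R S]" X \<epsilon> i
 for R :: "('a, 'k) ring_scheme" (structure) and S :: "'a set" and X :: "'x set" and \<epsilon> i
begin

text \<open>The module \<open>P\<close> of \<open>syzygy_extends\<close> is the quotient of \<open>Q\<^sup>(\<^sup>E\<^sup>)\<close> by \<open>sat\<close>.  It is an \<open>S\<^sup>-\<^sup>1R\<close>-module, and by the universal
property the map \<open>k\<close> from \<open>S\<^sup>-\<^sup>1E\<close> to it satisfies \<open>k \<circ> cov' = q\<close>; so a splitting of a free module onto \<open>S\<^sup>-\<^sup>1E\<close> supplies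
\<open>\<alpha>\<close> and \<open>\<beta>\<close>.\<close>

lemma extends_of_locally_projective:
 fixes E :: "('a, 'm) module" and C :: "('a, 'c) module"
 assumes E: "module R E" and tf: "!!s x. s \<in> S ==> x \<in> carrier E ==> s \<odot>[E] x = \<zero>[E] ==> x = \<zero>[E]"
  and red: "!!s. s \<in> S ==> projective_module (R Quot PIdl\<^bsub>R\<^esub> s) (reduced_module E s)"
  and loc: "projective_module LR (localized_module R S E)"
  and C: "module R C" and ext: "extends R F N C"
 shows "ext_vanishes R E C"
proof -
 interpret E: module R E by (rule E)
 interpret LR: cring LR by (rule loc_ring_cring)
 interpret emb: ring_hom_cring R LR embed by (rule embed_hom)
 let ?LE = "localized_module R S E" and ?\<iota> = "pure_tensor R L E \<one>[LR]"
 interpret b: base_change R LR embed E ?LE ?\<iota> by (rule localized_base_change[OF E])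
 let ?V = "free_module LR (carrier E)" and ?D = "pow (carrier E)" and ?F = "free_module R (carrier E)"
 let ?sat = "sat E" and ?c = "free_cover R E"
 interpret V: module LR ?V by (rule b.VM)
 interpret F: module R ?F by (rule free_module_module[OF is_cring])
 note ed = direct_power_eq_restrict
 have e: "carrier ?D = carrier ?V" "add ?D = add ?V" "zero ?D = zero ?V" "!!r d. r \<odot>[?D] d = embed r \<odot>[?V] d"
  by (simp_all only: ed restrict_scalars_sel)
 have cl: "linear R ?F E ?c" by (rule free_cover_lin[OF E])
 have "submodule ?sat R ?D" by (rule sat_submodule[OF E]) (rule tf)
 note SS = submodule_closed[OF pow_module this]
 have sd: "?sat = {d \<in> carrier ?D. \<exists>s\<in>S. \<exists>y\<in>carrier ?F. s \<odot>[?D] d = scale y & ?c y = \<zero>[E]}"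
  by (rule sat_def[OF E]) (rule tf)
 have B: "module R (quotient_module ?D (ints E))" by (rule Bq[OF E]) (rule tf)
 have sat_V: "submodule ?sat LR ?V"
 proof (rule submoduleI'[OF b.VM])
  show "?sat <= carrier ?V" using SS(1) unfolding e by blast
  show "\<zero>[?V] \<in> ?sat" using SS(2) unfolding e .
  show "d \<oplus>[?V] d' \<in> ?sat" if "d \<in> ?sat" "d' \<in> ?sat" for d d' using SS(4)[OF that] unfolding e .
  show "l \<odot>[?V] d \<in> ?sat" if l: "l \<in> carrier LR" and d: "d \<in> ?sat" for l d
  proof -
   obtain a t where t: "a \<in> carrier R" "t \<in> S" "l = fraction R S a t" using l by (rule loc_cases)
   obtain s y where s: "s \<in> S" "y \<in> carrier ?F" "s \<odot>[?D] d = scale y" "?c y = \<zero>[E]" and dc: "d \<in> carrier ?D"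
    using d unfolding sd by blast
   have dV: "d \<in> carrier ?V" using dc unfolding e .
   have ec: "embed s \<in> carrier LR" "embed t \<in> carrier LR" "embed a \<in> carrier LR" using s(1) t(1,2) by simp_all
   have tl: "embed t \<otimes>[LR] l = embed a"
    unfolding t(3) embed_smult[OF S_closed[OF t(2)] t(1,2)]
    unfolding embed_def using t(1,2) by (simp add: fraction_eq_iff m_comm)
   have el: "embed (s \<otimes> t) \<otimes>[LR] l = embed a \<otimes>[LR] embed s"
    unfolding embed_mult[OF S_closed[OF s(1)] S_closed[OF t(2)]] tl[symmetric] LR.m_assoc[OF ec(1,2) l]
    by (rule LR.m_comm[OF ec(1) LR.m_closed[OF ec(2) l]])
   have "embed (s \<otimes> t) \<odot>[?V] (l \<odot>[?V] d) = (embed a \<otimes>[LR] embed s) \<odot>[?V] d"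
    unfolding el[symmetric] by (rule V.smult_assoc1[OF _ l dV, symmetric]) (simp add: s(1) t(2))
   also have "\<dots> = embed a \<odot>[?V] (embed s \<odot>[?V] d)" by (rule V.smult_assoc1[OF ec(3,1) dV])
   finally have "(s \<otimes> t) \<odot>[?D] (l \<odot>[?V] d) = a \<odot>[?D] (s \<odot>[?D] d)" unfolding e .
   also have "\<dots> = scale (a \<odot>[?F] y)" unfolding s(3) by (rule lin_smult[OF scale_lin t(1) s(2), symmetric])
   finally have 1: "(s \<otimes> t) \<odot>[?D] (l \<odot>[?V] d) = scale (a \<odot>[?F] y)" .
   have 2: "?c (a \<odot>[?F] y) = \<zero>[E]" unfolding lin_smult[OF cl t(1) s(2)] s(4) by (rule E.smult_r_null[OF t(1)])
   have 3: "l \<odot>[?V] d \<in> carrier ?D" unfolding e by (rule V.smult_closed[OF l dV])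
   show ?thesis unfolding sd
    using 1 2 3 S_mult[OF s(1) t(2)] F.smult_closed[OF t(1) s(2)] by blast
  qed
 qed
 let ?P = "quotient_module ?V ?sat" and ?q = "%d. ?sat +>[?V] d"
 have PM: "module LR ?P" by (rule quotient_module_module[OF b.VM sat_V])
 have q: "linear LR ?V ?P ?q" by (rule coset_lin[OF b.VM sat_V])
 have q0: "?q d = \<zero>[?P] \<longleftrightarrow> d \<in> ?sat" if "d \<in> carrier ?V" for d
  unfolding quotient_module_sel by (rule coset_eq_zero[OF b.VM sat_V that])
 have scale_basis: "scale (basis_vector R x) = basis_vector LR x" for x
  by (auto simp: scale_def basis_vector_def fun_eq_iff embed_one embed_zero LR.l_one[OF LR.one_closed])
 have scale_V: "linear R ?F (restrict_scalars embed ?V) scale" using scale_lin unfolding ed .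
 have scale_c: "scale y \<in> carrier ?V" if "y \<in> carrier ?F" for y using lin_closed[OF scale_V that] by simp
 have PR: "module R (restrict_scalars embed ?P)" by (rule emb.restrict_scalars_module[OF PM])
 have qs: "linear R ?F (restrict_scalars embed ?P) (%y. ?q (scale y))"
  by (rule lin_compose[OF scale_V emb.restrict_scalars_lin[OF q] scale_c])
 have qs_eq: "?q (scale y) = ?q (scale y')" if c: "y \<in> carrier ?F" "y' \<in> carrier ?F" "?c y = ?c y'" for y y'
 proof -
  have "?c (y \<ominus>[?F] y') = \<zero>[E]"
   unfolding lin_minus[OF F.module_axioms E carrier_submodule[OF F.module_axioms] cl c(1,2)] c(3)
   by (rule E.minus_self[OF lin_closed[OF cl c(2)]])
  moreover have "\<one> \<odot>[?D] scale (y \<ominus>[?F] y') = scale (y \<ominus>[?F] y')"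
   by (rule module.smult_one[OF pow_module scale_closed[OF F.minus_closed[OF c(1,2)]]])
  ultimately have "scale (y \<ominus>[?F] y') \<in> ?sat"
   unfolding sd using F.minus_closed[OF c(1,2)] scale_closed[OF F.minus_closed[OF c(1,2)]] S_one by blast
  hence "?q (scale (y \<ominus>[?F] y')) = \<zero>[?P]" using q0[OF scale_c[OF F.minus_closed[OF c(1,2)]]] by blast
  hence z: "?q (scale (y \<ominus>[?F] y')) = \<zero>[restrict_scalars embed ?P]" by simp
  have "?q (scale (y \<ominus>[?F] y' \<oplus>[?F] y')) = \<zero>[restrict_scalars embed ?P] \<oplus>[restrict_scalars embed ?P] ?q (scale y')"
   unfolding lin_add[OF qs F.minus_closed[OF c(1,2)] c(2)] z ..
  thus ?thesis
   unfolding F.minus_add_cancel[OF c(1,2)]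
   using abelian_monoid.l_zero[OF abelian_group.axioms(1)[OF module.axioms(2)[OF PR]] lin_closed[OF qs c(2)]] by simp
 qed
 have bF: "basis_vector R x \<in> carrier ?F" if "x \<in> carrier E" for x by (rule basis_vector_closed[OF is_cring that])
 define g where "g x = ?q (scale (basis_vector R x))" for x
 have g: "linear R E (restrict_scalars embed ?P) g"
 proof (rule linI, unfold g_def)
  show "?q (scale (basis_vector R x)) \<in> carrier (restrict_scalars embed ?P)" if "x \<in> carrier E" for x
   by (rule lin_closed[OF qs bF[OF that]])
  show "?q (scale (basis_vector R (x \<oplus>[E] y))) =
    ?q (scale (basis_vector R x)) \<oplus>[restrict_scalars embed ?P] ?q (scale (basis_vector R y))"
   if c: "x \<in> carrier E" "y \<in> carrier E" for x y
   unfolding lin_add[OF qs bF[OF c(1)] bF[OF c(2)], symmetric]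
   by (rule qs_eq[OF bF[OF E.a_closed[OF c]] F.a_closed[OF bF[OF c(1)] bF[OF c(2)]]])
    (unfold lin_add[OF cl bF[OF c(1)] bF[OF c(2)]], simp only: free_cover_basis[OF E] c E.a_closed)
  show "?q (scale (basis_vector R (r \<odot>[E] x))) = r \<odot>[restrict_scalars embed ?P] ?q (scale (basis_vector R x))"
   if c: "r \<in> carrier R" "x \<in> carrier E" for r x
   unfolding lin_smult[OF qs c(1) bF[OF c(2)], symmetric]
   by (rule qs_eq[OF bF[OF E.smult_closed[OF c]] F.smult_closed[OF c(1) bF[OF c(2)]]])
    (unfold lin_smult[OF cl c(1) bF[OF c(2)]], simp only: free_cover_basis[OF E] c E.smult_closed)
 qed
 from localized_universal[OF E PM g] obtain k
  where k: "linear LR ?LE ?P k" "!!x. x \<in> carrier E ==> k (?\<iota> x) = g x" by blast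
 have cov'_closed: "b.cov' d \<in> carrier ?LE" if "d \<in> carrier ?V" for d by (rule lin_closed[OF b.cov'_lin that])
 have kq: "k (b.cov' d) = ?q d" if "d \<in> carrier ?V" for d
 proof (rule lin_eq_on_basis[OF LR.is_cring PM lin_compose[OF b.cov'_lin k(1) cov'_closed] q _ that])
  show "k (b.cov' (basis_vector LR x)) = ?q (basis_vector LR x)" if "x \<in> carrier E" for x
   unfolding b.cov'_basis[OF that] k(2)[OF that] g_def scale_basis ..
 qed
 have cov'_scale: "b.cov' (scale y) = ?\<iota> (?c y)" if "y \<in> carrier ?F" for y
 proof (rule lin_eq_on_basis[OF is_cring emb.restrict_scalars_module[OF b.E']
    lin_compose[OF scale_V emb.restrict_scalars_lin[OF b.cov'_lin] scale_c] lin_compose[OF cl b.\<iota> lin_closed[OF cl]] _ that])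
  show "b.cov' (scale (basis_vector R x)) = ?\<iota> (?c (basis_vector R x))" if "x \<in> carrier E" for x
   unfolding scale_basis b.cov'_basis[OF that] free_cover_basis[OF E that] ..
 qed
 have cov'_sat: "b.cov' d = \<zero>[?LE]" if d: "d \<in> ?sat" for d
 proof -
  obtain s y where s: "s \<in> S" "y \<in> carrier ?F" "s \<odot>[?D] d = scale y" "?c y = \<zero>[E]" and dc: "d \<in> carrier ?V"
   using d unfolding sd e(1) by blast
  have "embed s \<odot>[?LE] b.cov' d = b.cov' (s \<odot>[?D] d)"
   unfolding e by (rule lin_smult[OF b.cov'_lin embed_closed[OF S_closed[OF s(1)]] dc, symmetric])
  also have "\<dots> = \<zero>[?LE]" unfolding s(3) cov'_scale[OF s(2)] s(4) by (rule b.\<iota>_zero)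
  finally show ?thesis by (rule loc_torsion_free[OF b.E' s(1) cov'_closed[OF dc]])
 qed
 obtain Z :: "(('a \<times> 'a) set \<times> 'm => 'a) set set" and i' p where ip: "i' \<in> mod_hom LR ?LE (free_module LR Z)"
  "p \<in> mod_hom LR (free_module LR Z) ?LE" "\<forall>y\<in>carrier ?LE. p (i' y) = y"
  using loc unfolding projective_module_def by blast
 note i' = mod_hom_lin[OF ip(1)] and p = mod_hom_lin[OF ip(2)]
 show ?thesis
 proof (rule syzygy_extends[OF E _ _ C ext PR, where q = ?q and \<alpha> = "%d. i' (b.cov' d)" and Z = Z and \<beta> = "%z. k (p z)"])
  show "x = \<zero>[E]" if "s \<in> S" "x \<in> carrier E" "s \<odot>[E] x = \<zero>[E]" for s x by (rule tf[OF that])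
  show "\<exists>h. linear R E (quotient_module ?D (ints E)) h & (\<forall>x\<in>carrier E. \<Gamma> x (h x))"
   if v: "v \<in> S" and \<Gamma>: "linrel R E (carrier E) (quotient_module ?D (ints E)) \<Gamma>"
    and kill: "!!x w. \<Gamma> x w ==> v \<odot>[quotient_module ?D (ints E)] w = \<zero>[quotient_module ?D (ints E)]" for v \<Gamma>
  proof (rule base_change.projective_quotient_selects[OF reduced_base_change[OF E S_closed[OF v]] red[OF v] S_closed[OF v]
     _ _ _ _ B \<Gamma>])
   interpret I: ideal "PIdl\<^bsub>R\<^esub> v" R by (rule cgenideal_ideal[OF S_closed[OF v]])
   show "\<exists>r\<in>carrier R. PIdl\<^bsub>R\<^esub> v +>[R] r = r'" if "r' \<in> carrier (R Quot PIdl\<^bsub>R\<^esub> v)" for r'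
    by (rule quot_cases[OF E S_closed[OF v] that])
   show "\<exists>r'\<in>carrier R. r = v \<otimes> r'" if "r \<in> carrier R" "PIdl\<^bsub>R\<^esub> v +>[R] r = \<zero>[R Quot PIdl\<^bsub>R\<^esub> v]" for r
   proof -
    have "r \<in> PIdl\<^bsub>R\<^esub> v" using that I.a_rcos_self[OF that(1)] by (simp add: FactRing_def)
    thus ?thesis using m_comm S_closed[OF v] unfolding cgenideal_def by blast
   qed
   show "\<exists>x\<in>carrier E. (%x. v \<odot>[E] x) ` carrier E +>[E] x = y" if "y \<in> carrier (reduced_module E v)" for y
    using reduced_cases[OF E S_closed[OF v] that] by blast
   show "\<exists>x'\<in>carrier E. x = v \<odot>[E] x'"
    if "x \<in> carrier E" "(%x. v \<odot>[E] x) ` carrier E +>[E] x = \<zero>[reduced_module E v]" for x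
    using iffD1[OF reduced_zero_iff[OF E S_closed[OF v] that(1)] that(2)] by blast
  qed (rule kill)
  show "linear R ?D (restrict_scalars embed ?P) ?q"
   using emb.restrict_scalars_lin[OF q] unfolding ed restrict_scalars_sel .
  show "\<exists>d\<in>carrier ?D. ?q d = m" if "m \<in> carrier (restrict_scalars embed ?P)" for m
   using that unfolding restrict_scalars_sel e(1) by (elim coset_cases) blast
  show "?q d = \<zero>[restrict_scalars embed ?P] \<longleftrightarrow> d \<in> ?sat" if "d \<in> carrier ?D" for d
   using q0[of d] that unfolding restrict_scalars_sel e(1) by blast
  show "linear R ?D (pow Z) (%d. i' (b.cov' d))"
   using emb.restrict_scalars_lin[OF lin_compose[OF b.cov'_lin i' cov'_closed]] unfolding ed restrict_scalars_sel .
  show "i' (b.cov' n) = \<zero>[pow Z]" if n: "n \<in> ?sat" for n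
   unfolding cov'_sat[OF n] ed restrict_scalars_sel
   by (rule lin_zero[OF b.E' free_module_module[OF LR.is_cring] carrier_submodule[OF b.E'] i'])
  show "linear R (pow Z) (restrict_scalars embed ?P) (%z. k (p z))"
   using emb.restrict_scalars_lin[OF lin_compose[OF p k(1) lin_closed[OF p]]] unfolding ed restrict_scalars_sel .
  show "k (p (i' (b.cov' d))) = ?q d" if "d \<in> carrier ?D" for d
   using ip(3) cov'_closed kq that unfolding e(1) by simp
 qed
qed

end

text \<open>The kernel of the cover of a base change of \<open>F\<close> is weakly cotorsion, hence admits extensions along the syzygies of \<open>F\<close>.\<close>

lemma (in nonzerodivisors) strongly_flat_projective:
 fixes E :: "('a, 'm) module"
 assumes sf: "strongly_flat TYPE('c + ('m => ('a \<times> 'a) set)) R S E"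
 shows "projective_module LR (localized_module R S E)"
  and "s \<in> S ==> projective_module (R Quot PIdl\<^bsub>R\<^esub> s) (reduced_module E s)"
proof -
 have E: "module R E" using sf by (simp add: strongly_flat_def)
 note ex = strongly_flat_extends[OF sf loc_as_module_module]
 show "projective_module LR (localized_module R S E)"
 proof -
  interpret b: base_change R LR embed E "localized_module R S E" "pure_tensor R L E \<one>[LR]" by (rule localized_base_change[OF E])
  have K: "module LR (sub_module b.V {d \<in> carrier b.V. b.cov' d = \<zero>[localized_module R S E]})"
   unfolding singleton_iff[symmetric]
   by (rule sub_module_module[OF b.VM lin_kernel_submodule[OF b.VM b.E' carrier_submodule[OF b.VM] b.cov'_lin zero_submodule[OF b.E']]])
  show ?thesis
  proof (rule b.projective_of_extends[OF ex[OF b.restrict_scalars_module[OF K] _ loc_module_weakly_cotorsion[OF K]]])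
   show "inj_on Inr A" for A :: "('m => ('a \<times> 'a) set) set" by simp
  qed (rule localized_universal[OF E b.V'M])
 qed
 assume s: "s \<in> S"
 let ?R = "R Quot PIdl\<^bsub>R\<^esub> s" and ?\<phi> = "%r. PIdl\<^bsub>R\<^esub> s +>[R] r"
 interpret b: base_change R ?R ?\<phi> E "reduced_module E s" "%x. (%x. s \<odot>[E] x) ` carrier E +>[E] x"
  by (rule reduced_base_change[OF E S_closed[OF s]])
 have K: "module ?R (sub_module b.V {d \<in> carrier b.V. b.cov' d = \<zero>[reduced_module E s]})"
  unfolding singleton_iff[symmetric]
  by (rule sub_module_module[OF b.VM lin_kernel_submodule[OF b.VM b.E' carrier_submodule[OF b.VM] b.cov'_lin zero_submodule[OF b.E']]])
 \<comment> \<open>A subset of \<open>R\<close> is encoded by the corresponding subset of the diagonal.\<close>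
 define \<kappa> :: "('m => 'a set) => 'c + ('m => ('a \<times> 'a) set)" where "\<kappa> f = Inr (%x. (%a. (a, a)) ` f x)" for f
 have "inj \<kappa>"
  by (rule injI) (auto simp: \<kappa>_def fun_eq_iff inj_image_eq_iff[OF injI])
 hence \<kappa>: "inj_on \<kappa> A" for A by (rule inj_on_subset) simp
 show "projective_module ?R (reduced_module E s)"
  by (rule b.projective_of_extends[OF ex[OF b.restrict_scalars_module[OF K] \<kappa> quot_module_weakly_cotorsion[OF s K]]])
   (rule reduced_universal[OF E S_closed[OF s] b.V'M])
qed

theorem theorem1p4:
  fixes R :: "'a ring" and S :: "'a set" and F :: "('a, 'm) module"
  assumes "cring R" and "submonoid S R"
    and "\<And>s r. s \<in> S \<Longrightarrow> r \<in> carrier R \<Longrightarrow> s \<otimes>\<^bsub>R\<^esub> r = \<zero>\<^bsub>R\<^esub> \<Longrightarrow> r = \<zero>\<^bsub>R\<^esub>"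
    and "proj_dim_le TYPE('p) R (loc_as_module R S) 1"
    and "flat_module TYPE('a) R F"
  shows "strongly_flat TYPE('c + ('m \<Rightarrow> ('a \<times> 'a) set)) R S F \<longleftrightarrow>
    (\<forall>s\<in>S. projective_module (R Quot (PIdl\<^bsub>R\<^esub> s)) (reduced_module F s)) \<and>
    projective_module (loc_ring R S) (localized_module R S F)"
proof -
 interpret n: nonzerodivisors R S
  by (rule nonzerodivisors.intro[OF assms(1,2) nonzerodivisors_axioms.intro[OF assms(3)]])
 interpret fraction_module R S "loc_as_module R S" "\<one>[loc_ring R S]" by (rule n.loc_fraction_module)
 have F: "module R F" using assms(5) by (simp add: flat_module_def)
 obtain X :: "'p set" and \<epsilon> i where X: "linear R (free_module R X) (loc_as_module R S) \<epsilon>"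
  "\<epsilon> ` free_set R X = carrier (loc_as_module R S)"
  "dual_basis R (free_module R X) {y \<in> free_set R X. \<epsilon> y = \<zero>[loc_as_module R S]} i"
  using proj_dim_le_1_presentation[OF assms(4)] by blast
 interpret l: localized_presentation R S X \<epsilon> i
  by (intro localized_presentation.intro presented_fractions.intro presented_fractions_axioms.intro n.loc_fraction_module X)
 have tf: "x = \<zero>[F]" if "s \<in> S" "x \<in> carrier F" "s \<odot>[F] x = \<zero>[F]" for s x
  by (rule flat_torsion_free[OF assms(5) n.S_closed[OF that(1)] assms(3)[OF that(1)] that(2,3)])
 show ?thesis
 proof
  assume sf: "strongly_flat TYPE('c + ('m => ('a \<times> 'a) set)) R S F"
  show "(\<forall>s\<in>S. projective_module (R Quot (PIdl\<^bsub>R\<^esub> s)) (reduced_module F s)) &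
    projective_module (loc_ring R S) (localized_module R S F)"
   using n.strongly_flat_projective[OF sf] by blast
 next
  assume P: "(\<forall>s\<in>S. projective_module (R Quot (PIdl\<^bsub>R\<^esub> s)) (reduced_module F s)) &
    projective_module (loc_ring R S) (localized_module R S F)"
  show "strongly_flat TYPE('c + ('m => ('a \<times> 'a) set)) R S F"
   unfolding strongly_flat_def
  proof (intro conjI F allI impI)
   fix C :: "('a, 'c + ('m => ('a \<times> 'a) set)) module"
   assume "weakly_cotorsion R S C"
   hence C: "module R C" and z: "zero_module (Ext1 R (loc_as_module R S) C)" by (simp_all add: weakly_cotorsion_def)
   have e: "extends R l.F l.N C"
    by (rule l.weakly_cotorsion_presentation[OF C iffD1[OF zero_Ext1_iff[OF Q C] z]])
   show "zero_module (Ext1 R F C)"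
    unfolding zero_Ext1_iff[OF F C]
   proof (rule l.extends_of_locally_projective[OF F _ _ _ C e])
    show "x = \<zero>[F]" if "s \<in> S" "x \<in> carrier F" "s \<odot>[F] x = \<zero>[F]" for s x by (rule tf[OF that])
    show "projective_module (R Quot PIdl\<^bsub>R\<^esub> s) (reduced_module F s)" if "s \<in> S" for s
     by (rule bspec[OF conjunct1[OF P] that])
    show "projective_module (loc_ring R S) (localized_module R S F)" by (rule conjunct2[OF P])
   qed
  qed
 qed
qed


end
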